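(* Let $2\le r\le\infty$ and $\varepsilon>0$. There exist constants $C,c>0$, depending only on $r$ and $\varepsilon$, such that the following holds. Let $(u_0,u_1)\in H^\varepsilon(\mathbb{R}^3)\times H^{\varepsilon-1}(\mathbb{R}^3)$ be a pair of real-valued functions and let $(u_0^\omega,u_1^\omega)$ be its Wiener randomization, with random variables satisfying the exponential moment condition stated in the context. Let $T>0$ and let $S^*(t)$ be either $S(t)$ or $\widetilde S(t)$. Then, for all $\lambda>0$, $$P\Big(\|S^*(t)(u_0^\omega,u_1^\omega)\|_{L^\infty_t([0,T];L^r_x(\mathbb{R}^3))}>\lambda\Big)\le C(1+T)\exp\Bigg(-c\,\frac{\lambda^2}{\max(1,T^2)\,\|(u_0,u_1)\|^2_{H^\varepsilon(\mathbb{R}^3)\times H^{\varepsilon-1}(\mathbb{R}^3)}}\Bigg).$$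
   Context: Wiener randomization on $\mathbb{R}^3$: Fix $\psi \in \mathcal{S}(\mathbb{R}^3)$ with $\operatorname{supp}\psi \subset [-1,1]^3$, $\psi(-\xi)=\overline{\psi(\xi)}$ and $\sum_{n\in\mathbb{Z}^3}\psi(\xi-n)= 1$ for all $\xi\in\mathbb{R}^3$; $\psi(D-n)$ denotes the Fourier multiplier operator with symbol $\psi(\cdot-n)$. For $j=0,1$ let $\{g_{n,j}\}_{n\in\mathbb{Z}^3}$ be mean zero complex-valued random variables on a probability space $(\Omega,\mathcal{F},P)$ with $g_{-n,j}=\overline{g_{n,j}}$ (so $g_{0,j}$ is real-valued), such that $\{g_{0,j}, \operatorname{Re} g_{n,j}, \operatorname{Im} g_{n,j}\}_{n\in\mathcal{I},\, j=0,1}$ are independent, where $\mathcal{I} := \bigcup_{k=0}^{2}\mathbb{Z}^k\times\mathbb{Z}_+\times\{0\}^{2-k}$ (so $\mathbb{Z}^3=\mathcal{I}\cup(-\mathcal{I})\cup\{0\}$). Exponential moment condition: with $\mu_{n,j}$ the distribution of $g_{n,j}$ (a measure on $\mathbb{R}$ if $n=0$, and on $\mathbb{C}\cong\mathbb{R}^2$ if $n\neq0$), there is $c_0>0$ such that $\int e^{\gamma\cdot x}\,d\mu_{n,j}(x)\le e^{c_0|\gamma|^2}$ for $j=0,1$, all $n\in\mathbb{Z}^3$, all $\gamma\in\mathbb{R}$ when $n=0$ and all $\gamma\in\mathbb{R}^2$ when $n\ne 0$. The Wiener randomization of $(u_0,u_1)$ is $$(u_0^\omega,u_1^\omega) :=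 \Big(\sum_{n\in\mathbb{Z}^3} g_{n,0}(\omega)\psi(D-n)u_0,\ \sum_{n\in\mathbb{Z}^3} g_{n,1}(\omega)\psi(D-n)u_1\Big).$$ The cutoff $\psi$ and the random variables (in particular $c_0$) are fixed throughout; dependence of constants on them is not displayed. Propagators: with $\langle\nabla\rangle=(1-\Delta)^{1/2}$, $$S(t)(\phi_0,\phi_1):=\cos(t|\nabla|)\phi_0+\frac{\sin(t|\nabla|)}{|\nabla|}\phi_1,\qquad \widetilde S(t)(\phi_0,\phi_1):=-\frac{|\nabla|}{\langle\nabla\rangle}\sin(t|\nabla|)\phi_0+\frac{\cos(t|\nabla|)}{\langle\nabla\rangle}\phi_1,$$ so that $\partial_tS(t)(\phi_0,\phi_1)=\langle\nabla\rangle\widetilde S(t)(\phi_0,\phi_1)$. *)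

theory Defs
  imports "HOL-Probability.Probability"
begin

section \<open>Schwartz functions and tempered distributions on three-dimensional space\<close>

fun iter_pd :: "3 list \<Rightarrow> (real^3 \<Rightarrow> complex) \<Rightarrow> real^3 \<Rightarrow> complex" where
  "iter_pd [] f = f"
| "iter_pd (i # is) f = (\<lambda>x. frechet_derivative (iter_pd is f) (at x) (axis i 1))"

text \<open>Differentiability of every iterated partial derivative amounts to smoothness.\<close>

definition schwartz :: "(real^3 \<Rightarrow> complex) set" where
  "schwartz = {\<phi>. (\<forall>is x. iter_pd is \<phi> differentiable (at x)) \<and>
     (\<forall>is (k::nat). \<exists>B. \<forall>x. (1 + norm x) ^ k * cmod (iter_pd is \<phi> x) \<le> B)}"

definition schwartz_norm :: "nat \<Rightarrow> (real^3 \<Rightarrow> complex) \<Rightarrow> real" where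
  "schwartz_norm N \<phi> =
     (SUP (is, x) \<in> {is. length is \<le> N} \<times> UNIV. (1 + norm x) ^ N * cmod (iter_pd is \<phi> x))"

text \<open>Only the values of a functional on \<^const>\<open>schwartz\<close> are meaningful; the values at other
  arguments are irrelevant to everything below.\<close>

type_synonym distr3 = "(real^3 \<Rightarrow> complex) \<Rightarrow> complex"

definition tempered :: "distr3 \<Rightarrow> bool" where
  "tempered u \<longleftrightarrow>
     (\<forall>\<phi>\<in>schwartz. \<forall>\<eta>\<in>schwartz. u (\<lambda>x. \<phi> x + \<eta> x) = u \<phi> + u \<eta>) \<and>
     (\<forall>a. \<forall>\<phi>\<in>schwartz. u (\<lambda>x. a * \<phi> x) = a * u \<phi>) \<and>
     (\<exists>N B. \<forall>\<phi>\<in>schwartz. cmod (u \<phi>) \<le> B * schwartz_norm N \<phi>)"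

definition real_distr :: "distr3 \<Rightarrow> bool" where
  "real_distr u \<longleftrightarrow> (\<forall>\<phi>\<in>schwartz. u (\<lambda>x. cnj (\<phi> x)) = cnj (u \<phi>))"

definition represents :: "(real^3 \<Rightarrow> complex) \<Rightarrow> distr3 \<Rightarrow> bool" where
  "represents f u \<longleftrightarrow> f \<in> borel_measurable lborel \<and>
     (\<forall>\<phi>\<in>schwartz. integrable lborel (\<lambda>x. f x * \<phi> x) \<and> u \<phi> = (\<integral>x. f x * \<phi> x \<partial>lborel))"


section \<open>Fourier transform, multipliers and Sobolev spaces\<close>

text \<open>The unitary normalization with phase \<open>x \<bullet> \<xi>\<close>, for which \<open>-\<Delta>\<close> has the symbol \<open>|\<xi>|\<^sup>2\<close>.\<close>

definition fourier :: "(real^3 \<Rightarrow> complex) \<Rightarrow> real^3 \<Rightarrow> complex" where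
  "fourier \<phi> \<xi> = of_real ((2 * pi) powr (- 3 / 2)) * (\<integral>x. cis (- (x \<bullet> \<xi>)) * \<phi> x \<partial>lborel)"

definition inv_fourier :: "(real^3 \<Rightarrow> complex) \<Rightarrow> real^3 \<Rightarrow> complex" where
  "inv_fourier \<phi> x = of_real ((2 * pi) powr (- 3 / 2)) * (\<integral>\<xi>. cis (x \<bullet> \<xi>) * \<phi> \<xi> \<partial>lborel)"

definition fourier_distr :: "distr3 \<Rightarrow> distr3" where
  "fourier_distr u = (\<lambda>\<phi>. u (fourier \<phi>))"

text \<open>All distributions to which multipliers are applied (elements of Sobolev spaces) have a
  Fourier transform that is a function, unique up to a null set. The choice of
  representative does not affect \<open>multiplier\<close> or \<open>sobolev_norm\<close>.\<close>

definition fourier_fun :: "distr3 \<Rightarrow> real^3 \<Rightarrow> complex" where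
  "fourier_fun u = (SOME f. represents f (fourier_distr u))"

text \<open>The distribution with Fourier transform \<open>m \<cdot> fourier_fun u\<close>.\<close>

definition multiplier :: "(real^3 \<Rightarrow> complex) \<Rightarrow> distr3 \<Rightarrow> distr3" where
  "multiplier m u = (\<lambda>\<phi>. \<integral>\<xi>. m \<xi> * fourier_fun u \<xi> * inv_fourier \<phi> \<xi> \<partial>lborel)"

definition jap :: "real^3 \<Rightarrow> real" where
  "jap \<xi> = sqrt (1 + (norm \<xi>)\<^sup>2)"

definition sobolev :: "real \<Rightarrow> distr3 set" where
  "sobolev s = {u. tempered u \<and> (\<exists>f. represents f (fourier_distr u)) \<and>
     integrable lborel (\<lambda>\<xi>. (jap \<xi> powr s * cmod (fourier_fun u \<xi>))\<^sup>2)}"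

definition sobolev_norm :: "real \<Rightarrow> distr3 \<Rightarrow> real" where
  "sobolev_norm s u = sqrt (\<integral>\<xi>. (jap \<xi> powr s * cmod (fourier_fun u \<xi>))\<^sup>2 \<partial>lborel)"

definition sobolev_pair_norm :: "real \<Rightarrow> distr3 \<times> distr3 \<Rightarrow> real" where
  "sobolev_pair_norm s u = sqrt ((sobolev_norm s (fst u))\<^sup>2 + (sobolev_norm (s - 1) (snd u))\<^sup>2)"


section \<open>Lebesgue norms\<close>

definition Lr_norm :: "ennreal \<Rightarrow> (real^3 \<Rightarrow> complex) \<Rightarrow> ennreal" where
  "Lr_norm r f =
     (if r = \<infinity> then esssup lborel (\<lambda>x. ennreal (cmod (f x)))
      else let I = (\<integral>\<^sup>+x. ennreal (cmod (f x) powr enn2real r) \<partial>lborel)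
           in if I = \<infinity> then \<infinity> else ennreal (enn2real I powr (1 / enn2real r)))"

text \<open>The infimum is over at most one function up to null sets; it is \<open>\<infinity>\<close> if \<open>v\<close> is not a function.\<close>

definition Lr_norm_distr :: "ennreal \<Rightarrow> distr3 \<Rightarrow> ennreal" where
  "Lr_norm_distr r v = (INF f \<in> {f. represents f v}. Lr_norm r f)"

definition Linf_Lr_norm :: "real \<Rightarrow> ennreal \<Rightarrow> (real \<Rightarrow> distr3) \<Rightarrow> ennreal" where
  "Linf_Lr_norm T r v = esssup (lebesgue_on {0..T}) (\<lambda>t. Lr_norm_distr r (v t))"


section \<open>Wave propagators\<close>

text \<open>The symbol of \<open>sin (t |\<nabla>|) / |\<nabla>|\<close>, with its continuous extension to \<open>\<xi> = 0\<close>.\<close>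

definition sin_symbol :: "real \<Rightarrow> real^3 \<Rightarrow> real" where
  "sin_symbol t \<xi> = (if \<xi> = 0 then t else sin (t * norm \<xi>) / norm \<xi>)"

definition wave_S :: "real \<Rightarrow> distr3 \<times> distr3 \<Rightarrow> distr3" where
  "wave_S t u = (\<lambda>\<phi>.
     multiplier (\<lambda>\<xi>. of_real (cos (t * norm \<xi>))) (fst u) \<phi> +
     multiplier (\<lambda>\<xi>. of_real (sin_symbol t \<xi>)) (snd u) \<phi>)"

definition wave_S_tilde :: "real \<Rightarrow> distr3 \<times> distr3 \<Rightarrow> distr3" where
  "wave_S_tilde t u = (\<lambda>\<phi>.
     multiplier (\<lambda>\<xi>. of_real (- (norm \<xi> / jap \<xi>) * sin (t * norm \<xi>))) (fst u) \<phi> +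
     multiplier (\<lambda>\<xi>. of_real (cos (t * norm \<xi>) / jap \<xi>)) (snd u) \<phi>)"


section \<open>Wiener randomization\<close>

definition lattice_vec :: "int^3 \<Rightarrow> real^3" where
  "lattice_vec n = (\<chi> i. real_of_int (n $ i))"

text \<open>In \<open>half_lattice\<close> the last nonzero coordinate is positive. It, its negative and \<open>{0}\<close>
  partition the lattice.\<close>

definition half_lattice :: "(int^3) set" where
  "half_lattice = {n. n $ 1 > 0 \<and> n $ 2 = 0 \<and> n $ 3 = 0} \<union>
                  {n. n $ 2 > 0 \<and> n $ 3 = 0} \<union>
                  {n. n $ 3 > 0}"

definition wiener_cutoff :: "(real^3 \<Rightarrow> complex) \<Rightarrow> bool" where
  "wiener_cutoff \<psi> \<longleftrightarrow> \<psi> \<in> schwartz \<and>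
     closure {\<xi>. \<psi> \<xi> \<noteq> 0} \<subseteq> {\<xi>. \<forall>i. \<xi> $ i \<in> {-1..1}} \<and>
     (\<forall>\<xi>. \<psi> (- \<xi>) = cnj (\<psi> \<xi>)) \<and>
     (\<forall>\<xi>. ((\<lambda>n. \<psi> (\<xi> - lattice_vec n)) has_sum 1) UNIV)"

text \<open>The independent real variables are indexed by \<open>(j, n, b)\<close>, where \<open>b\<close> selects the imaginary
  part; for \<open>n = 0\<close> only the real part (equal to the variable itself) occurs.\<close>

definition wiener_variables :: "'a measure \<Rightarrow> (nat \<Rightarrow> int^3 \<Rightarrow> 'a \<Rightarrow> complex) \<Rightarrow> bool" where
  "wiener_variables M g \<longleftrightarrow> prob_space M \<and>
     (\<forall>j\<in>{0, 1}. \<forall>n. g j n \<in> borel_measurable M \<and> integrable M (g j n) \<and>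
        (\<integral>\<omega>. g j n \<omega> \<partial>M) = 0 \<and> (\<forall>\<omega>\<in>space M. g j (- n) \<omega> = cnj (g j n \<omega>))) \<and>
     prob_space.indep_vars M (\<lambda>_. borel)
       (\<lambda>(j, n, b) \<omega>. if b then Im (g j n \<omega>) else Re (g j n \<omega>))
       ({0, 1} \<times> ({0} \<times> {False} \<union> half_lattice \<times> UNIV))"

text \<open>On \<^typ>\<open>complex\<close>, \<open>\<bullet>\<close> is the Euclidean inner product of the plane.\<close>

definition exp_moment_bound ::
    "'a measure \<Rightarrow> (nat \<Rightarrow> int^3 \<Rightarrow> 'a \<Rightarrow> complex) \<Rightarrow> real \<Rightarrow> bool" where
  "exp_moment_bound M g c0 \<longleftrightarrow> (\<forall>j\<in>{0, 1}.
     (\<forall>\<gamma>::real. (\<integral>\<^sup>+x. ennreal (exp (\<gamma> * x)) \<partial>distr M borel (\<lambda>\<omega>. Re (g j 0 \<omega>)))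
                  \<le> ennreal (exp (c0 * \<gamma>\<^sup>2))) \<and>
     (\<forall>n. n \<noteq> 0 \<longrightarrow> (\<forall>\<gamma>::complex. (\<integral>\<^sup>+x. ennreal (exp (\<gamma> \<bullet> x)) \<partial>distr M borel (g j n))
                  \<le> ennreal (exp (c0 * (norm \<gamma>)\<^sup>2)))))"

text \<open>The series is taken in the sense of distributions, that is, after pairing with a test
  function. For data in a Sobolev space it converges for all test functions simultaneously
  outside a null event; on that event the value is arbitrary.\<close>

definition randomize ::
    "(real^3 \<Rightarrow> complex) \<Rightarrow> (int^3 \<Rightarrow> 'a \<Rightarrow> complex) \<Rightarrow> distr3 \<Rightarrow> 'a \<Rightarrow> distr3" where
  "randomize \<psi> h u \<omega> =
     (\<lambda>\<phi>. \<Sum>\<^sub>\<infinity>n\<in>UNIV. h n \<omega> * multiplier (\<lambda>\<xi>. \<psi> (\<xi> - lattice_vec n)) u \<phi>)"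

definition wiener_randomization ::
    "(real^3 \<Rightarrow> complex) \<Rightarrow> (nat \<Rightarrow> int^3 \<Rightarrow> 'a \<Rightarrow> complex) \<Rightarrow> distr3 \<times> distr3 \<Rightarrow> 'a
      \<Rightarrow> distr3 \<times> distr3" where
  "wiener_randomization \<psi> g u \<omega> =
     (randomize \<psi> (g 0) (fst u) \<omega>, randomize \<psi> (g 1) (snd u) \<omega>)"

text \<open>The right-hand side of the tail bound. For \<open>N = 0\<close> the exponent is \<open>-\<infinity>\<close>, which HOL's
  convention \<open>x / 0 = 0\<close> would turn into \<open>0\<close>.\<close>

definition tail_bound :: "real \<Rightarrow> real \<Rightarrow> real \<Rightarrow> real \<Rightarrow> real \<Rightarrow> real" where
  "tail_bound C c T N l =
     (if N = 0 then 0 else C * (1 + T) * exp (- c * (l\<^sup>2 / (max 1 (T\<^sup>2) * N\<^sup>2))))"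

text \<open>The event in question: it is measurable up to null sets only, since the randomization is
  defined up to a null event; probabilities are therefore taken in the completion.\<close>

definition exceed_event ::
    "'a measure \<Rightarrow> ('a \<Rightarrow> real \<Rightarrow> distr3) \<Rightarrow> real \<Rightarrow> ennreal \<Rightarrow> real \<Rightarrow> 'a set" where
  "exceed_event M v T r l = {\<omega> \<in> space M. Linf_Lr_norm T r (v \<omega>) > ennreal l}"

end

theory Submission imports Defs
begin

text \<open>At a fixed point of space-time a frequency truncation of the randomized wave is a sum of
  independent subgaussian variables, and by Plancherel the integral over space of its variance is at most
  a multiple of the energy of the data. Hence its values on a grid can be
  bounded simultaneously for most offsets of the grid. Chaining along dyadic grids in space
  and time gives a uniform bound: a link at scale \<open>2\<^sup>-\<^sup>k\<close> gains \<open>2\<^sup>-\<^sup>k\<^sup>e\<close> with \<open>e = min \<epsilon> 1\<close> by the excess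
  regularity, which beats the exponential growth of the number of links. The spatial \<open>L\<^sup>2\<close> norm is
  bounded at all times at once by the random energy, which has an exponential moment, and the \<open>L\<^sup>r\<close> bound follows
  by interpolation. The truncations converge to the full wave in \<open>L\<^sup>2\<close> at a geometric rate, again by the
  excess regularity, hence almost everywhere, and Fatou's lemma carries the bounds over.\<close>

section \<open>Gaussian integrals and Plancherel's inequality\<close>

text \<open>The randomization costs no derivatives because every piece occupies a frequency box of
  volume 8: Cauchy-Schwarz on that box bounds its sup norm by its L2 norm (\<open>kernel_L1\<close>,
  \<open>wave_bounds\<close>), where Sobolev embedding in three dimensions would ask for more than
  3/2 derivatives. The obstacle is the unbounded space: a tail bound uniform in \<open>x\<close>
  cannot be summed over an infinite grid, so every tail has to keep a factor that is integrable in
  \<open>x\<close>. A link at scale \<open>k\<close> is allowed an amount proportional to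
  \<open>ratio ^ k = 2^(-k e / 2)\<close>, half of the gain in the exponent, so that the allowances
  have a finite sum while the exponents of the tails still grow like \<open>2^(k e)\<close>. The
  tail bounds are uniform in the truncation but not summable over truncations; the limit therefore
  keeps only outcomes that are good for infinitely many of them. The factor \<open>1 + T\<close>
  counts grid times. The factor \<open>max 1 (T^2)\<close> is the square of the size of
  \<open>sin (t |\<nabla>|) / |\<nabla>|\<close> at low frequencies. All constants have to be fixed
  before the data and \<open>T\<close>, which is why \<open>chain_const\<close> is built from
  \<open>e\<close> alone.\<close>

lemma nn_integral_lborel_affine:
  fixes t :: "'a::euclidean_space"
  assumes [measurable]: "f \<in> borel_measurable borel" and c: "c \<noteq> 0"
  shows "(\<integral>\<^sup>+x. f x \<partial>lborel) = ennreal (\<bar>c\<bar> ^ DIM('a)) * (\<integral>\<^sup>+x. f (t + c *\<^sub>R x) \<partial>lborel)"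
  by (subst lborel_affine[OF c, of t])
     (simp add: nn_integral_density nn_integral_distr nn_integral_cmult)

lemma integrable_lborel_affine_iff:
  fixes t :: "'a::euclidean_space" and f :: "'a \<Rightarrow> 'b::{banach, second_countable_topology}"
  assumes [measurable]: "f \<in> borel_measurable borel" and c: "c \<noteq> 0"
  shows "integrable lborel (\<lambda>x. f (t + c *\<^sub>R x)) \<longleftrightarrow> integrable lborel f"
  by (subst (2) lborel_affine[OF c, of t])
     (use c integrable_scaleR_right[of "inverse (\<bar>c\<bar> ^ DIM('a))" lborel "\<lambda>x. \<bar>c\<bar> ^ DIM('a) *\<^sub>R f (t + c *\<^sub>R x)"]
      in \<open>auto simp: integrable_density integrable_distr_eq\<close>)

lemma integral_lborel_affine:
  fixes t :: "'a::euclidean_space" and f :: "'a \<Rightarrow> 'b::{banach, second_countable_topology}"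
  assumes [measurable]: "f \<in> borel_measurable borel" and c: "c \<noteq> 0"
  shows "(\<integral>x. f x \<partial>lborel) = (\<bar>c\<bar> ^ DIM('a)) *\<^sub>R (\<integral>x. f (t + c *\<^sub>R x) \<partial>lborel)"
  by (subst lborel_affine[OF c, of t]) (simp add: integral_density integral_distr)

text \<open>Dominates the kernels below, which become products once phases and cutoffs of modulus at
  most one are dropped; this is the integrability that Fubini's theorem asks for.\<close>

lemma lborel_times_integral:
  fixes f :: "'a::euclidean_space \<Rightarrow> 'c::{real_normed_field,banach,second_countable_topology}"
    and g :: "'b::euclidean_space \<Rightarrow> 'c"
  assumes f: "integrable lborel f" and g: "integrable lborel g"
  shows "integrable (lborel \<Otimes>\<^sub>M lborel) (\<lambda>p. f (fst p) * g (snd p))"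
    and "(\<integral>p. f (fst p) * g (snd p) \<partial>(lborel \<Otimes>\<^sub>M lborel)) = (\<integral>x. f x \<partial>lborel) * (\<integral>x. g x \<partial>lborel)"
proof -
  have [measurable]: "f \<in> borel_measurable borel" "g \<in> borel_measurable borel" using f g by auto
  show i: "integrable (lborel \<Otimes>\<^sub>M lborel) (\<lambda>p. f (fst p) * g (snd p))"
    by (rule lborel_pair.Fubini_integrable) (use f g in \<open>auto simp: norm_mult\<close>)
  show "(\<integral>p. f (fst p) * g (snd p) \<partial>(lborel \<Otimes>\<^sub>M lborel)) = (\<integral>x. f x \<partial>lborel) * (\<integral>x. g x \<partial>lborel)"
    using lborel_pair.integral_fst'[OF i] by simp
qed

lemma lborel_prod_integral:
  fixes f :: "'a::euclidean_space \<Rightarrow> real \<Rightarrow> 'b::{real_normed_field,banach,second_countable_topology}"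
  assumes f: "\<And>b. b \<in> Basis \<Longrightarrow> integrable lborel (f b)"
  shows "integrable lborel (\<lambda>x::'a. \<Prod>b\<in>Basis. f b (x \<bullet> b))"
    and "(\<integral>x. (\<Prod>b\<in>Basis. f b (x \<bullet> b)) \<partial>(lborel :: 'a measure)) = (\<Prod>b\<in>Basis. (\<integral>x. f b x \<partial>lborel))"
proof -
  interpret product_sigma_finite "\<lambda>_::'a. lborel :: real measure" ..
  have [measurable]: "f b \<in> borel_measurable borel" if "b \<in> Basis" for b
    using f[OF that] by auto
  have [measurable]: "(\<lambda>x::'a. \<Prod>b\<in>Basis. f b (x \<bullet> b)) \<in> borel_measurable borel"
    by measurable
  have [measurable]: "(\<lambda>f. \<Sum>b\<in>Basis. f b *\<^sub>R b) \<in> (\<Pi>\<^sub>M b\<in>(Basis::'a set). (lborel::real measure)) \<rightarrow>\<^sub>M borel"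
    by measurable
  show "integrable lborel (\<lambda>x::'a. \<Prod>b\<in>Basis. f b (x \<bullet> b))"
    by (subst lborel_eq) (simp add: integrable_distr_eq product_integrable_prod f)
  show "(\<integral>x. (\<Prod>b\<in>Basis. f b (x \<bullet> b)) \<partial>(lborel :: 'a measure)) = (\<Prod>b\<in>Basis. (\<integral>x. f b x \<partial>lborel))"
    by (subst lborel_eq) (simp add: integral_distr product_integral_prod f)
qed

lemma borel_measurable_cnj[measurable]: "cnj \<in> borel_measurable borel"
  by (intro borel_measurable_continuous_onI continuous_intros)

lemma borel_measurable_cis[measurable]: "cis \<in> borel_measurable borel"
  by (intro borel_measurable_continuous_onI continuous_intros)

section \<open>The Gaussian kernel and its Fourier transform\<close>

definition gauss :: "'a::euclidean_space \<Rightarrow> real" where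
  "gauss x = exp (- (norm x)\<^sup>2 / 2) / sqrt (2 * pi) ^ DIM('a)"

lemma gauss_pos: "gauss x > 0" by (simp add: gauss_def)
lemma gauss_nonneg[simp]: "gauss x \<ge> 0" using gauss_pos less_imp_le by blast
lemma gauss_measurable[measurable]: "gauss \<in> borel_measurable borel"
  unfolding gauss_def[abs_def] by measurable

lemma gauss_eq_prod: "gauss (x::'a::euclidean_space) = (\<Prod>b\<in>Basis. std_normal_density (x \<bullet> b))"
proof -
  have "(norm x)\<^sup>2 = (\<Sum>b\<in>Basis. (x \<bullet> b)\<^sup>2)"
    by (subst power2_norm_eq_inner, subst euclidean_inner) (simp add: power2_eq_square)
  then have "exp (- (norm x)\<^sup>2 / 2) = (\<Prod>b\<in>Basis. exp (- (x \<bullet> b)\<^sup>2 / 2))"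
    by (simp add: exp_sum[symmetric] sum_negf sum_divide_distrib)
  then show ?thesis
    by (simp add: gauss_def std_normal_density_def prod_dividef)
qed

lemma integrable_gauss: "integrable lborel (gauss :: 'a::euclidean_space \<Rightarrow> real)"
  and integral_gauss: "(\<integral>x. gauss (x::'a) \<partial>lborel) = 1"
  using lborel_prod_integral[of "\<lambda>_::'a. std_normal_density"]
  by (simp_all add: gauss_eq_prod[abs_def])

lemma nn_integral_gauss: "(\<integral>\<^sup>+x. ennreal (gauss (x::'a::euclidean_space)) \<partial>lborel) = 1"
  by (simp add: nn_integral_eq_integral integrable_gauss integral_gauss)

text \<open>The phase and the density both factor over the coordinates, so the characteristic
  function of the one-dimensional normal distribution is enough.\<close>

lemma integral_cis_gauss:
  "(\<integral>x. cis (x \<bullet> y) * of_real (gauss x) \<partial>lborel) = of_real (exp (- (norm (y::'a::euclidean_space))\<^sup>2 / 2))"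
proof -
  have 1: "integrable lborel (\<lambda>s::real. cis (t * s) * complex_of_real (std_normal_density s))" for t
    by (rule Bochner_Integration.integrable_bound[OF integrable_normal_density[of 1 0]])
       (auto simp: norm_mult)
  have 2: "(\<integral>s. cis (t * s) * complex_of_real (std_normal_density s) \<partial>lborel) = exp (- t\<^sup>2 / 2)" for t
    using fun_cong[OF char_std_normal_distribution, of t]
    unfolding char_def by (subst (asm) integral_density)
      (auto simp: cis_conv_exp mult.commute scaleR_conv_of_real)
  have n: "(norm y)\<^sup>2 = (\<Sum>b\<in>Basis. (y \<bullet> b)\<^sup>2)"
    by (subst power2_norm_eq_inner, subst euclidean_inner) (simp add: power2_eq_square)
  have c: "cis (\<Sum>b\<in>B. g b) = (\<Prod>b\<in>B. cis (g b))" if "finite B" for g and B :: "'a set"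
    using that by (induction rule: finite_induct) (auto simp: cis_mult[symmetric])
  have "(\<integral>x. cis (x \<bullet> y) * of_real (gauss x) \<partial>lborel) =
    (\<integral>x. (\<Prod>b\<in>Basis. cis ((y \<bullet> b) * (x \<bullet> b)) * of_real (std_normal_density (x \<bullet> b))) \<partial>lborel)"
    by (intro Bochner_Integration.integral_cong refl, subst euclidean_inner)
       (simp add: c gauss_eq_prod prod.distrib mult.commute)
  also have "\<dots> = (\<Prod>b\<in>Basis. of_real (exp (- (y \<bullet> b)\<^sup>2 / 2)))"
    by (subst lborel_prod_integral(2)[OF 1]) (simp add: 2)
  also have "\<dots> = of_real (exp (- (norm y)\<^sup>2 / 2))"
    by (simp add: n exp_sum[symmetric] sum_negf sum_divide_distrib flip: of_real_prod)
  finally show ?thesis .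
qed

lemma integral_cis_scaled_gauss:
  assumes d: "d > 0"
  shows "(\<integral>x. cis (x \<bullet> y) * of_real (exp (- (norm (d *\<^sub>R x))\<^sup>2 / 2)) \<partial>lborel) =
    of_real ((2 * pi) ^ DIM('a) / d ^ DIM('a) * gauss (y /\<^sub>R d :: 'a::euclidean_space))"
proof -
  have s: "sqrt (2 * pi) ^ DIM('a) * sqrt (2 * pi) ^ DIM('a) = (2 * pi) ^ DIM('a)"
    by (simp only: power_mult_distrib[symmetric] real_sqrt_mult_self) simp
  have e: "exp (- (norm z)\<^sup>2 / 2) = sqrt (2 * pi) ^ DIM('a) * gauss z" for z :: 'a
    by (simp add: gauss_def)
  have "(\<integral>x. cis (x \<bullet> y) * of_real (exp (- (norm (d *\<^sub>R x))\<^sup>2 / 2)) \<partial>lborel) =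
     ((1 / d) ^ DIM('a)) *\<^sub>R (\<integral>x. cis (x \<bullet> (y /\<^sub>R d)) * of_real (exp (- (norm x)\<^sup>2 / 2)) \<partial>lborel)"
  proof -
    have "(0 + (1 / d) *\<^sub>R x) \<bullet> y = x \<bullet> (y /\<^sub>R d)" "d *\<^sub>R (0 + (1 / d) *\<^sub>R x) = x" for x
      using d by (simp_all add: divide_inverse)
    moreover have "\<bar>1 / d\<bar> = 1 / d" "1 / d \<noteq> 0" using d by auto
    ultimately show ?thesis
      using integral_lborel_affine[where c="1/d" and t=0 and
          f="\<lambda>x. cis (x \<bullet> y) * of_real (exp (- (norm (d *\<^sub>R x))\<^sup>2 / 2))"] by simp
  qed
  also have "(\<integral>x. cis (x \<bullet> (y /\<^sub>R d)) * of_real (exp (- (norm x)\<^sup>2 / 2)) \<partial>lborel) =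
     of_real (sqrt (2 * pi) ^ DIM('a)) * (\<integral>x. cis (x \<bullet> (y /\<^sub>R d)) * of_real (gauss x) \<partial>lborel)"
    unfolding e by (simp only: integral_mult_right_zero[symmetric] of_real_mult mult_ac)
  also have "(\<integral>x. cis (x \<bullet> (y /\<^sub>R d)) * of_real (gauss x) \<partial>lborel) = of_real (exp (- (norm (y /\<^sub>R d))\<^sup>2 / 2))"
    by (rule integral_cis_gauss)
  also have "\<dots> = of_real (sqrt (2 * pi) ^ DIM('a) * gauss (y /\<^sub>R d))"
    by (simp only: e)
  finally have "(\<integral>x. cis (x \<bullet> y) * of_real (exp (- (norm (d *\<^sub>R x))\<^sup>2 / 2)) \<partial>lborel) =
      of_real ((1 / d) ^ DIM('a) * (sqrt (2 * pi) ^ DIM('a) * (sqrt (2 * pi) ^ DIM('a) * gauss (y /\<^sub>R d))))"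
    by (simp only: scaleR_conv_of_real of_real_mult)
  also have "(1 / d) ^ DIM('a) * (sqrt (2 * pi) ^ DIM('a) * (sqrt (2 * pi) ^ DIM('a) * gauss (y /\<^sub>R d))) =
      (2 * pi) ^ DIM('a) / d ^ DIM('a) * gauss (y /\<^sub>R d)"
    unfolding s[symmetric] by (simp only: power_one_over) (simp only: divide_inverse mult_1 mult_ac)
  finally show ?thesis .
qed

text \<open>In this form of the convolution the Gaussian stays fixed and only the argument of
  \<open>f\<close> shrinks towards \<open>y\<close>, so \<open>gauss x * B\<close> dominates for all
  \<open>k\<close> at once.\<close>

lemma gauss_approximate_identity:
  fixes f :: "'a::euclidean_space \<Rightarrow> 'b::{banach, second_countable_topology}"
  assumes [measurable]: "f \<in> borel_measurable borel" and B: "\<And>x. norm (f x) \<le> B"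
    and f: "isCont f y" and d: "d \<longlonglongrightarrow> 0"
  shows "(\<lambda>k. \<integral>x. gauss x *\<^sub>R f (y + d k *\<^sub>R x) \<partial>lborel) \<longlonglongrightarrow> f y"
proof -
  have "(\<lambda>k. \<integral>x. gauss x *\<^sub>R f (y + d k *\<^sub>R x) \<partial>lborel) \<longlonglongrightarrow> (\<integral>x. gauss (x::'a) *\<^sub>R f y \<partial>lborel)"
  proof (rule integral_dominated_convergence[where w="\<lambda>x. gauss x * B"
        and s="\<lambda>k x. gauss x *\<^sub>R f (y + d k *\<^sub>R x)" and f="\<lambda>x. gauss x *\<^sub>R f y" and M=lborel])
    show "integrable lborel (\<lambda>x::'a. gauss x * B)"
      by (simp add: integrable_gauss)
    show "AE x in lborel. (\<lambda>k. gauss x *\<^sub>R f (y + d k *\<^sub>R x)) \<longlonglongrightarrow> gauss x *\<^sub>R f y"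
    proof (rule AE_I2)
      fix x :: 'a
      have "(\<lambda>k. y + d k *\<^sub>R x) \<longlonglongrightarrow> y + 0 *\<^sub>R x" by (intro tendsto_intros d)
      then show "(\<lambda>k. gauss x *\<^sub>R f (y + d k *\<^sub>R x)) \<longlonglongrightarrow> gauss x *\<^sub>R f y"
        by (intro tendsto_intros isCont_tendsto_compose[OF f]) simp
    qed
  qed (auto intro!: mult_left_mono B AE_I2 simp del: scaleR_conv_of_real)
  then show ?thesis
    using integral_scaleR_left[of "f y" lborel "gauss :: 'a \<Rightarrow> real"] by (simp add: integral_gauss integrable_gauss)
qed

section \<open>Cauchy-Schwarz and the Plancherel inequality\<close>

lemma ennreal_power2_le_imp_le: "a \<le> b" if "a\<^sup>2 \<le> b\<^sup>2" for a b :: ennreal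
  using that
  by (cases a; cases b) (auto simp: ennreal_power ennreal_le_iff top_power_ennreal top_unique intro: power2_le_imp_le)

text \<open>With nonnegative integrals as hypotheses, integrability of the product is a conclusion.
  The pairing is bilinear, without conjugate, to match \<open>represents\<close>.\<close>

lemma Cauchy_Schwarz_lebesgue:
  fixes f g :: "'a \<Rightarrow> complex"
  assumes [measurable]: "f \<in> borel_measurable M" "g \<in> borel_measurable M"
    and f: "(\<integral>\<^sup>+x. ennreal ((cmod (f x))\<^sup>2) \<partial>M) \<le> ennreal F"
    and g: "(\<integral>\<^sup>+x. ennreal ((cmod (g x))\<^sup>2) \<partial>M) \<le> ennreal G"
    and nn: "F \<ge> 0" "G \<ge> 0"
  shows "integrable M (\<lambda>x. f x * g x)" and "cmod (\<integral>x. f x * g x \<partial>M) \<le> sqrt (F * G)"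
proof -
  have "(\<integral>\<^sup>+x. ennreal (cmod (f x * g x)) \<partial>M)\<^sup>2 = (\<integral>\<^sup>+x. ennreal (cmod (f x)) * ennreal (cmod (g x)) \<partial>M)\<^sup>2"
    by (simp add: norm_mult ennreal_mult)
  also have "\<dots> \<le> (\<integral>\<^sup>+x. ennreal (cmod (f x)) ^ 2 \<partial>M) * (\<integral>\<^sup>+x. ennreal (cmod (g x)) ^ 2 \<partial>M)"
    by (rule Cauchy_Schwarz_nn_integral) auto
  also have "\<dots> \<le> ennreal F * ennreal G"
    using f g by (intro mult_mono) (auto simp: ennreal_power)
  also have "\<dots> = (ennreal (sqrt (F * G)))\<^sup>2"
    using nn by (simp add: ennreal_mult ennreal_power real_sqrt_mult power_mult_distrib)
  finally have le: "(\<integral>\<^sup>+x. ennreal (cmod (f x * g x)) \<partial>M) \<le> ennreal (sqrt (F * G))"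
    by (rule ennreal_power2_le_imp_le)
  show i: "integrable M (\<lambda>x. f x * g x)"
    using le by (intro integrableI_bounded) (auto intro: le_less_trans)
  have "ennreal (cmod (\<integral>x. f x * g x \<partial>M)) \<le> (\<integral>\<^sup>+x. ennreal (cmod (f x * g x)) \<partial>M)"
    by (rule integral_norm_bound_ennreal[OF i])
  also note le
  finally show "cmod (\<integral>x. f x * g x \<partial>M) \<le> sqrt (F * G)"
    using nn by (simp add: ennreal_le_iff)
qed

lemma norm_diff_square_le: "(norm (a - b))\<^sup>2 \<le> 2 * (norm a)\<^sup>2 + 2 * (norm (b :: 'a :: real_normed_vector))\<^sup>2"
proof -
  have "(norm (a - b))\<^sup>2 \<le> (norm a + norm b)\<^sup>2"
    by (intro power_mono norm_triangle_ineq4) simp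
  also have "\<dots> \<le> 2 * (norm a)\<^sup>2 + 2 * (norm b)\<^sup>2"
    using sum_squares_bound[of "norm a" "norm b"] by (simp add: power2_sum)
  finally show ?thesis .
qed

text \<open>The weight \<open>exp (- |d x|\<^sup>2 / 2)\<close> turns the quadratic form of the transform into a
  convolution with a Gaussian of mass one, to which Schur's test applies.\<close>

lemma weighted_plancherel:
  fixes h :: "real^3 \<Rightarrow> complex"
  assumes h: "integrable lborel h" and d: "d > 0"
  shows "(\<integral>\<^sup>+x. ennreal ((cmod (inv_fourier h x))\<^sup>2 * exp (- (norm (d *\<^sub>R x))\<^sup>2 / 2)) \<partial>lborel)
    \<le> (\<integral>\<^sup>+\<xi>. ennreal ((cmod (h \<xi>))\<^sup>2) \<partial>lborel)"
proof -
  define w :: "real^3 \<Rightarrow> real" where "w x = exp (- (norm (d *\<^sub>R x))\<^sup>2 / 2)" for x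
  define c where "c = (2 * pi) powr (- 3 / 2)"
  define G where "G x = (\<integral>\<xi>. cis (x \<bullet> \<xi>) * h \<xi> \<partial>lborel)" for x
  define k where "k p = h (fst p) * cnj (h (snd p))" for p :: "(real^3) \<times> (real^3)"
  define \<gamma> where "\<gamma> z = gauss (z /\<^sub>R d) / d ^ 3" for z :: "real^3"
  have [measurable]: "h \<in> borel_measurable borel" using h by auto
  have [measurable]: "w \<in> borel_measurable borel" unfolding w_def[abs_def] by measurable
  have [measurable]: "\<gamma> \<in> borel_measurable borel" unfolding \<gamma>_def[abs_def] by measurable
  have hx: "integrable lborel (\<lambda>\<xi>. cis (x \<bullet> \<xi>) * h \<xi>)" for x
    by (rule Bochner_Integration.integrable_bound[OF h]) (auto simp: norm_mult)
  have cc: "c\<^sup>2 = 1 / (2 * pi) ^ 3"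
  proof -
    have "c\<^sup>2 = (2 * pi) powr (- 3)"
      unfolding c_def by (simp add: power2_eq_square powr_add[symmetric])
    also have "\<dots> = 1 / (2 * pi) ^ 3"
      using powr_realpow[of "2 * pi" 3] by (simp add: powr_minus_divide)
    finally show ?thesis .
  qed
  have [measurable]: "G \<in> borel_measurable borel"
    unfolding G_def[abs_def] by measurable
  have [measurable]: "k \<in> borel_measurable borel"
    unfolding k_def[abs_def] borel_prod[symmetric] by measurable
  have [measurable]: "k \<in> borel_measurable (lborel \<Otimes>\<^sub>M lborel)"
    unfolding lborel_prod by measurable
  have kint: "integrable lborel k"
    unfolding k_def[abs_def] lborel_prod[symmetric]
    by (rule lborel_times_integral(1)) (use h in auto)
  have \<gamma>1: "(\<integral>\<^sup>+z. ennreal (\<gamma> z) \<partial>lborel) = 1"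
  proof -
    have "ennreal (\<gamma> (0 + d *\<^sub>R z)) = ennreal (gauss z) * ennreal (1 / d ^ 3)" for z
      using d by (simp add: \<gamma>_def flip: ennreal_mult)
    then have "(\<integral>\<^sup>+z. ennreal (\<gamma> (0 + d *\<^sub>R z)) \<partial>lborel) = ennreal (1 / d ^ 3)"
      by (simp add: nn_integral_multc nn_integral_gauss)
    then show ?thesis
      using nn_integral_lborel_affine[of "\<lambda>z. ennreal (\<gamma> z)" d 0] d by (simp flip: ennreal_mult)
  qed
  have wint: "integrable lborel w"
  proof -
    have "integrable lborel (\<lambda>x. sqrt (2 * pi) ^ 3 * gauss (0 + d *\<^sub>R x :: real^3))"
      using integrable_lborel_affine_iff[of "gauss :: real^3 \<Rightarrow> real" d 0] d integrable_gauss
      by (intro integrable_mult_right) auto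
    then show ?thesis by (simp add: w_def[abs_def] gauss_def)
  qed
  have norms: "ennreal ((cmod (inv_fourier h x))\<^sup>2 * w x) = ennreal (c\<^sup>2 * Re (of_real (w x) * (G x * cnj (G x))))" for x
  proof -
    have "inv_fourier h x = of_real c * G x" by (simp add: inv_fourier_def G_def c_def)
    then have "(cmod (inv_fourier h x))\<^sup>2 = c\<^sup>2 * (cmod (G x))\<^sup>2" by (simp add: norm_mult power_mult_distrib)
    moreover have "Re (of_real (w x) * (G x * cnj (G x))) = w x * (cmod (G x))\<^sup>2"
      unfolding complex_norm_square[symmetric] by (simp flip: of_real_mult of_real_power)
    ultimately show ?thesis by (simp add: mult_ac)
  qed
  have cd: "cis (x \<bullet> (a - b)) = cis (x \<bullet> a) * cnj (cis (x \<bullet> b))" for x a b :: "real^3"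
    by (simp add: inner_diff_right cis_cnj cis_mult)
  \<comment> \<open>Squaring the transform gives a double integral over pairs of frequencies in
    which the phase sees only the difference \<open>fst p - snd p\<close>.\<close>
  have GG: "G x * cnj (G x) = (\<integral>p. cis (x \<bullet> (fst p - snd p)) * k p \<partial>lborel)" for x
  proof -
    have "(\<integral>p. cis (x \<bullet> (fst p - snd p)) * k p \<partial>lborel) =
        (\<integral>p. (cis (x \<bullet> fst p) * h (fst p)) * cnj (cis (x \<bullet> snd p) * h (snd p)) \<partial>(lborel \<Otimes>\<^sub>M lborel))"
      unfolding lborel_prod
      by (intro Bochner_Integration.integral_cong refl)
         (simp add: k_def cd mult_ac)
    also have "\<dots> = G x * cnj (G x)"
    proof -
      have "(\<integral>\<xi>. cnj (cis (x \<bullet> \<xi>) * h \<xi>) \<partial>lborel) = cnj (G x)"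
        unfolding G_def by (rule Bochner_Integration.integral_cnj)
      moreover have "integrable lborel (\<lambda>\<xi>. cnj (cis (x \<bullet> \<xi>) * h \<xi>))"
        using hx[of x] by (rule integrable_cnj)
      ultimately show ?thesis
        using lborel_times_integral(2)[OF hx[of x], of "\<lambda>\<xi>. cnj (cis (x \<bullet> \<xi>) * h \<xi>)"] by (simp only: G_def)
    qed
    finally show ?thesis by simp
  qed
  have [measurable]: "(\<lambda>q. fst (snd q)) \<in> borel_measurable ((lborel :: (real^3) measure) \<Otimes>\<^sub>M (lborel :: ((real^3) \<times> (real^3)) measure))"
    "(\<lambda>q. snd (snd q)) \<in> borel_measurable ((lborel :: (real^3) measure) \<Otimes>\<^sub>M (lborel :: ((real^3) \<times> (real^3)) measure))"
    "(\<lambda>q. k (snd q)) \<in> borel_measurable ((lborel :: (real^3) measure) \<Otimes>\<^sub>M (lborel :: ((real^3) \<times> (real^3)) measure))"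
    by (auto intro!: measurable_compose[OF measurable_snd] borel_measurable_continuous_onI continuous_intros)
  \<comment> \<open>The weight makes the integrand absolutely integrable in \<open>x\<close> and
    \<open>p\<close> jointly, which licenses the exchange of integrals in \<open>Gw\<close>.\<close>
  have wk: "integrable (lborel \<Otimes>\<^sub>M lborel) (\<lambda>q. of_real (w (fst q)) * (cis (fst q \<bullet> (fst (snd q) - snd (snd q))) * k (snd q)))"
  proof (rule Bochner_Integration.integrable_bound)
    show "integrable (lborel \<Otimes>\<^sub>M lborel) (\<lambda>q. complex_of_real (w (fst q)) * k (snd q))"
      by (rule lborel_times_integral(1)) (use wint kint in auto)
    show "(\<lambda>q. of_real (w (fst q)) * (cis (fst q \<bullet> (fst (snd q) - snd (snd q))) * k (snd q))) \<in> borel_measurable (lborel \<Otimes>\<^sub>M lborel)"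
      by measurable
  qed (auto simp: norm_mult)
  have Gw: "(\<integral>x. of_real (w x) * (G x * cnj (G x)) \<partial>lborel) =
    (\<integral>p. of_real ((2 * pi) ^ 3 * \<gamma> (fst p - snd p)) * k p \<partial>lborel)"
  proof -
    have "(\<integral>x. of_real (w x) * (G x * cnj (G x)) \<partial>lborel) =
      (\<integral>x. (\<integral>p. of_real (w x) * (cis (x \<bullet> (fst p - snd p)) * k p) \<partial>lborel) \<partial>lborel)"
      unfolding GG by (intro Bochner_Integration.integral_cong refl) simp
    also have "\<dots> = (\<integral>p. (\<integral>x. of_real (w x) * (cis (x \<bullet> (fst p - snd p)) * k p) \<partial>lborel) \<partial>lborel)"
      using lborel_pair.Fubini_integral[of "\<lambda>x p. of_real (w x) * (cis (x \<bullet> (fst p - snd p)) * k p)"] wk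
      by (simp add: case_prod_beta')
    also have "\<dots> = (\<integral>p. of_real ((2 * pi) ^ 3 * \<gamma> (fst p - snd p)) * k p \<partial>lborel)"
    proof (intro Bochner_Integration.integral_cong refl)
      fix p :: "(real^3) \<times> (real^3)"
      have "(\<integral>x. of_real (w x) * (cis (x \<bullet> (fst p - snd p)) * k p) \<partial>lborel) =
        (\<integral>x. cis (x \<bullet> (fst p - snd p)) * of_real (w x) \<partial>lborel) * k p"
        unfolding integral_mult_left_zero[symmetric] by (simp add: mult_ac)
      then show "(\<integral>x. of_real (w x) * (cis (x \<bullet> (fst p - snd p)) * k p) \<partial>lborel) =
         of_real ((2 * pi) ^ 3 * \<gamma> (fst p - snd p)) * k p"
        using integral_cis_scaled_gauss[OF d, of "fst p - snd p"] by (simp add: w_def \<gamma>_def)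
    qed
    finally show ?thesis .
  qed
  have schur: "(\<integral>\<^sup>+p. ennreal (\<gamma> (fst p - snd p) * cmod (k p)) \<partial>lborel) \<le> (\<integral>\<^sup>+\<xi>. ennreal ((cmod (h \<xi>))\<^sup>2) \<partial>lborel)"
    (is "_ \<le> ?H")
  proof -
    have \<gamma>0: "\<gamma> z \<ge> 0" for z using d by (simp add: \<gamma>_def)
    have sh: "(\<integral>\<^sup>+y. ennreal (\<gamma> (x - y)) \<partial>lborel) = 1" "(\<integral>\<^sup>+y. ennreal (\<gamma> (y - x)) \<partial>lborel) = 1" for x
    proof -
      show "(\<integral>\<^sup>+y. ennreal (\<gamma> (x - y)) \<partial>lborel) = 1"
        using nn_integral_lborel_affine[of "\<lambda>z. ennreal (\<gamma> z)" "-1" x] \<gamma>1 by simp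
      show "(\<integral>\<^sup>+y. ennreal (\<gamma> (y - x)) \<partial>lborel) = 1"
        using nn_integral_lborel_affine[of "\<lambda>z. ennreal (\<gamma> z)" "1" "-x"] \<gamma>1 by simp
    qed
    have H1: "(\<integral>\<^sup>+p. ennreal (\<gamma> (fst p - snd p)) * ennreal ((cmod (h (fst p)))\<^sup>2) \<partial>(lborel \<Otimes>\<^sub>M lborel)) = ?H"
      by (subst lborel_pair.nn_integral_snd[symmetric] lborel.nn_integral_fst[symmetric], measurable)
         (simp add: nn_integral_multc sh)
    have H2: "(\<integral>\<^sup>+p. ennreal (\<gamma> (fst p - snd p)) * ennreal ((cmod (h (snd p)))\<^sup>2) \<partial>(lborel \<Otimes>\<^sub>M lborel)) = ?H"
      by (subst lborel_pair.nn_integral_snd[symmetric], measurable)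
         (simp add: nn_integral_multc sh)
    have "2 * (\<integral>\<^sup>+p. ennreal (\<gamma> (fst p - snd p) * cmod (k p)) \<partial>lborel) =
       (\<integral>\<^sup>+p. ennreal (2 * (\<gamma> (fst p - snd p) * cmod (k p))) \<partial>(lborel \<Otimes>\<^sub>M lborel))"
      unfolding lborel_prod[symmetric]
      by (subst nn_integral_cmult[symmetric]) (auto simp: ennreal_mult \<gamma>0)
    also have "\<dots> \<le> (\<integral>\<^sup>+p. ennreal (\<gamma> (fst p - snd p)) * ennreal ((cmod (h (fst p)))\<^sup>2) +
        ennreal (\<gamma> (fst p - snd p)) * ennreal ((cmod (h (snd p)))\<^sup>2) \<partial>(lborel \<Otimes>\<^sub>M lborel))"
    proof (rule nn_integral_mono)
      fix p :: "(real^3) \<times> (real^3)"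
      have "2 * (\<gamma> (fst p - snd p) * cmod (k p)) \<le>
          \<gamma> (fst p - snd p) * ((cmod (h (fst p)))\<^sup>2 + (cmod (h (snd p)))\<^sup>2)"
        using mult_left_mono[OF sum_squares_bound[of "cmod (h (fst p))" "cmod (h (snd p))"] \<gamma>0[of "fst p - snd p"]]
        by (simp add: k_def norm_mult mult_ac)
      then show "ennreal (2 * (\<gamma> (fst p - snd p) * cmod (k p))) \<le>
          ennreal (\<gamma> (fst p - snd p)) * ennreal ((cmod (h (fst p)))\<^sup>2) +
          ennreal (\<gamma> (fst p - snd p)) * ennreal ((cmod (h (snd p)))\<^sup>2)"
        by (simp add: \<gamma>0 distrib_left flip: ennreal_mult ennreal_plus)
    qed
    also have "\<dots> = 2 * ?H"
      by (subst nn_integral_add) (auto simp: H1 H2 mult_2)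
    finally show ?thesis
      by (subst (asm) ennreal_mult_le_mult_iff) auto
  qed
  have Gwi: "integrable lborel (\<lambda>x. of_real (w x) * (G x * cnj (G x)))"
  proof -
    have "integrable lborel (\<lambda>x. \<integral>p. of_real (w x) * (cis (x \<bullet> (fst p - snd p)) * k p) \<partial>lborel)"
      using lborel_pair.integrable_fst[of "\<lambda>x p. of_real (w x) * (cis (x \<bullet> (fst p - snd p)) * k p)"] wk
      by (simp add: case_prod_beta')
    then show ?thesis by (simp add: GG)
  qed
  have "(\<integral>\<^sup>+x. ennreal ((cmod (inv_fourier h x))\<^sup>2 * w x) \<partial>lborel) =
    (\<integral>\<^sup>+x. ennreal (c\<^sup>2 * Re (of_real (w x) * (G x * cnj (G x)))) \<partial>lborel)"
    by (simp only: norms)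
  also have "\<dots> = ennreal (c\<^sup>2 * Re (\<integral>x. of_real (w x) * (G x * cnj (G x)) \<partial>lborel))"
    using Gwi by (subst nn_integral_eq_integral)
      (auto simp: complex_norm_square[symmetric] w_def complex_of_real_integrable_eq simp flip: of_real_mult of_real_power intro!: AE_I2)
  also have "\<dots> \<le> ennreal (c\<^sup>2 * cmod (\<integral>p. of_real ((2 * pi) ^ 3 * \<gamma> (fst p - snd p)) * k p \<partial>lborel))"
    unfolding Gw by (intro ennreal_leI mult_left_mono complex_Re_le_cmod) simp
  also have "\<dots> = ennreal (cmod (\<integral>p. of_real (\<gamma> (fst p - snd p)) * k p \<partial>lborel))"
    by (simp add: cc mult.assoc norm_mult norm_power)
  also have "\<dots> \<le> (\<integral>\<^sup>+p. ennreal (cmod (of_real (\<gamma> (fst p - snd p)) * k p)) \<partial>lborel)"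
    by (cases "integrable lborel (\<lambda>p. of_real (\<gamma> (fst p - snd p)) * k p)")
       (auto simp: not_integrable_integral_eq intro: integral_norm_bound_ennreal)
  also have "\<dots> = (\<integral>\<^sup>+p. ennreal (\<gamma> (fst p - snd p) * cmod (k p)) \<partial>lborel)"
    using d by (intro nn_integral_cong) (simp add: norm_mult norm_divide norm_power \<gamma>_def)
  also note schur
  finally show ?thesis by (simp add: w_def)
qed

text \<open>The weights tend to one as \<open>d\<close> tends to zero, so Fatou's lemma removes
  them. Integrability of \<open>h\<close> gives the transform a pointwise meaning; the right-hand
  side may be infinite.\<close>

theorem plancherel_le:
  fixes h :: "real^3 \<Rightarrow> complex"
  assumes h: "integrable lborel h"
  shows "(\<integral>\<^sup>+x. ennreal ((cmod (inv_fourier h x))\<^sup>2) \<partial>lborel) \<le> (\<integral>\<^sup>+\<xi>. ennreal ((cmod (h \<xi>))\<^sup>2) \<partial>lborel)"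
proof -
  have [measurable]: "h \<in> borel_measurable borel" using h by auto
  have [measurable]: "inv_fourier h \<in> borel_measurable borel"
    unfolding inv_fourier_def[abs_def] by measurable
  define d :: "nat \<Rightarrow> real" where "d n = 1 / real (Suc n)" for n
  have d: "d \<longlonglongrightarrow> 0" unfolding d_def using LIMSEQ_inverse_real_of_nat by (simp add: divide_inverse)
  have "(\<integral>\<^sup>+x. ennreal ((cmod (inv_fourier h x))\<^sup>2) \<partial>lborel) =
    (\<integral>\<^sup>+x. liminf (\<lambda>n. ennreal ((cmod (inv_fourier h x))\<^sup>2 * exp (- (norm (d n *\<^sub>R x))\<^sup>2 / 2))) \<partial>lborel)"
  proof (rule nn_integral_cong)
    fix x
    have "(\<lambda>n. ennreal ((cmod (inv_fourier h x))\<^sup>2 * exp (- (norm (d n *\<^sub>R x))\<^sup>2 / 2))) \<longlonglongrightarrow>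
       ennreal ((cmod (inv_fourier h x))\<^sup>2 * exp (- (norm (0 *\<^sub>R x))\<^sup>2 / 2))"
      by (intro tendsto_intros d) auto
    from lim_imp_Liminf[OF trivial_limit_sequentially this]
    show "ennreal ((cmod (inv_fourier h x))\<^sup>2) =
       liminf (\<lambda>n. ennreal ((cmod (inv_fourier h x))\<^sup>2 * exp (- (norm (d n *\<^sub>R x))\<^sup>2 / 2)))"
      by simp
  qed
  also have "\<dots> \<le> liminf (\<lambda>n. \<integral>\<^sup>+x. ennreal ((cmod (inv_fourier h x))\<^sup>2 * exp (- (norm (d n *\<^sub>R x))\<^sup>2 / 2)) \<partial>lborel)"
    by (intro nn_integral_liminf) measurable
  also have "\<dots> \<le> (\<integral>\<^sup>+\<xi>. ennreal ((cmod (h \<xi>))\<^sup>2) \<partial>lborel)"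
  proof (rule Liminf_le)
    have "d n > 0" for n by (simp add: d_def)
    then show "\<forall>\<^sub>F n in sequentially. (\<integral>\<^sup>+x. ennreal ((cmod (inv_fourier h x))\<^sup>2 * exp (- (norm (d n *\<^sub>R x))\<^sup>2 / 2)) \<partial>lborel)
        \<le> (\<integral>\<^sup>+\<xi>. ennreal ((cmod (h \<xi>))\<^sup>2) \<partial>lborel)"
      by (intro always_eventually allI weighted_plancherel[OF h])
  qed simp
  finally show ?thesis .
qed

section \<open>Lattice sums\<close>

lemma bij_betw_vec_box: "bij_betw (\<lambda>n. ($) n) {n::'a^'n. \<forall>i. n $ i \<in> S i} (\<Pi>\<^sub>E i\<in>UNIV. S i)"
proof (rule bij_betwI[where g=vec_lambda])
  show "(\<lambda>n. ($) n) \<in> {n::'a^'n. \<forall>i. n $ i \<in> S i} \<rightarrow> (\<Pi>\<^sub>E i\<in>UNIV. S i)" by auto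
  show "vec_lambda \<in> (\<Pi>\<^sub>E i\<in>UNIV. S i) \<rightarrow> {n::'a^'n. \<forall>i. n $ i \<in> S i}" by auto
qed auto

lemma card_vec_box: "card {n::'a^'n. \<forall>i. n $ i \<in> S i} = (\<Prod>i\<in>UNIV. card (S i))"
  using bij_betw_same_card[OF bij_betw_vec_box[of S]] by (simp add: card_PiE)

lemma finite_vec_box:
  assumes "\<And>i. finite (S i)" shows "finite {n::'a^'n. \<forall>i. n $ i \<in> S i}"
  using bij_betw_finite[OF bij_betw_vec_box[of S]] assms by (simp add: finite_PiE)

lemma lattice_vec_simps [simp]:
  "lattice_vec 0 = 0" "lattice_vec (- n) = - lattice_vec n" "lattice_vec n $ i = real_of_int (n $ i)"
  "lattice_vec (m + n) = lattice_vec m + lattice_vec n" "lattice_vec (m - n) = lattice_vec m - lattice_vec n"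
  by (simp_all add: lattice_vec_def vec_eq_iff)

lemma half_lattice_cases: "n = 0 \<or> n \<in> half_lattice \<or> - n \<in> half_lattice"
  by (auto simp: half_lattice_def vec_eq_iff forall_3)

lemma half_lattice_disjoint:
  "0 \<notin> half_lattice" "n \<in> half_lattice \<Longrightarrow> - n \<notin> half_lattice"
  by (auto simp: half_lattice_def)

text \<open>Pairs \<open>n\<close> with \<open>- n\<close>, the form in which the constraint
  \<open>g j (- n) = cnj (g j n)\<close> can be resolved into independent variables.\<close>

lemma sum_symmetric_half_lattice:
  fixes F :: "int^3 \<Rightarrow> 'b::comm_monoid_add"
  assumes B: "finite B" "uminus ` B = B"
  shows "(\<Sum>n\<in>B. F n) = (\<Sum>n\<in>B \<inter> {0}. F n) + (\<Sum>n\<in>B \<inter> half_lattice. F n + F (- n))"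
proof -
  have neg: "- n \<in> B" if "n \<in> B" for n using B that by auto
  have un: "B = (B \<inter> {0}) \<union> ((B \<inter> half_lattice) \<union> uminus ` (B \<inter> half_lattice))"
    using half_lattice_cases neg by (auto simp: image_iff) (metis neg minus_minus IntI)+
  have "(\<Sum>n\<in>B. F n) = (\<Sum>n\<in>B \<inter> {0}. F n) + ((\<Sum>n\<in>B \<inter> half_lattice. F n) + (\<Sum>n\<in>uminus ` (B \<inter> half_lattice). F n))"
    by (subst un, subst sum.union_disjoint, use B half_lattice_disjoint in force, use B in force,
        use half_lattice_disjoint in force, subst sum.union_disjoint)
       (use B half_lattice_disjoint in auto)
  also have "(\<Sum>n\<in>uminus ` (B \<inter> half_lattice). F n) = (\<Sum>n\<in>B \<inter> half_lattice. F (- n))"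
    by (subst sum.reindex) (auto simp: inj_on_def)
  finally show ?thesis by (simp add: sum.distrib)
qed

text \<open>The extra \<open>1\<close> is the radius of the support of the cutoff: a piece with
  index outside the box has all its frequencies of size at least \<open>2 ^ k\<close>
  (\<open>norm_ge_outside_box\<close>). The symmetric shape keeps \<open>n\<close> and
  \<open>- n\<close> together.\<close>

definition lattice_box :: "nat \<Rightarrow> (int^3) set" where
  "lattice_box k = {n. \<forall>i. n $ i \<in> {- (2 ^ k + 1)..2 ^ k + 1}}"

lemma finite_lattice_box [simp, intro]: "finite (lattice_box k)"
  unfolding lattice_box_def by (rule finite_vec_box) simp

lemma uminus_lattice_box: "uminus ` lattice_box k = lattice_box k"
proof -
  have neg: "- n \<in> lattice_box k" if "n \<in> lattice_box k" for n
    unfolding lattice_box_def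
  proof safe
    fix i
    from that have "- (2 ^ k + 1) \<le> n $ i \<and> n $ i \<le> 2 ^ k + 1" by (simp add: lattice_box_def)
    then show "(- n) $ i \<in> {- (2 ^ k + 1)..2 ^ k + 1}" by simp
  qed
  show ?thesis
  proof
    show "uminus ` lattice_box k \<subseteq> lattice_box k" using neg by auto
    show "lattice_box k \<subseteq> uminus ` lattice_box k"
      by (intro subsetI image_eqI[OF _ neg]) auto
  qed
qed

lemma lattice_box_mono: "k \<le> l \<Longrightarrow> lattice_box k \<subseteq> lattice_box l"
proof
  fix n assume kl: "k \<le> l" and n: "n \<in> lattice_box k"
  have "(2::int) ^ k \<le> 2 ^ l" using kl by (intro power_increasing) auto
  moreover have "- (2 ^ k + 1) \<le> n $ i \<and> n $ i \<le> 2 ^ k + 1" for i using n by (simp add: lattice_box_def)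
  ultimately have "- (2 ^ l + 1) \<le> n $ i \<and> n $ i \<le> 2 ^ l + 1" for i by (smt (verit))
  then show "n \<in> lattice_box l" by (simp add: lattice_box_def)
qed

lemma finite_subset_lattice_box:
  assumes "finite F" shows "\<exists>k. F \<subseteq> lattice_box k"
  using assms
proof (induction F rule: finite_induct)
  case (insert n F)
  then obtain k where k: "F \<subseteq> lattice_box k" by auto
  define m where "m = nat (Max (range (\<lambda>i. \<bar>n $ i\<bar>)))"
  have "\<bar>n $ i\<bar> \<le> Max (range (\<lambda>i. \<bar>n $ i\<bar>))" for i by (rule Max_ge) auto
  moreover have "int m \<ge> Max (range (\<lambda>i. \<bar>n $ i\<bar>))" unfolding m_def by linarith
  ultimately have le: "\<bar>n $ i\<bar> \<le> int m" for i by (meson order_trans)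
  have "int m < 2 ^ m" by (rule of_nat_less_two_power)
  then have "- (2 ^ m + 1) \<le> n $ i \<and> n $ i \<le> 2 ^ m + 1" for i using le[of i] by linarith
  then have "n \<in> lattice_box m" by (simp add: lattice_box_def)
  then show ?case
    using k lattice_box_mono[of k "max k m"] lattice_box_mono[of m "max k m"] by (intro exI[of _ "max k m"]) auto
qed simp

section \<open>Overlap of the translated cutoffs\<close>

locale compact_cutoff =
  fixes \<psi> :: "real^3 \<Rightarrow> complex"
  assumes supp: "\<psi> \<xi> \<noteq> 0 \<Longrightarrow> \<bar>\<xi> $ i\<bar> \<le> 1"
begin

abbreviation piece :: "int^3 \<Rightarrow> real^3 \<Rightarrow> complex" where
  "piece n \<xi> \<equiv> \<psi> (\<xi> - lattice_vec n)"

text \<open>A closed interval of length 2 contains at most 3 integers, and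
  \<open>27 = 3 ^ 3\<close>.\<close>

lemma overlap_finite: "finite {n. piece n \<xi> \<noteq> 0}" and overlap_card: "card {n. piece n \<xi> \<noteq> 0} \<le> 27"
proof -
  define S where "S i = {\<lceil>\<xi> $ i - 1\<rceil>..\<lfloor>\<xi> $ i + 1\<rfloor>}" for i
  have sub: "{n. piece n \<xi> \<noteq> 0} \<subseteq> {n. \<forall>i. n $ i \<in> S i}"
  proof safe
    fix n i assume "piece n \<xi> \<noteq> 0"
    from supp[OF this, of i] have "\<bar>\<xi> $ i - real_of_int (n $ i)\<bar> \<le> 1" by simp
    then show "n $ i \<in> S i" unfolding S_def atLeastAtMost_iff ceiling_le_iff le_floor_iff by linarith
  qed
  have fin: "finite {n. \<forall>i. n $ i \<in> S i}" by (rule finite_vec_box) (simp add: S_def)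
  show "finite {n. piece n \<xi> \<noteq> 0}" by (rule finite_subset[OF sub fin])
  have S3: "card (S i) \<le> 3" for i unfolding S_def by simp linarith
  have "card {n. piece n \<xi> \<noteq> 0} \<le> card {n. \<forall>i. n $ i \<in> S i}" by (rule card_mono[OF fin sub])
  also have "\<dots> \<le> (\<Prod>i\<in>(UNIV::3 set). 3)" unfolding card_vec_box by (intro prod_mono) (auto simp: S3)
  finally show "card {n. piece n \<xi> \<noteq> 0} \<le> 27" by simp
qed

text \<open>Almost orthogonality: at a fixed frequency at most 27 terms survive, so Cauchy-Schwarz
  costs this factor whatever the size of \<open>B\<close>.\<close>

lemma overlap_sum_square:
  fixes a :: "int^3 \<Rightarrow> real"
  assumes B: "finite B"
  shows "(\<Sum>n\<in>B. a n * cmod (piece n \<xi>))\<^sup>2 \<le> 27 * (\<Sum>n\<in>B. (a n)\<^sup>2 * (cmod (piece n \<xi>))\<^sup>2)"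
proof -
  define S where "S = {n\<in>B. piece n \<xi> \<noteq> 0}"
  have "card S \<le> card {n. piece n \<xi> \<noteq> 0}" by (intro card_mono overlap_finite) (auto simp: S_def)
  with overlap_card[of \<xi>] have c: "real (card S) \<le> 27" by linarith
  have "(\<Sum>n\<in>B. a n * cmod (piece n \<xi>)) = (\<Sum>n\<in>S. a n * cmod (piece n \<xi>))"
    using B by (intro sum.mono_neutral_right) (auto simp: S_def)
  then have "(\<Sum>n\<in>B. a n * cmod (piece n \<xi>))\<^sup>2 \<le> (\<Sum>n\<in>S. (a n * cmod (piece n \<xi>))\<^sup>2) * card S"
    using sum_squared_le_sum_of_squares by simp
  also have "\<dots> \<le> (\<Sum>n\<in>S. (a n * cmod (piece n \<xi>))\<^sup>2) * 27"
    using c by (intro mult_left_mono sum_nonneg) auto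
  also have "(\<Sum>n\<in>S. (a n * cmod (piece n \<xi>))\<^sup>2) \<le> (\<Sum>n\<in>B. (a n * cmod (piece n \<xi>))\<^sup>2)"
    using B by (intro sum_mono2) (auto simp: S_def)
  finally show ?thesis by (simp add: power_mult_distrib mult.commute)
qed

lemma overlap_norm_sum_square:
  assumes B: "finite B"
  shows "(cmod (\<Sum>n\<in>B. c n * piece n \<xi>))\<^sup>2 \<le> 27 * (\<Sum>n\<in>B. (cmod (c n))\<^sup>2 * (cmod (piece n \<xi>))\<^sup>2)"
proof -
  have "cmod (\<Sum>n\<in>B. c n * piece n \<xi>) \<le> (\<Sum>n\<in>B. cmod (c n) * cmod (piece n \<xi>))"
    by (rule order_trans[OF norm_sum]) (simp add: norm_mult)
  then have "(cmod (\<Sum>n\<in>B. c n * piece n \<xi>))\<^sup>2 \<le> (\<Sum>n\<in>B. cmod (c n) * cmod (piece n \<xi>))\<^sup>2"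
    by (intro power_mono) auto
  also note overlap_sum_square[OF B]
  finally show ?thesis .
qed

lemma overlap_square_sum:
  assumes B: "finite B" and b: "\<And>\<xi>. cmod (\<psi> \<xi>) \<le> b"
  shows "(\<Sum>n\<in>B. (cmod (piece n \<xi>))\<^sup>2) \<le> 27 * b\<^sup>2"
proof -
  define S where "S = {n\<in>B. piece n \<xi> \<noteq> 0}"
  have "card S \<le> card {n. piece n \<xi> \<noteq> 0}" by (intro card_mono overlap_finite) (auto simp: S_def)
  with overlap_card[of \<xi>] have c: "real (card S) \<le> 27" by linarith
  have "(\<Sum>n\<in>B. (cmod (piece n \<xi>))\<^sup>2) = (\<Sum>n\<in>S. (cmod (piece n \<xi>))\<^sup>2)"
    using B by (intro sum.mono_neutral_right) (auto simp: S_def)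
  also have "\<dots> \<le> (\<Sum>n\<in>S. b\<^sup>2)"
    by (intro sum_mono power_mono b) auto
  also have "\<dots> \<le> 27 * b\<^sup>2" using c by (simp add: mult_right_mono)
  finally show ?thesis .
qed

lemma norm_ge_outside_box:
  assumes "n \<notin> lattice_box k" and "piece n \<xi> \<noteq> 0"
  shows "norm \<xi> \<ge> 2 ^ k"
proof -
  from assms(1) obtain i where "\<not> (- (2 ^ k + 1) \<le> n $ i \<and> n $ i \<le> 2 ^ k + 1)"
    by (auto simp: lattice_box_def)
  then have "\<bar>n $ i\<bar> \<ge> 2 ^ k + 1" by linarith
  then have "real_of_int \<bar>n $ i\<bar> \<ge> real_of_int (2 ^ k + 1)" by (simp only: of_int_le_iff)
  moreover have "\<bar>\<xi> $ i - real_of_int (n $ i)\<bar> \<le> 1" using supp[OF assms(2), of i] by simp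
  ultimately have "\<bar>\<xi> $ i\<bar> \<ge> 2 ^ k" by simp
  with component_le_norm_cart[of \<xi> i] show ?thesis by linarith
qed

end

section \<open>Averages over shifted dyadic grids\<close>

definition unit_cube :: "(real^3) set" where
  "unit_cube = {y. \<forall>i. y $ i \<in> {0..<1}}"

lemma unit_cube_sets [measurable]: "unit_cube \<in> sets borel"
proof -
  have "unit_cube = (\<Inter>i. {y. 0 \<le> y $ i} \<inter> {y. y $ i < 1})" by (auto simp: unit_cube_def)
  moreover have "\<dots> \<in> sets borel" by (intro sets.countable_INT'' sets.Int) measurable
  ultimately show ?thesis by simp
qed

lemma emeasure_unit_cube: "emeasure lborel unit_cube = 1"
proof -
  have "box (0::real^3) 1 \<subseteq> unit_cube" "unit_cube \<subseteq> cbox 0 1"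
    by (auto simp: unit_cube_def mem_box_cart less_imp_le)
  then have "emeasure lborel (box (0::real^3) 1) \<le> emeasure lborel unit_cube"
    "emeasure lborel unit_cube \<le> emeasure lborel (cbox (0::real^3) 1)"
    by (intro emeasure_mono; simp)+
  moreover have one: "(1::real^3) \<bullet> b = 1" if "b \<in> Basis" for b
    using that by (auto simp: Basis_vec_def inner_axis)
  have "emeasure lborel (box (0::real^3) 1) = 1" "emeasure lborel (cbox (0::real^3) 1) = 1"
    by (subst emeasure_lborel_box emeasure_lborel_cbox; simp add: one prod.neutral)+
  ultimately show ?thesis by (metis antisym)
qed

text \<open>\<open>8 ^ k = (2 ^ k) ^ 3\<close>: a half-open interval of length 1 holds
  \<open>2 ^ k\<close> points of a grid of mesh \<open>1 / 2 ^ k\<close>.\<close>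

lemma card_lattice_points_le:
  fixes x :: "real^3"
  shows "finite {q. x - (1 / 2 ^ k) *\<^sub>R lattice_vec q \<in> unit_cube}"
    and "card {q. x - (1 / 2 ^ k) *\<^sub>R lattice_vec q \<in> unit_cube} \<le> 8 ^ k"
proof -
  define S where "S i = {\<lfloor>2 ^ k * x $ i\<rfloor> - 2 ^ k + 1..\<lfloor>2 ^ k * x $ i\<rfloor>}" for i
  have sub: "{q. x - (1 / 2 ^ k) *\<^sub>R lattice_vec q \<in> unit_cube} \<subseteq> {n. \<forall>i. n $ i \<in> S i}"
  proof safe
    fix q i assume "x - (1 / 2 ^ k) *\<^sub>R lattice_vec q \<in> unit_cube"
    then have "0 \<le> x $ i - real_of_int (q $ i) / 2 ^ k" "x $ i - real_of_int (q $ i) / 2 ^ k < 1"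
      by (auto simp: unit_cube_def)
    then have "real_of_int (q $ i) \<le> 2 ^ k * x $ i" "2 ^ k * x $ i < real_of_int (q $ i) + 2 ^ k"
      by (simp_all add: field_simps)
    then have "q $ i \<le> \<lfloor>2 ^ k * x $ i\<rfloor>" "\<lfloor>2 ^ k * x $ i\<rfloor> < q $ i + 2 ^ k"
      by (simp_all add: le_floor_iff floor_less_iff)
    then show "q $ i \<in> S i" by (simp add: S_def)
  qed
  have fin: "finite {n. \<forall>i. n $ i \<in> S i}" by (rule finite_vec_box) (simp add: S_def)
  show "finite {q. x - (1 / 2 ^ k) *\<^sub>R lattice_vec q \<in> unit_cube}" by (rule finite_subset[OF sub fin])
  have "card {q. x - (1 / 2 ^ k) *\<^sub>R lattice_vec q \<in> unit_cube} \<le> card {n. \<forall>i. n $ i \<in> S i}"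
    by (rule card_mono[OF fin sub])
  also have "\<dots> = (2 ^ k) ^ 3" unfolding card_vec_box by (simp add: S_def nat_power_eq)
  also have "\<dots> = (2 ^ 3) ^ k" by (simp only: power_mult[symmetric] mult.commute)
  also have "\<dots> = 8 ^ k" by simp
  finally show "card {q. x - (1 / 2 ^ k) *\<^sub>R lattice_vec q \<in> unit_cube} \<le> 8 ^ k" .
qed

lemma nn_integral_lborel_shift:
  fixes v :: "'a::euclidean_space"
  assumes [measurable]: "f \<in> borel_measurable borel"
  shows "(\<integral>\<^sup>+y. f (v + y) \<partial>lborel) = (\<integral>\<^sup>+y. f y \<partial>lborel)"
  by (subst (2) lborel_distr_plus[of v, symmetric]) (simp add: nn_integral_distr)

text \<open>Unfolding: the translates of the cube by grid points cover each point of space at most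
  \<open>8 ^ k\<close> times. The offset \<open>y\<close> runs over the same unit cube for every
  \<open>k\<close>, so that a single offset can later be chosen for all scales at once.\<close>

lemma lattice_average_le:
  fixes f :: "real^3 \<Rightarrow> ennreal" and e :: "nat \<Rightarrow> int^3"
  assumes [measurable]: "f \<in> borel_measurable borel" and e: "inj e"
  shows "(\<integral>\<^sup>+y. (\<Sum>m. f (y + (1 / 2 ^ k) *\<^sub>R lattice_vec (e m))) * indicator unit_cube y \<partial>lborel)
    \<le> 8 ^ k * (\<integral>\<^sup>+x. f x \<partial>lborel)"
proof -
  define v where "v m = (1 / 2 ^ k) *\<^sub>R lattice_vec (e m)" for m
  have "(\<integral>\<^sup>+y. (\<Sum>m. f (y + v m)) * indicator unit_cube y \<partial>lborel) =
     (\<Sum>m. \<integral>\<^sup>+y. f (y + v m) * indicator unit_cube y \<partial>lborel)"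
    by (simp add: nn_integral_suminf flip: ennreal_suminf_multc)
  also have "\<dots> = (\<Sum>m. \<integral>\<^sup>+x. f x * indicator unit_cube (x - v m) \<partial>lborel)"
  proof (rule suminf_cong)
    fix m
    show "(\<integral>\<^sup>+y. f (y + v m) * indicator unit_cube y \<partial>lborel) = (\<integral>\<^sup>+x. f x * indicator unit_cube (x - v m) \<partial>lborel)"
      using nn_integral_lborel_shift[of "\<lambda>x. f x * indicator unit_cube (x - v m)" "v m"]
      by (simp add: add.commute)
  qed
  also have "\<dots> = (\<integral>\<^sup>+x. f x * (\<Sum>m. indicator unit_cube (x - v m)) \<partial>lborel)"
    by (simp add: nn_integral_suminf flip: ennreal_suminf_cmult)
  also have "\<dots> \<le> (\<integral>\<^sup>+x. f x * 8 ^ k \<partial>lborel)"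
  proof (intro nn_integral_mono mult_left_mono)
    fix x
    define S where "S = {m. x - v m \<in> unit_cube}"
    have im: "e ` S \<subseteq> {q. x - (1 / 2 ^ k) *\<^sub>R lattice_vec q \<in> unit_cube}" by (auto simp: S_def v_def)
    have inj: "inj_on e S" using e by (rule inj_on_subset) simp
    have fS: "finite S"
      using finite_subset[OF im card_lattice_points_le(1)] inj by (rule finite_imageD)
    have "card S = card (e ` S)" using inj by (simp add: card_image)
    also have "\<dots> \<le> 8 ^ k"
      by (rule order_trans[OF card_mono[OF card_lattice_points_le(1) im] card_lattice_points_le(2)])
    finally have "(of_nat (card S) :: ennreal) \<le> of_nat (8 ^ k)" by (rule of_nat_mono)
    then have cS: "(of_nat (card S) :: ennreal) \<le> 8 ^ k" by simp
    have "(\<Sum>m. indicator unit_cube (x - v m) :: ennreal) = (\<Sum>m\<in>S. indicator unit_cube (x - v m))"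
      by (rule suminf_finite[OF fS]) (simp add: S_def)
    also have "\<dots> = of_nat (card S)" by (simp add: S_def)
    finally show "(\<Sum>m. indicator unit_cube (x - v m) :: ennreal) \<le> 8 ^ k" using cS by simp
  qed auto
  also have "\<dots> = 8 ^ k * (\<integral>\<^sup>+x. f x \<partial>lborel)"
    by (subst nn_integral_multc) (auto simp: mult.commute)
  finally show ?thesis by (simp add: v_def)
qed



section \<open>Subgaussian sums\<close>

text \<open>The nonnegative integral makes finiteness of the moment generating function part of the
  condition.\<close>

definition subgaussian :: "'a measure \<Rightarrow> real \<Rightarrow> ('a \<Rightarrow> real) \<Rightarrow> bool" where
  "subgaussian M c X \<longleftrightarrow> X \<in> borel_measurable M \<and>
     (\<forall>a. (\<integral>\<^sup>+\<omega>. ennreal (exp (a * X \<omega>)) \<partial>M) \<le> ennreal (exp (c * a\<^sup>2)))"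

context prob_space
begin

lemma subgaussian_sum_mgf:
  assumes I: "finite I" and ind: "indep_vars (\<lambda>_. borel) X I"
    and X: "\<And>i. i \<in> I \<Longrightarrow> subgaussian M c (X i)"
  shows "(\<integral>\<^sup>+\<omega>. ennreal (exp (\<Sum>i\<in>I. a i * X i \<omega>)) \<partial>M) \<le> ennreal (exp (c * (\<Sum>i\<in>I. (a i)\<^sup>2)))"
proof -
  have "(\<integral>\<^sup>+\<omega>. ennreal (exp (\<Sum>i\<in>I. a i * X i \<omega>)) \<partial>M) = (\<integral>\<^sup>+\<omega>. (\<Prod>i\<in>I. ennreal (exp (a i * X i \<omega>))) \<partial>M)"
    by (simp add: exp_sum I prod_ennreal)
  also have "\<dots> = (\<Prod>i\<in>I. \<integral>\<^sup>+\<omega>. ennreal (exp (a i * X i \<omega>)) \<partial>M)"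
    by (intro indep_vars_nn_integral I indep_vars_compose2[OF ind, where Y="\<lambda>i x. ennreal (exp (a i * x))"]) auto
  also have "\<dots> \<le> (\<Prod>i\<in>I. ennreal (exp (c * (a i)\<^sup>2)))"
    using X by (intro prod_mono_ennreal) (auto simp: subgaussian_def)
  also have "\<dots> = ennreal (exp (c * (\<Sum>i\<in>I. (a i)\<^sup>2)))"
    by (simp add: prod_ennreal exp_sum I sum_distrib_left)
  finally show ?thesis .
qed

lemma subgaussian_sum_tail1:
  assumes I: "finite I" and ind: "indep_vars (\<lambda>_. borel) X I"
    and X: "\<And>i. i \<in> I \<Longrightarrow> subgaussian M c (X i)"
    and c: "c > 0" and V: "(\<Sum>i\<in>I. (a i)\<^sup>2) \<le> V" "V > 0" and s: "s > 0"
  shows "emeasure M {\<omega>\<in>space M. s \<le> (\<Sum>i\<in>I. a i * X i \<omega>)} \<le> ennreal (exp (- s\<^sup>2 / (4 * c * V)))"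
proof -
  \<comment> \<open>The minimizer of the exponent
    \<open>- \<theta> * s + c * \<theta>^2 * V\<close>.\<close>
  define \<theta> where "\<theta> = s / (2 * c * V)"
  have \<theta>: "\<theta> > 0" using c V s by (simp add: \<theta>_def)
  have [measurable]: "X i \<in> borel_measurable M" if "i \<in> I" for i
    using X[OF that] by (simp add: subgaussian_def)
  have "emeasure M {\<omega>\<in>space M. s \<le> (\<Sum>i\<in>I. a i * X i \<omega>)} \<le>
     ennreal (exp (- \<theta> * s)) * (\<integral>\<^sup>+\<omega>. ennreal (exp (\<theta> * (\<Sum>i\<in>I. a i * X i \<omega>))) * indicator (space M) \<omega> \<partial>M)"
    by (rule Chernoff_ineq_nn_integral_ge[OF \<theta>]) measurable
  also have "(\<integral>\<^sup>+\<omega>. ennreal (exp (\<theta> * (\<Sum>i\<in>I. a i * X i \<omega>))) * indicator (space M) \<omega> \<partial>M) =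
     (\<integral>\<^sup>+\<omega>. ennreal (exp (\<Sum>i\<in>I. (\<theta> * a i) * X i \<omega>)) \<partial>M)"
    by (intro nn_integral_cong) (simp add: sum_distrib_left mult.assoc)
  also have "\<dots> \<le> ennreal (exp (c * (\<Sum>i\<in>I. (\<theta> * a i)\<^sup>2)))"
    by (rule subgaussian_sum_mgf[OF I ind X])
  also have "\<dots> \<le> ennreal (exp (c * (\<theta>\<^sup>2 * V)))"
    using c V by (simp add: power_mult_distrib mult_left_mono flip: sum_distrib_left)
  also have "ennreal (exp (- \<theta> * s)) * ennreal (exp (c * (\<theta>\<^sup>2 * V))) = ennreal (exp (- s\<^sup>2 / (4 * c * V)))"
  proof -
    have "- \<theta> * s + c * (\<theta>\<^sup>2 * V) = - s\<^sup>2 / (4 * c * V)"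
      using c V by (simp add: \<theta>_def field_simps power2_eq_square)
    then show ?thesis by (simp flip: ennreal_mult exp_add)
  qed
  finally show ?thesis by (simp add: mult_left_mono)
qed

lemma subgaussian_sum_tail:
  assumes I: "finite I" and ind: "indep_vars (\<lambda>_. borel) X I"
    and X: "\<And>i. i \<in> I \<Longrightarrow> subgaussian M c (X i)"
    and c: "c > 0" and V: "(\<Sum>i\<in>I. (a i)\<^sup>2) \<le> V" "V > 0" and s: "s > 0"
  shows "emeasure M {\<omega>\<in>space M. s \<le> \<bar>\<Sum>i\<in>I. a i * X i \<omega>\<bar>} \<le> ennreal (2 * exp (- s\<^sup>2 / (4 * c * V)))"
proof -
  have [measurable]: "X i \<in> borel_measurable M" if "i \<in> I" for i
    using X[OF that] by (simp add: subgaussian_def)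
  have "emeasure M {\<omega>\<in>space M. s \<le> \<bar>\<Sum>i\<in>I. a i * X i \<omega>\<bar>} \<le>
     emeasure M ({\<omega>\<in>space M. s \<le> (\<Sum>i\<in>I. a i * X i \<omega>)} \<union> {\<omega>\<in>space M. s \<le> (\<Sum>i\<in>I. (- a i) * X i \<omega>)})"
    by (intro emeasure_mono) (auto simp: abs_if sum_negf split: if_splits)
  also have "\<dots> \<le> emeasure M {\<omega>\<in>space M. s \<le> (\<Sum>i\<in>I. a i * X i \<omega>)} +
      emeasure M {\<omega>\<in>space M. s \<le> (\<Sum>i\<in>I. (- a i) * X i \<omega>)}"
    by (intro emeasure_subadditive) measurable
  also have "\<dots> \<le> ennreal (exp (- s\<^sup>2 / (4 * c * V))) + ennreal (exp (- s\<^sup>2 / (4 * c * V)))"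
    by (intro add_mono subgaussian_sum_tail1[OF I ind X c _ _ s]) (use V in auto)
  also have "\<dots> = ennreal (2 * exp (- s\<^sup>2 / (4 * c * V)))"
    by (simp flip: ennreal_plus)
  finally show ?thesis .
qed

text \<open>If the modulus exceeds \<open>s\<close>, the real or the imaginary part is at least
  \<open>s / 2\<close> in absolute value; this doubles the prefactor and turns the 4 in the exponent
  into 16.\<close>

lemma subgaussian_sum_tail_complex:
  fixes e :: "_ \<Rightarrow> complex"
  assumes I: "finite I" and ind: "indep_vars (\<lambda>_. borel) X I"
    and X: "\<And>i. i \<in> I \<Longrightarrow> subgaussian M c (X i)"
    and c: "c > 0" and V: "(\<Sum>i\<in>I. (cmod (e i))\<^sup>2) \<le> V" "V > 0" and s: "s > 0"
  shows "emeasure M {\<omega>\<in>space M. s < cmod (\<Sum>i\<in>I. e i * of_real (X i \<omega>))} \<le> ennreal (4 * exp (- s\<^sup>2 / (16 * c * V)))"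
proof -
  have [measurable]: "X i \<in> borel_measurable M" if "i \<in> I" for i
    using X[OF that] by (simp add: subgaussian_def)
  have le: "(\<Sum>i\<in>I. (Re (e i))\<^sup>2) \<le> V" "(\<Sum>i\<in>I. (Im (e i))\<^sup>2) \<le> V"
    using V(1) by (auto intro!: order_trans[OF sum_mono V(1)] simp: cmod_power2)
  have "emeasure M {\<omega>\<in>space M. s < cmod (\<Sum>i\<in>I. e i * of_real (X i \<omega>))} \<le>
     emeasure M ({\<omega>\<in>space M. s / 2 \<le> \<bar>\<Sum>i\<in>I. Re (e i) * X i \<omega>\<bar>} \<union> {\<omega>\<in>space M. s / 2 \<le> \<bar>\<Sum>i\<in>I. Im (e i) * X i \<omega>\<bar>})"
  proof (intro emeasure_mono subsetI)
    fix \<omega> assume "\<omega> \<in> {\<omega>\<in>space M. s < cmod (\<Sum>i\<in>I. e i * of_real (X i \<omega>))}"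
    moreover have "cmod (\<Sum>i\<in>I. e i * of_real (X i \<omega>)) \<le> \<bar>\<Sum>i\<in>I. Re (e i) * X i \<omega>\<bar> + \<bar>\<Sum>i\<in>I. Im (e i) * X i \<omega>\<bar>"
      using cmod_le[of "\<Sum>i\<in>I. e i * of_real (X i \<omega>)"] by simp
    ultimately show "\<omega> \<in> {\<omega>\<in>space M. s / 2 \<le> \<bar>\<Sum>i\<in>I. Re (e i) * X i \<omega>\<bar>} \<union> {\<omega>\<in>space M. s / 2 \<le> \<bar>\<Sum>i\<in>I. Im (e i) * X i \<omega>\<bar>}"
      by auto
  qed measurable
  also have "\<dots> \<le> emeasure M {\<omega>\<in>space M. s / 2 \<le> \<bar>\<Sum>i\<in>I. Re (e i) * X i \<omega>\<bar>} +
      emeasure M {\<omega>\<in>space M. s / 2 \<le> \<bar>\<Sum>i\<in>I. Im (e i) * X i \<omega>\<bar>}"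
    by (intro emeasure_subadditive) measurable
  also have "\<dots> \<le> ennreal (2 * exp (- (s / 2)\<^sup>2 / (4 * c * V))) + ennreal (2 * exp (- (s / 2)\<^sup>2 / (4 * c * V)))"
    by (intro add_mono subgaussian_sum_tail[OF I ind X c]) (use le V s in auto)
  also have "\<dots> = ennreal (4 * exp (- s\<^sup>2 / (16 * c * V)))"
    by (simp add: power_divide flip: ennreal_plus)
  finally show ?thesis .
qed

text \<open>Averaging the moment generating function over a Gaussian parameter produces a Gaussian
  moment.\<close>

lemma subgaussian_exp_square:
  assumes X: "subgaussian M c X" and c: "c > 0"
  shows "(\<integral>\<^sup>+\<omega>. ennreal (exp ((X \<omega>)\<^sup>2 / (8 * c))) \<partial>M) \<le> 2"
proof -
  have [measurable]: "X \<in> borel_measurable M" using X by (simp add: subgaussian_def)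
  \<comment> \<open>With \<open>s^2 = 1 / (4 * c)\<close> the Gaussian average of
    \<open>exp (s z x)\<close> is exactly \<open>exp (x^2 / (8 * c))\<close>, while the subgaussian
    bound \<open>exp (c s^2 z^2) = exp (z^2 / 4)\<close> leaves half of the Gaussian decay in
    \<open>z\<close>. The remaining integral is \<open>sqrt 2\<close>.\<close>
  define s where "s = 1 / (2 * sqrt c)"
  have s2: "s\<^sup>2 = 1 / (4 * c)" using c by (simp add: s_def power_divide power_mult_distrib)
  have 1: "ennreal (exp (x\<^sup>2 / (8 * c))) = (\<integral>\<^sup>+z. ennreal (std_normal_density z) * ennreal (exp (s * z * x)) \<partial>lborel)" for x
  proof -
    have "(\<integral>\<^sup>+z. ennreal (std_normal_density z) * ennreal (exp (s * z * x)) \<partial>lborel) =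
       (\<integral>\<^sup>+z. ennreal (exp (x\<^sup>2 / (8 * c))) * ennreal (normal_density (s * x) 1 z) \<partial>lborel)"
    proof (intro nn_integral_cong)
      fix z
      have "- z\<^sup>2 / 2 + s * z * x = s\<^sup>2 * x\<^sup>2 / 2 - (z - s * x)\<^sup>2 / 2"
        by (simp add: power2_eq_square field_simps)
      then have "- z\<^sup>2 / 2 + s * z * x = x\<^sup>2 / (8 * c) - (z - s * x)\<^sup>2 / 2"
        by (simp add: s2)
      then have "std_normal_density z * exp (s * z * x) = exp (x\<^sup>2 / (8 * c)) * normal_density (s * x) 1 z"
        by (simp add: normal_density_def flip: exp_add)
      then show "ennreal (std_normal_density z) * ennreal (exp (s * z * x)) =
          ennreal (exp (x\<^sup>2 / (8 * c))) * ennreal (normal_density (s * x) 1 z)"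
        by (simp flip: ennreal_mult)
    qed
    also have "\<dots> = ennreal (exp (x\<^sup>2 / (8 * c)))"
      by (simp add: nn_integral_cmult nn_integral_eq_integral)
    finally show ?thesis by simp
  qed
  have "(\<integral>\<^sup>+\<omega>. ennreal (exp ((X \<omega>)\<^sup>2 / (8 * c))) \<partial>M) =
     (\<integral>\<^sup>+\<omega>. (\<integral>\<^sup>+z. ennreal (std_normal_density z) * ennreal (exp (s * z * X \<omega>)) \<partial>lborel) \<partial>M)"
    by (simp only: 1)
  also have "\<dots> = (\<integral>\<^sup>+z. (\<integral>\<^sup>+\<omega>. ennreal (std_normal_density z) * ennreal (exp (s * z * X \<omega>)) \<partial>M) \<partial>lborel)"
  proof -
    interpret P: pair_sigma_finite M "lborel :: real measure" ..
    show ?thesis by (rule P.Fubini'[symmetric]) measurable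
  qed
  also have "\<dots> \<le> (\<integral>\<^sup>+z. ennreal (sqrt 2) * ennreal (normal_density 0 (sqrt 2) z) \<partial>lborel)"
  proof (rule nn_integral_mono)
    fix z
    have "(\<integral>\<^sup>+\<omega>. ennreal (std_normal_density z) * ennreal (exp (s * z * X \<omega>)) \<partial>M) \<le>
      ennreal (std_normal_density z) * ennreal (exp (c * (s * z)\<^sup>2))"
      using X by (subst nn_integral_cmult) (auto simp: subgaussian_def intro!: mult_left_mono)
    also have "c * (s * z)\<^sup>2 = z\<^sup>2 / 4"
      using c by (simp add: power_mult_distrib s2)
    also have "ennreal (std_normal_density z) * ennreal (exp (z\<^sup>2 / 4)) = ennreal (sqrt 2) * ennreal (normal_density 0 (sqrt 2) z)"
    proof -
      have "exp (- z\<^sup>2 / 2) * exp (z\<^sup>2 / 4) = exp (- z\<^sup>2 / 4)"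
        by (simp flip: exp_add)
      then have "std_normal_density z * exp (z\<^sup>2 / 4) = sqrt 2 * normal_density 0 (sqrt 2) z"
        by (simp add: normal_density_def real_sqrt_mult field_simps)
      then show ?thesis by (simp flip: ennreal_mult)
    qed
    finally show "(\<integral>\<^sup>+\<omega>. ennreal (std_normal_density z) * ennreal (exp (s * z * X \<omega>)) \<partial>M) \<le>
       ennreal (sqrt 2) * ennreal (normal_density 0 (sqrt 2) z)" .
  qed
  also have "\<dots> = ennreal (sqrt 2)"
    by (simp add: nn_integral_cmult nn_integral_eq_integral)
  also have "\<dots> \<le> 2"
    using sqrt2_less_2 by (simp add: ennreal_le_iff flip: ennreal_numeral)
  finally show ?thesis .
qed

text \<open>Convexity of \<open>exp\<close> reduces the exponential moment of a weighted mean to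
  those of the single squares. This suits the coefficients below, whose moduli at \<open>n\<close>
  and \<open>- n\<close> coincide and are thus far from independent.\<close>

lemma exp_square_norm_weighted_sum:
  fixes g :: "'i \<Rightarrow> 'a \<Rightarrow> 'b::{real_normed_vector, second_countable_topology}"
  assumes I: "finite I" and g[measurable]: "\<And>i. i \<in> I \<Longrightarrow> g i \<in> borel_measurable M"
    and ex: "\<And>i. i \<in> I \<Longrightarrow> (\<integral>\<^sup>+\<omega>. ennreal (exp ((norm (g i \<omega>))\<^sup>2 / K)) \<partial>M) \<le> 2"
    and w: "\<And>i. i \<in> I \<Longrightarrow> w i \<ge> 0" "(\<Sum>i\<in>I. w i) \<le> W" and pos: "W > 0" "K > 0"
  shows "emeasure M {\<omega>\<in>space M. s < (\<Sum>i\<in>I. w i * (norm (g i \<omega>))\<^sup>2)} \<le> ennreal (2 * exp (- s / (K * W)))"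
proof -
  define p where "p i = w i / W" for i
  define P where "P = (\<Sum>i\<in>I. p i)"
  have p: "p i \<ge> 0" if "i \<in> I" for i using w(1)[OF that] pos by (simp add: p_def)
  have P: "P \<le> 1" "P \<ge> 0" using w pos p by (auto simp: P_def p_def sum_nonneg simp flip: sum_divide_distrib)
  \<comment> \<open>The weights \<open>p\<close> may have total mass \<open>P\<close> below one; the
    missing mass is placed at the value 0, where \<open>exp\<close> is 1. Jensen's inequality is
    obtained from the tangent line at the mean.\<close>
  have jensen: "exp (\<Sum>i\<in>I. p i * x i) \<le> (\<Sum>i\<in>I. p i * exp (x i)) + (1 - P)" for x :: "'i \<Rightarrow> real"
  proof -
    define m where "m = (\<Sum>i\<in>I. p i * x i)"
    have tan: "exp m * (1 + y - m) \<le> exp y" for y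
      using exp_ge_add_one_self[of "y - m"] by (simp add: exp_diff field_simps)
    have "exp m = (\<Sum>i\<in>I. p i * (exp m * (1 + x i - m))) + (1 - P) * (exp m * (1 + 0 - m))"
    proof -
      have "(\<Sum>i\<in>I. p i * (exp m * (1 + x i - m))) = exp m * ((\<Sum>i\<in>I. p i * x i) + (\<Sum>i\<in>I. p i) * (1 - m))"
        by (simp add: sum_distrib_left sum_distrib_right sum.distrib[symmetric] algebra_simps)
      also have "\<dots> = exp m * (m + P * (1 - m))" by (simp add: m_def P_def)
      finally show ?thesis by (simp add: algebra_simps)
    qed
    also have "\<dots> \<le> (\<Sum>i\<in>I. p i * exp (x i)) + (1 - P) * exp 0"
      using p P by (intro add_mono sum_mono mult_left_mono tan) auto
    finally show ?thesis by (simp add: m_def)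
  qed
  have "emeasure M {\<omega>\<in>space M. s < (\<Sum>i\<in>I. w i * (norm (g i \<omega>))\<^sup>2)} \<le>
      emeasure M {\<omega>\<in>space M. s / (K * W) \<le> (\<Sum>i\<in>I. p i * ((norm (g i \<omega>))\<^sup>2 / K))}"
  proof (intro emeasure_mono subsetI)
    fix \<omega> assume a: "\<omega> \<in> {\<omega>\<in>space M. s < (\<Sum>i\<in>I. w i * (norm (g i \<omega>))\<^sup>2)}"
    have "(\<Sum>i\<in>I. p i * ((norm (g i \<omega>))\<^sup>2 / K)) = (\<Sum>i\<in>I. w i * (norm (g i \<omega>))\<^sup>2) / (K * W)"
      by (simp add: p_def sum_divide_distrib mult_ac)
    with a pos show "\<omega> \<in> {\<omega>\<in>space M. s / (K * W) \<le> (\<Sum>i\<in>I. p i * ((norm (g i \<omega>))\<^sup>2 / K))}"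
      by (simp add: divide_right_mono)
  qed measurable
  also have "\<dots> \<le> ennreal (exp (- 1 * (s / (K * W)))) *
     (\<integral>\<^sup>+\<omega>. ennreal (exp (1 * (\<Sum>i\<in>I. p i * ((norm (g i \<omega>))\<^sup>2 / K)))) * indicator (space M) \<omega> \<partial>M)"
    by (rule Chernoff_ineq_nn_integral_ge) measurable
  also have "(\<integral>\<^sup>+\<omega>. ennreal (exp (1 * (\<Sum>i\<in>I. p i * ((norm (g i \<omega>))\<^sup>2 / K)))) * indicator (space M) \<omega> \<partial>M) \<le>
     (\<integral>\<^sup>+\<omega>. (\<Sum>i\<in>I. ennreal (p i) * ennreal (exp ((norm (g i \<omega>))\<^sup>2 / K))) + ennreal (1 - P) \<partial>M)"
  proof (rule nn_integral_mono)
    fix \<omega>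
    have "ennreal (exp (\<Sum>i\<in>I. p i * ((norm (g i \<omega>))\<^sup>2 / K))) \<le>
       ennreal ((\<Sum>i\<in>I. p i * exp ((norm (g i \<omega>))\<^sup>2 / K)) + (1 - P))"
      by (intro ennreal_leI jensen)
    also have "\<dots> = (\<Sum>i\<in>I. ennreal (p i) * ennreal (exp ((norm (g i \<omega>))\<^sup>2 / K))) + ennreal (1 - P)"
      using p P by (simp add: sum_nonneg ennreal_plus ennreal_mult flip: sum_ennreal)
    finally show "ennreal (exp (1 * (\<Sum>i\<in>I. p i * ((norm (g i \<omega>))\<^sup>2 / K)))) * indicator (space M) \<omega> \<le>
       (\<Sum>i\<in>I. ennreal (p i) * ennreal (exp ((norm (g i \<omega>))\<^sup>2 / K))) + ennreal (1 - P)"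
      by (auto split: split_indicator)
  qed
  also have "\<dots> = (\<Sum>i\<in>I. ennreal (p i) * (\<integral>\<^sup>+\<omega>. ennreal (exp ((norm (g i \<omega>))\<^sup>2 / K)) \<partial>M)) + ennreal (1 - P)"
    by (subst nn_integral_add) (auto simp: nn_integral_sum nn_integral_cmult emeasure_space_1)
  also have "\<dots> \<le> (\<Sum>i\<in>I. ennreal (p i) * 2) + ennreal (1 - P)"
    by (intro add_mono sum_mono mult_left_mono ex) auto
  also have "\<dots> = ennreal (2 * P + (1 - P))"
  proof -
    have "(\<Sum>i\<in>I. ennreal (p i) * 2) = (\<Sum>i\<in>I. ennreal (p i * 2))"
      using p by (intro sum.cong refl) (simp add: ennreal_mult)
    also have "\<dots> = ennreal (2 * P)"
      using p by (subst sum_ennreal) (simp_all add: P_def sum_distrib_right[symmetric] mult.commute)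
    finally have *: "(\<Sum>i\<in>I. ennreal (p i) * 2) = ennreal (2 * P)" .
    show ?thesis unfolding * using P by (subst ennreal_plus) auto
  qed
  also have "\<dots> \<le> ennreal 2"
    using P by (intro ennreal_leI) auto
  finally have "emeasure M {\<omega>\<in>space M. s < (\<Sum>i\<in>I. w i * (norm (g i \<omega>))\<^sup>2)} \<le>
      ennreal (exp (- 1 * (s / (K * W)))) * ennreal 2"
    by (meson mult_left_mono zero_le)
  also have "\<dots> = ennreal (2 * exp (- s / (K * W)))"
    by (subst ennreal_mult[symmetric]) (auto simp: mult.commute)
  finally show ?thesis .
qed

end

section \<open>Fourier inversion for Schwartz functions\<close>

lemma iter_pd_append: "iter_pd (is @ js) \<phi> = iter_pd is (iter_pd js \<phi>)"
  by (induction "is") simp_all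

lemma schwartz_iter_pd: "\<phi> \<in> schwartz \<Longrightarrow> iter_pd js \<phi> \<in> schwartz"
proof -
  assume \<phi>: "\<phi> \<in> schwartz"
  show "iter_pd js \<phi> \<in> schwartz"
    unfolding schwartz_def mem_Collect_eq
  proof (intro conjI allI)
    fix "is" :: "3 list" and x and k :: nat
    show "iter_pd is (iter_pd js \<phi>) differentiable at x"
      using \<phi> unfolding iter_pd_append[symmetric] schwartz_def by simp
    show "\<exists>B. \<forall>x. (1 + norm x) ^ k * cmod (iter_pd is (iter_pd js \<phi>) x) \<le> B"
      using \<phi> unfolding iter_pd_append[symmetric] schwartz_def by simp
  qed
qed

section \<open>Decay and integrability of Schwartz functions\<close>

lemma schwartz_bound:
  assumes "\<phi> \<in> schwartz"
  obtains B where "B \<ge> 0" "\<And>x. (1 + norm x) ^ k * cmod (\<phi> x) \<le> B"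
proof -
  from assms obtain B where B: "\<And>x. (1 + norm x) ^ k * cmod (iter_pd [] \<phi> x) \<le> B"
    unfolding schwartz_def by blast
  from order_trans[OF _ B[of 0]] have "B \<ge> 0" by simp
  with B that show ?thesis by simp
qed

lemma schwartz_has_derivative:
  assumes "\<phi> \<in> schwartz"
  shows "(\<phi> has_derivative frechet_derivative \<phi> (at x)) (at x)"
proof -
  have "iter_pd [] \<phi> differentiable (at x)" using assms unfolding schwartz_def by blast
  then show ?thesis by (simp add: frechet_derivative_works)
qed

lemma schwartz_isCont: "\<phi> \<in> schwartz \<Longrightarrow> isCont \<phi> x"
  by (rule has_derivative_continuous[OF schwartz_has_derivative])

lemma schwartz_measurable: "\<phi> \<in> schwartz \<Longrightarrow> \<phi> \<in> borel_measurable borel"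
  by (intro borel_measurable_continuous_onI continuous_at_imp_continuous_on) (auto simp: schwartz_isCont)

text \<open>A product over coordinates, so that integrability reduces to that of
  \<open>1 / (1 + x^2)\<close> on the line. Its inverse is a polynomial in the squared coordinates,
  which matches bounds on second derivatives taken coordinate by coordinate
  (\<open>fourier_decay\<close>).\<close>

definition decay :: "real^3 \<Rightarrow> real" where
  "decay x = (\<Prod>b\<in>Basis. inverse (1 + (x \<bullet> b)\<^sup>2))"

lemma decay_nonneg [simp]: "decay x \<ge> 0"
  unfolding decay_def by (intro prod_nonneg) auto

lemma integrable_decay: "integrable lborel decay"
proof -
  have "integrable lborel (\<lambda>x::real. inverse (1 + x\<^sup>2))"
    using integrable_inverse_1_plus_square by (simp add: set_integrable_def einterval_eq)
  then show ?thesis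
    unfolding decay_def[abs_def] by (intro lborel_prod_integral(1))
qed

text \<open>Each of the three factors \<open>1 + (x \<bullet> b)^2\<close> is at most
  \<open>(1 + norm x)^2\<close>; this is the origin of the exponent 6 in the decay bounds
  below.\<close>

lemma decay_lower: "1 \<le> (1 + norm x) ^ 6 * decay x"
proof -
  have "(\<Prod>b\<in>Basis. 1 + (x \<bullet> b)\<^sup>2) \<le> (\<Prod>b\<in>(Basis :: (real^3) set). (1 + norm x)\<^sup>2)"
  proof (intro prod_mono conjI)
    fix b :: "real^3" assume b: "b \<in> Basis"
    have "(x \<bullet> b)\<^sup>2 \<le> (norm x)\<^sup>2" using Basis_le_norm[OF b, of x] by (simp add: power2_le_iff_abs_le)
    then show "1 + (x \<bullet> b)\<^sup>2 \<le> (1 + norm x)\<^sup>2" using norm_ge_zero[of x] by (simp add: power2_sum add_increasing2)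
  qed simp
  also have "\<dots> = (1 + norm x) ^ 6" by (simp flip: power_mult)
  finally have le: "(\<Prod>b\<in>Basis. 1 + (x \<bullet> b)\<^sup>2) \<le> (1 + norm x) ^ 6" .
  have pos: "(\<Prod>b\<in>Basis. 1 + (x \<bullet> b)\<^sup>2) > 0" by (intro prod_pos) (auto simp: add_pos_nonneg)
  have "decay x = inverse (\<Prod>b\<in>Basis. 1 + (x \<bullet> b)\<^sup>2)" unfolding decay_def by (subst prod_inversef[symmetric]) (simp add: o_def)
  with le pos show ?thesis by (simp add: field_simps)
qed

lemma integrable_of_decay:
  fixes f :: "real^3 \<Rightarrow> 'b::{banach, second_countable_topology}"
  assumes [measurable]: "f \<in> borel_measurable borel" and B: "\<And>x. (1 + norm x) ^ 6 * norm (f x) \<le> B"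
  shows "integrable lborel f"
proof (rule Bochner_Integration.integrable_bound)
  show "integrable lborel (\<lambda>x. B * decay x)" using integrable_decay by simp
  show "AE x in lborel. norm (f x) \<le> norm (B * decay x)"
  proof (rule AE_I2)
    fix x
    have "norm (f x) \<le> norm (f x) * ((1 + norm x) ^ 6 * decay x)"
      using mult_left_mono[OF decay_lower norm_ge_zero, of "f x" x] by simp
    also have "\<dots> = ((1 + norm x) ^ 6 * norm (f x)) * decay x" by (simp add: mult_ac)
    also have "\<dots> \<le> B * decay x" by (intro mult_right_mono B) simp
    finally show "norm (f x) \<le> norm (B * decay x)" by simp
  qed
qed simp

lemma schwartz_integrable: "\<phi> \<in> schwartz \<Longrightarrow> integrable lborel \<phi>"
  by (rule schwartz_bound[of \<phi> 6], assumption) (rule integrable_of_decay[OF schwartz_measurable])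

lemma jap_ge_1: "jap x \<ge> 1" and jap_ge_norm: "jap x \<ge> norm x" and jap_le: "jap x \<le> 1 + norm x"
proof -
  show "jap x \<ge> 1" by (simp add: jap_def)
  show "jap x \<ge> norm x" unfolding jap_def by (rule real_le_rsqrt) simp
  show "jap x \<le> 1 + norm x" unfolding jap_def by (rule real_le_lsqrt) (auto simp: power2_sum)
qed

lemma jap_pos [simp]: "jap x > 0" using jap_ge_1[of x] by linarith

lemma jap_measurable [measurable]: "jap \<in> borel_measurable borel"
  unfolding jap_def[abs_def] by measurable

text \<open>The weight \<open>jap\<close> is there for the second datum, whose order is one lower:
  before it is paired in L2, one power of \<open>jap\<close> is moved to the test function
  (\<open>randomize_represents\<close>).\<close>

lemma schwartz_weighted_L2:
  assumes \<phi>: "\<phi> \<in> schwartz"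
  obtains F where "F \<ge> 0" "(\<integral>\<^sup>+x. ennreal ((jap x * cmod (\<phi> x))\<^sup>2) \<partial>lborel) \<le> ennreal F"
proof -
  note [measurable] = schwartz_measurable[OF \<phi>]
  obtain B where B: "B \<ge> 0" "\<And>x. (1 + norm x) ^ 4 * cmod (\<phi> x) \<le> B" using schwartz_bound[OF \<phi>] by blast
  have "integrable lborel (\<lambda>x. (jap x * cmod (\<phi> x))\<^sup>2)"
  proof (rule integrable_of_decay)
    fix x
    have "(1 + norm x) ^ 6 * norm ((jap x * cmod (\<phi> x))\<^sup>2) = ((1 + norm x) ^ 3 * (jap x * cmod (\<phi> x)))\<^sup>2"
      by (simp add: power_mult_distrib flip: power_mult)
    also have "\<dots> \<le> ((1 + norm x) ^ 3 * ((1 + norm x) * cmod (\<phi> x)))\<^sup>2"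
      using jap_le[of x] less_imp_le[OF jap_pos[of x]] by (intro power_mono mult_left_mono mult_right_mono mult_nonneg_nonneg) auto
    also have "\<dots> = ((1 + norm x) ^ 4 * cmod (\<phi> x))\<^sup>2" by (simp add: power4_eq_xxxx power3_eq_cube mult_ac)
    also have "\<dots> \<le> B\<^sup>2" using B by (intro power_mono) auto
    finally show "(1 + norm x) ^ 6 * norm ((jap x * cmod (\<phi> x))\<^sup>2) \<le> B\<^sup>2" .
  qed measurable
  then have "(\<integral>\<^sup>+x. ennreal ((jap x * cmod (\<phi> x))\<^sup>2) \<partial>lborel) = ennreal (\<integral>x. (jap x * cmod (\<phi> x))\<^sup>2 \<partial>lborel)"
    by (intro nn_integral_eq_integral) auto
  then show ?thesis by (intro that[of "\<integral>x. (jap x * cmod (\<phi> x))\<^sup>2 \<partial>lborel"]) auto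
qed

section \<open>Fourier transform of derivatives\<close>

text \<open>A dominating function for all small steps \<open>s\<close>: moving by at most 1 changes
  \<open>1 + norm x\<close> by at most a factor 2, and \<open>64 = 2 ^ 6\<close>.\<close>

lemma difference_quotient_bound:
  assumes \<phi>: "\<phi> \<in> schwartz" and B: "\<And>x. (1 + norm x) ^ 6 * cmod (iter_pd [i] \<phi> x) \<le> B" and s: "0 < s" "s \<le> 1"
  shows "(1 + norm x) ^ 6 * cmod ((\<phi> (x + s *\<^sub>R axis i 1) - \<phi> x) / of_real s) \<le> 64 * B"
proof -
  define C where "C = 64 * B / (1 + norm x) ^ 6"
  have pos: "(1 + norm x) ^ 6 > 0" by (intro zero_less_power add_pos_nonneg) auto
  define f where "f t = \<phi> (x + t *\<^sub>R axis i 1)" for t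
  have der: "(f has_derivative (\<lambda>h. h *\<^sub>R iter_pd [i] \<phi> (x + t *\<^sub>R axis i 1))) (at t within {0..s})" for t
  proof -
    have "((\<lambda>t. x + t *\<^sub>R axis i 1) has_derivative (\<lambda>h. h *\<^sub>R axis i 1)) (at t within {0..s})"
      by (auto intro!: derivative_eq_intros)
    from has_derivative_compose[OF this schwartz_has_derivative[OF \<phi>]]
    have "(f has_derivative (\<lambda>h. frechet_derivative \<phi> (at (x + t *\<^sub>R axis i 1)) (h *\<^sub>R axis i 1))) (at t within {0..s})"
      unfolding f_def .
    moreover have "frechet_derivative \<phi> (at y) (h *\<^sub>R axis i 1) = h *\<^sub>R iter_pd [i] \<phi> y" for h y
      using linear_cmul[OF has_derivative_linear[OF schwartz_has_derivative[OF \<phi>, of y]]] by simp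
    ultimately show ?thesis by simp
  qed
  have "norm (f s - f 0) \<le> C * norm (s - 0)"
  proof (rule differentiable_bound[where S="{0..s}" and f'="\<lambda>t h. h *\<^sub>R iter_pd [i] \<phi> (x + t *\<^sub>R axis i 1)"])
    fix t assume t: "t \<in> {0..s}"
    define y where "y = x + t *\<^sub>R axis i 1"
    have "norm x \<le> norm y + norm (t *\<^sub>R axis i (1::real))"
      using norm_triangle_ineq4[of y "t *\<^sub>R axis i 1"] by (simp add: y_def)
    moreover have "norm (t *\<^sub>R axis i (1::real)) \<le> 1" using t s by (simp add: norm_axis_1)
    ultimately have "norm x \<le> norm y + 1" by (rule order_trans[OF _ add_left_mono])
    then have "1 + norm x \<le> 2 * (1 + norm y)" using norm_ge_zero[of y] by (smt (verit))
    then have "(1 + norm x) ^ 6 \<le> (2 * (1 + norm y)) ^ 6" by (intro power_mono) auto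
    then have "(1 + norm x) ^ 6 * cmod (iter_pd [i] \<phi> y) \<le> (2 * (1 + norm y)) ^ 6 * cmod (iter_pd [i] \<phi> y)"
      by (intro mult_right_mono) auto
    also have "\<dots> = 64 * ((1 + norm y) ^ 6 * cmod (iter_pd [i] \<phi> y))" unfolding power_mult_distrib by simp
    also have "\<dots> \<le> 64 * B" by (intro mult_left_mono B) auto
    finally have c: "cmod (iter_pd [i] \<phi> y) \<le> C"
      unfolding C_def pos_le_divide_eq[OF pos] by (simp only: mult.commute)
    then have "0 \<le> C" using norm_ge_zero order_trans by blast
    with c show "onorm (\<lambda>h. h *\<^sub>R iter_pd [i] \<phi> (x + t *\<^sub>R axis i 1)) \<le> C"
      unfolding y_def[symmetric]
      by (intro onorm_bound) (simp_all add: mult_left_mono mult.commute[of C] del: iter_pd.simps)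
  qed (use s der in auto)
  then have "cmod ((\<phi> (x + s *\<^sub>R axis i 1) - \<phi> x) / of_real s) \<le> C"
    using s by (simp add: f_def norm_divide divide_le_eq)
  then show ?thesis unfolding C_def pos_le_divide_eq[OF pos] by (simp only: mult.commute)
qed

lemma difference_quotient_tendsto:
  assumes \<phi>: "\<phi> \<in> schwartz" and s: "s \<longlonglongrightarrow> 0" "\<And>n. s n > 0"
  shows "(\<lambda>n. (\<phi> (x + s n *\<^sub>R axis i 1) - \<phi> x) / of_real (s n)) \<longlonglongrightarrow> iter_pd [i] \<phi> x"
proof -
  define D where "D = frechet_derivative \<phi> (at x)"
  have D: "bounded_linear D" "(\<lambda>h. norm (\<phi> (x + h) - \<phi> x - D h) / norm h) \<midarrow>0\<rightarrow> 0"
    using schwartz_has_derivative[OF \<phi>, of x] by (simp_all add: has_derivative_at D_def)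
  have ne: "\<forall>\<^sub>F n in sequentially. s n *\<^sub>R axis i (1::real) \<noteq> 0"
    using s(2) by (intro always_eventually) (simp add: less_imp_neq[symmetric] axis_eq_0_iff)
  have "(\<lambda>n. s n *\<^sub>R axis i (1::real) :: real^3) \<longlonglongrightarrow> 0 *\<^sub>R axis i 1" by (intro tendsto_intros s)
  with ne have "filterlim (\<lambda>n. s n *\<^sub>R axis i (1::real)) (at 0) sequentially" by (simp add: filterlim_at)
  from filterlim_compose[OF D(2) this]
  have l: "(\<lambda>n. norm (\<phi> (x + s n *\<^sub>R axis i 1) - \<phi> x - D (s n *\<^sub>R axis i 1)) / norm (s n *\<^sub>R axis i (1::real))) \<longlonglongrightarrow> 0" .
  have "(\<lambda>n. (\<phi> (x + s n *\<^sub>R axis i 1) - \<phi> x) / of_real (s n) - iter_pd [i] \<phi> x) \<longlonglongrightarrow> 0"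
  proof (rule tendsto_norm_zero_cancel, rule Lim_transform_eventually[OF l], rule always_eventually, rule allI)
    fix n
    have "D (s n *\<^sub>R axis i 1) = of_real (s n) * iter_pd [i] \<phi> x"
      using linear_cmul[OF bounded_linear.linear[OF D(1)]] by (simp add: D_def scaleR_conv_of_real)
    then have "(\<phi> (x + s n *\<^sub>R axis i 1) - \<phi> x) / of_real (s n) - iter_pd [i] \<phi> x =
        (\<phi> (x + s n *\<^sub>R axis i 1) - \<phi> x - D (s n *\<^sub>R axis i 1)) / of_real (s n)"
      using s(2)[of n] by (simp add: field_simps)
    then show "norm (\<phi> (x + s n *\<^sub>R axis i 1) - \<phi> x - D (s n *\<^sub>R axis i 1)) / norm (s n *\<^sub>R axis i (1::real)) =
        norm ((\<phi> (x + s n *\<^sub>R axis i 1) - \<phi> x) / of_real (s n) - iter_pd [i] \<phi> x)"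
      by (simp add: norm_divide norm_axis_1)
  qed
  then show ?thesis by (simp add: LIM_zero_iff)
qed

lemma cis_difference_quotient:
  assumes s: "s \<longlonglongrightarrow> 0" "\<And>n. s n > 0"
  shows "(\<lambda>n. (cis (s n * a) - 1) / of_real (s n)) \<longlonglongrightarrow> \<i> * of_real a"
proof -
  have "((\<lambda>z. exp (\<i> * of_real a * z)) has_field_derivative (\<i> * of_real a)) (at 0)"
    by (auto intro!: derivative_eq_intros)
  then have "(\<lambda>h. (exp (\<i> * of_real a * (0 + h)) - exp (\<i> * of_real a * 0)) / h) \<midarrow>0\<rightarrow> \<i> * of_real a"
    by (simp add: DERIV_def)
  moreover have "filterlim (\<lambda>n. complex_of_real (s n)) (at 0) sequentially"
    using tendsto_of_real[OF s(1), where 'a=complex] s(2) by (auto simp: filterlim_at less_imp_neq[symmetric])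
  ultimately have "(\<lambda>n. (exp (\<i> * of_real a * (0 + of_real (s n))) - exp (\<i> * of_real a * 0)) / of_real (s n)) \<longlonglongrightarrow> \<i> * of_real a"
    by (rule filterlim_compose)
  then show ?thesis by (simp add: cis_conv_exp mult_ac)
qed

text \<open>A translation becomes a phase, so the transform of a difference quotient is known
  exactly. Letting the step tend to zero on both sides gives the rule without integration by
  parts.\<close>

lemma fourier_iter_pd1:
  assumes \<phi>: "\<phi> \<in> schwartz"
  shows "fourier (iter_pd [i] \<phi>) \<xi> = \<i> * of_real (\<xi> $ i) * fourier \<phi> \<xi>"
proof -
  note [measurable] = schwartz_measurable[OF \<phi>] schwartz_measurable[OF schwartz_iter_pd[OF \<phi>]]
  define s where "s n = 1 / real (Suc n)" for n
  have s: "s \<longlonglongrightarrow> 0" "\<And>n. s n > 0" "\<And>n. s n \<le> 1"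
    using LIMSEQ_inverse_real_of_nat by (auto simp: s_def[abs_def] inverse_eq_divide)
  obtain B where B: "\<And>x. (1 + norm x) ^ 6 * cmod (iter_pd [i] \<phi> x) \<le> B"
    using schwartz_bound[OF schwartz_iter_pd[OF \<phi>, of "[i]"], of 6] by blast
  define q where "q n x = cis (- (x \<bullet> \<xi>)) * ((\<phi> (x + s n *\<^sub>R axis i 1) - \<phi> x) / of_real (s n))" for n x
  define I where "I = (\<integral>x. cis (- (x \<bullet> \<xi>)) * \<phi> x \<partial>lborel)"
  have i0: "integrable lborel (\<lambda>x. cis (- (x \<bullet> \<xi>)) * \<phi> x)"
    by (rule Bochner_Integration.integrable_bound[OF schwartz_integrable[OF \<phi>]]) (auto simp: norm_mult)
  have "(\<lambda>n. \<integral>x. q n x \<partial>lborel) \<longlonglongrightarrow> (\<integral>x. cis (- (x \<bullet> \<xi>)) * iter_pd [i] \<phi> x \<partial>lborel)"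
  proof (rule integral_dominated_convergence[where w="\<lambda>x. 64 * B / (1 + norm x) ^ 6"])
    show "integrable lborel (\<lambda>x::real^3. 64 * B / (1 + norm x) ^ 6)"
      by (rule integrable_of_decay[where B="\<bar>64 * B\<bar>"]) (auto simp: add_nonneg_eq_0_iff)
    show "AE x in lborel. (\<lambda>n. q n x) \<longlonglongrightarrow> cis (- (x \<bullet> \<xi>)) * iter_pd [i] \<phi> x"
      unfolding q_def by (intro AE_I2 tendsto_intros difference_quotient_tendsto \<phi> s)
    show "AE x in lborel. norm (q n x) \<le> 64 * B / (1 + norm x) ^ 6" for n
    proof (rule AE_I2)
      fix x :: "real^3"
      have "norm (q n x) = cmod ((\<phi> (x + s n *\<^sub>R axis i 1) - \<phi> x) / of_real (s n))"
        by (simp add: q_def norm_mult norm_divide)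
      then show "norm (q n x) \<le> 64 * B / (1 + norm x) ^ 6"
        using difference_quotient_bound[OF \<phi> B s(2,3), of x n]
        by (simp only: pos_le_divide_eq[OF zero_less_power] add_pos_nonneg zero_less_one norm_ge_zero mult.commute)
    qed
  qed (auto simp: q_def simp del: iter_pd.simps)
  moreover have "(\<integral>x. q n x \<partial>lborel) = (cis (s n * \<xi> $ i) - 1) / of_real (s n) * I" for n
  proof -
    have eq: "cis (- (x \<bullet> \<xi>)) * \<phi> (x + s n *\<^sub>R axis i 1) =
       cis (s n * \<xi> $ i) * (cis (- ((s n *\<^sub>R axis i 1 + 1 *\<^sub>R x) \<bullet> \<xi>)) * \<phi> (s n *\<^sub>R axis i 1 + 1 *\<^sub>R x))" for x
      by (simp add: cis_mult[symmetric] inner_add_left inner_axis' add.commute mult.assoc[symmetric]) (simp add: cis_mult)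
    have i1: "integrable lborel (\<lambda>x. cis (- (x \<bullet> \<xi>)) * \<phi> (x + s n *\<^sub>R axis i 1))"
      unfolding eq using i0 integrable_lborel_affine_iff[of "\<lambda>x. cis (- (x \<bullet> \<xi>)) * \<phi> x" 1 "s n *\<^sub>R axis i 1"]
      by (intro integrable_mult_right) simp
    have "(\<integral>x. cis (- (x \<bullet> \<xi>)) * \<phi> (x + s n *\<^sub>R axis i 1) \<partial>lborel) = cis (s n * \<xi> $ i) * I"
      unfolding eq I_def
      using integral_lborel_affine[of "\<lambda>x. cis (- (x \<bullet> \<xi>)) * \<phi> x" 1 "s n *\<^sub>R axis i 1"] by simp
    moreover have "(\<integral>x. q n x \<partial>lborel) =
       ((\<integral>x. cis (- (x \<bullet> \<xi>)) * \<phi> (x + s n *\<^sub>R axis i 1) \<partial>lborel) - I) / of_real (s n)"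
    proof -
      have "q n x = (cis (- (x \<bullet> \<xi>)) * \<phi> (x + s n *\<^sub>R axis i 1) - cis (- (x \<bullet> \<xi>)) * \<phi> x) / of_real (s n)" for x
        by (simp add: q_def algebra_simps)
      then show ?thesis
        unfolding I_def by (simp only: Bochner_Integration.integral_diff[OF i1 i0] integral_divide_zero)
    qed
    ultimately show ?thesis by (simp add: algebra_simps)
  qed
  ultimately have "(\<lambda>n. (cis (s n * \<xi> $ i) - 1) / of_real (s n) * I) \<longlonglongrightarrow> (\<integral>x. cis (- (x \<bullet> \<xi>)) * iter_pd [i] \<phi> x \<partial>lborel)"
    by simp
  moreover have "(\<lambda>n. (cis (s n * \<xi> $ i) - 1) / of_real (s n) * I) \<longlonglongrightarrow> \<i> * of_real (\<xi> $ i) * I"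
    by (intro tendsto_intros cis_difference_quotient s)
  ultimately have "(\<integral>x. cis (- (x \<bullet> \<xi>)) * iter_pd [i] \<phi> x \<partial>lborel) = \<i> * of_real (\<xi> $ i) * I"
    by (rule LIMSEQ_unique)
  then show ?thesis by (simp add: fourier_def I_def mult_ac)
qed

lemma norm_fourier_iter_pd:
  assumes "\<phi> \<in> schwartz"
  shows "cmod (fourier (iter_pd is \<phi>) \<xi>) = (\<Prod>i\<leftarrow>is. \<bar>\<xi> $ i\<bar>) * cmod (fourier \<phi> \<xi>)"
proof (induction "is")
  case (Cons i "is")
  have "iter_pd (i # is) \<phi> = iter_pd [i] (iter_pd is \<phi>)" by simp
  then show ?case
    using Cons fourier_iter_pd1[OF schwartz_iter_pd[OF assms], of i "is" \<xi>] by (simp add: norm_mult del: iter_pd.simps)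
qed simp

lemma fourier_bounded:
  assumes "\<phi> \<in> schwartz" obtains B where "\<And>\<xi>. cmod (fourier \<phi> \<xi>) \<le> B"
proof
  fix \<xi> :: "real^3"
  have "cmod (\<integral>x. cis (- (x \<bullet> \<xi>)) * \<phi> x \<partial>lborel) \<le> (\<integral>x. cmod (cis (- (x \<bullet> \<xi>)) * \<phi> x) \<partial>lborel)"
    by (rule integral_norm_bound)
  then show "cmod (fourier \<phi> \<xi>) \<le> (2 * pi) powr (- 3 / 2) * (\<integral>x. cmod (\<phi> x) \<partial>lborel)"
    unfolding fourier_def norm_mult by (intro mult_mono) (auto simp: norm_mult)
qed

lemma decay_inverse: "inverse (decay \<xi>) = (1 + (\<xi> $ 1)\<^sup>2) * (1 + (\<xi> $ 2)\<^sup>2) * (1 + (\<xi> $ 3)\<^sup>2)"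
proof -
  have B: "(Basis :: (real^3) set) = {axis 1 1, axis 2 1, axis 3 1}"
    by (auto simp: Basis_vec_def) (metis exhaust_3)
  have "axis (1::3) (1::real) \<noteq> axis 2 1" "axis (1::3) (1::real) \<noteq> axis 3 1" "axis (2::3) (1::real) \<noteq> axis 3 1"
    by (auto simp: axis_eq_axis)
  then show ?thesis by (simp add: decay_def B inner_axis mult.assoc)
qed

text \<open>The eight derivative lists are the monomials of
  \<open>(1 + \<xi>_1^2) (1 + \<xi>_2^2) (1 + \<xi>_3^2)\<close>, the inverse of
  \<open>decay\<close>. Each monomial times the transform is bounded by \<open>B\<close>, hence the
  factor 8.\<close>

lemma fourier_decay:
  assumes \<phi>: "\<phi> \<in> schwartz" obtains B where "\<And>\<xi>. cmod (fourier \<phi> \<xi>) \<le> B * decay \<xi>"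
proof -
  have "\<exists>B. \<forall>is. is \<in> set [[], [1,1], [2,2], [3,3], [1,1,2,2], [1,1,3,3], [2,2,3,3], [1,1,2,2,3,3::3]] \<longrightarrow>
     (\<forall>\<xi>. cmod (fourier (iter_pd is \<phi>) \<xi>) \<le> B)" (is "\<exists>B. \<forall>is. is \<in> ?L \<longrightarrow> ?P B is")
  proof -
    have "\<exists>b. ?P b is" for "is" using fourier_bounded[OF schwartz_iter_pd[OF \<phi>]] by meson
    then obtain b where b: "?P (b is) is" for "is" by metis
    show ?thesis
      by (rule exI[of _ "Max (b ` ?L)"]) (meson List.finite_set Max_ge b finite_imageI image_eqI order_trans)
  qed
  then obtain B where B: "is \<in> set [[], [1,1], [2,2], [3,3], [1,1,2,2], [1,1,3,3], [2,2,3,3], [1,1,2,2,3,3::3]] \<Longrightarrow>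
     cmod (fourier (iter_pd is \<phi>) \<xi>) \<le> B" for "is" \<xi> by blast
  show ?thesis
  proof
    fix \<xi>
    define F where "F = cmod (fourier \<phi> \<xi>)"
    define a where "a i = (\<xi> $ i)\<^sup>2" for i
    have "F \<le> B" "a 1 * F \<le> B" "a 2 * F \<le> B" "a 3 * F \<le> B" "a 1 * a 2 * F \<le> B" "a 1 * a 3 * F \<le> B"
      "a 2 * a 3 * F \<le> B" "a 1 * a 2 * a 3 * F \<le> B"
      using B[of "[]" \<xi>] B[of "[1,1]" \<xi>] B[of "[2,2]" \<xi>] B[of "[3,3]" \<xi>] B[of "[1,1,2,2]" \<xi>] B[of "[1,1,3,3]" \<xi>]
        B[of "[2,2,3,3]" \<xi>] B[of "[1,1,2,2,3,3]" \<xi>]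
      unfolding norm_fourier_iter_pd[OF \<phi>]
      by (simp_all add: F_def[symmetric] a_def power2_eq_square abs_mult[symmetric] mult.assoc[symmetric])
    then have "inverse (decay \<xi>) * F \<le> 8 * B"
      unfolding decay_inverse a_def[symmetric] by (simp add: algebra_simps)
    moreover have "decay \<xi> > 0" using decay_lower[of \<xi>] decay_nonneg[of \<xi>] by (cases "decay \<xi> = 0") (auto simp: less_le)
    ultimately show "cmod (fourier \<phi> \<xi>) \<le> 8 * B * decay \<xi>" by (simp add: F_def field_simps)
  qed
qed

lemma fourier_measurable:
  assumes [measurable]: "\<phi> \<in> borel_measurable borel"
  shows "fourier \<phi> \<in> borel_measurable borel" "inv_fourier \<phi> \<in> borel_measurable borel"
  unfolding fourier_def[abs_def] inv_fourier_def[abs_def] by measurable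

lemma fourier_integrable:
  assumes \<phi>: "\<phi> \<in> schwartz" shows "integrable lborel (fourier \<phi>)"
proof -
  obtain B where B: "\<And>\<xi>. cmod (fourier \<phi> \<xi>) \<le> B * decay \<xi>" using fourier_decay[OF \<phi>] by blast
  have "integrable lborel (\<lambda>\<xi>. B * decay \<xi>)" using integrable_decay by simp
  then show ?thesis
  proof (rule Bochner_Integration.integrable_bound)
    show "AE \<xi> in lborel. cmod (fourier \<phi> \<xi>) \<le> norm (B * decay \<xi>)"
      by (intro AE_I2 order_trans[OF B]) simp
  qed (simp add: fourier_measurable schwartz_measurable[OF \<phi>])
qed

text \<open>The Gaussian cutoff makes the iterated integral absolutely convergent; removing it is an
  approximate identity on one side and dominated convergence on the other.\<close>

lemma inv_fourier_fourier:
  assumes \<phi>: "\<phi> \<in> schwartz"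
  shows "inv_fourier (fourier \<phi>) = \<phi>"
proof
  fix x :: "real^3"
  note [measurable] = schwartz_measurable[OF \<phi>]
  note [measurable] = fourier_measurable[OF schwartz_measurable[OF \<phi>]]
  define c where "c = (2 * pi) powr (- 3 / 2)"
  have cc: "c * c * (2 * pi) ^ 3 = 1"
  proof -
    have "c * c = (2 * pi) powr (- 3)" unfolding c_def by (simp add: powr_add[symmetric])
    also have "\<dots> = 1 / (2 * pi) ^ 3" using powr_realpow[of "2 * pi" 3] by (simp add: powr_minus_divide)
    finally show ?thesis by simp
  qed
  define d :: "nat \<Rightarrow> real" where "d n = 1 / real (Suc n)" for n
  have d: "d \<longlonglongrightarrow> 0" "d n > 0" for n
    using LIMSEQ_inverse_real_of_nat by (auto simp: d_def[abs_def] inverse_eq_divide)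
  define w where "w n \<xi> = exp (- (norm (d n *\<^sub>R \<xi>))\<^sup>2 / 2)" for n and \<xi> :: "real^3"
  have [measurable]: "w n \<in> borel_measurable borel" for n unfolding w_def[abs_def] by measurable
  have wint: "integrable lborel (w n)" for n
  proof -
    have "integrable lborel (\<lambda>x. sqrt (2 * pi) ^ 3 * gauss (0 + d n *\<^sub>R x :: real^3))"
      using integrable_lborel_affine_iff[of "gauss :: real^3 \<Rightarrow> real" "d n" 0] d(2)[of n] integrable_gauss
      by (intro integrable_mult_right) auto
    then show ?thesis by (simp add: w_def[abs_def] gauss_def)
  qed
  obtain B where B: "\<And>x. cmod (\<phi> x) \<le> B" using schwartz_bound[OF \<phi>, of 0] by auto
  have L1: "(\<lambda>n. \<integral>\<xi>. of_real (w n \<xi>) * (cis (x \<bullet> \<xi>) * fourier \<phi> \<xi>) \<partial>lborel) \<longlonglongrightarrow>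
      (\<integral>\<xi>. cis (x \<bullet> \<xi>) * fourier \<phi> \<xi> \<partial>lborel)"
  proof (rule integral_dominated_convergence[where w="\<lambda>\<xi>. cmod (fourier \<phi> \<xi>)"])
    show "integrable lborel (\<lambda>\<xi>. cmod (fourier \<phi> \<xi>))" using fourier_integrable[OF \<phi>] by simp
    show "AE \<xi> in lborel. (\<lambda>n. of_real (w n \<xi>) * (cis (x \<bullet> \<xi>) * fourier \<phi> \<xi>)) \<longlonglongrightarrow> cis (x \<bullet> \<xi>) * fourier \<phi> \<xi>"
    proof (rule AE_I2)
      fix \<xi>
      have "(\<lambda>n. of_real (w n \<xi>) * (cis (x \<bullet> \<xi>) * fourier \<phi> \<xi>)) \<longlonglongrightarrow>
         of_real (exp (- (norm (0 *\<^sub>R \<xi>))\<^sup>2 / 2)) * (cis (x \<bullet> \<xi>) * fourier \<phi> \<xi>)"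
        unfolding w_def by (intro tendsto_intros d) auto
      then show "(\<lambda>n. of_real (w n \<xi>) * (cis (x \<bullet> \<xi>) * fourier \<phi> \<xi>)) \<longlonglongrightarrow> cis (x \<bullet> \<xi>) * fourier \<phi> \<xi>"
        by simp
    qed
    show "AE \<xi> in lborel. norm (of_real (w n \<xi>) * (cis (x \<bullet> \<xi>) * fourier \<phi> \<xi>)) \<le> cmod (fourier \<phi> \<xi>)" for n
      by (intro AE_I2) (simp add: norm_mult w_def mult_left_le_one_le)
  qed auto
  have L2: "(\<lambda>n. \<integral>z. gauss z *\<^sub>R \<phi> (x + d n *\<^sub>R z) \<partial>lborel) \<longlonglongrightarrow> \<phi> x"
    by (rule gauss_approximate_identity[OF _ B schwartz_isCont[OF \<phi>] d(1)]) simp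
  \<comment> \<open>By Fubini the integral over \<xi> is done first; the cutoff is a Gaussian there,
    so its transform is again a Gaussian, of width \<open>d n\<close>.\<close>
  have eq: "(\<integral>\<xi>. of_real (w n \<xi>) * (cis (x \<bullet> \<xi>) * fourier \<phi> \<xi>) \<partial>lborel) =
      of_real (c * (2 * pi) ^ 3) * (\<integral>z. gauss z *\<^sub>R \<phi> (x + d n *\<^sub>R z) \<partial>lborel)" for n
  proof -
    define F where "F \<xi> y = of_real (w n \<xi>) * (cis (\<xi> \<bullet> (x - y)) * \<phi> y)" for \<xi> y
    have Fi: "integrable (lborel \<Otimes>\<^sub>M lborel) (\<lambda>(\<xi>, y). F \<xi> y)"
    proof (rule Bochner_Integration.integrable_bound)
      show "integrable (lborel \<Otimes>\<^sub>M lborel) (\<lambda>q. complex_of_real (w n (fst q)) * \<phi> (snd q))"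
        by (rule lborel_times_integral(1)) (use wint schwartz_integrable[OF \<phi>] in auto)
      show "(\<lambda>(\<xi>, y). F \<xi> y) \<in> borel_measurable (lborel \<Otimes>\<^sub>M lborel)"
        unfolding F_def by measurable
    qed (auto simp: F_def norm_mult)
    have "(\<integral>\<xi>. of_real (w n \<xi>) * (cis (x \<bullet> \<xi>) * fourier \<phi> \<xi>) \<partial>lborel) = (\<integral>\<xi>. of_real c * (\<integral>y. F \<xi> y \<partial>lborel) \<partial>lborel)"
    proof (intro Bochner_Integration.integral_cong refl)
      fix \<xi>
      have "cis (x \<bullet> \<xi>) * cis (- (y \<bullet> \<xi>)) = cis (\<xi> \<bullet> (x - y))" for y
        by (simp add: cis_mult inner_diff_right inner_commute)
      then have "F \<xi> y = (of_real (w n \<xi>) * cis (x \<bullet> \<xi>)) * (cis (- (y \<bullet> \<xi>)) * \<phi> y)" for y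
        unfolding F_def by (metis mult.assoc)
      then show "of_real (w n \<xi>) * (cis (x \<bullet> \<xi>) * fourier \<phi> \<xi>) = of_real c * (\<integral>y. F \<xi> y \<partial>lborel)"
        by (simp add: fourier_def c_def)
    qed
    also have "\<dots> = of_real c * (\<integral>\<xi>. (\<integral>y. F \<xi> y \<partial>lborel) \<partial>lborel)" by simp
    also have "(\<integral>\<xi>. (\<integral>y. F \<xi> y \<partial>lborel) \<partial>lborel) = (\<integral>y. (\<integral>\<xi>. F \<xi> y \<partial>lborel) \<partial>lborel)"
      using lborel_pair.Fubini_integral[OF Fi] by simp
    also have "\<dots> = (\<integral>y. of_real ((2 * pi) ^ 3 / d n ^ 3 * gauss ((x - y) /\<^sub>R d n)) * \<phi> y \<partial>lborel)"
    proof (intro Bochner_Integration.integral_cong refl)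
      fix y
      have "(\<integral>\<xi>. F \<xi> y \<partial>lborel) = (\<integral>\<xi>. cis (\<xi> \<bullet> (x - y)) * of_real (exp (- (norm (d n *\<^sub>R \<xi>))\<^sup>2 / 2)) \<partial>lborel) * \<phi> y"
        unfolding integral_mult_left_zero[symmetric] F_def w_def by (simp add: mult_ac)
      then show "(\<integral>\<xi>. F \<xi> y \<partial>lborel) = of_real ((2 * pi) ^ 3 / d n ^ 3 * gauss ((x - y) /\<^sub>R d n)) * \<phi> y"
        unfolding integral_cis_scaled_gauss[OF d(2)] by simp
    qed
    also have "\<dots> = (d n ^ 3) *\<^sub>R (\<integral>z. of_real ((2 * pi) ^ 3 / d n ^ 3 * gauss z) * \<phi> (x + d n *\<^sub>R z) \<partial>lborel)"
    proof -
      have "gauss ((x - (x + d n *\<^sub>R z)) /\<^sub>R d n) = gauss z" for z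
        using d(2)[of n] by (simp add: gauss_def)
      then show ?thesis
        using d(2)[of n] integral_lborel_affine[of "\<lambda>y. of_real ((2 * pi) ^ 3 / d n ^ 3 * gauss ((x - y) /\<^sub>R d n)) * \<phi> y" "d n" x]
        by simp
    qed
    also have "(\<integral>z. of_real ((2 * pi) ^ 3 / d n ^ 3 * gauss z) * \<phi> (x + d n *\<^sub>R z) \<partial>lborel) =
        of_real ((2 * pi) ^ 3 / d n ^ 3) * (\<integral>z. gauss z *\<^sub>R \<phi> (x + d n *\<^sub>R z) \<partial>lborel)"
      unfolding integral_mult_right_zero[symmetric] by (simp add: scaleR_conv_of_real mult_ac)
    finally show ?thesis using d(2)[of n] by (simp add: scaleR_conv_of_real)
  qed
  have "(\<integral>\<xi>. cis (x \<bullet> \<xi>) * fourier \<phi> \<xi> \<partial>lborel) = of_real (c * (2 * pi) ^ 3) * \<phi> x"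
    using LIMSEQ_unique[OF L1[unfolded eq] tendsto_mult_left[OF L2, of "of_real (c * (2 * pi) ^ 3)"]] .
  then have "inv_fourier (fourier \<phi>) x = of_real (c * c * (2 * pi) ^ 3) * \<phi> x"
    by (simp add: inv_fourier_def c_def mult_ac)
  then show "inv_fourier (fourier \<phi>) x = \<phi> x" by (simp only: cc of_real_1 mult_1)
qed

section \<open>Schwartz functions determine functions\<close>

lemma real_polynomial_function_pd:
  fixes p :: "real^3 \<Rightarrow> real"
  assumes "real_polynomial_function p"
  shows "\<exists>p'. real_polynomial_function p' \<and> (\<forall>x. \<exists>D. (p has_derivative D) (at x) \<and> D (axis i 1) = p' x)"
  using assms
proof induction
  case (linear f)
  then show ?case
    by (intro exI[of _ "\<lambda>x. f (axis i 1)"]) (auto intro: bounded_linear_imp_has_derivative)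
next
  case (const c)
  then show ?case by (intro exI[of _ "\<lambda>x. 0"]) (auto intro!: exI[of _ "\<lambda>x. 0"])
next
  case (add f g)
  then obtain f' g' where "real_polynomial_function f'" "real_polynomial_function g'"
    and D: "\<And>x. \<exists>D. (f has_derivative D) (at x) \<and> D (axis i 1) = f' x"
     "\<And>x. \<exists>D. (g has_derivative D) (at x) \<and> D (axis i 1) = g' x" by metis
  moreover have "\<exists>D. ((\<lambda>x. f x + g x) has_derivative D) (at x) \<and> D (axis i 1) = f' x + g' x" for x
  proof -
    obtain D1 D2 where "(f has_derivative D1) (at x)" "D1 (axis i 1) = f' x" "(g has_derivative D2) (at x)" "D2 (axis i 1) = g' x"
      using D(1)[of x] D(2)[of x] by (elim exE conjE) (rule that)
    then show ?thesis by (intro exI[of _ "\<lambda>h. D1 h + D2 h"]) (auto intro: has_derivative_add)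
  qed
  ultimately show ?case by (intro exI[of _ "\<lambda>x. f' x + g' x"]) auto
next
  case (mult f g)
  then obtain f' g' where "real_polynomial_function f'" "real_polynomial_function g'"
    and D: "\<And>x. \<exists>D. (f has_derivative D) (at x) \<and> D (axis i 1) = f' x"
     "\<And>x. \<exists>D. (g has_derivative D) (at x) \<and> D (axis i 1) = g' x" by metis
  moreover have "\<exists>D. ((\<lambda>x. f x * g x) has_derivative D) (at x) \<and> D (axis i 1) = f x * g' x + f' x * g x" for x
  proof -
    obtain D1 D2 where "(f has_derivative D1) (at x)" "D1 (axis i 1) = f' x" "(g has_derivative D2) (at x)" "D2 (axis i 1) = g' x"
      using D(1)[of x] D(2)[of x] by (elim exE conjE) (rule that)
    then show ?thesis by (intro exI[of _ "\<lambda>h. f x * D2 h + D1 h * g x"]) (auto intro: has_derivative_mult)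
  qed
  ultimately show ?case using mult by (intro exI[of _ "\<lambda>x. f x * g' x + f' x * g x"]) auto
qed

lemma real_polynomial_function_growth:
  fixes p :: "'a::real_normed_vector \<Rightarrow> real"
  assumes "real_polynomial_function p"
  shows "\<exists>C m. \<forall>x. \<bar>p x\<bar> \<le> C * (1 + norm x) ^ m"
  using assms
proof induction
  case (linear f)
  then obtain K where K: "\<And>x. norm (f x) \<le> norm x * K" "K > 0" using bounded_linear.pos_bounded by blast
  have "\<bar>f x\<bar> \<le> K * (1 + norm x) ^ 1" for x using K(1)[of x] K(2) by (simp add: algebra_simps)
  then show ?case by blast
next
  case (const c)
  then show ?case by (intro exI[of _ "\<bar>c\<bar>"] exI[of _ 0]) simp
next
  case (add f g)
  then obtain C m D l where b: "\<And>x. \<bar>f x\<bar> \<le> C * (1 + norm x) ^ m" "\<And>x. \<bar>g x\<bar> \<le> D * (1 + norm x) ^ l" by blast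
  have nn: "C \<ge> 0" "D \<ge> 0" using order_trans[OF abs_ge_zero b(1)[of 0]] order_trans[OF abs_ge_zero b(2)[of 0]] by auto
  have "\<bar>f x + g x\<bar> \<le> (C + D) * (1 + norm x) ^ (m + l)" for x
  proof -
    have "(1 + norm x) ^ m \<le> (1 + norm x) ^ (m + l)" "(1 + norm x) ^ l \<le> (1 + norm x) ^ (m + l)"
      by (intro power_increasing; simp)+
    then have "C * (1 + norm x) ^ m + D * (1 + norm x) ^ l \<le> C * (1 + norm x) ^ (m + l) + D * (1 + norm x) ^ (m + l)"
      using nn by (intro add_mono mult_left_mono) auto
    then show ?thesis using b(1)[of x] b(2)[of x] by (simp add: algebra_simps)
  qed
  then show ?case by blast
next
  case (mult f g)
  then obtain C m D l where b: "\<And>x. \<bar>f x\<bar> \<le> C * (1 + norm x) ^ m" "\<And>x. \<bar>g x\<bar> \<le> D * (1 + norm x) ^ l" by blast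
  have "\<bar>f x * g x\<bar> \<le> (C * D) * (1 + norm x) ^ (m + l)" for x
    using mult_mono[OF b(1)[of x] b(2)[of x]] order_trans[OF abs_ge_zero b(1)[of x]]
    by (simp add: abs_mult power_add mult_ac)
  then show ?case by blast
qed

lemma power_over_fact_le_exp: "y ^ k / fact k \<le> exp y" if "y \<ge> 0" for y :: real
proof -
  have "(\<Sum>n\<in>{k}. y ^ n /\<^sub>R fact n) \<le> (\<Sum>n. y ^ n /\<^sub>R fact n)"
    using that by (intro sum_le_suminf summable_exp_generic) auto
  then show ?thesis by (simp add: exp_def divide_inverse mult.commute)
qed

lemma power_times_gaussian_bounded:
  assumes a: "a > 0"
  shows "\<exists>K. \<forall>x::real^3. (1 + norm x) ^ k * exp (- (a * (norm x)\<^sup>2) + b \<bullet> x + c) \<le> K"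
proof -
  \<comment> \<open>Completing the square bounds the exponent by \<open>K - (1 + norm x)\<close>;
    the spare \<open>exp (- (1 + norm x))\<close> absorbs the power through one term of the
    exponential series.\<close>
  define K where "K = (norm b + 1)\<^sup>2 / (4 * a) + c + 1"
  have "(1 + norm x) ^ k * exp (- (a * (norm x)\<^sup>2) + b \<bullet> x + c) \<le> fact k * exp K" for x
  proof -
    have "a * (norm x)\<^sup>2 - (norm b + 1) * norm x + (norm b + 1)\<^sup>2 / (4 * a) = a * (norm x - (norm b + 1) / (2 * a))\<^sup>2"
      using a by (simp add: power2_eq_square field_simps)
    also have "\<dots> \<ge> 0" using a by simp
    finally have "- (a * (norm x)\<^sup>2) + norm b * norm x + norm x \<le> (norm b + 1)\<^sup>2 / (4 * a)"
      by (simp add: algebra_simps)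
    then have e: "- (a * (norm x)\<^sup>2) + b \<bullet> x + c \<le> K - (1 + norm x)"
      using norm_cauchy_schwarz[of b x] by (simp add: K_def)
    have "(1 + norm x) ^ k / fact k \<le> exp (1 + norm x)"
      by (rule power_over_fact_le_exp) simp
    then have "(1 + norm x) ^ k * exp (- (a * (norm x)\<^sup>2) + b \<bullet> x + c) \<le> (fact k * exp (1 + norm x)) * exp (K - (1 + norm x))"
      using e by (intro mult_mono) (auto simp: field_simps)
    also have "\<dots> = fact k * exp K" by (simp add: mult.assoc flip: exp_add)
    finally show ?thesis .
  qed
  then show ?thesis by blast
qed

text \<open>Polynomial multiples of a fixed Gaussian are closed under partial derivatives, so all
  iterated derivatives have this form and decay rapidly.\<close>

lemma schwartz_poly_gauss:
  fixes p :: "real^3 \<Rightarrow> real"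
  assumes p: "real_polynomial_function p" and a: "a > 0"
  shows "(\<lambda>x. complex_of_real (p x * exp (- (a * (norm x)\<^sup>2) + b \<bullet> x + c))) \<in> schwartz"
proof -
  define E where "E x = exp (- (a * (norm x)\<^sup>2) + b \<bullet> x + c)" for x
  have E: "(E has_derivative (\<lambda>h. E x * (- (a * (2 * (x \<bullet> h))) + b \<bullet> h))) (at x)" for x
    unfolding E_def power2_norm_eq_inner
    by (auto intro!: derivative_eq_intros simp: inner_commute algebra_simps)
  have step: "\<exists>q'. real_polynomial_function q' \<and> (\<forall>x. \<exists>D. ((\<lambda>x. complex_of_real (q x * E x)) has_derivative D) (at x) \<and>
       D (axis i 1) = complex_of_real (q' x * E x))" if q: "real_polynomial_function q" for q i
  proof -
    obtain q1 where q1: "real_polynomial_function q1" "\<And>x. \<exists>D. (q has_derivative D) (at x) \<and> D (axis i 1) = q1 x"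
      using real_polynomial_function_pd[OF q] by blast
    define q' where "q' x = q1 x + q x * (- (2 * a) * (x \<bullet> axis i 1) + b \<bullet> axis i 1)" for x
    have "bounded_linear (\<lambda>x. x \<bullet> axis i (1::real))" by (rule bounded_linear_inner_left)
    then have "real_polynomial_function q'"
      unfolding q'_def[abs_def]
      by (intro real_polynomial_function.intros q q1(1))
    moreover have "\<exists>D. ((\<lambda>x. complex_of_real (q x * E x)) has_derivative D) (at x) \<and> D (axis i 1) = complex_of_real (q' x * E x)" for x
    proof -
      obtain D where D: "(q has_derivative D) (at x)" "D (axis i 1) = q1 x" using q1(2) by blast
      have "((\<lambda>x. complex_of_real (q x * E x)) has_derivative
         (\<lambda>h. complex_of_real (q x * (E x * (- (a * (2 * (x \<bullet> h))) + b \<bullet> h)) + D h * E x))) (at x)"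
        by (intro has_derivative_of_real has_derivative_mult D(1) E)
      then show ?thesis by (intro exI conjI, assumption) (simp add: D(2) q'_def algebra_simps)
    qed
    ultimately show ?thesis by blast
  qed
  have iter: "\<exists>q. real_polynomial_function q \<and> iter_pd is (\<lambda>x. complex_of_real (p x * E x)) = (\<lambda>x. complex_of_real (q x * E x))" for "is"
  proof (induction "is")
    case Nil
    then show ?case using p by auto
  next
    case (Cons i "is")
    then obtain q where q: "real_polynomial_function q" "iter_pd is (\<lambda>x. complex_of_real (p x * E x)) = (\<lambda>x. complex_of_real (q x * E x))"
      by blast
    obtain q' where q': "real_polynomial_function q'" "\<And>x. \<exists>D. ((\<lambda>x. complex_of_real (q x * E x)) has_derivative D) (at x) \<and>
       D (axis i 1) = complex_of_real (q' x * E x)" using step[OF q(1), of i] by blast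
    have "frechet_derivative (\<lambda>x. complex_of_real (q x * E x)) (at x) (axis i 1) = complex_of_real (q' x * E x)" for x
      using q'(2)[of x] frechet_derivative_at by metis
    then show ?case unfolding iter_pd.simps q(2) by (intro exI[of _ q'] conjI q'(1) ext)
  qed
  show ?thesis
    unfolding schwartz_def mem_Collect_eq E_def[symmetric]
  proof (intro conjI allI)
    fix "is" :: "3 list" and k :: nat
    obtain q where q: "real_polynomial_function q" "iter_pd is (\<lambda>x. complex_of_real (p x * E x)) = (\<lambda>x. complex_of_real (q x * E x))"
      using iter by blast
    show "iter_pd is (\<lambda>x. complex_of_real (p x * E x)) differentiable at x" for x
      unfolding q(2) using step[OF q(1)] by (meson differentiableI)
    obtain C m where C: "\<And>x. \<bar>q x\<bar> \<le> C * (1 + norm x) ^ m" using real_polynomial_function_growth[OF q(1)] by blast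
    have C0: "C \<ge> 0" using order_trans[OF abs_ge_zero C[of 0]] by simp
    obtain K where K: "\<And>x::real^3. (1 + norm x) ^ (k + m) * E x \<le> K"
      using power_times_gaussian_bounded[OF a, of "k + m" b c] unfolding E_def by blast
    have "(1 + norm x) ^ k * cmod (complex_of_real (q x * E x)) \<le> C * K" for x
    proof -
      have "(1 + norm x) ^ k * cmod (complex_of_real (q x * E x)) = (1 + norm x) ^ k * \<bar>q x\<bar> * E x"
        by (simp add: norm_mult abs_mult E_def)
      also have "\<dots> \<le> (1 + norm x) ^ k * (C * (1 + norm x) ^ m) * E x"
        by (intro mult_right_mono mult_left_mono C) (auto simp: E_def)
      also have "\<dots> = C * ((1 + norm x) ^ (k + m) * E x)" by (simp add: power_add mult_ac)
      also have "\<dots> \<le> C * K" by (intro mult_left_mono K C0)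
      finally show ?thesis .
    qed
    then show "\<exists>B. \<forall>x. (1 + norm x) ^ k * cmod (iter_pd is (\<lambda>x. complex_of_real (p x * E x)) x) \<le> B"
      unfolding q(2) by blast
  qed
qed

text \<open>The factor \<open>exp (- (norm x)^2)\<close> belongs to the test function because it is
  the one that makes \<open>f\<close> integrable in \<open>schwartz_determines\<close>. Expanding
  the squares merges both Gaussians into one, with a linear term in the exponent.\<close>

lemma schwartz_gauss_translate:
  assumes d: "d > 0"
  shows "(\<lambda>x. complex_of_real (exp (- (norm x)\<^sup>2) * gauss ((x - y) /\<^sub>R d))) \<in> schwartz"
proof -
  have e: "- (norm x)\<^sup>2 + - (norm ((x - y) /\<^sub>R d))\<^sup>2 / 2 =
     - ((1 + 1 / (2 * d\<^sup>2)) * (norm x)\<^sup>2) + (y /\<^sub>R d\<^sup>2) \<bullet> x + (- (norm y)\<^sup>2 / (2 * d\<^sup>2))" for x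
  proof -
    have "norm ((x - y) /\<^sub>R d) = norm (x - y) / d" using d unfolding norm_scaleR by (simp add: divide_inverse mult.commute)
    moreover have "(norm (x - y))\<^sup>2 = (norm x)\<^sup>2 - 2 * (y \<bullet> x) + (norm y)\<^sup>2"
      by (simp add: power2_norm_eq_inner inner_diff inner_commute)
    ultimately have *: "(norm ((x - y) /\<^sub>R d))\<^sup>2 = ((norm x)\<^sup>2 - 2 * (y \<bullet> x) + (norm y)\<^sup>2) / d\<^sup>2"
      by (simp add: power_divide)
    show ?thesis unfolding * using d by (simp add: field_simps)
  qed
  have "(\<lambda>x. complex_of_real (1 / sqrt (2 * pi) ^ 3 * exp (- ((1 + 1 / (2 * d\<^sup>2)) * (norm x)\<^sup>2) + (y /\<^sub>R d\<^sup>2) \<bullet> x +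
     (- (norm y)\<^sup>2 / (2 * d\<^sup>2))))) \<in> schwartz"
    using d by (intro schwartz_poly_gauss real_polynomial_function.intros(2)) (simp add: add_pos_nonneg)
  then show ?thesis
    unfolding e[symmetric] exp_add by (simp add: gauss_def)
qed

text \<open>\<open>\<kappa>\<close> is the limit of its Gaussian averages \<open>m n\<close>, and by
  Fubini each average is a superposition of translated Gaussians, against which \<open>h\<close>
  integrates to zero.\<close>

lemma integral_continuous_eq_0:
  fixes h :: "real^3 \<Rightarrow> complex"
  assumes h: "integrable lborel h"
    and z: "\<And>y d. d > 0 \<Longrightarrow> (\<integral>x. of_real (gauss ((x - y) /\<^sub>R d)) * h x \<partial>lborel) = 0"
    and \<kappa>: "\<And>x. isCont \<kappa> x" "\<And>x. \<bar>\<kappa> x\<bar> \<le> 1" and supp: "integrable lborel \<kappa>"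
  shows "(\<integral>x. of_real (\<kappa> x) * h x \<partial>lborel) = 0"
proof -
  have [measurable]: "h \<in> borel_measurable borel" using h by auto
  have [measurable]: "\<kappa> \<in> borel_measurable borel" using supp by auto
  define d :: "nat \<Rightarrow> real" where "d n = 1 / real (Suc n)" for n
  have d: "d \<longlonglongrightarrow> 0" "d n > 0" for n
    using LIMSEQ_inverse_real_of_nat by (auto simp: d_def[abs_def] inverse_eq_divide)
  define m where "m n x = (\<integral>z. gauss z *\<^sub>R \<kappa> (x + d n *\<^sub>R z) \<partial>lborel)" for n x
  have m_eq: "d n ^ 3 * m n x = (\<integral>y. gauss ((x - y) /\<^sub>R d n) * \<kappa> y \<partial>lborel)" for n x
  proof -
    have "gauss ((x - (x + d n *\<^sub>R z)) /\<^sub>R d n) = gauss z" for z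
      using d(2)[of n] by (simp add: gauss_def)
    then show ?thesis
      using d(2)[of n] integral_lborel_affine[of "\<lambda>y. gauss ((x - y) /\<^sub>R d n) * \<kappa> y" "d n" x] by (simp add: m_def)
  qed
  have "(\<lambda>n. \<integral>x. of_real (m n x) * h x \<partial>lborel) \<longlonglongrightarrow> (\<integral>x. of_real (\<kappa> x) * h x \<partial>lborel)"
  proof (rule integral_dominated_convergence[where w="\<lambda>x. cmod (h x)"])
    show "integrable lborel (\<lambda>x. cmod (h x))" using h by simp
    show "AE x in lborel. (\<lambda>n. of_real (m n x) * h x) \<longlonglongrightarrow> of_real (\<kappa> x) * h x"
      unfolding m_def by (intro AE_I2 tendsto_intros gauss_approximate_identity[where B=1] \<kappa> d) (use \<kappa> in auto)
    show "AE x in lborel. norm (of_real (m n x) * h x) \<le> cmod (h x)" for n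
    proof (rule AE_I2)
      fix x
      have "\<bar>m n x\<bar> \<le> (\<integral>z. norm (gauss z *\<^sub>R \<kappa> (x + d n *\<^sub>R z)) \<partial>lborel)"
        unfolding m_def using integral_norm_bound[of lborel "\<lambda>z. gauss z *\<^sub>R \<kappa> (x + d n *\<^sub>R z)"] by simp
      also have "\<dots> \<le> (\<integral>z. gauss (z::real^3) \<partial>lborel)"
        by (intro integral_mono' integrable_gauss) (auto simp: abs_mult \<kappa>(2) mult_left_le)
      finally show "norm (of_real (m n x) * h x) \<le> cmod (h x)"
        by (simp add: integral_gauss norm_mult mult_left_le_one_le)
    qed
  qed (auto simp: m_def)
  moreover have "(\<integral>x. of_real (m n x) * h x \<partial>lborel) = 0" for n
  proof -
    define F where "F x y = of_real (gauss ((x - y) /\<^sub>R d n)) * h x * of_real (\<kappa> y)" for x y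
    have gb: "gauss (z::real^3) \<le> 1" for z
    proof -
      have "1 \<le> sqrt (2 * pi)" using pi_ge_two by (simp add: real_le_rsqrt)
      then have "1 \<le> sqrt (2 * pi) ^ 3" by (rule one_le_power)
      then show ?thesis unfolding gauss_def by (simp add: divide_le_eq_1_pos order_trans[OF _ \<open>1 \<le> sqrt (2 * pi) ^ 3\<close>])
    qed
    have Fi: "integrable (lborel \<Otimes>\<^sub>M lborel) (\<lambda>(x, y). F x y)"
    proof (rule Bochner_Integration.integrable_bound)
      show "integrable (lborel \<Otimes>\<^sub>M lborel) (\<lambda>q. h (fst q) * complex_of_real (\<kappa> (snd q)))"
        by (rule lborel_times_integral(1)) (use h supp in auto)
      show "(\<lambda>(x, y). F x y) \<in> borel_measurable (lborel \<Otimes>\<^sub>M lborel)"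
        unfolding F_def by measurable
      show "AE q in lborel \<Otimes>\<^sub>M lborel. norm (case q of (x, y) \<Rightarrow> F x y) \<le> norm (h (fst q) * complex_of_real (\<kappa> (snd q)))"
        by (intro AE_I2) (auto simp: F_def norm_mult mult.assoc gb intro!: mult_left_le_one_le)
    qed
    have "of_real (d n ^ 3) * (\<integral>x. of_real (m n x) * h x \<partial>lborel) = (\<integral>x. of_real (d n ^ 3 * m n x) * h x \<partial>lborel)"
      by (simp add: mult.assoc)
    also have "\<dots> = (\<integral>x. (\<integral>y. F x y \<partial>lborel) \<partial>lborel)"
    proof (intro Bochner_Integration.integral_cong refl)
      fix x
      have "(\<integral>y. F x y \<partial>lborel) = (\<integral>y. of_real (gauss ((x - y) /\<^sub>R d n) * \<kappa> y) * h x \<partial>lborel)"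
        unfolding F_def by (intro Bochner_Integration.integral_cong refl) simp
      also have "\<dots> = of_real (d n ^ 3 * m n x) * h x"
        unfolding m_eq integral_mult_left_zero integral_complex_of_real ..
      finally show "of_real (d n ^ 3 * m n x) * h x = (\<integral>y. F x y \<partial>lborel)" by simp
    qed
    also have "\<dots> = (\<integral>y. (\<integral>x. F x y \<partial>lborel) \<partial>lborel)"
      using lborel_pair.Fubini_integral[OF Fi] by simp
    also have "\<dots> = 0"
      unfolding F_def integral_mult_left_zero by (simp add: z[OF d(2)])
    finally show ?thesis using d(2)[of n] by simp
  qed
  ultimately show ?thesis by (simp add: LIMSEQ_const_iff)
qed

text \<open>Compact sets exhaust closed sets, closed sets form an intersection-stable generator, and
  the Borel sets over which \<open>h\<close> integrates to zero form a Dynkin system.\<close>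

lemma AE_eq_0_of_integral_compact:
  fixes h :: "real^3 \<Rightarrow> complex"
  assumes h: "integrable lborel h"
    and z: "\<And>C. compact C \<Longrightarrow> (\<integral>x. of_real (indicator C x) * h x \<partial>lborel) = 0"
  shows "AE x in lborel. h x = 0"
proof -
  have [measurable]: "h \<in> borel_measurable borel" using h by auto
  have hi: "integrable lborel (\<lambda>x. of_real (indicator A x) * h x)" if [measurable]: "A \<in> sets borel" for A
    by (rule Bochner_Integration.integrable_bound[OF h]) (auto simp: norm_mult indicator_def)
  have cl: "(\<integral>x. of_real (indicator C x) * h x \<partial>lborel) = 0" if C: "closed C" for C
  proof -
    have [measurable]: "C \<in> sets borel" using C by auto
    have "(\<lambda>n. \<integral>x. of_real (indicator (C \<inter> cball 0 (real n)) x) * h x \<partial>lborel) \<longlonglongrightarrow> (\<integral>x. of_real (indicator C x) * h x \<partial>lborel)"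
    proof (rule integral_dominated_convergence[where w="\<lambda>x. cmod (h x)"])
      show "AE x in lborel. (\<lambda>n. complex_of_real (indicator (C \<inter> cball 0 (real n)) x) * h x) \<longlonglongrightarrow> of_real (indicator C x) * h x"
      proof (rule AE_I2, rule tendsto_eventually)
        fix x :: "real^3"
        obtain N where "norm x \<le> real N" using real_arch_simple by blast
        then show "\<forall>\<^sub>F n in sequentially. complex_of_real (indicator (C \<inter> cball 0 (real n)) x) * h x = of_real (indicator C x) * h x"
          by (intro eventually_sequentiallyI[of N]) (auto simp: indicator_def)
      qed
    qed (use h in \<open>auto simp: norm_mult indicator_def\<close>)
    moreover have "(\<integral>x. of_real (indicator (C \<inter> cball 0 (real n)) x) * h x \<partial>lborel) = 0" for n
      using C by (intro z closed_Int_compact) auto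
    ultimately show ?thesis by (simp add: LIMSEQ_const_iff)
  qed
  have zero: "(\<integral>x. of_real (indicator A x) * h x \<partial>lborel) = 0" if "A \<in> sets borel" for A
  proof -
    have "A \<in> sigma_sets UNIV (Collect closed)" using that by (simp add: borel_eq_closed)
    moreover have "Int_stable (Collect closed :: (real^3) set set)" by (auto simp: Int_stable_def)
    moreover have "(Collect closed :: (real^3) set set) \<subseteq> Pow UNIV" by auto
    ultimately have "Int_stable (Collect closed :: (real^3) set set)" "(Collect closed :: (real^3) set set) \<subseteq> Pow UNIV"
      "A \<in> sigma_sets UNIV (Collect closed)" by auto
    then show ?thesis
    proof (induction A rule: sigma_sets_induct_disjoint)
      case (compl A)
      then have [measurable]: "A \<in> sets borel" by (simp add: borel_eq_closed)
      have "(\<integral>x. of_real (indicator (UNIV - A) x) * h x \<partial>lborel) =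
        (\<integral>x. of_real (indicator UNIV x) * h x - of_real (indicator A x) * h x \<partial>lborel)"
        by (intro Bochner_Integration.integral_cong refl) (auto simp: indicator_def)
      also have "\<dots> = (\<integral>x. of_real (indicator UNIV x) * h x \<partial>lborel) - (\<integral>x. of_real (indicator A x) * h x \<partial>lborel)"
        by (intro Bochner_Integration.integral_diff hi) auto
      also have "\<dots> = 0" using compl cl[of UNIV] by simp
      finally show ?case .
    next
      case (union A)
      then have [measurable]: "A i \<in> sets borel" for i by (auto simp: borel_eq_closed)
      have "(\<lambda>n. \<integral>x. of_real (indicator (\<Union>i<n. A i) x) * h x \<partial>lborel) \<longlonglongrightarrow> (\<integral>x. of_real (indicator (\<Union>i. A i) x) * h x \<partial>lborel)"
      proof (rule integral_dominated_convergence[where w="\<lambda>x. cmod (h x)"])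
        show "AE x in lborel. (\<lambda>n. complex_of_real (indicator (\<Union>i<n. A i) x) * h x) \<longlonglongrightarrow> of_real (indicator (\<Union>i. A i) x) * h x"
        proof (rule AE_I2, rule tendsto_eventually)
          fix x :: "real^3"
          show "\<forall>\<^sub>F n in sequentially. complex_of_real (indicator (\<Union>i<n. A i) x) * h x = of_real (indicator (\<Union>i. A i) x) * h x"
          proof (cases "x \<in> (\<Union>i. A i)")
            case True
            then obtain i where "x \<in> A i" by auto
            then show ?thesis by (intro eventually_sequentiallyI[of "Suc i"]) (auto simp: indicator_def)
          qed (auto simp: indicator_def)
        qed
      qed (use h in \<open>auto simp: norm_mult indicator_def\<close>)
      moreover have "(\<integral>x. of_real (indicator (\<Union>i<n. A i) x) * h x \<partial>lborel) = 0" for n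
      proof -
        have "indicator (\<Union>i<n. A i) x = (\<Sum>i<n. indicator (A i) x :: real)" for x
          using union(1) by (intro indicator_UN_disjoint) (auto simp: disjoint_family_on_def)
        then have "(\<integral>x. of_real (indicator (\<Union>i<n. A i) x) * h x \<partial>lborel) = (\<integral>x. (\<Sum>i<n. of_real (indicator (A i) x) * h x) \<partial>lborel)"
          by (simp add: sum_distrib_right)
        also have "\<dots> = (\<Sum>i<n. \<integral>x. of_real (indicator (A i) x) * h x \<partial>lborel)"
          by (intro Bochner_Integration.integral_sum hi) auto
        also have "\<dots> = 0" using union by simp
        finally show ?thesis .
      qed
      ultimately show ?case by (simp add: LIMSEQ_const_iff)
    qed (auto simp: cl)
  qed
  show ?thesis
  proof (rule sigma_finite_measure.density_zero[OF sigma_finite_lborel h])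
    fix A assume "A \<in> sets (lborel :: (real^3) measure)"
    then show "set_lebesgue_integral lborel A h = 0"
      using zero[of A] by (simp add: set_lebesgue_integral_def scaleR_conv_of_real)
  qed
qed

text \<open>The Gaussian is itself a Schwartz function, so \<open>h\<close> is integrable even when
  \<open>f\<close> is not. Indicators of compact sets are then reached as limits of the tent
  functions \<open>\<kappa>\<close>.\<close>

theorem schwartz_determines:
  fixes f :: "real^3 \<Rightarrow> complex"
  assumes [measurable]: "f \<in> borel_measurable borel"
    and f: "\<And>\<phi>. \<phi> \<in> schwartz \<Longrightarrow> integrable lborel (\<lambda>x. f x * \<phi> x)"
    and z: "\<And>\<phi>. \<phi> \<in> schwartz \<Longrightarrow> (\<integral>x. f x * \<phi> x \<partial>lborel) = 0"
  shows "AE x in lborel. f x = 0"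
proof -
  define h where "h x = f x * of_real (exp (- (norm x)\<^sup>2))" for x
  have "(\<lambda>x::real^3. complex_of_real (1 * exp (- (1 * (norm x)\<^sup>2) + 0 \<bullet> x + 0))) \<in> schwartz"
    by (intro schwartz_poly_gauss real_polynomial_function.intros(2)) simp
  from f[OF this] have h: "integrable lborel h" by (simp add: h_def[abs_def])
  have "AE x in lborel. h x = 0"
  proof (rule AE_eq_0_of_integral_compact[OF h])
    fix C :: "(real^3) set" assume C: "compact C"
    have [measurable]: "C \<in> sets borel" using C by (simp add: compact_imp_closed borel_closed)
    have hz: "(\<integral>x. of_real (gauss ((x - y) /\<^sub>R d)) * h x \<partial>lborel) = 0" if "d > 0" for y d
      using z[OF schwartz_gauss_translate[OF that, of y]] by (simp add: h_def mult_ac)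
    define \<kappa> :: "nat \<Rightarrow> real^3 \<Rightarrow> real" where "\<kappa> n x = max 0 (1 - real n * infdist x C)" for n x
    show "(\<integral>x. of_real (indicator C x) * h x \<partial>lborel) = 0"
    proof (cases "C = {}")
      case False
      have \<kappa>c: "isCont (\<kappa> n) x" for n x
        unfolding \<kappa>_def[abs_def] by (intro continuous_intros)
      then have [measurable]: "\<kappa> n \<in> borel_measurable borel" for n
        by (intro borel_measurable_continuous_onI continuous_at_imp_continuous_on) auto
      have \<kappa>1: "\<bar>\<kappa> n x\<bar> \<le> 1" for n x by (simp add: \<kappa>_def infdist_nonneg)
      \<comment> \<open>\<open>Suc n\<close> and not \<open>n\<close>: the tent
        \<open>\<kappa> 0\<close> is constantly 1 and not integrable, whereas for slope at least 1
        the support stays within distance 1 of \<open>C\<close>.\<close>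
      have "(\<lambda>n. \<integral>x. of_real (\<kappa> (Suc n) x) * h x \<partial>lborel) \<longlonglongrightarrow> (\<integral>x. of_real (indicator C x) * h x \<partial>lborel)"
      proof (rule integral_dominated_convergence[where w="\<lambda>x. cmod (h x)"])
        show "AE x in lborel. (\<lambda>n. complex_of_real (\<kappa> (Suc n) x) * h x) \<longlonglongrightarrow> of_real (indicator C x) * h x"
        proof (rule AE_I2, rule tendsto_eventually)
          fix x :: "real^3"
          show "\<forall>\<^sub>F n in sequentially. complex_of_real (\<kappa> (Suc n) x) * h x = of_real (indicator C x) * h x"
          proof (cases "x \<in> C")
            case False
            then have "infdist x C > 0"
              using C \<open>C \<noteq> {}\<close> by (simp add: compact_imp_closed infdist_pos_not_in_closed)
            moreover obtain N :: nat where "1 / infdist x C \<le> real N" using real_arch_simple by blast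
            ultimately have N: "1 \<le> real N * infdist x C" by (simp add: divide_le_eq)
            have "\<kappa> (Suc n) x = 0" if "n \<ge> N" for n
            proof -
              have "real N * infdist x C \<le> real (Suc n) * infdist x C"
                using that by (intro mult_right_mono infdist_nonneg) auto
              then show ?thesis using N by (simp add: \<kappa>_def)
            qed
            then show ?thesis using False by (intro eventually_sequentiallyI[of N]) auto
          qed (auto simp: \<kappa>_def)
        qed
        show "AE x in lborel. norm (complex_of_real (\<kappa> (Suc n) x) * h x) \<le> cmod (h x)" for n
          by (intro AE_I2) (simp add: norm_mult mult_left_le_one_le \<kappa>1)
      qed (use h in auto)
      moreover have "(\<integral>x. of_real (\<kappa> (Suc n) x) * h x \<partial>lborel) = 0" for n
      proof (rule integral_continuous_eq_0[OF h hz \<kappa>c \<kappa>1])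
        obtain R where R: "\<And>x. x \<in> C \<Longrightarrow> norm x \<le> R" using compact_imp_bounded[OF C] bounded_iff by metis
        show "integrable lborel (\<kappa> (Suc n))"
        proof (rule Bochner_Integration.integrable_bound[where f="indicator (cball 0 (R + 1))"])
          show "integrable lborel (indicator (cball (0::real^3) (R + 1)) :: _ \<Rightarrow> real)"
            by (intro integrable_real_indicator) (use emeasure_lborel_cball_finite[of 0 "R + 1"] in auto)
          show "AE x in lborel. norm (\<kappa> (Suc n) x) \<le> norm (indicator (cball 0 (R + 1)) x :: real)"
          proof (rule AE_I2)
            fix x :: "real^3"
            show "norm (\<kappa> (Suc n) x) \<le> norm (indicator (cball 0 (R + 1)) x :: real)"
            proof (cases "norm x \<le> R + 1")
              case False
              have "1 \<le> infdist x C"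
                unfolding infdist_notempty[OF \<open>C \<noteq> {}\<close>]
              proof (rule cINF_greatest[OF \<open>C \<noteq> {}\<close>])
                fix y assume "y \<in> C"
                then show "1 \<le> dist x y" using R[of y] False norm_triangle_ineq2[of x y] by (simp add: dist_norm)
              qed
              then have "1 * 1 \<le> real (Suc n) * infdist x C" by (intro mult_mono) auto
              then show ?thesis by (simp add: \<kappa>_def)
            qed (use \<kappa>1 in \<open>simp add: indicator_def\<close>)
          qed
        qed simp
      qed
      ultimately show ?thesis by (simp add: LIMSEQ_const_iff)
    qed simp
  qed
  then show ?thesis by (simp add: h_def)
qed

text \<open>Makes the choice in \<open>fourier_fun\<close> and the infimum in
  \<open>Lr_norm_distr\<close> harmless.\<close>

lemma represents_unique:
  assumes f: "represents f u" and g: "represents g u"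
  shows "AE x in lborel. f x = g x"
proof -
  have [measurable]: "f \<in> borel_measurable borel" "g \<in> borel_measurable borel"
    using f g by (auto simp: represents_def)
  have "AE x in lborel. f x - g x = 0"
  proof (rule schwartz_determines)
    fix \<phi> assume \<phi>: "\<phi> \<in> schwartz"
    have "integrable lborel (\<lambda>x. f x * \<phi> x)" "integrable lborel (\<lambda>x. g x * \<phi> x)"
      "(\<integral>x. f x * \<phi> x \<partial>lborel) = (\<integral>x. g x * \<phi> x \<partial>lborel)"
      using f g \<phi> by (auto simp: represents_def)
    then show "integrable lborel (\<lambda>x. (f x - g x) * \<phi> x)" "(\<integral>x. (f x - g x) * \<phi> x \<partial>lborel) = 0"
      by (simp_all add: left_diff_distrib)
  qed simp
  then show ?thesis by simp
qed

section \<open>The random coefficients\<close>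

locale wiener =
  fixes M :: "'a measure" and g :: "nat \<Rightarrow> int^3 \<Rightarrow> 'a \<Rightarrow> complex" and \<psi> :: "real^3 \<Rightarrow> complex" and c0 :: real
  assumes cutoff: "wiener_cutoff \<psi>" and vars: "wiener_variables M g"
    and c0: "c0 > 0" and moments: "exp_moment_bound M g c0"

sublocale wiener \<subseteq> prob_space M
  using vars unfolding wiener_variables_def by (rule conjunct1)

sublocale wiener \<subseteq> compact_cutoff \<psi>
proof
  fix \<xi> i assume "\<psi> \<xi> \<noteq> 0"
  then have "\<xi> \<in> closure {\<xi>. \<psi> \<xi> \<noteq> 0}" using subsetD[OF closure_subset, of \<xi> "{\<xi>. \<psi> \<xi> \<noteq> 0}"] by simp
  moreover have "closure {\<xi>. \<psi> \<xi> \<noteq> 0} \<subseteq> {\<xi>. \<forall>i. \<xi> $ i \<in> {-1..1}}"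
    using cutoff unfolding wiener_cutoff_def by (elim conjE)
  ultimately have "\<xi> $ i \<in> {-1..1}" by blast
  then show "\<bar>\<xi> $ i\<bar> \<le> 1" by (simp add: abs_le_iff)
qed

lemma sum_half_lattice_index:
  fixes \<phi> :: "nat \<Rightarrow> int^3 \<Rightarrow> bool \<Rightarrow> 'b::comm_monoid_add"
  assumes B: "finite B"
  shows "(\<Sum>(j, n, b)\<in>{0, 1} \<times> ((B \<inter> {0}) \<times> {False} \<union> (B \<inter> half_lattice) \<times> UNIV). \<phi> j n b) =
    (\<Sum>j\<in>{0, 1}. (\<Sum>n\<in>B \<inter> {0}. \<phi> j n False) + (\<Sum>n\<in>B \<inter> half_lattice. \<phi> j n False + \<phi> j n True))"
proof -
  have "(\<Sum>(n, b)\<in>(B \<inter> {0}) \<times> {False} \<union> (B \<inter> half_lattice) \<times> UNIV. \<phi> j n b) =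
     (\<Sum>n\<in>B \<inter> {0}. \<phi> j n False) + (\<Sum>n\<in>B \<inter> half_lattice. \<phi> j n False + \<phi> j n True)" for j
  proof (subst sum.union_disjoint)
    show "(B \<inter> {0}) \<times> {False} \<inter> (B \<inter> half_lattice) \<times> UNIV = {}" using half_lattice_disjoint(1) by auto
    show "(\<Sum>(n, b)\<in>(B \<inter> {0}) \<times> {False}. \<phi> j n b) + (\<Sum>(n, b)\<in>(B \<inter> half_lattice) \<times> UNIV. \<phi> j n b) =
      (\<Sum>n\<in>B \<inter> {0}. \<phi> j n False) + (\<Sum>n\<in>B \<inter> half_lattice. \<phi> j n False + \<phi> j n True)"
      by (simp add: sum.cartesian_product[symmetric] UNIV_bool)
  qed (use B in auto)
  then show ?thesis
    by (simp add: sum.cartesian_product[symmetric, of "\<lambda>j p. case p of (n, b) \<Rightarrow> \<phi> j n b", unfolded case_prod_conv] del: sum.insert)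
qed

context wiener
begin

lemma g_measurable [measurable]: "j \<in> {0, 1} \<Longrightarrow> g j n \<in> borel_measurable M"
  using vars by (auto simp: wiener_variables_def)

lemma g_uminus: "j \<in> {0, 1} \<Longrightarrow> \<omega> \<in> space M \<Longrightarrow> g j (- n) \<omega> = cnj (g j n \<omega>)"
  using vars by (auto simp: wiener_variables_def)

lemma g_zero_real: "j \<in> {0, 1} \<Longrightarrow> \<omega> \<in> space M \<Longrightarrow> Im (g j 0 \<omega>) = 0"
  using g_uminus[of j \<omega> 0] by (simp add: complex_eq_iff)

lemma subgaussian_Re: "j \<in> {0, 1} \<Longrightarrow> subgaussian M c0 (\<lambda>\<omega>. Re (g j n \<omega>))"
  unfolding subgaussian_def
proof (intro conjI allI)
  fix a :: real assume j: "j \<in> {0, 1}"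
  show "(\<integral>\<^sup>+\<omega>. ennreal (exp (a * Re (g j n \<omega>))) \<partial>M) \<le> ennreal (exp (c0 * a\<^sup>2))"
  proof (cases "n = 0")
    case True
    have "(\<integral>\<^sup>+x. ennreal (exp (a * x)) \<partial>distr M borel (\<lambda>\<omega>. Re (g j 0 \<omega>))) \<le> ennreal (exp (c0 * a\<^sup>2))"
      using moments j unfolding exp_moment_bound_def by blast
    then show ?thesis using True j by (simp add: nn_integral_distr)
  next
    case False
    have "(\<integral>\<^sup>+x. ennreal (exp (complex_of_real a \<bullet> x)) \<partial>distr M borel (g j n)) \<le> ennreal (exp (c0 * (norm (complex_of_real a))\<^sup>2))"
      using moments j False unfolding exp_moment_bound_def by blast
    then show ?thesis using j by (simp add: nn_integral_distr inner_complex_def)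
  qed
qed (use g_measurable in auto)

lemma subgaussian_Im: "j \<in> {0, 1} \<Longrightarrow> subgaussian M c0 (\<lambda>\<omega>. Im (g j n \<omega>))"
  unfolding subgaussian_def
proof (intro conjI allI)
  fix a :: real assume j: "j \<in> {0, 1}"
  show "(\<integral>\<^sup>+\<omega>. ennreal (exp (a * Im (g j n \<omega>))) \<partial>M) \<le> ennreal (exp (c0 * a\<^sup>2))"
  proof (cases "n = 0")
    case True
    have "(\<integral>\<^sup>+\<omega>. ennreal (exp (a * Im (g j n \<omega>))) \<partial>M) = (\<integral>\<^sup>+\<omega>. 1 \<partial>M)"
      using True j by (intro nn_integral_cong) (simp add: g_zero_real)
    also have "\<dots> = ennreal 1" by (simp add: emeasure_space_1)
    also have "\<dots> \<le> ennreal (exp (c0 * a\<^sup>2))" using c0 by (intro ennreal_leI) simp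
    finally show ?thesis .
  next
    case False
    have "(\<integral>\<^sup>+x. ennreal (exp ((\<i> * complex_of_real a) \<bullet> x)) \<partial>distr M borel (g j n)) \<le>
        ennreal (exp (c0 * (norm (\<i> * complex_of_real a))\<^sup>2))"
      using moments j False unfolding exp_moment_bound_def by blast
    then show ?thesis using j by (simp add: nn_integral_distr inner_complex_def norm_mult)
  qed
qed (use g_measurable in auto)

text \<open>As \<open>g j (- n)\<close> is the conjugate of \<open>g j n\<close>, the two terms of a
  pair combine into \<open>(d j n + d j (- n))\<close> times the real part plus
  \<open>\<i> * (d j n - d j (- n))\<close> times the imaginary part, and these real variables are
  independent. By the parallelogram law the new coefficients have square sum at most
  \<open>2 * V\<close>, hence 32 in place of 16.\<close>

lemma lattice_sum_tail:
  assumes B: "finite B" "uminus ` B = B" and V: "(\<Sum>j\<in>{0, 1}. \<Sum>n\<in>B. (cmod (d j n))\<^sup>2) \<le> V" "V > 0" and s: "s > 0"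
  shows "emeasure M {\<omega>\<in>space M. s < cmod (\<Sum>j\<in>{0, 1}. \<Sum>n\<in>B. g j n \<omega> * d j n)} \<le> ennreal (4 * exp (- s\<^sup>2 / (32 * c0 * V)))"
proof -
  define I where "I = ({0, 1}::nat set) \<times> ((B \<inter> {0}) \<times> {False} \<union> (B \<inter> half_lattice) \<times> UNIV)"
  define X where "X = (\<lambda>(j, n, b) \<omega>. if b then Im (g j n \<omega>) else Re (g j n \<omega>))"
  \<comment> \<open>The origin is its own negative, so \<open>d j n + d j (- n)\<close> would count
    it twice.\<close>
  define e where "e = (\<lambda>(j, n, b). if n = 0 then d j 0 else if b then \<i> * (d j n - d j (- n)) else d j n + d j (- n))"
  have n0: "n \<noteq> 0" if "n \<in> half_lattice" for n using that half_lattice_disjoint(1) by auto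
  have ind: "indep_vars (\<lambda>_. borel) X I"
    using vars unfolding wiener_variables_def X_def by (auto simp: I_def intro: indep_vars_subset)
  have sg: "subgaussian M c0 (X i)" if "i \<in> I" for i
  proof -
    obtain j n b where i: "i = (j, n, b)" "j \<in> {0, 1}" using \<open>i \<in> I\<close> unfolding I_def by blast
    then show ?thesis using subgaussian_Re[OF i(2), of n] subgaussian_Im[OF i(2), of n] by (cases b) (simp_all add: X_def)
  qed
  have fin: "finite I" using B by (simp add: I_def)
  have eq: "(\<Sum>j\<in>{0, 1}. \<Sum>n\<in>B. g j n \<omega> * d j n) = (\<Sum>i\<in>I. e i * of_real (X i \<omega>))" if \<omega>: "\<omega> \<in> space M" for \<omega>
  proof -
    have "(\<Sum>i\<in>I. e i * of_real (X i \<omega>)) = (\<Sum>(j, n, b)\<in>I. e (j, n, b) * of_real (X (j, n, b) \<omega>))"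
      by (intro sum.cong refl) auto
    also have "\<dots> = (\<Sum>j\<in>{0, 1}. (\<Sum>n\<in>B \<inter> {0}. g j n \<omega> * d j n) + (\<Sum>n\<in>B \<inter> half_lattice. g j n \<omega> * d j n + g j (- n) \<omega> * d j (- n)))"
      unfolding I_def sum_half_lattice_index[OF B(1)]
    proof (rule sum.cong[OF refl], rule arg_cong2[of _ _ _ _ "(+)"]; rule sum.cong[OF refl])
      fix j :: nat and n assume j: "j \<in> {0, 1}" and n: "n \<in> B \<inter> {0}"
      then show "e (j, n, False) * of_real (X (j, n, False) \<omega>) = g j n \<omega> * d j n"
        using g_zero_real[OF j \<omega>] by (simp add: e_def X_def complex_eq_iff)
    next
      fix j :: nat and n assume j: "j \<in> {0, 1}" and n: "n \<in> B \<inter> half_lattice"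
      define a b where "a = Re (g j n \<omega>)" and "b = Im (g j n \<omega>)"
      have G: "g j n \<omega> = of_real a + \<i> * of_real b" "g j (- n) \<omega> = of_real a - \<i> * of_real b"
        unfolding g_uminus[OF j \<omega>] by (simp_all add: a_def b_def complex_eq_iff)
      have E: "e (j, n, False) * of_real (X (j, n, False) \<omega>) = (d j n + d j (- n)) * of_real a"
        "e (j, n, True) * of_real (X (j, n, True) \<omega>) = \<i> * (d j n - d j (- n)) * of_real b"
        using n n0 by (simp_all add: e_def X_def a_def b_def)
      show "e (j, n, False) * of_real (X (j, n, False) \<omega>) + e (j, n, True) * of_real (X (j, n, True) \<omega>) =
         g j n \<omega> * d j n + g j (- n) \<omega> * d j (- n)"
        unfolding E G by (simp add: algebra_simps)
    qed
    also have "\<dots> = (\<Sum>j\<in>{0, 1}. \<Sum>n\<in>B. g j n \<omega> * d j n)"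
      unfolding sum_symmetric_half_lattice[OF B] ..
    finally show ?thesis by simp
  qed
  have "(\<Sum>i\<in>I. (cmod (e i))\<^sup>2) = (\<Sum>(j, n, b)\<in>I. (cmod (e (j, n, b)))\<^sup>2)"
    by (intro sum.cong refl) auto
  also have "\<dots> = (\<Sum>j\<in>{0, 1}. (\<Sum>n\<in>B \<inter> {0}. (cmod (e (j, n, False)))\<^sup>2) +
     (\<Sum>n\<in>B \<inter> half_lattice. (cmod (e (j, n, False)))\<^sup>2 + (cmod (e (j, n, True)))\<^sup>2))"
    unfolding I_def sum_half_lattice_index[OF B(1)] ..
  also have "\<dots> \<le> (\<Sum>j\<in>{0, 1}. (\<Sum>n\<in>B \<inter> {0}. 2 * (cmod (d j n))\<^sup>2) +
      (\<Sum>n\<in>B \<inter> half_lattice. 2 * (cmod (d j n))\<^sup>2 + 2 * (cmod (d j (- n)))\<^sup>2))"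
  proof (rule sum_mono, rule add_mono; rule sum_mono)
    fix j n assume "n \<in> B \<inter> half_lattice"
    have "(cmod (a + b))\<^sup>2 + (cmod (a - b))\<^sup>2 = 2 * (cmod a)\<^sup>2 + 2 * (cmod b)\<^sup>2" for a b
      unfolding cmod_power2 by (simp add: power2_eq_square algebra_simps)
    then show "(cmod (e (j, n, False)))\<^sup>2 + (cmod (e (j, n, True)))\<^sup>2 \<le> 2 * (cmod (d j n))\<^sup>2 + 2 * (cmod (d j (- n)))\<^sup>2"
      using \<open>n \<in> B \<inter> half_lattice\<close> n0 by (simp add: e_def norm_mult)
  qed (auto simp: e_def)
  also have "\<dots> = (\<Sum>j\<in>{0, 1}. \<Sum>n\<in>B. 2 * (cmod (d j n))\<^sup>2)"
    unfolding sum_symmetric_half_lattice[OF B] ..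
  also have "\<dots> \<le> 2 * V" using V(1) by (simp flip: sum_distrib_left)
  finally have le: "(\<Sum>i\<in>I. (cmod (e i))\<^sup>2) \<le> 2 * V" .
  have "emeasure M {\<omega>\<in>space M. s < cmod (\<Sum>i\<in>I. e i * of_real (X i \<omega>))} \<le> ennreal (4 * exp (- s\<^sup>2 / (16 * c0 * (2 * V))))"
    using V s by (intro subgaussian_sum_tail_complex[OF fin ind sg c0 le]) auto
  also have "{\<omega>\<in>space M. s < cmod (\<Sum>i\<in>I. e i * of_real (X i \<omega>))} = {\<omega>\<in>space M. s < cmod (\<Sum>j\<in>{0, 1}. \<Sum>n\<in>B. g j n \<omega> * d j n)}"
    using eq by auto
  finally show ?thesis by (simp add: mult_ac)
qed

text \<open>\<open>exp (u + v)\<close> is at most the mean of \<open>exp (2 u)\<close> and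
  \<open>exp (2 v)\<close>, which doubles the denominator \<open>8 * c0\<close> of a single real
  component.\<close>

lemma g_exp_square:
  assumes j: "j \<in> {0, 1}"
  shows "(\<integral>\<^sup>+\<omega>. ennreal (exp ((cmod (g j n \<omega>))\<^sup>2 / (16 * c0))) \<partial>M) \<le> 2"
proof -
  note [measurable] = g_measurable[OF j]
  have "(\<integral>\<^sup>+\<omega>. ennreal (exp ((cmod (g j n \<omega>))\<^sup>2 / (16 * c0))) \<partial>M) \<le>
     (\<integral>\<^sup>+\<omega>. ennreal (1 / 2) * ennreal (exp ((Re (g j n \<omega>))\<^sup>2 / (8 * c0))) +
        ennreal (1 / 2) * ennreal (exp ((Im (g j n \<omega>))\<^sup>2 / (8 * c0))) \<partial>M)"
  proof (rule nn_integral_mono)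
    fix \<omega>
    define u v where "u = (Re (g j n \<omega>))\<^sup>2 / (16 * c0)" and "v = (Im (g j n \<omega>))\<^sup>2 / (16 * c0)"
    have uv: "(cmod (g j n \<omega>))\<^sup>2 / (16 * c0) = u + v"
      "(Re (g j n \<omega>))\<^sup>2 / (8 * c0) = u + u" "(Im (g j n \<omega>))\<^sup>2 / (8 * c0) = v + v"
      by (simp_all add: u_def v_def cmod_power2 add_divide_distrib)
    have "exp (u + v) \<le> 1 / 2 * exp (u + u) + 1 / 2 * exp (v + v)"
      using sum_squares_bound[of "exp u" "exp v"] unfolding exp_add power2_eq_square by linarith
    then have "ennreal (exp (u + v)) \<le> ennreal (1 / 2 * exp (u + u) + 1 / 2 * exp (v + v))" by (rule ennreal_leI)
    also have "\<dots> = ennreal (1 / 2 * exp (u + u)) + ennreal (1 / 2 * exp (v + v))" by (rule ennreal_plus) auto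
    also have "ennreal (1 / 2 * exp (u + u)) = ennreal (1 / 2) * ennreal (exp (u + u))" by (rule ennreal_mult) auto
    also have "ennreal (1 / 2 * exp (v + v)) = ennreal (1 / 2) * ennreal (exp (v + v))" by (rule ennreal_mult) auto
    finally show "ennreal (exp ((cmod (g j n \<omega>))\<^sup>2 / (16 * c0))) \<le> ennreal (1 / 2) * ennreal (exp ((Re (g j n \<omega>))\<^sup>2 / (8 * c0))) +
        ennreal (1 / 2) * ennreal (exp ((Im (g j n \<omega>))\<^sup>2 / (8 * c0)))"
      unfolding uv .
  qed
  also have "\<dots> = ennreal (1 / 2) * (\<integral>\<^sup>+\<omega>. ennreal (exp ((Re (g j n \<omega>))\<^sup>2 / (8 * c0))) \<partial>M) +
     ennreal (1 / 2) * (\<integral>\<^sup>+\<omega>. ennreal (exp ((Im (g j n \<omega>))\<^sup>2 / (8 * c0))) \<partial>M)"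
    by (simp add: nn_integral_add nn_integral_cmult)
  also have "\<dots> \<le> ennreal (1 / 2) * 2 + ennreal (1 / 2) * 2"
    by (intro add_mono mult_left_mono subgaussian_exp_square subgaussian_Re subgaussian_Im j c0) auto
  also have "\<dots> = 2"
  proof -
    have "ennreal (1 / 2) * 2 = ennreal (1 / 2) * ennreal 2" by simp
    also have "\<dots> = 1" by (subst ennreal_mult[symmetric]) auto
    finally show ?thesis by simp
  qed
  finally show ?thesis .
qed

lemma g_second_moment:
  assumes j: "j \<in> {0, 1}"
  shows "(\<integral>\<^sup>+\<omega>. ennreal ((cmod (g j n \<omega>))\<^sup>2) \<partial>M) \<le> ennreal (32 * c0)"
proof -
  note [measurable] = g_measurable[OF j]
  have "(\<integral>\<^sup>+\<omega>. ennreal ((cmod (g j n \<omega>))\<^sup>2) \<partial>M) \<le> (\<integral>\<^sup>+\<omega>. ennreal (16 * c0) * ennreal (exp ((cmod (g j n \<omega>))\<^sup>2 / (16 * c0))) \<partial>M)"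
  proof (rule nn_integral_mono)
    fix \<omega>
    have "(cmod (g j n \<omega>))\<^sup>2 / (16 * c0) \<le> exp ((cmod (g j n \<omega>))\<^sup>2 / (16 * c0))"
      using exp_ge_add_one_self[of "(cmod (g j n \<omega>))\<^sup>2 / (16 * c0)"] by linarith
    then have "(cmod (g j n \<omega>))\<^sup>2 \<le> 16 * c0 * exp ((cmod (g j n \<omega>))\<^sup>2 / (16 * c0))"
      using c0 by (simp add: divide_le_eq mult.commute)
    then show "ennreal ((cmod (g j n \<omega>))\<^sup>2) \<le> ennreal (16 * c0) * ennreal (exp ((cmod (g j n \<omega>))\<^sup>2 / (16 * c0)))"
      using c0 by (simp add: ennreal_leI flip: ennreal_mult)
  qed
  also have "\<dots> \<le> ennreal (16 * c0) * 2"
    by (subst nn_integral_cmult) (auto intro!: mult_left_mono g_exp_square[OF j])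
  also have "\<dots> = ennreal (16 * c0) * ennreal 2" by simp
  also have "\<dots> = ennreal (32 * c0)" using c0 by (subst ennreal_mult[symmetric]) (auto simp: mult.commute)
  finally show ?thesis .
qed

lemma cutoff_measurable [measurable]: "\<psi> \<in> borel_measurable borel"
  using cutoff schwartz_measurable by (auto simp: wiener_cutoff_def)

text \<open>At least 1, so that \<open>total_energy\<close> is positive and can stand in
  denominators.\<close>

definition cutoff_bound :: real where
  "cutoff_bound = (SOME b. b \<ge> 1 \<and> (\<forall>\<xi>. cmod (\<psi> \<xi>) \<le> b))"

lemma cutoff_bound: "cutoff_bound \<ge> 1" "cmod (\<psi> \<xi>) \<le> cutoff_bound"
proof -
  have "\<psi> \<in> schwartz" using cutoff by (simp add: wiener_cutoff_def)
  then obtain B where B: "\<And>\<xi>. (1 + norm \<xi>) ^ 0 * cmod (\<psi> \<xi>) \<le> B" using schwartz_bound[of \<psi> 0] by blast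
  then have "max 1 B \<ge> 1 \<and> (\<forall>\<xi>. cmod (\<psi> \<xi>) \<le> max 1 B)" by (auto simp: le_max_iff_disj)
  from someI[of "\<lambda>b. b \<ge> 1 \<and> (\<forall>\<xi>. cmod (\<psi> \<xi>) \<le> b)", OF this]
  show "cutoff_bound \<ge> 1" "cmod (\<psi> \<xi>) \<le> cutoff_bound" unfolding cutoff_bound_def by auto
qed

end

lemma jap_neq_0 [simp]: "jap \<xi> \<noteq> 0"
  by (metis jap_pos less_irrefl)

section \<open>Frequency-localized pieces\<close>

text \<open>\<open>f 0\<close> and \<open>f 1\<close> stand for the Fourier transforms of the data,
  measured in the Sobolev spaces of order \<open>e\<close> and \<open>e - 1\<close>.
  \<open>N\<close> is any positive upper bound of the norm rather than the norm itself, which later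
  allows data of norm zero.\<close>

locale wiener_data = wiener +
  fixes f :: "nat \<Rightarrow> real^3 \<Rightarrow> complex" and e N :: real
  assumes f_measurable [measurable]: "\<And>j. f j \<in> borel_measurable borel"
    and e: "0 < e" "e \<le> 1" and N: "N > 0"
    and f_integrable: "\<And>j. j \<in> {0, 1} \<Longrightarrow> integrable lborel (\<lambda>\<xi>. (jap \<xi> powr (e - real j) * cmod (f j \<xi>))\<^sup>2)"
    and f_norm: "(\<Sum>j\<in>{0, 1}. \<integral>\<xi>. (jap \<xi> powr (e - real j) * cmod (f j \<xi>))\<^sup>2 \<partial>lborel) \<le> N\<^sup>2"
begin

definition weight :: "nat \<Rightarrow> real^3 \<Rightarrow> real" where
  "weight j \<xi> = jap \<xi> powr (e - real j)"

lemma weight_measurable [measurable]: "weight j \<in> borel_measurable borel"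
  unfolding weight_def[abs_def] by measurable

lemma weight_pos [simp]: "weight j \<xi> > 0"
  unfolding weight_def by simp

text \<open>The squared Sobolev norm, of order \<open>e - j\<close>, of the piece \<open>n\<close>
  of the datum \<open>j\<close>.\<close>

definition energy :: "nat \<Rightarrow> int^3 \<Rightarrow> real" where
  "energy j n = (\<integral>\<xi>. (weight j \<xi> * cmod (piece n \<xi> * f j \<xi>))\<^sup>2 \<partial>lborel)"

lemma energy_nonneg [simp]: "energy j n \<ge> 0" by (simp add: energy_def)

lemma piece_integrable:
  assumes j: "j \<in> {0, 1}"
  shows "integrable lborel (\<lambda>\<xi>. (weight j \<xi> * cmod (piece n \<xi> * f j \<xi>))\<^sup>2)"
proof (rule Bochner_Integration.integrable_bound)
  show "integrable lborel (\<lambda>\<xi>. cutoff_bound\<^sup>2 * (jap \<xi> powr (e - real j) * cmod (f j \<xi>))\<^sup>2)"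
    using f_integrable[OF j] by simp
  show "AE \<xi> in lborel. norm ((weight j \<xi> * cmod (piece n \<xi> * f j \<xi>))\<^sup>2) \<le>
      norm (cutoff_bound\<^sup>2 * (jap \<xi> powr (e - real j) * cmod (f j \<xi>))\<^sup>2)"
  proof (rule AE_I2)
    fix \<xi>
    have "(cmod (piece n \<xi>))\<^sup>2 \<le> cutoff_bound\<^sup>2" by (intro power_mono cutoff_bound) auto
    from mult_right_mono[OF this, of "(jap \<xi> powr (e - real j) * cmod (f j \<xi>))\<^sup>2"]
    show "norm ((weight j \<xi> * cmod (piece n \<xi> * f j \<xi>))\<^sup>2) \<le>
      norm (cutoff_bound\<^sup>2 * (jap \<xi> powr (e - real j) * cmod (f j \<xi>))\<^sup>2)"
      by (simp add: weight_def norm_mult power_mult_distrib mult_ac)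
  qed
qed measurable

lemma nn_integral_piece:
  "j \<in> {0, 1} \<Longrightarrow> (\<integral>\<^sup>+\<xi>. ennreal ((weight j \<xi> * cmod (piece n \<xi> * f j \<xi>))\<^sup>2) \<partial>lborel) = ennreal (energy j n)"
  unfolding energy_def by (intro nn_integral_eq_integral piece_integrable) auto

definition total_energy :: real where
  "total_energy = 27 * cutoff_bound\<^sup>2 * N\<^sup>2"

lemma total_energy_pos: "total_energy > 0"
  using cutoff_bound(1) N by (simp add: total_energy_def)

lemma energy_sum:
  assumes B: "finite B"
  shows "(\<Sum>j\<in>{0, 1}. \<Sum>n\<in>B. energy j n) \<le> total_energy"
proof -
  have "(\<Sum>n\<in>B. energy j n) \<le> 27 * cutoff_bound\<^sup>2 * (\<integral>\<xi>. (jap \<xi> powr (e - real j) * cmod (f j \<xi>))\<^sup>2 \<partial>lborel)"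
    if j: "j \<in> {0, 1}" for j
  proof -
    have "(\<Sum>n\<in>B. energy j n) = (\<integral>\<xi>. (\<Sum>n\<in>B. (weight j \<xi> * cmod (piece n \<xi> * f j \<xi>))\<^sup>2) \<partial>lborel)"
      unfolding energy_def by (intro Bochner_Integration.integral_sum[symmetric] piece_integrable j)
    also have "\<dots> \<le> (\<integral>\<xi>. 27 * cutoff_bound\<^sup>2 * (jap \<xi> powr (e - real j) * cmod (f j \<xi>))\<^sup>2 \<partial>lborel)"
    proof (intro integral_mono Bochner_Integration.integrable_sum piece_integrable j integrable_mult_right f_integrable)
      fix \<xi>
      have "(\<Sum>n\<in>B. (weight j \<xi> * cmod (piece n \<xi> * f j \<xi>))\<^sup>2) =
         (\<Sum>n\<in>B. (cmod (piece n \<xi>))\<^sup>2) * (jap \<xi> powr (e - real j) * cmod (f j \<xi>))\<^sup>2"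
        by (simp add: weight_def norm_mult power_mult_distrib mult_ac sum_distrib_left)
      also have "\<dots> \<le> 27 * cutoff_bound\<^sup>2 * (jap \<xi> powr (e - real j) * cmod (f j \<xi>))\<^sup>2"
        by (intro mult_right_mono overlap_square_sum[OF B] cutoff_bound(2)) auto
      finally show "(\<Sum>n\<in>B. (weight j \<xi> * cmod (piece n \<xi> * f j \<xi>))\<^sup>2) \<le>
         27 * cutoff_bound\<^sup>2 * (jap \<xi> powr (e - real j) * cmod (f j \<xi>))\<^sup>2" .
    qed
    finally show ?thesis by simp
  qed
  then have "(\<Sum>j\<in>{0, 1}. \<Sum>n\<in>B. energy j n) \<le>
      (\<Sum>j\<in>{0, 1}. 27 * cutoff_bound\<^sup>2 * (\<integral>\<xi>. (jap \<xi> powr (e - real j) * cmod (f j \<xi>))\<^sup>2 \<partial>lborel))"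
    by (rule sum_mono)
  also have "\<dots> \<le> total_energy"
    using mult_left_mono[OF f_norm, of "27 * cutoff_bound\<^sup>2"] unfolding total_energy_def sum_distrib_left[symmetric] by simp
  finally show ?thesis .
qed

text \<open>The multiplier \<open>\<kappa>\<close> is arbitrary so that propagators and their
  increments in time and space are treated alike.\<close>

definition wave :: "(real^3 \<Rightarrow> complex) \<Rightarrow> nat \<Rightarrow> int^3 \<Rightarrow> real^3 \<Rightarrow> complex" where
  "wave \<kappa> j n = inv_fourier (\<lambda>\<xi>. \<kappa> \<xi> * (piece n \<xi> * f j \<xi>))"

lemma kernel_L2:
  assumes j: "j \<in> {0, 1}" and [measurable]: "\<kappa> \<in> borel_measurable borel"
    and \<kappa>: "\<And>\<xi>. piece n \<xi> \<noteq> 0 \<Longrightarrow> cmod (\<kappa> \<xi>) \<le> \<beta> * weight j \<xi>"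
  shows "(\<integral>\<^sup>+\<xi>. ennreal ((cmod (\<kappa> \<xi> * (piece n \<xi> * f j \<xi>)))\<^sup>2) \<partial>lborel) \<le> ennreal (\<beta>\<^sup>2 * energy j n)"
proof -
  have "(\<integral>\<^sup>+\<xi>. ennreal ((cmod (\<kappa> \<xi> * (piece n \<xi> * f j \<xi>)))\<^sup>2) \<partial>lborel) \<le>
     (\<integral>\<^sup>+\<xi>. ennreal (\<beta>\<^sup>2) * ennreal ((weight j \<xi> * cmod (piece n \<xi> * f j \<xi>))\<^sup>2) \<partial>lborel)"
  proof (rule nn_integral_mono)
    fix \<xi>
    have "cmod (\<kappa> \<xi> * (piece n \<xi> * f j \<xi>)) \<le> \<beta> * weight j \<xi> * cmod (piece n \<xi> * f j \<xi>)"
      using mult_right_mono[OF \<kappa>, of \<xi> "cmod (piece n \<xi> * f j \<xi>)"] by (cases "piece n \<xi> = 0") (auto simp: norm_mult)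
    then have "(cmod (\<kappa> \<xi> * (piece n \<xi> * f j \<xi>)))\<^sup>2 \<le> (\<beta> * weight j \<xi> * cmod (piece n \<xi> * f j \<xi>))\<^sup>2"
      by (intro power_mono) auto
    then show "ennreal ((cmod (\<kappa> \<xi> * (piece n \<xi> * f j \<xi>)))\<^sup>2) \<le> ennreal (\<beta>\<^sup>2) * ennreal ((weight j \<xi> * cmod (piece n \<xi> * f j \<xi>))\<^sup>2)"
      by (simp add: ennreal_leI power_mult_distrib mult.assoc flip: ennreal_mult)
  qed
  also have "\<dots> = ennreal (\<beta>\<^sup>2 * energy j n)"
    by (subst nn_integral_cmult) (auto simp: nn_integral_piece[OF j] ennreal_mult)
  finally show ?thesis .
qed

definition piece_box :: "int^3 \<Rightarrow> (real^3) set" where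
  "piece_box n = cbox (lattice_vec n - 1) (lattice_vec n + 1)"

lemma piece_box_sets [measurable]: "piece_box n \<in> sets borel"
  by (simp add: piece_box_def)

lemma piece_in_box: "piece n \<xi> \<noteq> 0 \<Longrightarrow> \<xi> \<in> piece_box n"
  unfolding piece_box_def mem_box_cart
proof
  fix i assume "piece n \<xi> \<noteq> 0"
  from supp[OF this, of i] show "(lattice_vec n - 1) $ i \<le> \<xi> $ i \<and> \<xi> $ i \<le> (lattice_vec n + 1) $ i"
    by (auto simp: abs_le_iff)
qed

lemma emeasure_piece_box: "emeasure lborel (piece_box n) = ennreal 8"
proof -
  have two: "(lattice_vec n + 1 - (lattice_vec n - 1)) \<bullet> b = 2" if "b \<in> Basis" for b :: "real^3"
    using that by (auto simp: Basis_vec_def inner_axis)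
  have le: "(lattice_vec n - 1) \<bullet> b \<le> (lattice_vec n + 1) \<bullet> b" if "b \<in> Basis" for b :: "real^3"
    using that by (auto simp: Basis_vec_def inner_axis)
  have "emeasure lborel (piece_box n) = ennreal (\<Prod>b\<in>(Basis :: (real^3) set). 2)"
    unfolding piece_box_def using le two by (subst emeasure_lborel_cbox) (auto intro!: arg_cong[where f=ennreal] prod.cong)
  then show ?thesis by simp
qed

text \<open>Cauchy-Schwarz against the indicator of the box of volume 8 that carries the
  piece.\<close>

lemma kernel_L1:
  assumes j: "j \<in> {0, 1}" and [measurable]: "\<kappa> \<in> borel_measurable borel" and \<beta>: "\<beta> \<ge> 0"
    and \<kappa>: "\<And>\<xi>. piece n \<xi> \<noteq> 0 \<Longrightarrow> cmod (\<kappa> \<xi>) \<le> \<beta> * weight j \<xi>"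
  shows "integrable lborel (\<lambda>\<xi>. \<kappa> \<xi> * (piece n \<xi> * f j \<xi>))"
    and "cmod (\<integral>\<xi>. \<kappa> \<xi> * (piece n \<xi> * f j \<xi>) \<partial>lborel) \<le> sqrt (8 * \<beta>\<^sup>2 * energy j n)"
proof -
  define I where "I \<xi> = complex_of_real (indicator (piece_box n) \<xi>)" for \<xi>
  have eq: "\<kappa> \<xi> * (piece n \<xi> * f j \<xi>) = I \<xi> * (\<kappa> \<xi> * (piece n \<xi> * f j \<xi>))" for \<xi>
    using piece_in_box[where n=n and \<xi>=\<xi>] by (cases "piece n \<xi> = 0") (auto simp: I_def)
  have I2: "(\<integral>\<^sup>+\<xi>. ennreal ((cmod (I \<xi>))\<^sup>2) \<partial>lborel) \<le> ennreal 8"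
  proof -
    have "(\<integral>\<^sup>+\<xi>. ennreal ((cmod (I \<xi>))\<^sup>2) \<partial>lborel) = (\<integral>\<^sup>+\<xi>. indicator (piece_box n) \<xi> \<partial>lborel)"
      by (intro nn_integral_cong) (auto simp: I_def indicator_def)
    then show ?thesis by (simp add: emeasure_piece_box)
  qed
  have [measurable]: "I \<in> borel_measurable borel" unfolding I_def[abs_def] by measurable
  note cs = Cauchy_Schwarz_lebesgue[of I lborel "\<lambda>\<xi>. \<kappa> \<xi> * (piece n \<xi> * f j \<xi>)", OF _ _ I2 kernel_L2[OF j _ \<kappa>]]
  show "integrable lborel (\<lambda>\<xi>. \<kappa> \<xi> * (piece n \<xi> * f j \<xi>))"
    by (subst eq) (rule cs(1), auto)
  have "cmod (\<integral>\<xi>. I \<xi> * (\<kappa> \<xi> * (piece n \<xi> * f j \<xi>)) \<partial>lborel) \<le> sqrt (8 * (\<beta>\<^sup>2 * energy j n))"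
    by (rule cs(2)) auto
  then show "cmod (\<integral>\<xi>. \<kappa> \<xi> * (piece n \<xi> * f j \<xi>) \<partial>lborel) \<le> sqrt (8 * \<beta>\<^sup>2 * energy j n)"
    by (simp add: eq[symmetric] mult.assoc)
qed

text \<open>A Bernstein inequality at unit scale and Plancherel, with the same energy on the right.
  The first bounds the variance at every point, the second bounds its integral over space.\<close>

lemma wave_bounds:
  assumes j: "j \<in> {0, 1}" and [measurable]: "\<kappa> \<in> borel_measurable borel" and \<beta>: "\<beta> \<ge> 0"
    and \<kappa>: "\<And>\<xi>. piece n \<xi> \<noteq> 0 \<Longrightarrow> cmod (\<kappa> \<xi>) \<le> \<beta> * weight j \<xi>"
  shows "(cmod (wave \<kappa> j n x))\<^sup>2 \<le> 8 * \<beta>\<^sup>2 * energy j n"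
    and "(\<integral>\<^sup>+x. ennreal ((cmod (wave \<kappa> j n x))\<^sup>2) \<partial>lborel) \<le> ennreal (\<beta>\<^sup>2 * energy j n)"
proof -
  have le1: "(2 * pi) powr (- 3 / 2) \<le> 1"
  proof -
    have "1 \<le> (2 * pi) powr (3 / 2)" using pi_ge_two by (intro ge_one_powr_ge_zero) auto
    then show ?thesis using powr_minus_divide[of "2 * pi" "3 / 2"] by (simp add: divide_le_eq_1)
  qed
  have "cmod (\<integral>\<xi>. (cis (x \<bullet> \<xi>) * \<kappa> \<xi>) * (piece n \<xi> * f j \<xi>) \<partial>lborel) \<le> sqrt (8 * \<beta>\<^sup>2 * energy j n)"
    by (rule kernel_L1(2)[OF j _ \<beta>]) (use \<kappa> in \<open>auto simp: norm_mult\<close>)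
  then have "cmod (wave \<kappa> j n x) \<le> 1 * sqrt (8 * \<beta>\<^sup>2 * energy j n)"
    unfolding wave_def inv_fourier_def norm_mult using le1 by (intro mult_mono) (auto simp: mult.assoc)
  then have "(cmod (wave \<kappa> j n x))\<^sup>2 \<le> (sqrt (8 * \<beta>\<^sup>2 * energy j n))\<^sup>2"
    by (intro power_mono) auto
  then show "(cmod (wave \<kappa> j n x))\<^sup>2 \<le> 8 * \<beta>\<^sup>2 * energy j n" by simp
  show "(\<integral>\<^sup>+x. ennreal ((cmod (wave \<kappa> j n x))\<^sup>2) \<partial>lborel) \<le> ennreal (\<beta>\<^sup>2 * energy j n)"
    unfolding wave_def
    by (rule order_trans[OF plancherel_le[OF kernel_L1(1)[OF j _ \<beta> \<kappa>]] kernel_L2[OF j _ \<kappa>]]) auto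
qed

lemma wave_measurable [measurable (raw)]:
  assumes [measurable]: "\<kappa> \<in> borel_measurable borel"
  shows "wave \<kappa> j n \<in> borel_measurable borel"
  unfolding wave_def by (intro fourier_measurable) measurable

definition spectrum :: "(nat \<Rightarrow> real^3 \<Rightarrow> complex) \<Rightarrow> (nat \<Rightarrow> int^3 \<Rightarrow> complex) \<Rightarrow> (int^3) set \<Rightarrow> real^3 \<Rightarrow> complex" where
  "spectrum \<kappa> c B \<xi> = (\<Sum>j\<in>{0, 1}. \<Sum>n\<in>B. c j n * (\<kappa> j \<xi> * (piece n \<xi> * f j \<xi>)))"

text \<open>\<open>54 = 2 * 27\<close>: two data, and 27 overlapping pieces at each frequency. The
  coefficients are arbitrary numbers, so the bound can be used outcome by outcome.\<close>

lemma spectrum_L2: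
  assumes B: "finite B" and [measurable]: "\<And>j. \<kappa> j \<in> borel_measurable borel"
    and \<kappa>: "\<And>j n \<xi>. j \<in> {0, 1} \<Longrightarrow> n \<in> B \<Longrightarrow> piece n \<xi> \<noteq> 0 \<Longrightarrow> cmod (\<kappa> j \<xi>) \<le> \<beta> * weight j \<xi>"
  shows "(\<integral>\<^sup>+\<xi>. ennreal ((cmod (spectrum \<kappa> c B \<xi>))\<^sup>2) \<partial>lborel) \<le>
    ennreal (54 * \<beta>\<^sup>2 * (\<Sum>j\<in>{0, 1}. \<Sum>n\<in>B. (cmod (c j n))\<^sup>2 * energy j n))"
proof -
  have pw: "(cmod (spectrum \<kappa> c B \<xi>))\<^sup>2 \<le> 54 * \<beta>\<^sup>2 * (\<Sum>j\<in>{0, 1}. \<Sum>n\<in>B. (cmod (c j n))\<^sup>2 * (weight j \<xi> * cmod (piece n \<xi> * f j \<xi>))\<^sup>2)" for \<xi>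
  proof -
    define s where "s j = (\<Sum>n\<in>B. c j n * (\<kappa> j \<xi> * (piece n \<xi> * f j \<xi>)))" for j
    have sj: "(cmod (s j))\<^sup>2 \<le> 27 * \<beta>\<^sup>2 * (\<Sum>n\<in>B. (cmod (c j n))\<^sup>2 * (weight j \<xi> * cmod (piece n \<xi> * f j \<xi>))\<^sup>2)" if j: "j \<in> {0, 1}" for j
    proof -
      have "s j = (\<Sum>n\<in>B. (c j n * \<kappa> j \<xi> * f j \<xi>) * piece n \<xi>)"
        unfolding s_def by (intro sum.cong refl) (simp only: mult_ac)
      then have "(cmod (s j))\<^sup>2 \<le> 27 * (\<Sum>n\<in>B. (cmod (c j n * \<kappa> j \<xi> * f j \<xi>))\<^sup>2 * (cmod (piece n \<xi>))\<^sup>2)"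
        using overlap_norm_sum_square[OF B, of "\<lambda>n. c j n * \<kappa> j \<xi> * f j \<xi>" \<xi>] by (simp only:)
      also have "\<dots> \<le> 27 * (\<Sum>n\<in>B. \<beta>\<^sup>2 * ((cmod (c j n))\<^sup>2 * (weight j \<xi> * cmod (piece n \<xi> * f j \<xi>))\<^sup>2))"
      proof (intro mult_left_mono sum_mono)
        fix n assume n: "n \<in> B"
        show "(cmod (c j n * \<kappa> j \<xi> * f j \<xi>))\<^sup>2 * (cmod (piece n \<xi>))\<^sup>2 \<le>
           \<beta>\<^sup>2 * ((cmod (c j n))\<^sup>2 * (weight j \<xi> * cmod (piece n \<xi> * f j \<xi>))\<^sup>2)"
        proof (cases "piece n \<xi> = 0")
          case False
          have "(cmod (\<kappa> j \<xi>))\<^sup>2 \<le> (\<beta> * weight j \<xi>)\<^sup>2" by (intro power_mono \<kappa>[OF j n False]) auto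
          from mult_right_mono[OF this, of "(cmod (c j n))\<^sup>2 * (cmod (f j \<xi>))\<^sup>2 * (cmod (piece n \<xi>))\<^sup>2"]
          show ?thesis by (simp add: norm_mult power_mult_distrib mult_ac)
        qed simp
      qed auto
      finally show ?thesis by (simp add: sum_distrib_left mult_ac)
    qed
    have "(cmod (spectrum \<kappa> c B \<xi>))\<^sup>2 = (cmod (s 0 - (- s 1)))\<^sup>2" by (simp add: spectrum_def s_def)
    also have "\<dots> \<le> 2 * (cmod (s 0))\<^sup>2 + 2 * (cmod (- s 1))\<^sup>2" by (rule norm_diff_square_le)
    also have "\<dots> \<le> 54 * \<beta>\<^sup>2 * (\<Sum>j\<in>{0, 1}. \<Sum>n\<in>B. (cmod (c j n))\<^sup>2 * (weight j \<xi> * cmod (piece n \<xi> * f j \<xi>))\<^sup>2)"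
      using sj[of 0] sj[of 1] by (simp add: algebra_simps)
    finally show ?thesis .
  qed
  have int: "integrable lborel (\<lambda>\<xi>. 54 * \<beta>\<^sup>2 * (\<Sum>j\<in>{0, 1}. \<Sum>n\<in>B. (cmod (c j n))\<^sup>2 * (weight j \<xi> * cmod (piece n \<xi> * f j \<xi>))\<^sup>2))"
    by (intro integrable_mult_right Bochner_Integration.integrable_sum piece_integrable)
  have "(\<integral>\<^sup>+\<xi>. ennreal ((cmod (spectrum \<kappa> c B \<xi>))\<^sup>2) \<partial>lborel) \<le>
     (\<integral>\<^sup>+\<xi>. ennreal (54 * \<beta>\<^sup>2 * (\<Sum>j\<in>{0, 1}. \<Sum>n\<in>B. (cmod (c j n))\<^sup>2 * (weight j \<xi> * cmod (piece n \<xi> * f j \<xi>))\<^sup>2)) \<partial>lborel)"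
    by (intro nn_integral_mono ennreal_leI pw)
  also have "\<dots> = ennreal (\<integral>\<xi>. 54 * \<beta>\<^sup>2 * (\<Sum>j\<in>{0, 1}. \<Sum>n\<in>B. (cmod (c j n))\<^sup>2 * (weight j \<xi> * cmod (piece n \<xi> * f j \<xi>))\<^sup>2) \<partial>lborel)"
    by (intro nn_integral_eq_integral int AE_I2 mult_nonneg_nonneg sum_nonneg) auto
  also have "(\<integral>\<xi>. 54 * \<beta>\<^sup>2 * (\<Sum>j\<in>{0, 1}. \<Sum>n\<in>B. (cmod (c j n))\<^sup>2 * (weight j \<xi> * cmod (piece n \<xi> * f j \<xi>))\<^sup>2) \<partial>lborel) =
     54 * \<beta>\<^sup>2 * (\<integral>\<xi>. (\<Sum>j\<in>{0, 1}. \<Sum>n\<in>B. (cmod (c j n))\<^sup>2 * (weight j \<xi> * cmod (piece n \<xi> * f j \<xi>))\<^sup>2) \<partial>lborel)"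
    by simp
  also have "(\<integral>\<xi>. (\<Sum>j\<in>{0, 1}. \<Sum>n\<in>B. (cmod (c j n))\<^sup>2 * (weight j \<xi> * cmod (piece n \<xi> * f j \<xi>))\<^sup>2) \<partial>lborel) =
     (\<Sum>j\<in>{0, 1}. \<Sum>n\<in>B. (cmod (c j n))\<^sup>2 * energy j n)"
    unfolding energy_def
    by (subst Bochner_Integration.integral_sum, (intro Bochner_Integration.integrable_sum integrable_mult_right piece_integrable; assumption), intro sum.cong refl,
        subst Bochner_Integration.integral_sum, (intro integrable_mult_right piece_integrable; assumption), simp)
  finally show ?thesis .
qed

end

section \<open>Chaining\<close>

lemma infinite_UNIV_int3: "infinite (UNIV :: (int^3) set)"
proof -
  have "inj (\<lambda>i::int. (vec i :: int^3))" by (auto simp: inj_def vec_eq_iff)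
  then have "infinite (range (\<lambda>i::int. (vec i :: int^3)))"
    using finite_imageD infinite_UNIV_int by blast
  then show ?thesis by (rule infinite_super[rotated]) simp
qed

lemma int3_enumeration: obtains q :: "nat \<Rightarrow> int^3" where "inj q" "range q = UNIV"
proof -
  have "bij_betw (from_nat_into (UNIV :: (int^3) set)) UNIV UNIV"
    by (rule bij_betw_from_nat_into[OF _ infinite_UNIV_int3]) simp
  then show ?thesis by (intro that[of "from_nat_into UNIV"]) (simp_all add: bij_betw_def)
qed

lemma exp_neg_le_inverse:
  fixes x :: real
  assumes "x > 0" shows "exp (- x) \<le> 1 / x"
proof -
  have "x \<le> exp x" using exp_ge_add_one_self[of x] by linarith
  then have "1 / exp x \<le> 1 / x" using assms by (intro divide_left_mono) auto
  then show ?thesis by (simp add: exp_minus inverse_eq_divide)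
qed

text \<open>Interpolates between a trivial bound 1 and a Lipschitz bound \<open>x\<close>. Here lies
  the reason for cutting the regularity down to \<open>min \<epsilon> 1\<close>.\<close>

lemma min_le_powr:
  fixes x e :: real
  assumes "0 < e" "e \<le> 1" "0 < x" shows "min 1 x \<le> x powr e"
proof (cases "x \<le> 1")
  case True
  then have "x powr 1 \<le> x powr e" using assms by (intro powr_mono') auto
  then show ?thesis using assms by simp
next
  case False
  then have "1 \<le> x powr e" using assms by (intro ge_one_powr_ge_zero) auto
  then show ?thesis by simp
qed

lemma norm_1_minus_cis_le: "cmod (1 - cis \<theta>) \<le> \<bar>\<theta>\<bar>"
proof -
  have "cmod (cis \<theta> - 1) \<le> \<bar>\<theta>\<bar>"
    using iexp_approx1[of \<theta> 0] by (simp add: cis_conv_exp)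
  then show ?thesis by (simp add: norm_minus_commute)
qed

context wiener_data
begin

definition field :: "(nat \<Rightarrow> real^3 \<Rightarrow> complex) \<Rightarrow> (int^3) set \<Rightarrow> 'a \<Rightarrow> real^3 \<Rightarrow> complex" where
  "field \<kappa> B \<omega> x = (\<Sum>j\<in>{0, 1}. \<Sum>n\<in>B. g j n \<omega> * wave (\<kappa> j) j n x)"

lemma wave_integrable:
  assumes j: "j \<in> {0, 1}" and [measurable]: "\<kappa> \<in> borel_measurable borel" and \<beta>: "\<beta> \<ge> 0"
    and \<kappa>: "\<And>\<xi>. piece n \<xi> \<noteq> 0 \<Longrightarrow> cmod (\<kappa> \<xi>) \<le> \<beta> * weight j \<xi>"
  shows "integrable lborel (\<lambda>\<xi>. cis (x \<bullet> \<xi>) * (\<kappa> \<xi> * (piece n \<xi> * f j \<xi>)))"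
proof -
  have "integrable lborel (\<lambda>\<xi>. (cis (x \<bullet> \<xi>) * \<kappa> \<xi>) * (piece n \<xi> * f j \<xi>))"
    by (rule kernel_L1(1)[OF j _ \<beta>]) (use \<kappa> in \<open>auto simp: norm_mult\<close>)
  then show ?thesis by (simp only: mult.assoc)
qed

lemma field_eq_inv_fourier:
  assumes B: "finite B" and [measurable]: "\<And>j. \<kappa> j \<in> borel_measurable borel" and \<beta>: "\<beta> \<ge> 0"
    and \<kappa>: "\<And>j n \<xi>. j \<in> {0, 1} \<Longrightarrow> n \<in> B \<Longrightarrow> piece n \<xi> \<noteq> 0 \<Longrightarrow> cmod (\<kappa> j \<xi>) \<le> \<beta> * weight j \<xi>"
  shows "field \<kappa> B \<omega> = inv_fourier (spectrum \<kappa> (\<lambda>j n. g j n \<omega>) B)"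
    and "integrable lborel (spectrum \<kappa> (\<lambda>j n. g j n \<omega>) B)"
proof -
  have i: "integrable lborel (\<lambda>\<xi>. g j n \<omega> * (cis (x \<bullet> \<xi>) * (\<kappa> j \<xi> * (piece n \<xi> * f j \<xi>))))"
    if "j \<in> {0, 1}" "n \<in> B" for j n x
    by (intro integrable_mult_right wave_integrable[OF that(1) _ \<beta> \<kappa>[OF that]]) auto
  show "integrable lborel (spectrum \<kappa> (\<lambda>j n. g j n \<omega>) B)"
    unfolding spectrum_def[abs_def]
    using i[of _ _ 0] by (intro Bochner_Integration.integrable_sum) simp
  show "field \<kappa> B \<omega> = inv_fourier (spectrum \<kappa> (\<lambda>j n. g j n \<omega>) B)"
  proof
    fix x
    have "(\<integral>\<xi>. cis (x \<bullet> \<xi>) * spectrum \<kappa> (\<lambda>j n. g j n \<omega>) B \<xi> \<partial>lborel) =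
      (\<integral>\<xi>. (\<Sum>j\<in>{0, 1}. \<Sum>n\<in>B. g j n \<omega> * (cis (x \<bullet> \<xi>) * (\<kappa> j \<xi> * (piece n \<xi> * f j \<xi>)))) \<partial>lborel)"
      unfolding spectrum_def sum_distrib_left by (intro Bochner_Integration.integral_cong refl sum.cong) (simp only: mult_ac)
    also have "\<dots> = (\<Sum>j\<in>{0, 1}. \<integral>\<xi>. (\<Sum>n\<in>B. g j n \<omega> * (cis (x \<bullet> \<xi>) * (\<kappa> j \<xi> * (piece n \<xi> * f j \<xi>)))) \<partial>lborel)"
      by (intro Bochner_Integration.integral_sum Bochner_Integration.integrable_sum i)
    also have "\<dots> = (\<Sum>j\<in>{0, 1}. \<Sum>n\<in>B. \<integral>\<xi>. g j n \<omega> * (cis (x \<bullet> \<xi>) * (\<kappa> j \<xi> * (piece n \<xi> * f j \<xi>))) \<partial>lborel)"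
      by (intro sum.cong[OF refl] Bochner_Integration.integral_sum i)
    finally have eq: "(\<integral>\<xi>. cis (x \<bullet> \<xi>) * spectrum \<kappa> (\<lambda>j n. g j n \<omega>) B \<xi> \<partial>lborel) =
      (\<Sum>j\<in>{0, 1}. \<Sum>n\<in>B. g j n \<omega> * (\<integral>\<xi>. cis (x \<bullet> \<xi>) * (\<kappa> j \<xi> * (piece n \<xi> * f j \<xi>)) \<partial>lborel))"
      by (simp only: integral_mult_right_zero)
    show "field \<kappa> B \<omega> x = inv_fourier (spectrum \<kappa> (\<lambda>j n. g j n \<omega>) B) x"
      unfolding field_def wave_def inv_fourier_def eq sum_distrib_left by (intro sum.cong refl) (simp only: mult_ac)
  qed
qed

lemma field_measurable [measurable (raw)]:
  assumes [measurable]: "\<And>j. \<kappa> j \<in> borel_measurable borel"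
  shows "(\<lambda>\<omega>. field \<kappa> B \<omega> x) \<in> borel_measurable M"
  unfolding field_def by (intro borel_measurable_sum borel_measurable_times g_measurable borel_measurable_const)

text \<open>The union over the infinite grid is affordable only on average over its offset \<open>y\<close>: the sum of
  the tails over the grid becomes an integral over space, which is finite because the variance \<open>D\<close> is
  integrable and, for the tail at \<open>x\<close>, \<open>exp (- u / D x)\<close> is bounded by a multiple of \<open>D x\<close>.\<close>

lemma grid_tail:
  assumes B: "finite B" "uminus ` B = B" and [measurable]: "\<And>j. \<kappa> j \<in> borel_measurable borel" and \<beta>: "\<beta> > 0"
    and \<kappa>: "\<And>j \<xi>. j \<in> {0, 1} \<Longrightarrow> cmod (\<kappa> j \<xi>) \<le> \<beta> * weight j \<xi>" and s: "s > 0"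
  defines "z \<equiv> s\<^sup>2 / (512 * c0 * \<beta>\<^sup>2 * total_energy)"
  shows "\<exists>\<Phi>. \<Phi> \<in> borel_measurable borel \<and>
    (\<forall>y. emeasure M (\<Union>q. {\<omega>\<in>space M. s < cmod (field \<kappa> B \<omega> (y + (1 / 2 ^ k) *\<^sub>R lattice_vec q))}) \<le> \<Phi> y) \<and>
    (\<integral>\<^sup>+y. \<Phi> y * indicator unit_cube y \<partial>lborel) \<le> ennreal (8 ^ k * (exp (- z) / (2 * z)))"
proof -
  define D where "D x = (\<Sum>j\<in>{0, 1}. \<Sum>n\<in>B. (cmod (wave (\<kappa> j) j n x))\<^sup>2)" for x
  define V where "V = 8 * \<beta>\<^sup>2 * total_energy"
  \<comment> \<open>At variance \<open>D x\<close> the tail from \<open>lattice_sum_tail\<close> is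
    \<open>4 * exp (- u / D x)\<close>; \<open>z\<close> is half of this exponent at the largest
    possible variance \<open>V\<close>.\<close>
  define u where "u = s\<^sup>2 / (32 * c0)"
  define a where "a = 8 / u * exp (- z)"
  have V: "V > 0" using \<beta> total_energy_pos by (simp add: V_def)
  have u: "u > 0" using s c0 by (simp add: u_def)
  have zu: "z = u / (2 * V)" by (simp add: z_def u_def V_def)
  have z: "z > 0" using u V by (simp add: zu)
  have a: "a \<ge> 0" using u by (simp add: a_def)
  have [measurable]: "D \<in> borel_measurable borel"
    unfolding D_def[abs_def] by measurable
  have D0: "D x \<ge> 0" for x unfolding D_def by (intro sum_nonneg) auto
  have "D x \<le> (\<Sum>j\<in>{0, 1}. \<Sum>n\<in>B. 8 * \<beta>\<^sup>2 * energy j n)" for x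
    unfolding D_def using \<beta> \<kappa> by (intro sum_mono wave_bounds(1)) auto
  moreover have "(\<Sum>j\<in>{0, 1}. \<Sum>n\<in>B. 8 * \<beta>\<^sup>2 * energy j n) \<le> V"
    using mult_left_mono[OF energy_sum[OF B(1)], of "8 * \<beta>\<^sup>2"] unfolding V_def sum_distrib_left by simp
  ultimately have DV: "D x \<le> V" for x by (rule order_trans)
  have Dint: "(\<integral>\<^sup>+x. ennreal (D x) \<partial>lborel) \<le> ennreal (\<beta>\<^sup>2 * total_energy)"
  proof -
    have "(\<integral>\<^sup>+x. ennreal (D x) \<partial>lborel) = (\<integral>\<^sup>+x. (\<Sum>j\<in>{0, 1}. \<Sum>n\<in>B. ennreal ((cmod (wave (\<kappa> j) j n x))\<^sup>2)) \<partial>lborel)"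
      unfolding D_def by (intro nn_integral_cong) (simp add: sum_nonneg flip: sum_ennreal)
    also have "\<dots> = (\<Sum>j\<in>{0, 1}. \<Sum>n\<in>B. \<integral>\<^sup>+x. ennreal ((cmod (wave (\<kappa> j) j n x))\<^sup>2) \<partial>lborel)"
    proof -
      have "(\<integral>\<^sup>+x. (\<Sum>j\<in>{0, 1}. \<Sum>n\<in>B. ennreal ((cmod (wave (\<kappa> j) j n x))\<^sup>2)) \<partial>lborel) =
        (\<Sum>j\<in>{0, 1}. \<integral>\<^sup>+x. (\<Sum>n\<in>B. ennreal ((cmod (wave (\<kappa> j) j n x))\<^sup>2)) \<partial>lborel)"
        by (rule nn_integral_sum) measurable
      also have "\<dots> = (\<Sum>j\<in>{0, 1}. \<Sum>n\<in>B. \<integral>\<^sup>+x. ennreal ((cmod (wave (\<kappa> j) j n x))\<^sup>2) \<partial>lborel)"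
        by (intro sum.cong refl nn_integral_sum) measurable
      finally show ?thesis .
    qed
    also have "\<dots> \<le> (\<Sum>j\<in>{0, 1}. \<Sum>n\<in>B. ennreal (\<beta>\<^sup>2 * energy j n))"
      using \<beta> \<kappa> by (intro sum_mono wave_bounds(2)) auto
    also have "\<dots> = ennreal (\<Sum>j\<in>{0, 1}. \<Sum>n\<in>B. \<beta>\<^sup>2 * energy j n)"
      by (subst sum_ennreal[symmetric], simp add: sum_nonneg, intro sum.cong refl, subst sum_ennreal, auto)
    also have "\<dots> \<le> ennreal (\<beta>\<^sup>2 * total_energy)"
      using mult_left_mono[OF energy_sum[OF B(1)], of "\<beta>\<^sup>2"] by (intro ennreal_leI) (simp only: sum_distrib_left zero_le_power2)
    finally show ?thesis .
  qed
  have point: "emeasure M {\<omega>\<in>space M. s < cmod (field \<kappa> B \<omega> x)} \<le> ennreal a * ennreal (D x)" for x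
  proof (cases "D x = 0")
    case True
    then have "\<forall>j\<in>{0, 1}. (\<Sum>n\<in>B. (cmod (wave (\<kappa> j) j n x))\<^sup>2) = 0"
      unfolding D_def by (subst (asm) sum_nonneg_eq_0_iff) (auto intro: sum_nonneg)
    then have "wave (\<kappa> j) j n x = 0" if "j \<in> {0, 1}" "n \<in> B" for j n
      using that B(1) by (auto simp: sum_nonneg_eq_0_iff)
    then have "field \<kappa> B \<omega> x = 0" for \<omega> unfolding field_def by (intro sum.neutral ballI) auto
    then show ?thesis using s by simp
  next
    case False
    then have D: "D x > 0" using D0[of x] by simp
    have "emeasure M {\<omega>\<in>space M. s < cmod (field \<kappa> B \<omega> x)} \<le> ennreal (4 * exp (- s\<^sup>2 / (32 * c0 * D x)))"
      unfolding field_def by (rule lattice_sum_tail[OF B _ D s]) (simp add: D_def)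
    \<comment> \<open>Half of the exponent is kept as the uniform factor \<open>exp (- z)\<close>,
      the other half is traded for the factor \<open>D x\<close>.\<close>
    also have "- s\<^sup>2 / (32 * c0 * D x) = - (u / (2 * D x)) + - (u / (2 * D x))"
      using D c0 by (simp add: u_def field_simps)
    also have "4 * exp (- (u / (2 * D x)) + - (u / (2 * D x))) \<le> 4 * (exp (- z) * (1 / (u / (2 * D x))))"
      unfolding exp_add
    proof (intro mult_left_mono mult_mono)
      have "u / (2 * V) \<le> u / (2 * D x)" using D DV[of x] u by (intro divide_left_mono) auto
      then show "exp (- (u / (2 * D x))) \<le> exp (- z)" by (simp add: zu)
      show "exp (- (u / (2 * D x))) \<le> 1 / (u / (2 * D x))" using u D by (intro exp_neg_le_inverse) auto
    qed auto
    also have "4 * (exp (- z) * (1 / (u / (2 * D x)))) = a * D x"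
      by (simp add: a_def)
    finally show ?thesis using a D0 by (simp add: ennreal_mult ennreal_leI)
  qed
  obtain q :: "nat \<Rightarrow> int^3" where q: "inj q" "range q = UNIV" by (rule int3_enumeration)
  define \<Phi> where "\<Phi> y = (\<Sum>i. ennreal a * ennreal (D (y + (1 / 2 ^ k) *\<^sub>R lattice_vec (q i))))" for y
  have [measurable]: "\<Phi> \<in> borel_measurable borel" unfolding \<Phi>_def[abs_def] by measurable
  have "emeasure M (\<Union>q. {\<omega>\<in>space M. s < cmod (field \<kappa> B \<omega> (y + (1 / 2 ^ k) *\<^sub>R lattice_vec q))}) \<le> \<Phi> y" for y
  proof -
    have "(\<Union>q. {\<omega>\<in>space M. s < cmod (field \<kappa> B \<omega> (y + (1 / 2 ^ k) *\<^sub>R lattice_vec q))}) =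
      (\<Union>i. {\<omega>\<in>space M. s < cmod (field \<kappa> B \<omega> (y + (1 / 2 ^ k) *\<^sub>R lattice_vec (q i)))})"
    proof -
      have "(\<Union>p. F p) = (\<Union>p\<in>range q. F p)" for F :: "int^3 \<Rightarrow> 'a set" unfolding q(2) ..
      then show ?thesis by simp
    qed
    also have "emeasure M \<dots> \<le> (\<Sum>i. emeasure M {\<omega>\<in>space M. s < cmod (field \<kappa> B \<omega> (y + (1 / 2 ^ k) *\<^sub>R lattice_vec (q i)))})"
      by (rule emeasure_subadditive_countably) auto
    also have "\<dots> \<le> \<Phi> y" unfolding \<Phi>_def by (intro suminf_le point) auto
    finally show ?thesis .
  qed
  moreover have "(\<integral>\<^sup>+y. \<Phi> y * indicator unit_cube y \<partial>lborel) \<le> ennreal (8 ^ k * (exp (- z) / (2 * z)))"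
  proof -
    have "(\<integral>\<^sup>+y. \<Phi> y * indicator unit_cube y \<partial>lborel) \<le> 8 ^ k * (\<integral>\<^sup>+x. ennreal a * ennreal (D x) \<partial>lborel)"
      unfolding \<Phi>_def by (rule lattice_average_le[OF _ q(1)]) measurable
    also have "\<dots> \<le> 8 ^ k * (ennreal a * ennreal (\<beta>\<^sup>2 * total_energy))"
      by (subst nn_integral_cmult) (auto intro!: mult_left_mono Dint)
    also have "\<dots> = ennreal (8 ^ k) * ennreal (a * (\<beta>\<^sup>2 * total_energy))"
      using a total_energy_pos by (simp add: ennreal_mult flip: ennreal_power)
    also have "\<dots> = ennreal (8 ^ k * (a * (\<beta>\<^sup>2 * total_energy)))"
      using a total_energy_pos by (subst ennreal_mult) auto
    also have "a * (\<beta>\<^sup>2 * total_energy) = exp (- z) / (2 * z)"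
      using V u by (simp add: a_def zu V_def)
    finally show ?thesis .
  qed
  ultimately show ?thesis by (intro exI[of _ \<Phi>]) simp
qed

end

section \<open>Symbols of a flow and their increments\<close>

text \<open>Covers both propagators: symbols of order \<open>- j\<close> that are Lipschitz in time
  at the cost of one derivative, with a common constant \<open>A\<close>. Joint measurability in
  time and frequency is what later makes the norms measurable in time and outcome.\<close>

locale wiener_flow = wiener_data +
  fixes m :: "nat \<Rightarrow> real \<Rightarrow> real^3 \<Rightarrow> real" and T A :: real
  assumes T: "T > 0" and A: "A > 0"
    and m_measurable [measurable]: "\<And>j. (\<lambda>p. m j (fst p) (snd p)) \<in> borel_measurable (borel \<Otimes>\<^sub>M borel)"
    and m_bound: "\<And>j t \<xi>. j \<in> {0, 1} \<Longrightarrow> t \<in> {0..T} \<Longrightarrow> \<bar>m j t \<xi>\<bar> \<le> A * jap \<xi> powr (- real j)"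
    and m_lipschitz: "\<And>j t t' \<xi>. j \<in> {0, 1} \<Longrightarrow> t \<in> {0..T} \<Longrightarrow> t' \<in> {0..T} \<Longrightarrow>
      \<bar>m j t \<xi> - m j t' \<xi>\<bar> \<le> A * \<bar>t - t'\<bar> * jap \<xi> powr (1 - real j)"
begin

abbreviation symbol :: "real \<Rightarrow> nat \<Rightarrow> real^3 \<Rightarrow> complex" where
  "symbol t j \<xi> \<equiv> complex_of_real (m j t \<xi>)"

lemma m_measurable2 [measurable]: "m j t \<in> borel_measurable borel"
proof -
  have "(\<lambda>\<xi>. m j (fst (t, \<xi>)) (snd (t, \<xi>))) \<in> borel_measurable borel" by measurable
  then show ?thesis by simp
qed

lemma jap_powr_le_weight: "jap \<xi> powr (- real j) \<le> weight j \<xi>"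
  unfolding weight_def using e jap_ge_1[of \<xi>] by (intro powr_mono) auto

lemma symbol_bound: "j \<in> {0, 1} \<Longrightarrow> t \<in> {0..T} \<Longrightarrow> cmod (symbol t j \<xi>) \<le> A * weight j \<xi>"
  using order_trans[OF m_bound mult_left_mono[OF jap_powr_le_weight]] A by simp

text \<open>The multiplier whose field at \<open>x\<close> is the increment from
  \<open>(t', x - v)\<close> to \<open>(t, x)\<close> (\<open>field_link\<close>), so that
  increments obey the same tail bound as values.\<close>

definition link :: "real \<Rightarrow> real \<Rightarrow> real^3 \<Rightarrow> nat \<Rightarrow> real^3 \<Rightarrow> complex" where
  "link t t' v j \<xi> = symbol t j \<xi> - symbol t' j \<xi> * cis (- (v \<bullet> \<xi>))"

lemma link_measurable [measurable]: "link t t' v j \<in> borel_measurable borel"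
  unfolding link_def[abs_def] by measurable

text \<open>The sizes of the two symbols give a trivial bound; their Lipschitz dependence gives one
  with an extra factor \<open>\<tau> * jap \<xi>\<close>. Interpolation leaves
  \<open>\<tau> powr e\<close> at the price of \<open>e\<close> derivatives, which the data provide.
  The constant 3 is 1 for the step in time plus 2 for the step in space, as \<open>norm v\<close> is
  at most \<open>2 * \<tau>\<close>.\<close>

lemma link_bound:
  assumes j: "j \<in> {0, 1}" and t: "t \<in> {0..T}" "t' \<in> {0..T}" and \<tau>: "\<tau> > 0" "\<bar>t - t'\<bar> \<le> \<tau>" "norm v \<le> 2 * \<tau>"
  shows "cmod (link t t' v j \<xi>) \<le> 3 * A * \<tau> powr e * weight j \<xi>"
proof -
  define J where "J = jap \<xi>"
  have J: "J > 0" "J \<ge> 1" using jap_ge_1[of \<xi>] by (auto simp: J_def)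
  define P where "P = J powr (- real j)"
  have P: "P > 0" using J by (simp add: P_def)
  have PJ: "J powr (1 - real j) = P * J" using J by (simp add: P_def powr_diff powr_minus divide_inverse mult.commute)
  have mt: "\<bar>m j t \<xi>\<bar> \<le> A * P" "\<bar>m j t' \<xi>\<bar> \<le> A * P"
    using m_bound[OF j] t by (auto simp: P_def J_def)
  have c: "cmod (link t t' v j \<xi>) \<le> \<bar>m j t \<xi>\<bar> + \<bar>m j t' \<xi>\<bar>"
    unfolding link_def by (rule order_trans[OF norm_triangle_ineq4]) (simp add: norm_mult)
  have b1: "cmod (link t t' v j \<xi>) \<le> 3 * (A * P)"
    using c mt A P by (smt (verit) mult_pos_pos)
  have "link t t' v j \<xi> = complex_of_real (m j t \<xi> - m j t' \<xi>) + complex_of_real (m j t' \<xi>) * (1 - cis (- (v \<bullet> \<xi>)))"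
    by (simp add: link_def algebra_simps)
  then have "cmod (link t t' v j \<xi>) \<le> \<bar>m j t \<xi> - m j t' \<xi>\<bar> + \<bar>m j t' \<xi>\<bar> * cmod (1 - cis (- (v \<bullet> \<xi>)))"
    using norm_triangle_ineq[of "complex_of_real (m j t \<xi> - m j t' \<xi>)" "symbol t' j \<xi> * (1 - cis (- (v \<bullet> \<xi>)))"]
    by (simp only: norm_mult norm_of_real)
  also have "\<dots> \<le> A * \<tau> * (P * J) + (A * P) * (2 * \<tau> * J)"
  proof (intro add_mono mult_mono mt)
    show "\<bar>m j t \<xi> - m j t' \<xi>\<bar> \<le> A * \<tau> * (P * J)"
      using m_lipschitz[OF j t, of \<xi>] \<tau> A J P
      by (smt (verit) J_def PJ mult_left_mono mult_right_mono powr_ge_zero)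
    have "cmod (1 - cis (- (v \<bullet> \<xi>))) \<le> norm v * norm \<xi>"
      using norm_1_minus_cis_le[of "- (v \<bullet> \<xi>)"] Cauchy_Schwarz_ineq2[of v \<xi>] by simp
    also have "\<dots> \<le> 2 * \<tau> * J"
      using \<tau> jap_ge_norm[of \<xi>] by (intro mult_mono) (auto simp: J_def)
    finally show "cmod (1 - cis (- (v \<bullet> \<xi>))) \<le> 2 * \<tau> * J" .
  qed (use A P in auto)
  also have "\<dots> = 3 * (A * P) * (\<tau> * J)" by (simp add: algebra_simps)
  finally have b2: "cmod (link t t' v j \<xi>) \<le> 3 * (A * P) * (\<tau> * J)" .
  have "cmod (link t t' v j \<xi>) \<le> 3 * (A * P) * min 1 (\<tau> * J)"
    using b1 b2 by (auto simp: min_def)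
  also have "\<dots> \<le> 3 * (A * P) * (\<tau> * J) powr e"
    using e \<tau> J A P by (intro mult_left_mono min_le_powr) auto
  also have "\<dots> = 3 * A * \<tau> powr e * weight j \<xi>"
    using J \<tau> by (simp add: powr_mult P_def weight_def J_def powr_diff powr_minus divide_inverse)
  finally show ?thesis .
qed

lemma field_link:
  assumes B: "finite B" and t: "t \<in> {0..T}" "t' \<in> {0..T}"
  shows "field (link t t' v) B \<omega> x = field (symbol t) B \<omega> x - field (symbol t') B \<omega> (x - v)"
proof -
  have "wave (link t t' v j) j n x = wave (symbol t j) j n x - wave (symbol t' j) j n (x - v)" if j: "j \<in> {0, 1}" for j n
  proof -
    have i: "integrable lborel (\<lambda>\<xi>. cis (x \<bullet> \<xi>) * (symbol s j \<xi> * (piece n \<xi> * f j \<xi>)))" if "s \<in> {0..T}" for s x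
      using A by (intro wave_integrable[OF j, where \<beta>=A] symbol_bound j that) auto
    have "(\<integral>\<xi>. cis (x \<bullet> \<xi>) * (link t t' v j \<xi> * (piece n \<xi> * f j \<xi>)) \<partial>lborel) =
      (\<integral>\<xi>. cis (x \<bullet> \<xi>) * (symbol t j \<xi> * (piece n \<xi> * f j \<xi>)) - cis ((x - v) \<bullet> \<xi>) * (symbol t' j \<xi> * (piece n \<xi> * f j \<xi>)) \<partial>lborel)"
    proof (intro Bochner_Integration.integral_cong refl)
      fix \<xi>
      have "cis ((x - v) \<bullet> \<xi>) = cis (x \<bullet> \<xi>) * cis (- (v \<bullet> \<xi>))" by (simp add: cis_mult inner_diff_left)
      then show "cis (x \<bullet> \<xi>) * (link t t' v j \<xi> * (piece n \<xi> * f j \<xi>)) =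
         cis (x \<bullet> \<xi>) * (symbol t j \<xi> * (piece n \<xi> * f j \<xi>)) - cis ((x - v) \<bullet> \<xi>) * (symbol t' j \<xi> * (piece n \<xi> * f j \<xi>))"
        by (simp add: link_def algebra_simps)
    qed
    also have "\<dots> = (\<integral>\<xi>. cis (x \<bullet> \<xi>) * (symbol t j \<xi> * (piece n \<xi> * f j \<xi>)) \<partial>lborel) -
       (\<integral>\<xi>. cis ((x - v) \<bullet> \<xi>) * (symbol t' j \<xi> * (piece n \<xi> * f j \<xi>)) \<partial>lborel)"
      by (intro Bochner_Integration.integral_diff i t)
    finally show ?thesis unfolding wave_def inv_fourier_def by (simp only: right_diff_distrib)
  qed
  then have "field (link t t' v) B \<omega> x = (\<Sum>j\<in>{0, 1}. \<Sum>n\<in>B. g j n \<omega> * wave (symbol t j) j n x - g j n \<omega> * wave (symbol t' j) j n (x - v))"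
    unfolding field_def by (intro sum.cong refl) (simp only: right_diff_distrib)
  then show ?thesis unfolding field_def by (simp only: sum_subtractf)
qed

text \<open>Joint continuity of a truncated field: its values along dyadic approximations determine
  it at every time and position.\<close>

lemma field_tendsto:
  assumes B: "finite B" and t: "\<And>k. t k \<in> {0..T}" "t \<longlonglongrightarrow> s" "s \<in> {0..T}" and x: "x \<longlonglongrightarrow> y"
  shows "(\<lambda>k. field (symbol (t k)) B \<omega> (x k)) \<longlonglongrightarrow> field (symbol s) B \<omega> y"
proof -
  have "(\<lambda>k. wave (symbol (t k) j) j n (x k)) \<longlonglongrightarrow> wave (symbol s j) j n y" if j: "j \<in> {0, 1}" for j n
    unfolding wave_def inv_fourier_def
  proof (intro tendsto_mult tendsto_const)
    show "(\<lambda>k. \<integral>\<xi>. cis (x k \<bullet> \<xi>) * (symbol (t k) j \<xi> * (piece n \<xi> * f j \<xi>)) \<partial>lborel) \<longlonglongrightarrow>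
      (\<integral>\<xi>. cis (y \<bullet> \<xi>) * (symbol s j \<xi> * (piece n \<xi> * f j \<xi>)) \<partial>lborel)"
    proof (rule integral_dominated_convergence[where w="\<lambda>\<xi>. cmod (complex_of_real (A * weight j \<xi>) * (piece n \<xi> * f j \<xi>))"])
      show "integrable lborel (\<lambda>\<xi>. cmod (complex_of_real (A * weight j \<xi>) * (piece n \<xi> * f j \<xi>)))"
        using A by (intro integrable_norm kernel_L1(1)[OF j, where \<beta>=A]) (auto simp: norm_mult abs_mult less_imp_le)
      show "AE \<xi> in lborel. (\<lambda>k. cis (x k \<bullet> \<xi>) * (symbol (t k) j \<xi> * (piece n \<xi> * f j \<xi>))) \<longlonglongrightarrow>
          cis (y \<bullet> \<xi>) * (symbol s j \<xi> * (piece n \<xi> * f j \<xi>))"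
      proof (rule AE_I2)
        fix \<xi>
        have "(\<lambda>k. m j (t k) \<xi> - m j s \<xi>) \<longlonglongrightarrow> 0"
        proof (rule Lim_null_comparison)
          show "\<forall>\<^sub>F k in sequentially. norm (m j (t k) \<xi> - m j s \<xi>) \<le> A * \<bar>t k - s\<bar> * jap \<xi> powr (1 - real j)"
            using m_lipschitz[OF j t(1) t(3), of _ \<xi>] by (intro always_eventually) simp
          have "(\<lambda>k. A * \<bar>t k - s\<bar> * jap \<xi> powr (1 - real j)) \<longlonglongrightarrow> A * \<bar>s - s\<bar> * jap \<xi> powr (1 - real j)"
            by (intro tendsto_intros t(2))
          then show "(\<lambda>k. A * \<bar>t k - s\<bar> * jap \<xi> powr (1 - real j)) \<longlonglongrightarrow> 0" by simp
        qed
        then have "(\<lambda>k. m j (t k) \<xi>) \<longlonglongrightarrow> m j s \<xi>" by (simp add: LIM_zero_iff)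
        moreover have "(\<lambda>k. cis (x k \<bullet> \<xi>)) \<longlonglongrightarrow> cis (y \<bullet> \<xi>)"
          by (intro isCont_tendsto_compose[of _ cis] continuous_intros tendsto_intros x)
        ultimately show "(\<lambda>k. cis (x k \<bullet> \<xi>) * (symbol (t k) j \<xi> * (piece n \<xi> * f j \<xi>))) \<longlonglongrightarrow>
            cis (y \<bullet> \<xi>) * (symbol s j \<xi> * (piece n \<xi> * f j \<xi>))"
          by (intro tendsto_mult tendsto_of_real tendsto_const)
      qed
      show "AE \<xi> in lborel. norm (cis (x k \<bullet> \<xi>) * (symbol (t k) j \<xi> * (piece n \<xi> * f j \<xi>))) \<le>
          cmod (complex_of_real (A * weight j \<xi>) * (piece n \<xi> * f j \<xi>))" for k
      proof (rule AE_I2)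
        fix \<xi>
        have "cmod (symbol (t k) j \<xi>) \<le> cmod (complex_of_real (A * weight j \<xi>))"
          using symbol_bound[OF j t(1), of k \<xi>] A by (simp add: norm_mult abs_mult less_imp_le)
        from mult_right_mono[OF this norm_ge_zero[of "piece n \<xi> * f j \<xi>"]]
        show "norm (cis (x k \<bullet> \<xi>) * (symbol (t k) j \<xi> * (piece n \<xi> * f j \<xi>))) \<le>
          cmod (complex_of_real (A * weight j \<xi>) * (piece n \<xi> * f j \<xi>))"
          by (simp only: norm_mult norm_cis mult_1 mult.assoc)
      qed
    qed measurable
  qed
  then show ?thesis unfolding field_def by (intro tendsto_sum tendsto_mult tendsto_const)
qed

text \<open>No probability enters: for a fixed outcome the right-hand side is the same at all times,
  so the L2 norm needs no chaining in time.\<close>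

lemma field_L2:
  assumes B: "finite B" and t: "t \<in> {0..T}"
  shows "(\<integral>\<^sup>+x. ennreal ((cmod (field (symbol t) B \<omega> x))\<^sup>2) \<partial>lborel) \<le>
    ennreal (54 * A\<^sup>2 * (\<Sum>j\<in>{0, 1}. \<Sum>n\<in>B. (cmod (g j n \<omega>))\<^sup>2 * energy j n))"
proof -
  have m: "\<And>j. symbol t j \<in> borel_measurable borel" by measurable
  have b: "\<And>j n \<xi>. j \<in> {0, 1} \<Longrightarrow> n \<in> B \<Longrightarrow> piece n \<xi> \<noteq> 0 \<Longrightarrow> cmod (symbol t j \<xi>) \<le> A * weight j \<xi>"
    using symbol_bound t by blast
  have 1: "field (symbol t) B \<omega> = inv_fourier (spectrum (symbol t) (\<lambda>j n. g j n \<omega>) B)"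
    "integrable lborel (spectrum (symbol t) (\<lambda>j n. g j n \<omega>) B)"
    using A b by (intro field_eq_inv_fourier[OF B m, where \<beta>=A]; simp)+
  show ?thesis
    unfolding 1(1) using plancherel_le[OF 1(2)] spectrum_L2[OF B m b, where c="\<lambda>j n. g j n \<omega>"] by (rule order_trans)
qed

section \<open>Dyadic chains in time and space\<close>

text \<open>The square root of the gain per dyadic scale. Links at scale \<open>k\<close> have size
  \<open>ratio ^ (2 * k)\<close> but are granted the threshold \<open>ratio ^ k\<close>, so
  thresholds are summable and the tail exponents still grow.\<close>

definition ratio :: real where "ratio = 2 powr (- e / 2)"

lemma ratio: "0 < ratio" "ratio < 1"
proof -
  show "0 < ratio" by (simp add: ratio_def)
  have "2 powr (- e / 2) < 2 powr (0::real)" using e by (intro powr_less_mono) auto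
  then show "ratio < 1" by (simp add: ratio_def)
qed

text \<open>The exponent \<open>z\<close> of \<open>grid_tail\<close> at scale 0, where
  \<open>s = l * (1 - ratio)\<close> and \<open>\<beta> = 3 * A\<close>;
  \<open>4608 = 512 * 9\<close>.\<close>

definition chain_exponent :: "real \<Rightarrow> real" where
  "chain_exponent l = l\<^sup>2 * (1 - ratio)\<^sup>2 / (4608 * c0 * A\<^sup>2 * total_energy)"

text \<open>Scale 0 carries values at integer times, scale \<open>k > 0\<close> the increments from
  a parent to a child in the dyadic tree. Subtraction on the naturals stops at 0, so
  \<open>i - \<tau>\<close> never leads to a negative time.\<close>

definition chain_kernel :: "nat \<Rightarrow> nat \<times> nat \<times> (int^3) \<Rightarrow> nat \<Rightarrow> real^3 \<Rightarrow> complex" where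
  "chain_kernel k = (\<lambda>(i, \<tau>, v). if k = 0 then symbol (real i)
     else link (real i / 2 ^ k) (real (i - \<tau>) / 2 ^ k) ((1 / 2 ^ k) *\<^sub>R lattice_vec v))"

text \<open>\<open>\<tau>\<close> and the coordinates of \<open>v\<close> are the binary digits
  gained when a dyadic approximation is refined, 16 choices in all. The spatial grid point is not
  part of the index, since \<open>grid_tail\<close> already takes the union over it.\<close>

definition chain_index :: "nat \<Rightarrow> (nat \<times> nat \<times> (int^3)) set" where
  "chain_index k = {i. real i / 2 ^ k \<le> T} \<times> {0, 1} \<times> {v. \<forall>a. v $ a \<in> {0, 1}}"

lemma chain_index_finite: "finite (chain_index k)"
  and chain_index_card: "real (card (chain_index k)) \<le> 16 * (1 + T) * 2 ^ k"
proof -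
  have eq: "{i. real i / 2 ^ k \<le> T} = {0..nat \<lfloor>2 ^ k * T\<rfloor>}"
    using T by (auto simp: divide_le_eq le_nat_floor mult.commute) (simp add: le_nat_iff le_floor_iff mult.commute)
  have fv: "finite {v::int^3. \<forall>a. v $ a \<in> {0, 1}}" by (rule finite_vec_box) simp
  have cv: "card {v::int^3. \<forall>a. v $ a \<in> {0, 1}} = 8" unfolding card_vec_box by (simp add: power3_eq_cube)
  show "finite (chain_index k)" unfolding chain_index_def eq using fv by simp
  have "real (card (chain_index k)) = 16 * (real (nat \<lfloor>2 ^ k * T\<rfloor>) + 1)"
    unfolding chain_index_def eq card_cartesian_product cv by simp
  also have "real (nat \<lfloor>2 ^ k * T\<rfloor>) \<le> 2 ^ k * T" using T by (intro of_nat_floor) auto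
  also have "16 * (2 ^ k * T + 1) \<le> 16 * (1 + T) * 2 ^ k" by (simp add: algebra_simps)
  finally show "real (card (chain_index k)) \<le> 16 * (1 + T) * 2 ^ k" by simp
qed

lemma chain_kernel_measurable [measurable]: "chain_kernel k i j \<in> borel_measurable borel"
proof -
  obtain a \<tau> v where i: "i = (a, \<tau>, v)" by (cases i)
  show ?thesis by (cases "k = 0") (simp_all add: chain_kernel_def i)
qed

lemma chain_kernel_bound:
  assumes i: "i \<in> chain_index k" and j: "j \<in> {0, 1}"
  shows "cmod (chain_kernel k i j \<xi>) \<le> 3 * A * ratio ^ (2 * k) * weight j \<xi>"
proof -
  obtain a \<tau> v where a: "i = (a, \<tau>, v)" "real a / 2 ^ k \<le> T" "\<tau> \<in> {0, 1}" "\<And>b. v $ b \<in> {0, 1}"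
    using i by (auto simp: chain_index_def)
  show ?thesis
  proof (cases "k = 0")
    case True
    have "cmod (symbol (real a) j \<xi>) \<le> A * weight j \<xi>" using a True by (intro symbol_bound j) auto
    also have "\<dots> \<le> 3 * A * weight j \<xi>" using A by simp
    finally show ?thesis using True by (simp add: chain_kernel_def a)
  next
    case False
    have sub: "real (a - \<tau>) / 2 ^ k \<le> real a / 2 ^ k" by (intro divide_right_mono) auto
    have diff: "\<bar>real a / 2 ^ k - real (a - \<tau>) / 2 ^ k\<bar> \<le> 1 / 2 ^ k"
    proof -
      have "\<bar>real a - real (a - \<tau>)\<bar> \<le> 1" using a(3) by auto
      then have "\<bar>real a - real (a - \<tau>)\<bar> / 2 ^ k \<le> 1 / 2 ^ k" by (intro divide_right_mono) auto
      then show ?thesis by (simp add: abs_divide flip: diff_divide_distrib)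
    qed
    have nv: "norm (lattice_vec v) \<le> 2"
    proof -
      have "(norm (lattice_vec v))\<^sup>2 = (\<Sum>b\<in>UNIV. (real_of_int (v $ b))\<^sup>2)"
        unfolding power2_norm_eq_inner inner_vec_def by (simp add: power2_eq_square)
      also have "\<dots> \<le> (\<Sum>b\<in>(UNIV::3 set). 1)"
      proof (rule sum_mono)
        fix b
        show "(real_of_int (v $ b))\<^sup>2 \<le> 1" using a(4)[of b] by auto
      qed
      finally have "(norm (lattice_vec v))\<^sup>2 \<le> 2\<^sup>2" by simp
      then show ?thesis by (rule power2_le_imp_le) simp
    qed
    have pw: "(1 / 2 ^ k) powr e = ratio ^ (2 * k)"
    proof -
      have "(1 / 2 ^ k :: real) = 2 powr (- real k)" by (simp add: powr_minus_divide powr_realpow)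
      then have "(1 / 2 ^ k) powr e = 2 powr (- real k * e)" by (simp add: powr_powr)
      also have "\<dots> = (2 powr (- e / 2)) powr (real (2 * k))" by (simp add: powr_powr mult.commute)
      also have "\<dots> = ratio ^ (2 * k)" unfolding ratio_def[symmetric] using ratio by (intro powr_realpow)
      finally show ?thesis .
    qed
    have "cmod (link (real a / 2 ^ k) (real (a - \<tau>) / 2 ^ k) ((1 / 2 ^ k) *\<^sub>R lattice_vec v) j \<xi>) \<le>
        3 * A * (1 / 2 ^ k) powr e * weight j \<xi>"
    proof (intro link_bound j)
      show "real (a - \<tau>) / 2 ^ k \<in> {0..T}" using order_trans[OF sub a(2)] by simp
    qed (use a diff nv in \<open>auto simp: divide_right_mono\<close>)
    then show ?thesis using False by (simp add: chain_kernel_def a pw)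
  qed
qed

text \<open>The level sums are dominated by a fixed convergent series times the level-zero tail.\<close>

definition chain_const :: real where
  "chain_const = (\<Sum>k. 16 ^ k * exp (- ((1 / ratio) ^ (2 * k)) / 2))"

lemma chain_summable: "summable (\<lambda>k. 16 ^ k * exp (- ((1 / ratio) ^ (2 * k)) / 2))"
proof -
  define \<theta> where "\<theta> = (1 / ratio) ^ 2"
  have \<theta>: "\<theta> > 1" using ratio by (simp add: \<theta>_def power_divide power_less_one_iff divide_simps)
  \<comment> \<open>\<open>exp (- x)\<close> is at most \<open>p! / x ^ p\<close>, which decays like
    \<open>32 ^ (- k)\<close> once \<open>\<theta> ^ p\<close> is at least 32; against
    \<open>16 ^ k\<close> the geometric ratio 1/2 remains.\<close>
  obtain p where p: "\<theta> ^ p \<ge> 32" using real_arch_pow[OF \<theta>, of 32] less_imp_le by blast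
  have "norm (16 ^ k * exp (- ((1 / ratio) ^ (2 * k)) / 2)) \<le> (fact p * 2 ^ p) * (1 / 2) ^ k" for k
  proof -
    define x where "x = \<theta> ^ k / 2"
    have x: "x > 0" using \<theta> by (simp add: x_def)
    have "x ^ p / fact p \<le> exp x" using x by (intro power_over_fact_le_exp) simp
    then have "exp (- x) \<le> fact p / x ^ p" using x by (simp add: exp_minus field_simps)
    also have "\<dots> = fact p * 2 ^ p / (\<theta> ^ p) ^ k"
      by (simp add: x_def power_divide power_mult[symmetric] mult.commute)
    also have "\<dots> \<le> fact p * 2 ^ p / 32 ^ k" using p by (intro divide_left_mono power_mono mult_pos_pos) auto
    finally have "16 ^ k * exp (- x) \<le> 16 ^ k * (fact p * 2 ^ p / 32 ^ k)" by (intro mult_left_mono) auto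
    also have "\<dots> = (fact p * 2 ^ p) * (16 / 32) ^ k" unfolding power_divide by (simp only: times_divide_eq_right mult_ac)
    finally show ?thesis by (simp add: x_def \<theta>_def power_mult)
  qed
  moreover have "summable (\<lambda>k. (fact p * 2 ^ p) * (1 / 2 :: real) ^ k)"
    by (intro summable_mult summable_geometric) simp
  ultimately show ?thesis by (rule summable_comparison_test'[where N=0, rotated])
qed

lemma chain_const_nonneg: "chain_const \<ge> 0"
  unfolding chain_const_def by (intro suminf_nonneg chain_summable) auto

text \<open>The difference is the next binary digit of \<open>x\<close>.\<close>

lemma floor_double: "\<lfloor>2 * x\<rfloor> - 2 * \<lfloor>x\<rfloor> \<in> {0, 1}" for x :: real
proof -
  have x: "of_int \<lfloor>x\<rfloor> \<le> x" "x < of_int \<lfloor>x\<rfloor> + 1"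
    by (rule of_int_floor_le, rule real_of_int_floor_add_one_gt)
  have "2 * \<lfloor>x\<rfloor> \<le> \<lfloor>2 * x\<rfloor>" by (subst le_floor_iff) (use x in simp)
  moreover have "\<lfloor>2 * x\<rfloor> < 2 * \<lfloor>x\<rfloor> + 2" by (subst floor_less_iff, unfold of_int_add of_int_mult of_int_numeral, use x(2) in linarith)
  ultimately show ?thesis by auto
qed

lemma dyadic_floor_tendsto: "(\<lambda>k. real_of_int \<lfloor>2 ^ k * x\<rfloor> / 2 ^ k) \<longlonglongrightarrow> x"
proof -
  have "(\<lambda>k. x - real_of_int \<lfloor>2 ^ k * x\<rfloor> / 2 ^ k) \<longlonglongrightarrow> 0"
  proof (rule Lim_null_comparison)
    show "\<forall>\<^sub>F k in sequentially. norm (x - real_of_int \<lfloor>2 ^ k * x\<rfloor> / 2 ^ k) \<le> (1 / 2) ^ k"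
    proof (intro always_eventually allI)
      fix k
      have "\<bar>2 ^ k * x - real_of_int \<lfloor>2 ^ k * x\<rfloor>\<bar> \<le> 1" by linarith
      then have "\<bar>2 ^ k * x - real_of_int \<lfloor>2 ^ k * x\<rfloor>\<bar> / 2 ^ k \<le> 1 / 2 ^ k" by (intro divide_right_mono) auto
      moreover have "x - real_of_int \<lfloor>2 ^ k * x\<rfloor> / 2 ^ k = (2 ^ k * x - real_of_int \<lfloor>2 ^ k * x\<rfloor>) / 2 ^ k"
        by (simp add: diff_divide_distrib)
      ultimately show "norm (x - real_of_int \<lfloor>2 ^ k * x\<rfloor> / 2 ^ k) \<le> (1 / 2) ^ k"
        by (simp add: abs_divide power_one_over)
    qed
    show "(\<lambda>k. (1 / 2 :: real) ^ k) \<longlonglongrightarrow> 0" by (rule LIMSEQ_power_zero) simp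
  qed
  from tendsto_diff[OF tendsto_const[of x] this] show ?thesis by simp
qed

text \<open>Telescoping along dyadic approximations of \<open>(t, x)\<close> in the grid shifted by
  \<open>y\<close>; the allowances \<open>l * (1 - ratio) * ratio ^ k\<close> add up to
  \<open>l\<close>, and continuity passes to the end of the chain.\<close>

lemma chain_deterministic:
  assumes B: "finite B" and l: "l \<ge> 0"
    and good: "\<And>k i q. i \<in> chain_index k \<Longrightarrow>
      cmod (field (chain_kernel k i) B \<omega> (y + (1 / 2 ^ k) *\<^sub>R lattice_vec q)) \<le> l * (1 - ratio) * ratio ^ k"
    and t: "t \<in> {0..T}"
  shows "cmod (field (symbol t) B \<omega> x) \<le> l"
proof -
  \<comment> \<open>Rounding down keeps all approximating times inside \<open>{0..T}\<close>;
    positions are rounded relative to the offset \<open>y\<close>.\<close>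
  define i where "i k = nat \<lfloor>2 ^ k * t\<rfloor>" for k
  define q :: "nat \<Rightarrow> int^3" where "q k = (\<chi> a. \<lfloor>2 ^ k * (x - y) $ a\<rfloor>)" for k
  define s where "s k = real (i k) / 2 ^ k" for k
  define z where "z k = y + (1 / 2 ^ k) *\<^sub>R lattice_vec (q k)" for k
  have t0: "0 \<le> 2 ^ k * t" for k using t by auto
  have i_int: "int (i k) = \<lfloor>2 ^ k * t\<rfloor>" for k using t0[of k] by (simp add: i_def)
  have i_real: "real (i k) = real_of_int \<lfloor>2 ^ k * t\<rfloor>" for k using i_int[of k] by (metis of_int_of_nat_eq)
  have sT: "s k \<in> {0..T}" for k
  proof -
    have "real (i k) \<le> 2 ^ k * t" by (simp add: i_real)
    then have "s k \<le> t" by (simp add: s_def divide_le_eq mult.commute)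
    then show ?thesis using t by (simp add: s_def)
  qed
  have s_lim: "s \<longlonglongrightarrow> t" unfolding s_def i_real by (rule dyadic_floor_tendsto)
  have z_lim: "z \<longlonglongrightarrow> x"
  proof (rule vec_tendstoI)
    fix a
    have "(\<lambda>k. y $ a + real_of_int \<lfloor>2 ^ k * (x - y) $ a\<rfloor> / 2 ^ k) \<longlonglongrightarrow> y $ a + (x - y) $ a"
      by (intro tendsto_add tendsto_const dyadic_floor_tendsto)
    then show "(\<lambda>k. z k $ a) \<longlonglongrightarrow> x $ a" by (simp add: z_def q_def)
  qed
  have partial: "cmod (field (symbol (s k)) B \<omega> (z k)) \<le> l * (1 - ratio ^ Suc k)" for k
  proof (induction k)
    case 0
    have "(i 0, 0, 0) \<in> chain_index 0" using sT[of 0] by (simp add: chain_index_def s_def)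
    from good[OF this, of "q 0"] show ?case by (simp add: chain_kernel_def s_def z_def)
  next
    case (Suc k)
    define \<tau> where "\<tau> = i (Suc k) - 2 * i k"
    define v where "v = q (Suc k) - 2 * q k"
    have fl: "\<lfloor>2 ^ Suc k * r\<rfloor> - 2 * \<lfloor>2 ^ k * r\<rfloor> \<in> {0, 1}" for r :: real
      using floor_double[of "2 ^ k * r"] by (simp add: mult.assoc)
    have \<tau>: "\<tau> \<in> {0, 1}" "i (Suc k) - \<tau> = 2 * i k"
      using fl[of t] unfolding i_int[symmetric] by (auto simp: \<tau>_def)
    have v: "v $ a \<in> {0, 1}" for a using fl[of "(x - y) $ a"] by (simp add: v_def q_def)
    have idx: "(i (Suc k), \<tau>, v) \<in> chain_index (Suc k)"
      using sT[of "Suc k"] \<tau>(1) v by (simp add: chain_index_def s_def)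
    have e1: "real (i (Suc k) - \<tau>) / 2 ^ Suc k = s k" unfolding \<tau>(2) by (simp add: s_def)
    have e2: "z (Suc k) - (1 / 2 ^ Suc k) *\<^sub>R lattice_vec v = z k"
      by (simp add: z_def v_def vec_eq_iff field_simps)
    have "field (chain_kernel (Suc k) (i (Suc k), \<tau>, v)) B \<omega> (z (Suc k)) =
        field (symbol (s (Suc k))) B \<omega> (z (Suc k)) - field (symbol (s k)) B \<omega> (z k)"
      unfolding chain_kernel_def prod.case e1 using field_link[OF B sT[of "Suc k"] sT[of k], of "(1 / 2 ^ Suc k) *\<^sub>R lattice_vec v" \<omega> "z (Suc k)"]
      by (simp add: e2 s_def[symmetric] del: power_Suc)
    with good[OF idx, of "q (Suc k)"]
    have "cmod (field (symbol (s (Suc k))) B \<omega> (z (Suc k)) - field (symbol (s k)) B \<omega> (z k)) \<le> l * (1 - ratio) * ratio ^ Suc k"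
      by (simp only: z_def)
    then have "cmod (field (symbol (s (Suc k))) B \<omega> (z (Suc k))) \<le> l * (1 - ratio ^ Suc k) + l * (1 - ratio) * ratio ^ Suc k"
      using Suc norm_triangle_ineq2[of "field (symbol (s (Suc k))) B \<omega> (z (Suc k))" "field (symbol (s k)) B \<omega> (z k)"] by linarith
    also have "\<dots> = l * (1 - ratio ^ Suc (Suc k))" by (simp add: algebra_simps)
    finally show ?case .
  qed
  have "(\<lambda>k. cmod (field (symbol (s k)) B \<omega> (z k))) \<longlonglongrightarrow> cmod (field (symbol t) B \<omega> x)"
    by (intro tendsto_norm field_tendsto B sT s_lim t z_lim)
  moreover have "cmod (field (symbol (s k)) B \<omega> (z k)) \<le> l" for k
    using ratio by (intro order_trans[OF partial] mult_left_le l) (auto simp: power_le_one)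
  ultimately show ?thesis by (intro LIMSEQ_le_const2) auto
qed

text \<open>One offset \<open>y\<close>, fixed before the outcome, serves all scales, because the
  averages over \<open>y\<close> of the bad probabilities can be summed over scales and links. The
  bound does not depend on \<open>B\<close>, which is what survives the removal of the
  truncation.\<close>

theorem truncated_sup_bound:
  assumes B: "finite B" "uminus ` B = B" and l: "l > 0" and L: "chain_exponent l \<ge> 1"
  obtains E where "E \<in> sets M" "emeasure M E \<le> ennreal (16 * chain_const * (1 + T) * exp (- chain_exponent l / 2))"
    and "\<And>\<omega> t x. \<omega> \<in> space M - E \<Longrightarrow> t \<in> {0..T} \<Longrightarrow> cmod (field (symbol t) B \<omega> x) \<le> l"
proof -
  define s where "s k = l * (1 - ratio) * ratio ^ k" for k
  define \<beta> where "\<beta> k = 3 * A * ratio ^ (2 * k)" for k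
  define \<theta> where "\<theta> k = (1 / ratio) ^ (2 * k)" for k
  define z where "z k = chain_exponent l * \<theta> k" for k
  have s: "s k > 0" and \<beta>: "\<beta> k > 0" and \<theta>1: "\<theta> k \<ge> 1" for k
    using l ratio A by (auto simp: s_def \<beta>_def \<theta>_def intro!: one_le_power)
  have z_eq: "(s k)\<^sup>2 / (512 * c0 * (\<beta> k)\<^sup>2 * total_energy) = z k" for k
  proof -
    define r where "r = ratio ^ k"
    have r: "r > 0" using ratio by (simp add: r_def)
    have "ratio ^ (2 * k) = r\<^sup>2" by (simp add: r_def power_mult[symmetric] mult.commute)
    moreover have "\<theta> k = 1 / r\<^sup>2" by (simp add: \<theta>_def power_divide r_def power_mult[symmetric] mult.commute)
    ultimately show ?thesis
      using r A c0 total_energy_pos unfolding s_def \<beta>_def z_def chain_exponent_def r_def[symmetric]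
      by (simp add: divide_simps power2_eq_square)
  qed
  define bad where "bad k i y = (\<Union>q. {\<omega>\<in>space M. s k < cmod (field (chain_kernel k i) B \<omega> (y + (1 / 2 ^ k) *\<^sub>R lattice_vec q))})" for k i y
  have bad_sets: "bad k i y \<in> sets M" for k i y
    unfolding bad_def by (intro sets.countable_UN'' countableI_type) measurable
  \<comment> \<open>Measurable majorants: the average over \<open>y\<close> is taken of
    \<open>\<Phi>\<close> and never of the probability of the bad event itself.\<close>
  define Q where "Q k i \<Phi> \<longleftrightarrow> \<Phi> \<in> borel_measurable borel \<and> (\<forall>y. emeasure M (bad k i y) \<le> \<Phi> y) \<and>
      (\<integral>\<^sup>+y. \<Phi> y * indicator unit_cube y \<partial>lborel) \<le> ennreal (8 ^ k * (exp (- z k) / (2 * z k)))" for k i \<Phi>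
  have ex: "\<exists>\<Phi>. Q k i \<Phi>" if "i \<in> chain_index k" for k i
    unfolding Q_def bad_def z_eq[symmetric]
    by (rule grid_tail[OF B _ \<beta> _ s]) (use chain_kernel_bound[OF that] in \<open>auto simp: \<beta>_def\<close>)
  define \<Phi> where "\<Phi> k i = (SOME \<Phi>. Q k i \<Phi>)" for k i
  have Q: "Q k i (\<Phi> k i)" if "i \<in> chain_index k" for k i
    unfolding \<Phi>_def by (rule someI_ex[OF ex[OF that]])
  have \<Phi>: "\<And>k i. i \<in> chain_index k \<Longrightarrow> \<Phi> k i \<in> borel_measurable borel"
    "\<And>k i y. i \<in> chain_index k \<Longrightarrow> emeasure M (bad k i y) \<le> \<Phi> k i y"
    "\<And>k i. i \<in> chain_index k \<Longrightarrow> (\<integral>\<^sup>+y. \<Phi> k i y * indicator unit_cube y \<partial>lborel) \<le> ennreal (8 ^ k * (exp (- z k) / (2 * z k)))"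
    using Q unfolding Q_def by simp_all
  define E where "E y = (\<Union>k. \<Union>i\<in>chain_index k. bad k i y)" for y
  have E_sets: "E y \<in> sets M" for y
    unfolding E_def by (intro sets.countable_UN'' countableI_type sets.finite_UN chain_index_finite bad_sets)
  have E_le: "emeasure M (E y) \<le> (\<Sum>k. \<Sum>i\<in>chain_index k. \<Phi> k i y)" for y
  proof -
    have "emeasure M (E y) \<le> (\<Sum>k. emeasure M (\<Union>i\<in>chain_index k. bad k i y))"
      unfolding E_def by (intro emeasure_subadditive_countably) (auto intro!: sets.finite_UN chain_index_finite bad_sets)
    also have "\<dots> \<le> (\<Sum>k. \<Sum>i\<in>chain_index k. \<Phi> k i y)"
    proof (intro suminf_le allI)
      fix k
      have "emeasure M (\<Union>i\<in>chain_index k. bad k i y) \<le> (\<Sum>i\<in>chain_index k. emeasure M (bad k i y))"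
        by (intro emeasure_subadditive_finite chain_index_finite) (auto intro: bad_sets)
      also have "\<dots> \<le> (\<Sum>i\<in>chain_index k. \<Phi> k i y)" by (intro sum_mono \<Phi>(2))
      finally show "emeasure M (\<Union>i\<in>chain_index k. bad k i y) \<le> (\<Sum>i\<in>chain_index k. \<Phi> k i y)" .
    qed auto
    finally show ?thesis .
  qed
  define R where "R = 8 * chain_const * (1 + T) * exp (- chain_exponent l / 2)"
  have int: "(\<integral>\<^sup>+y. (\<Sum>k. \<Sum>i\<in>chain_index k. \<Phi> k i y) * indicator unit_cube y \<partial>lborel) \<le> ennreal R"
  proof -
    have [measurable]: "(\<lambda>y. \<Sum>i\<in>chain_index k. \<Phi> k i y) \<in> borel_measurable borel" for k
      by (intro borel_measurable_sum \<Phi>(1))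
    have "(\<integral>\<^sup>+y. (\<Sum>k. \<Sum>i\<in>chain_index k. \<Phi> k i y) * indicator unit_cube y \<partial>lborel) =
      (\<Sum>k. \<integral>\<^sup>+y. (\<Sum>i\<in>chain_index k. \<Phi> k i y) * indicator unit_cube y \<partial>lborel)"
      by (simp add: nn_integral_suminf flip: ennreal_suminf_multc)
    also have "\<dots> \<le> (\<Sum>k. ennreal (8 * (1 + T) * exp (- chain_exponent l / 2) * (16 ^ k * exp (- ((1 / ratio) ^ (2 * k)) / 2))))"
    proof (intro suminf_le allI)
      fix k
      \<comment> \<open>Both factors of \<open>z k\<close> are at least 1, so the product is at
        least each of them and hence at least their mean. One half yields the final exponent, the
        other makes the sum over \<open>k\<close> converge.\<close>
      have zk: "z k \<ge> 1" "z k \<ge> chain_exponent l / 2 + \<theta> k / 2"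
      proof -
        have "chain_exponent l * 1 \<le> z k" "1 * \<theta> k \<le> z k"
          unfolding z_def using L \<theta>1[of k] by (intro mult_left_mono mult_right_mono; simp)+
        then show "z k \<ge> 1" "z k \<ge> chain_exponent l / 2 + \<theta> k / 2" using L by auto
      qed
      have "(\<integral>\<^sup>+y. (\<Sum>i\<in>chain_index k. \<Phi> k i y) * indicator unit_cube y \<partial>lborel) =
        (\<integral>\<^sup>+y. (\<Sum>i\<in>chain_index k. \<Phi> k i y * indicator unit_cube y) \<partial>lborel)"
        by (simp add: sum_distrib_right)
      also have "\<dots> = (\<Sum>i\<in>chain_index k. \<integral>\<^sup>+y. \<Phi> k i y * indicator unit_cube y \<partial>lborel)"
        using \<Phi>(1) by (intro nn_integral_sum) auto
      also have "\<dots> \<le> (\<Sum>i\<in>chain_index k. ennreal (8 ^ k * (exp (- z k) / (2 * z k))))"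
        by (intro sum_mono \<Phi>(3))
      also have "\<dots> = ennreal (real (card (chain_index k)) * (8 ^ k * (exp (- z k) / (2 * z k))))"
        unfolding sum_constant ennreal_of_nat_eq_real_of_nat using zk by (intro ennreal_mult[symmetric]) auto
      also have "\<dots> \<le> ennreal ((16 * (1 + T) * 2 ^ k) * (8 ^ k * ((exp (- chain_exponent l / 2) * exp (- \<theta> k / 2)) / 2)))"
      proof (intro ennreal_leI mult_mono chain_index_card)
        have "exp (- z k) / (2 * z k) \<le> exp (- z k) / (2 * 1)" using zk by (intro divide_left_mono) auto
        also have "exp (- z k) \<le> exp (- chain_exponent l / 2) * exp (- \<theta> k / 2)"
          using zk(2) by (simp flip: exp_add)
        finally show "exp (- z k) / (2 * z k) \<le> (exp (- chain_exponent l / 2) * exp (- \<theta> k / 2)) / 2"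
          by (simp add: divide_right_mono)
      qed (use T zk in auto)
      also have "(16 * (1 + T) * 2 ^ k) * (8 ^ k * ((exp (- chain_exponent l / 2) * exp (- \<theta> k / 2)) / 2)) =
        8 * (1 + T) * exp (- chain_exponent l / 2) * (16 ^ k * exp (- \<theta> k / 2))"
      proof -
        \<comment> \<open>\<open>2 ^ k\<close> from the number of grid times, \<open>8 ^ k\<close>
          from the density of the spatial grid.\<close>
        have p: "(16::real) ^ k = 2 ^ k * 8 ^ k" by (simp flip: power_mult_distrib)
        show ?thesis unfolding p by (simp add: mult_ac)
      qed
      finally show "(\<integral>\<^sup>+y. (\<Sum>i\<in>chain_index k. \<Phi> k i y) * indicator unit_cube y \<partial>lborel) \<le>
         ennreal (8 * (1 + T) * exp (- chain_exponent l / 2) * (16 ^ k * exp (- ((1 / ratio) ^ (2 * k)) / 2)))"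
        by (simp only: \<theta>_def)
    qed auto
    also have "\<dots> = ennreal (\<Sum>k. 8 * (1 + T) * exp (- chain_exponent l / 2) * (16 ^ k * exp (- ((1 / ratio) ^ (2 * k)) / 2)))"
      using T by (intro suminf_ennreal2 summable_mult chain_summable) auto
    also have "(\<Sum>k. 8 * (1 + T) * exp (- chain_exponent l / 2) * (16 ^ k * exp (- ((1 / ratio) ^ (2 * k)) / 2))) = R"
      unfolding R_def chain_const_def by (subst suminf_mult[OF chain_summable]) simp
    finally show ?thesis .
  qed
  have R: "R > 0"
  proof -
    have "(16::real) ^ 0 * exp (- ((1 / ratio) ^ (2 * 0)) / 2) \<le> chain_const"
      unfolding chain_const_def using sum_le_suminf[OF chain_summable, of "{0}"] by simp
    then have "exp (- 1 / 2) \<le> chain_const" by simp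
    then have "chain_const > 0" by (rule order_less_le_trans[OF exp_gt_zero])
    then show ?thesis using T by (simp add: R_def)
  qed
  \<comment> \<open>If every offset had probability at least \<open>2 * R\<close>, so would the
    average over the unit cube, which is at most \<open>R > 0\<close>.\<close>
  obtain y where y: "emeasure M (E y) \<le> ennreal (2 * R)"
  proof (rule ccontr)
    assume "\<not> thesis"
    with that have ge: "ennreal (2 * R) \<le> emeasure M (E y)" for y by (meson le_cases)
    have le: "ennreal (2 * R) \<le> (\<Sum>k. \<Sum>i\<in>chain_index k. \<Phi> k i y)" for y by (rule order_trans[OF ge E_le])
    have "ennreal (2 * R) = (\<integral>\<^sup>+y. ennreal (2 * R) * indicator unit_cube y \<partial>lborel)"
      by (simp add: nn_integral_cmult_indicator emeasure_unit_cube)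
    also have "\<dots> \<le> (\<integral>\<^sup>+y. (\<Sum>k. \<Sum>i\<in>chain_index k. \<Phi> k i y) * indicator unit_cube y \<partial>lborel)"
      by (intro nn_integral_mono mult_right_mono le) auto
    finally have "ennreal (2 * R) \<le> ennreal R" using int by (rule order_trans)
    then show False using R by (simp add: ennreal_le_iff)
  qed
  show ?thesis
  proof (rule that[OF E_sets])
    show "emeasure M (E y) \<le> ennreal (16 * chain_const * (1 + T) * exp (- chain_exponent l / 2))"
      using y by (simp add: R_def mult.assoc)
    fix \<omega> t x assume \<omega>: "\<omega> \<in> space M - E y" and t: "t \<in> {0..T}"
    show "cmod (field (symbol t) B \<omega> x) \<le> l"
    proof (rule chain_deterministic[OF B(1) less_imp_le[OF l] _ t])
      fix k i q assume "i \<in> chain_index k"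
      then show "cmod (field (chain_kernel k i) B \<omega> (y + (1 / 2 ^ k) *\<^sub>R lattice_vec q)) \<le> l * (1 - ratio) * ratio ^ k"
        using \<omega> by (force simp: E_def bad_def s_def not_less)
    qed
  qed
qed

end

section \<open>The limiting random field\<close>

text \<open>The kernel \<open>cis (x \<bullet> \<xi>)\<close> is symmetric in its two variables, so
  Fubini moves the inverse transform unchanged to the other factor.\<close>

lemma inv_fourier_pairing:
  assumes h: "integrable lborel h" and \<phi>: "integrable lborel \<phi>"
  shows "(\<integral>x. inv_fourier h x * \<phi> x \<partial>lborel) = (\<integral>\<xi>. h \<xi> * inv_fourier \<phi> \<xi> \<partial>lborel)"
proof -
  have [measurable]: "h \<in> borel_measurable borel" "\<phi> \<in> borel_measurable borel" using h \<phi> by auto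
  define c where "c = complex_of_real ((2 * pi) powr (- 3 / 2))"
  define K where "K x \<xi> = cis (x \<bullet> \<xi>) * h \<xi> * \<phi> x" for x \<xi> :: "real^3"
  have K: "integrable (lborel \<Otimes>\<^sub>M lborel) (\<lambda>(x, \<xi>). K x \<xi>)"
  proof (rule Bochner_Integration.integrable_bound)
    show "integrable (lborel \<Otimes>\<^sub>M lborel) (\<lambda>q. \<phi> (fst q) * h (snd q))"
      by (rule lborel_times_integral(1)[OF \<phi> h])
    show "(\<lambda>(x, \<xi>). K x \<xi>) \<in> borel_measurable (lborel \<Otimes>\<^sub>M lborel)"
      unfolding K_def by measurable
  qed (auto simp: K_def norm_mult)
  have "(\<integral>x. inv_fourier h x * \<phi> x \<partial>lborel) = (\<integral>x. c * (\<integral>\<xi>. K x \<xi> \<partial>lborel) \<partial>lborel)"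
    unfolding K_def integral_mult_left_zero by (simp add: inv_fourier_def c_def mult.assoc)
  also have "\<dots> = c * (\<integral>x. (\<integral>\<xi>. K x \<xi> \<partial>lborel) \<partial>lborel)" by simp
  also have "(\<integral>x. (\<integral>\<xi>. K x \<xi> \<partial>lborel) \<partial>lborel) = (\<integral>\<xi>. (\<integral>x. K x \<xi> \<partial>lborel) \<partial>lborel)"
    using lborel_pair.Fubini_integral[OF K] by simp
  also have "c * \<dots> = (\<integral>\<xi>. c * (\<integral>x. K x \<xi> \<partial>lborel) \<partial>lborel)" by simp
  also have "\<dots> = (\<integral>\<xi>. h \<xi> * inv_fourier \<phi> \<xi> \<partial>lborel)"
  proof (intro Bochner_Integration.integral_cong refl)
    fix \<xi>
    have "(\<integral>x. K x \<xi> \<partial>lborel) = (\<integral>x. h \<xi> * (cis (\<xi> \<bullet> x) * \<phi> x) \<partial>lborel)"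
      unfolding K_def by (intro Bochner_Integration.integral_cong refl) (simp add: inner_commute mult_ac)
    then show "c * (\<integral>x. K x \<xi> \<partial>lborel) = h \<xi> * inv_fourier \<phi> \<xi>"
      by (simp add: inv_fourier_def c_def)
  qed
  finally show ?thesis .
qed

text \<open>With an approximant for \<open>H\<close> it gives rates of convergence, with
  \<open>H = 0\<close> it gives norm bounds.\<close>

lemma Fatou_L2:
  fixes F :: "nat \<Rightarrow> 'a \<Rightarrow> complex"
  assumes [measurable]: "\<And>k. F k \<in> borel_measurable M"
    and lim: "AE x in M. (\<lambda>k. F k x) \<longlonglongrightarrow> G x"
    and b: "\<forall>\<^sub>F k in sequentially. (\<integral>\<^sup>+x. ennreal ((cmod (F k x - H x))\<^sup>2) \<partial>M) \<le> C"
    and [measurable]: "H \<in> borel_measurable M"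
  shows "(\<integral>\<^sup>+x. ennreal ((cmod (G x - H x))\<^sup>2) \<partial>M) \<le> C"
proof -
  have "(\<integral>\<^sup>+x. ennreal ((cmod (G x - H x))\<^sup>2) \<partial>M) = (\<integral>\<^sup>+x. liminf (\<lambda>k. ennreal ((cmod (F k x - H x))\<^sup>2)) \<partial>M)"
  proof (rule nn_integral_cong_AE)
    show "AE x in M. ennreal ((cmod (G x - H x))\<^sup>2) = liminf (\<lambda>k. ennreal ((cmod (F k x - H x))\<^sup>2))"
      using lim
    proof eventually_elim
      case (elim x)
      then have "(\<lambda>k. ennreal ((cmod (F k x - H x))\<^sup>2)) \<longlonglongrightarrow> ennreal ((cmod (G x - H x))\<^sup>2)"
        by (intro tendsto_ennrealI tendsto_power tendsto_norm tendsto_diff tendsto_const)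
      from lim_imp_Liminf[OF trivial_limit_sequentially this] show ?case by simp
    qed
  qed
  also have "\<dots> \<le> liminf (\<lambda>k. \<integral>\<^sup>+x. ennreal ((cmod (F k x - H x))\<^sup>2) \<partial>M)"
    by (rule nn_integral_liminf) measurable
  also have "\<dots> \<le> C" by (rule Liminf_le[OF _ b]) simp
  finally show ?thesis .
qed

text \<open>Weighting the squared increments by \<open>(1 / r) ^ k\<close> leaves their sum
  integrable. Wherever this sum is a finite \<open>S\<close>, the increments are at most
  \<open>sqrt S * sqrt r ^ k\<close> and hence summable.\<close>

lemma L2_fast_Cauchy_AE_convergent:
  fixes F :: "nat \<Rightarrow> 'a \<Rightarrow> complex"
  assumes [measurable]: "\<And>k. F k \<in> borel_measurable M" and r: "0 < r" "r < 1" and C: "C \<ge> 0"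
    and b: "\<And>k. (\<integral>\<^sup>+x. ennreal ((cmod (F (Suc k) x - F k x))\<^sup>2) \<partial>M) \<le> ennreal (C * (r ^ k)\<^sup>2)"
  shows "AE x in M. convergent (\<lambda>k. F k x)"
proof -
  have "(\<integral>\<^sup>+x. (\<Sum>k. ennreal ((1 / r) ^ k) * ennreal ((cmod (F (Suc k) x - F k x))\<^sup>2)) \<partial>M) =
    (\<Sum>k. ennreal ((1 / r) ^ k) * (\<integral>\<^sup>+x. ennreal ((cmod (F (Suc k) x - F k x))\<^sup>2) \<partial>M))"
    by (subst nn_integral_suminf) (auto simp: nn_integral_cmult)
  also have "\<dots> \<le> (\<Sum>k. ennreal (C * r ^ k))"
  proof (intro suminf_le allI)
    fix k
    have "ennreal ((1 / r) ^ k) * (\<integral>\<^sup>+x. ennreal ((cmod (F (Suc k) x - F k x))\<^sup>2) \<partial>M) \<le> ennreal ((1 / r) ^ k) * ennreal (C * (r ^ k)\<^sup>2)"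
      by (intro mult_left_mono b) auto
    also have "\<dots> = ennreal ((1 / r) ^ k * (C * (r ^ k)\<^sup>2))" using r C by (intro ennreal_mult[symmetric]) auto
    also have "(1 / r) ^ k * (C * (r ^ k)\<^sup>2) = C * r ^ k"
      using r by (simp add: power_divide power2_eq_square)
    finally show "ennreal ((1 / r) ^ k) * (\<integral>\<^sup>+x. ennreal ((cmod (F (Suc k) x - F k x))\<^sup>2) \<partial>M) \<le> ennreal (C * r ^ k)" .
  qed auto
  also have "\<dots> = ennreal (\<Sum>k. C * r ^ k)"
    using r C by (intro suminf_ennreal2 summable_mult summable_geometric) auto
  also have "\<dots> < \<infinity>" by simp
  finally have "AE x in M. (\<Sum>k. ennreal ((1 / r) ^ k) * ennreal ((cmod (F (Suc k) x - F k x))\<^sup>2)) \<noteq> \<infinity>"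
    by (intro nn_integral_noteq_infinite) auto
  then show ?thesis
  proof eventually_elim
    case (elim x)
    define S where "S = enn2real (\<Sum>k. ennreal ((1 / r) ^ k) * ennreal ((cmod (F (Suc k) x - F k x))\<^sup>2))"
    have S: "ennreal S = (\<Sum>k. ennreal ((1 / r) ^ k) * ennreal ((cmod (F (Suc k) x - F k x))\<^sup>2))"
      using elim unfolding S_def by (intro ennreal_enn2real) (simp add: less_top)
    have "cmod (F (Suc k) x - F k x) \<le> sqrt S * sqrt r ^ k" for k
    proof -
      have "ennreal ((1 / r) ^ k) * ennreal ((cmod (F (Suc k) x - F k x))\<^sup>2) \<le> ennreal S"
        unfolding S using sum_le_suminf[of "\<lambda>k. ennreal ((1 / r) ^ k) * ennreal ((cmod (F (Suc k) x - F k x))\<^sup>2)" "{k}"] by simp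
      then have "ennreal ((1 / r) ^ k * (cmod (F (Suc k) x - F k x))\<^sup>2) \<le> ennreal S"
        using r by (subst ennreal_mult) auto
      then have "(1 / r) ^ k * (cmod (F (Suc k) x - F k x))\<^sup>2 \<le> S"
        by (subst (asm) ennreal_le_iff) (auto simp: S_def)
      then have "(cmod (F (Suc k) x - F k x))\<^sup>2 \<le> S * r ^ k"
        using r by (simp add: power_divide divide_le_eq mult.commute)
      then have "sqrt ((cmod (F (Suc k) x - F k x))\<^sup>2) \<le> sqrt (S * r ^ k)" by (rule real_sqrt_le_mono)
      then show ?thesis by (simp add: real_sqrt_mult real_sqrt_power)
    qed
    moreover have "summable (\<lambda>k. sqrt S * sqrt r ^ k)"
      using r by (intro summable_mult summable_geometric) (auto simp: real_sqrt_lt_1_iff)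
    ultimately have "summable (\<lambda>k. F (Suc k) x - F k x)" by (rule summable_comparison_test'[where N=0, rotated])
    then have "(\<lambda>n. \<Sum>k<n. F (Suc k) x - F k x) \<longlonglongrightarrow> (\<Sum>k. F (Suc k) x - F k x)" by (rule summable_LIMSEQ)
    then have "(\<lambda>n. F n x - F 0 x) \<longlonglongrightarrow> (\<Sum>k. F (Suc k) x - F k x)" unfolding sum_lessThan_telescope[of "\<lambda>n. F n x"] .
    from tendsto_add[OF this tendsto_const[of "F 0 x"]] show ?case by (auto simp: convergent_def)
  qed
qed

lemma pairing_tendsto:
  fixes h :: "nat \<Rightarrow> real^3 \<Rightarrow> complex"
  assumes [measurable]: "\<And>k. h k \<in> borel_measurable lborel" "H \<in> borel_measurable lborel" "\<phi> \<in> borel_measurable lborel"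
    and \<phi>: "(\<integral>\<^sup>+x. ennreal ((cmod (\<phi> x))\<^sup>2) \<partial>lborel) \<le> ennreal P" "P \<ge> 0"
    and H: "(\<integral>\<^sup>+x. ennreal ((cmod (H x))\<^sup>2) \<partial>lborel) \<le> ennreal Q" "Q \<ge> 0"
    and b: "\<And>k. (\<integral>\<^sup>+x. ennreal ((cmod (H x - h k x))\<^sup>2) \<partial>lborel) \<le> ennreal (D k)" "\<And>k. D k \<ge> 0" "D \<longlonglongrightarrow> 0"
  shows "integrable lborel (\<lambda>x. H x * \<phi> x)"
    and "(\<lambda>k. \<integral>x. h k x * \<phi> x \<partial>lborel) \<longlonglongrightarrow> (\<integral>x. H x * \<phi> x \<partial>lborel)"
proof -
  show i: "integrable lborel (\<lambda>x. H x * \<phi> x)"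
    by (rule Cauchy_Schwarz_lebesgue(1)[OF _ _ H(1) \<phi>(1)]) (use H \<phi> in auto)
  have d: "integrable lborel (\<lambda>x. (H x - h k x) * \<phi> x)" "cmod (\<integral>x. (H x - h k x) * \<phi> x \<partial>lborel) \<le> sqrt (D k * P)" for k
    by (rule Cauchy_Schwarz_lebesgue[OF _ _ b(1)[of k] \<phi>(1)]; use b(2) \<phi>(2) in simp)+
  have eq: "(\<integral>x. h k x * \<phi> x \<partial>lborel) = (\<integral>x. H x * \<phi> x \<partial>lborel) - (\<integral>x. (H x - h k x) * \<phi> x \<partial>lborel)" for k
    by (subst Bochner_Integration.integral_diff[symmetric, OF i d(1)]) (simp add: algebra_simps)
  have "(\<lambda>k. \<integral>x. (H x - h k x) * \<phi> x \<partial>lborel) \<longlonglongrightarrow> 0"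
  proof (rule Lim_null_comparison)
    show "\<forall>\<^sub>F k in sequentially. norm (\<integral>x. (H x - h k x) * \<phi> x \<partial>lborel) \<le> sqrt (D k * P)"
      using d(2) by (intro always_eventually) simp
    have "(\<lambda>k. sqrt (D k * P)) \<longlonglongrightarrow> sqrt (0 * P)" by (intro tendsto_intros b(3))
    then show "(\<lambda>k. sqrt (D k * P)) \<longlonglongrightarrow> 0" by simp
  qed
  from tendsto_diff[OF tendsto_const this]
  show "(\<lambda>k. \<integral>x. h k x * \<phi> x \<partial>lborel) \<longlonglongrightarrow> (\<integral>x. H x * \<phi> x \<partial>lborel)" by (simp add: eq)
qed

section \<open>Infinite sums on the frequency side\<close>

context wiener_data
begin

definition gain :: real where "gain = 2 powr (- e)"

lemma gain: "0 < gain" "gain < 1"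
proof -
  show "0 < gain" by (simp add: gain_def)
  have "2 powr (- e) < 2 powr (0::real)" using e by (intro powr_less_mono) auto
  then show "gain < 1" by (simp add: gain_def)
qed

definition overlap :: "real^3 \<Rightarrow> (int^3) set" where
  "overlap \<xi> = {n. piece n \<xi> \<noteq> 0}"

text \<open>At each frequency only finitely many pieces differ from zero, so the sum over the whole
  lattice is a finite sum pointwise and raises no question of convergence.\<close>

definition full_spectrum :: "(nat \<Rightarrow> real^3 \<Rightarrow> complex) \<Rightarrow> (nat \<Rightarrow> int^3 \<Rightarrow> complex) \<Rightarrow> real^3 \<Rightarrow> complex" where
  "full_spectrum \<kappa> c \<xi> = spectrum \<kappa> c (overlap \<xi>) \<xi>"

lemma sum_overlap_eq:
  assumes "finite B" "overlap \<xi> \<subseteq> B"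
  shows "(\<Sum>n\<in>B. a n * piece n \<xi>) = (\<Sum>n\<in>overlap \<xi>. a n * piece n \<xi>)"
  using assms by (intro sum.mono_neutral_right) (auto simp: overlap_def)

lemma overlap_eventually: "\<forall>\<^sub>F k in sequentially. overlap \<xi> \<subseteq> lattice_box k"
proof -
  obtain k where "overlap \<xi> \<subseteq> lattice_box k"
    using finite_subset_lattice_box[of "overlap \<xi>"] overlap_finite by (auto simp: overlap_def)
  then show ?thesis
    using lattice_box_mono by (intro eventually_sequentiallyI[of k]) blast
qed

lemma spectrum_eq: "spectrum \<kappa> c B \<xi> = (\<Sum>j\<in>{0, 1}. \<kappa> j \<xi> * f j \<xi> * (\<Sum>n\<in>B. c j n * piece n \<xi>))"
  unfolding spectrum_def sum_distrib_left by (intro sum.cong refl) (simp only: mult_ac)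

lemma spectrum_tendsto: "(\<lambda>k. spectrum \<kappa> c (lattice_box k) \<xi>) \<longlonglongrightarrow> full_spectrum \<kappa> c \<xi>"
proof (rule tendsto_eventually)
  show "\<forall>\<^sub>F k in sequentially. spectrum \<kappa> c (lattice_box k) \<xi> = full_spectrum \<kappa> c \<xi>"
    using overlap_eventually[of \<xi>]
  proof eventually_elim
    case (elim k)
    show ?case
      unfolding full_spectrum_def spectrum_eq sum_overlap_eq[OF finite_lattice_box elim] ..
  qed
qed

lemma spectrum_measurable [measurable (raw)]:
  assumes [measurable]: "\<And>j. \<kappa> j \<in> borel_measurable borel"
  shows "spectrum \<kappa> c B \<in> borel_measurable borel"
  unfolding spectrum_def[abs_def] by measurable

lemma full_spectrum_measurable [measurable (raw)]:
  assumes [measurable]: "\<And>j. \<kappa> j \<in> borel_measurable borel"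
  shows "full_spectrum \<kappa> c \<in> borel_measurable borel"
  by (rule borel_measurable_LIMSEQ_metric[OF _ spectrum_tendsto[of \<kappa> c]]) measurable

lemma powr_neg_le_weight: "jap \<xi> powr (- real j) \<le> weight j \<xi>"
  unfolding weight_def using e jap_ge_1[of \<xi>] by (intro powr_mono) auto

text \<open>Excess regularity at work: where \<open>jap \<xi>\<close> is at least
  \<open>2 ^ k\<close>, the weight of the data exceeds the weight that L2 requires by
  \<open>2 ^ (k * e)\<close>.\<close>

lemma powr_neg_le_weight_far:
  assumes n: "n \<notin> lattice_box k" "piece n \<xi> \<noteq> 0"
  shows "jap \<xi> powr (- real j) \<le> gain ^ k * weight j \<xi>"
proof -
  have "2 ^ k \<le> jap \<xi>" using norm_ge_outside_box[OF n] jap_ge_norm[of \<xi>] by linarith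
  then have "(2 ^ k) powr e \<le> jap \<xi> powr e" using e by (intro powr_mono2) auto
  moreover have "(2 ^ k) powr e = (1 / gain) ^ k"
  proof -
    have "1 / gain = 2 powr e" by (simp add: gain_def powr_minus_divide)
    then have "(1 / gain) ^ k = (2 powr e) powr real k" by (simp add: powr_realpow)
    also have "\<dots> = (2 powr real k) powr e" by (simp add: powr_powr mult.commute)
    finally show ?thesis by (simp add: powr_realpow)
  qed
  ultimately have "1 \<le> gain ^ k * jap \<xi> powr e"
    using gain by (simp add: power_divide divide_le_eq mult.commute)
  then have "1 * jap \<xi> powr (- real j) \<le> gain ^ k * jap \<xi> powr e * jap \<xi> powr (- real j)"
    by (intro mult_right_mono) auto
  also have "\<dots> = gain ^ k * weight j \<xi>" by (simp add: weight_def powr_add[symmetric])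
  finally show ?thesis by simp
qed

text \<open>A fixed outcome: \<open>c\<close> stands for the random coefficients and
  \<open>R\<close> for a finite bound on their energy. Everything in this block is
  deterministic.\<close>

context
  fixes \<kappa> :: "nat \<Rightarrow> real^3 \<Rightarrow> complex" and c :: "nat \<Rightarrow> int^3 \<Rightarrow> complex" and \<alpha> R :: real
  assumes \<kappa>_meas [measurable]: "\<And>j. \<kappa> j \<in> borel_measurable borel" and \<alpha>: "\<alpha> \<ge> 0"
    and \<kappa>: "\<And>j \<xi>. j \<in> {0, 1} \<Longrightarrow> cmod (\<kappa> j \<xi>) \<le> \<alpha> * jap \<xi> powr (- real j)"
    and R: "\<And>k. (\<Sum>j\<in>{0, 1}. \<Sum>n\<in>lattice_box k. (cmod (c j n))\<^sup>2 * energy j n) \<le> R"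
begin

lemma kernel_weight: "j \<in> {0, 1} \<Longrightarrow> cmod (\<kappa> j \<xi>) \<le> \<alpha> * weight j \<xi>"
  using order_trans[OF \<kappa> mult_left_mono[OF powr_neg_le_weight \<alpha>]] .

lemma energy_finite_le:
  assumes B: "finite B" shows "(\<Sum>j\<in>{0, 1}. \<Sum>n\<in>B. (cmod (c j n))\<^sup>2 * energy j n) \<le> R"
proof -
  obtain k where k: "B \<subseteq> lattice_box k" using finite_subset_lattice_box[OF B] by auto
  have "(\<Sum>j\<in>{0, 1}. \<Sum>n\<in>B. (cmod (c j n))\<^sup>2 * energy j n) \<le> (\<Sum>j\<in>{0, 1}. \<Sum>n\<in>lattice_box k. (cmod (c j n))\<^sup>2 * energy j n)"
    by (intro sum_mono sum_mono2 k finite_lattice_box) auto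
  with R[of k] show ?thesis by linarith
qed

lemma R_nonneg: "R \<ge> 0"
  using energy_finite_le[of "{}"] by simp

lemma spectrum_bound:
  assumes B: "finite B"
  shows "(\<integral>\<^sup>+\<xi>. ennreal ((cmod (spectrum \<kappa> c B \<xi>))\<^sup>2) \<partial>lborel) \<le> ennreal (54 * \<alpha>\<^sup>2 * R)"
proof -
  have "(\<integral>\<^sup>+\<xi>. ennreal ((cmod (spectrum \<kappa> c B \<xi>))\<^sup>2) \<partial>lborel) \<le>
     ennreal (54 * \<alpha>\<^sup>2 * (\<Sum>j\<in>{0, 1}. \<Sum>n\<in>B. (cmod (c j n))\<^sup>2 * energy j n))"
    by (rule spectrum_L2[OF B \<kappa>_meas kernel_weight])
  also have "\<dots> \<le> ennreal (54 * \<alpha>\<^sup>2 * R)" by (intro ennreal_leI mult_left_mono energy_finite_le B) auto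
  finally show ?thesis .
qed

lemma spectrum_far_bound:
  assumes B: "finite B" "B \<inter> lattice_box k = {}"
  shows "(\<integral>\<^sup>+\<xi>. ennreal ((cmod (spectrum \<kappa> c B \<xi>))\<^sup>2) \<partial>lborel) \<le> ennreal (54 * \<alpha>\<^sup>2 * R * (gain ^ k)\<^sup>2)"
proof -
  have "(\<integral>\<^sup>+\<xi>. ennreal ((cmod (spectrum \<kappa> c B \<xi>))\<^sup>2) \<partial>lborel) \<le>
     ennreal (54 * (\<alpha> * gain ^ k)\<^sup>2 * (\<Sum>j\<in>{0, 1}. \<Sum>n\<in>B. (cmod (c j n))\<^sup>2 * energy j n))"
  proof (rule spectrum_L2[OF B(1) \<kappa>_meas])
    fix j :: nat and n \<xi> assume j: "j \<in> {0, 1}" and n: "n \<in> B" "piece n \<xi> \<noteq> 0"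
    then have "n \<notin> lattice_box k" using B(2) by auto
    from order_trans[OF \<kappa>[OF j] mult_left_mono[OF powr_neg_le_weight_far[OF this n(2)] \<alpha>]]
    show "cmod (\<kappa> j \<xi>) \<le> \<alpha> * gain ^ k * weight j \<xi>" by (simp only: mult.assoc)
  qed
  also have "\<dots> \<le> ennreal (54 * (\<alpha> * gain ^ k)\<^sup>2 * R)" by (intro ennreal_leI mult_left_mono energy_finite_le B) auto
  finally show ?thesis by (simp add: power_mult_distrib mult_ac)
qed

lemma spectrum_diff: "k \<le> l \<Longrightarrow> spectrum \<kappa> c (lattice_box l) \<xi> - spectrum \<kappa> c (lattice_box k) \<xi> = spectrum \<kappa> c (lattice_box l - lattice_box k) \<xi>"
  unfolding spectrum_def sum_subtractf[symmetric]
  by (intro sum.cong refl) (simp add: sum_diff lattice_box_mono)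

lemma full_spectrum_approx:
  "(\<integral>\<^sup>+\<xi>. ennreal ((cmod (full_spectrum \<kappa> c \<xi> - spectrum \<kappa> c (lattice_box k) \<xi>))\<^sup>2) \<partial>lborel) \<le> ennreal (54 * \<alpha>\<^sup>2 * R * (gain ^ k)\<^sup>2)"
proof (rule Fatou_L2[where F="\<lambda>l. spectrum \<kappa> c (lattice_box l)"])
  show "\<forall>\<^sub>F l in sequentially. (\<integral>\<^sup>+\<xi>. ennreal ((cmod (spectrum \<kappa> c (lattice_box l) \<xi> - spectrum \<kappa> c (lattice_box k) \<xi>))\<^sup>2) \<partial>lborel)
     \<le> ennreal (54 * \<alpha>\<^sup>2 * R * (gain ^ k)\<^sup>2)"
  proof (rule eventually_sequentiallyI[of k])
    fix l assume "k \<le> l"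
    show "(\<integral>\<^sup>+\<xi>. ennreal ((cmod (spectrum \<kappa> c (lattice_box l) \<xi> - spectrum \<kappa> c (lattice_box k) \<xi>))\<^sup>2) \<partial>lborel)
     \<le> ennreal (54 * \<alpha>\<^sup>2 * R * (gain ^ k)\<^sup>2)"
      unfolding spectrum_diff[OF \<open>k \<le> l\<close>] by (rule spectrum_far_bound) auto
  qed
qed (auto simp: spectrum_tendsto)

lemma full_spectrum_L2:
  "(\<integral>\<^sup>+\<xi>. ennreal ((cmod (full_spectrum \<kappa> c \<xi>))\<^sup>2) \<partial>lborel) \<le> ennreal (54 * \<alpha>\<^sup>2 * R)"
proof -
  have "(\<integral>\<^sup>+\<xi>. ennreal ((cmod (full_spectrum \<kappa> c \<xi> - 0))\<^sup>2) \<partial>lborel) \<le> ennreal (54 * \<alpha>\<^sup>2 * R)"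
  proof (rule Fatou_L2[where F="\<lambda>l. spectrum \<kappa> c (lattice_box l)"])
    show "\<forall>\<^sub>F l in sequentially. (\<integral>\<^sup>+\<xi>. ennreal ((cmod (spectrum \<kappa> c (lattice_box l) \<xi> - 0))\<^sup>2) \<partial>lborel) \<le> ennreal (54 * \<alpha>\<^sup>2 * R)"
      using spectrum_bound by (intro always_eventually) simp
  qed (auto simp: spectrum_tendsto)
  then show ?thesis by simp
qed

lemma gain_tendsto: "(\<lambda>k. 54 * \<alpha>\<^sup>2 * R * (gain ^ k)\<^sup>2) \<longlonglongrightarrow> 0"
proof -
  have "(\<lambda>k. 54 * \<alpha>\<^sup>2 * R * (gain ^ k)\<^sup>2) \<longlonglongrightarrow> 54 * \<alpha>\<^sup>2 * R * 0\<^sup>2"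
    using gain by (intro tendsto_intros LIMSEQ_power_zero) simp
  then show ?thesis by simp
qed

lemma full_spectrum_pairing:
  assumes [measurable]: "\<phi> \<in> borel_measurable borel"
    and \<phi>: "(\<integral>\<^sup>+x. ennreal ((cmod (\<phi> x))\<^sup>2) \<partial>lborel) \<le> ennreal P" "P \<ge> 0"
  shows "integrable lborel (\<lambda>\<xi>. full_spectrum \<kappa> c \<xi> * \<phi> \<xi>)"
    and "(\<lambda>k. \<integral>\<xi>. spectrum \<kappa> c (lattice_box k) \<xi> * \<phi> \<xi> \<partial>lborel) \<longlonglongrightarrow> (\<integral>\<xi>. full_spectrum \<kappa> c \<xi> * \<phi> \<xi> \<partial>lborel)"
  by (rule pairing_tendsto[OF _ _ _ \<phi> full_spectrum_L2 _ full_spectrum_approx _ gain_tendsto]; use R_nonneg in simp)+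

end

text \<open>The factors \<open>c'\<close> turn every term onto the positive axis, so a bound uniform
  in them is a bound on the sums of absolute values.\<close>

lemma abs_summable_pairing:
  fixes a :: "int^3 \<Rightarrow> complex"
  assumes "\<And>B c'. finite B \<Longrightarrow> (\<And>n. cmod (c' n) \<le> 1) \<Longrightarrow> cmod (\<Sum>n\<in>B. c' n * a n) \<le> K"
  shows "(\<lambda>n. norm (a n)) summable_on UNIV"
proof (rule nonneg_bdd_above_summable_on)
  show "bdd_above (sum (\<lambda>n. norm (a n)) ` {F. F \<subseteq> UNIV \<and> finite F})"
  proof (rule bdd_aboveI2)
    fix B :: "(int^3) set" assume "B \<in> {F. F \<subseteq> UNIV \<and> finite F}"
    then have B: "finite B" by simp
    define c' where "c' n = (if a n = 0 then 0 else of_real (cmod (a n)) / a n)" for n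
    have "(\<Sum>n\<in>B. c' n * a n) = of_real (\<Sum>n\<in>B. cmod (a n))"
      unfolding of_real_sum by (intro sum.cong refl) (simp add: c'_def)
    moreover have "cmod (\<Sum>n\<in>B. c' n * a n) \<le> K"
      by (intro assms B) (simp add: c'_def norm_divide)
    ultimately show "(\<Sum>n\<in>B. norm (a n)) \<le> K" by (simp add: sum_nonneg del: of_real_sum)
  qed
qed auto

section \<open>The randomized datum as a distribution\<close>

lemma piece_pairing:
  assumes j: "j \<in> {0, 1}" and \<phi>: "\<phi> \<in> schwartz"
  shows "integrable lborel (\<lambda>\<xi>. piece n \<xi> * f j \<xi> * \<phi> \<xi>)"
proof -
  note [measurable] = schwartz_measurable[OF \<phi>]
  obtain B where B: "B \<ge> 0" "\<And>\<xi>. (1 + norm \<xi>) ^ 1 * cmod (\<phi> \<xi>) \<le> B" using schwartz_bound[OF \<phi>, of 1] by blast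
  have b: "cmod (\<phi> \<xi>) \<le> B * weight j \<xi>" for \<xi>
  proof -
    have p: "jap \<xi> * cmod (\<phi> \<xi>) \<le> B"
      using order_trans[OF mult_right_mono[OF jap_le[of \<xi>] norm_ge_zero[of "\<phi> \<xi>"]]] B(2)[of \<xi>] by simp
    have "jap \<xi> powr (- 1) \<le> weight j \<xi>"
      unfolding weight_def using e j jap_ge_1[of \<xi>] by (intro powr_mono) auto
    then have w: "1 / jap \<xi> \<le> weight j \<xi>" by (simp add: powr_minus_divide less_imp_le)
    have "cmod (\<phi> \<xi>) \<le> B * (1 / jap \<xi>)" using p by (simp add: pos_le_divide_eq mult.commute)
    also have "\<dots> \<le> B * weight j \<xi>" using w B by (intro mult_left_mono)
    finally show ?thesis .
  qed
  have "integrable lborel (\<lambda>\<xi>. \<phi> \<xi> * (piece n \<xi> * f j \<xi>))"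
    using b B by (intro kernel_L1(1)[OF j]) auto
  then show ?thesis by (simp add: mult_ac)
qed

text \<open>For \<open>j0 = 1\<close> the transform need not lie in L2, so it receives the weight
  \<open>jap powr (- j0)\<close> and the test function the inverse weight. The sum in
  \<open>randomize\<close> is unordered: its terms are first shown to be absolutely summable, after
  which its value can be computed along the boxes.\<close>

lemma randomize_represents:
  assumes j0: "j0 \<in> {0, 1}" and u: "fourier_fun u = f j0"
    and R: "\<And>k. (\<Sum>j\<in>{0, 1}. \<Sum>n\<in>lattice_box k. (cmod (g j n \<omega>))\<^sup>2 * energy j n) \<le> R"
  shows "represents (\<lambda>\<xi>. f j0 \<xi> * (\<Sum>n\<in>overlap \<xi>. g j0 n \<omega> * piece n \<xi>)) (fourier_distr (randomize \<psi> (g j0) u \<omega>))"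
proof -
  \<comment> \<open>Vanishes on the other datum, so that the results for pairs of data apply to a
    single one.\<close>
  define \<kappa> :: "nat \<Rightarrow> real^3 \<Rightarrow> complex" where "\<kappa> j \<xi> = (if j = j0 then of_real (jap \<xi> powr (- real j)) else 0)" for j \<xi>
  have [measurable]: "\<kappa> j \<in> borel_measurable borel" for j unfolding \<kappa>_def[abs_def] by (cases "j = j0") auto
  have \<kappa>b: "cmod (\<kappa> j \<xi>) \<le> 1 * jap \<xi> powr (- real j)" for j \<xi> by (simp add: \<kappa>_def)
  have sp: "spectrum \<kappa> c B \<xi> = of_real (jap \<xi> powr (- real j0)) * (f j0 \<xi> * (\<Sum>n\<in>B. c j0 n * piece n \<xi>))" for c B \<xi>
    unfolding spectrum_eq using j0 by (auto simp: \<kappa>_def)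
  define h where "h \<xi> = f j0 \<xi> * (\<Sum>n\<in>overlap \<xi>. g j0 n \<omega> * piece n \<xi>)" for \<xi>
  have full: "full_spectrum \<kappa> (\<lambda>j n. g j n \<omega>) \<xi> = of_real (jap \<xi> powr (- real j0)) * h \<xi>" for \<xi>
    by (simp add: full_spectrum_def sp h_def)
  have cancel: "of_real (jap \<xi> powr (- real j0)) * a * (of_real (jap \<xi> powr real j0) * b) = a * b" for \<xi> and a b :: complex
    by (simp add: powr_minus_divide)
  have "h \<xi> = of_real (jap \<xi> powr real j0) * full_spectrum \<kappa> (\<lambda>j n. g j n \<omega>) \<xi>" for \<xi>
    by (simp add: full powr_minus_divide)
  then have h_meas: "h \<in> borel_measurable borel" by (simp add: measurable_cong[of _ h])
  have main: "integrable lborel (\<lambda>\<xi>. h \<xi> * \<phi> \<xi>) \<and> fourier_distr (randomize \<psi> (g j0) u \<omega>) \<phi> = (\<integral>\<xi>. h \<xi> * \<phi> \<xi> \<partial>lborel)"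
    if \<phi>: "\<phi> \<in> schwartz" for \<phi>
  proof -
    note [measurable] = schwartz_measurable[OF \<phi>]
    define \<phi>' where "\<phi>' \<xi> = of_real (jap \<xi> powr real j0) * \<phi> \<xi>" for \<xi>
    have [measurable]: "\<phi>' \<in> borel_measurable borel" unfolding \<phi>'_def[abs_def] by measurable
    obtain P where P: "P \<ge> 0" "(\<integral>\<^sup>+x. ennreal ((jap x * cmod (\<phi> x))\<^sup>2) \<partial>lborel) \<le> ennreal P"
      using schwartz_weighted_L2[OF \<phi>] by blast
    have P': "(\<integral>\<^sup>+x. ennreal ((cmod (\<phi>' x))\<^sup>2) \<partial>lborel) \<le> ennreal P"
    proof (rule order_trans[OF nn_integral_mono P(2)])
      fix x
      have "jap x powr real j0 \<le> jap x powr 1" using jap_ge_1[of x] j0 by (intro powr_mono) auto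
      then show "ennreal ((cmod (\<phi>' x))\<^sup>2) \<le> ennreal ((jap x * cmod (\<phi> x))\<^sup>2)"
        unfolding \<phi>'_def norm_mult by (intro ennreal_leI power_mono mult_right_mono) (auto simp: less_imp_le)
    qed
    define a where "a n = g j0 n \<omega> * (\<integral>\<xi>. piece n \<xi> * f j0 \<xi> * \<phi> \<xi> \<partial>lborel)" for n
    have lhs: "fourier_distr (randomize \<psi> (g j0) u \<omega>) \<phi> = (\<Sum>\<^sub>\<infinity>n\<in>UNIV. a n)"
      unfolding fourier_distr_def randomize_def multiplier_def u inv_fourier_fourier[OF \<phi>] a_def ..
    have fin: "(\<Sum>n\<in>B. c n * a n) = (\<integral>\<xi>. spectrum \<kappa> (\<lambda>j n. c n * g j n \<omega>) B \<xi> * \<phi>' \<xi> \<partial>lborel)" for c B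
    proof -
      have "(\<Sum>n\<in>B. c n * a n) = (\<Sum>n\<in>B. \<integral>\<xi>. c n * g j0 n \<omega> * (piece n \<xi> * f j0 \<xi> * \<phi> \<xi>) \<partial>lborel)"
        unfolding a_def by (simp add: mult.assoc)
      also have "\<dots> = (\<integral>\<xi>. (\<Sum>n\<in>B. c n * g j0 n \<omega> * (piece n \<xi> * f j0 \<xi> * \<phi> \<xi>)) \<partial>lborel)"
        by (intro Bochner_Integration.integral_sum[symmetric] integrable_mult_right piece_pairing j0 \<phi>)
      also have "\<dots> = (\<integral>\<xi>. spectrum \<kappa> (\<lambda>j n. c n * g j n \<omega>) B \<xi> * \<phi>' \<xi> \<partial>lborel)"
      proof (intro Bochner_Integration.integral_cong refl)
        fix \<xi>
        have "spectrum \<kappa> (\<lambda>j n. c n * g j n \<omega>) B \<xi> * \<phi>' \<xi> = (f j0 \<xi> * (\<Sum>n\<in>B. c n * g j0 n \<omega> * piece n \<xi>)) * \<phi> \<xi>"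
          unfolding sp \<phi>'_def by (rule cancel)
        then show "(\<Sum>n\<in>B. c n * g j0 n \<omega> * (piece n \<xi> * f j0 \<xi> * \<phi> \<xi>)) = spectrum \<kappa> (\<lambda>j n. c n * g j n \<omega>) B \<xi> * \<phi>' \<xi>"
          by (simp add: sum_distrib_left sum_distrib_right mult_ac)
      qed
      finally show ?thesis .
    qed
    have "(\<lambda>n. norm (a n)) summable_on UNIV"
    proof (rule abs_summable_pairing)
      fix B :: "(int^3) set" and c' :: "int^3 \<Rightarrow> complex" assume B: "finite B" and c': "\<And>n. cmod (c' n) \<le> 1"
      have R': "(\<Sum>j\<in>{0, 1}. \<Sum>n\<in>lattice_box k. (cmod (c' n * g j n \<omega>))\<^sup>2 * energy j n) \<le> R" for k
      proof (rule order_trans[OF _ R[of k]], intro sum_mono mult_right_mono)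
        fix j n
        show "(cmod (c' n * g j n \<omega>))\<^sup>2 \<le> (cmod (g j n \<omega>))\<^sup>2"
          using c'[of n] by (intro power_mono) (auto simp: norm_mult mult_left_le_one_le)
      qed auto
      show "cmod (\<Sum>n\<in>B. c' n * a n) \<le> sqrt (54 * 1\<^sup>2 * R * P)"
        unfolding fin
        by (rule Cauchy_Schwarz_lebesgue(2)[OF _ _ spectrum_bound[OF _ _ \<kappa>b R' B] P'])
           (use P R_nonneg[OF _ _ \<kappa>b R'] in auto)
    qed
    then have "(a has_sum (\<Sum>\<^sub>\<infinity>n\<in>UNIV. a n)) UNIV"
      by (rule has_sum_infsum[OF Infinite_Sum.abs_summable_summable])
    then have "(sum a \<longlongrightarrow> (\<Sum>\<^sub>\<infinity>n\<in>UNIV. a n)) (finite_subsets_at_top UNIV)" by (simp add: has_sum_def)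
    moreover have "filterlim lattice_box (finite_subsets_at_top UNIV) sequentially"
      unfolding filterlim_finite_subsets_at_top
    proof safe
      fix X :: "(int^3) set" assume "finite X"
      then obtain k where "X \<subseteq> lattice_box k" using finite_subset_lattice_box by blast
      then show "\<forall>\<^sub>F l in sequentially. finite (lattice_box l) \<and> X \<subseteq> lattice_box l \<and> lattice_box l \<subseteq> UNIV"
        using lattice_box_mono by (intro eventually_sequentiallyI[of k]) blast
    qed
    ultimately have "(\<lambda>k. \<Sum>n\<in>lattice_box k. a n) \<longlonglongrightarrow> (\<Sum>\<^sub>\<infinity>n\<in>UNIV. a n)"
      by (rule filterlim_compose)
    moreover have "(\<lambda>k. \<Sum>n\<in>lattice_box k. a n) \<longlonglongrightarrow> (\<integral>\<xi>. full_spectrum \<kappa> (\<lambda>j n. g j n \<omega>) \<xi> * \<phi>' \<xi> \<partial>lborel)"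
      using full_spectrum_pairing(2)[OF _ _ \<kappa>b R _ P' P(1)] fin[of "\<lambda>_. 1"] by simp
    ultimately have "(\<Sum>\<^sub>\<infinity>n\<in>UNIV. a n) = (\<integral>\<xi>. full_spectrum \<kappa> (\<lambda>j n. g j n \<omega>) \<xi> * \<phi>' \<xi> \<partial>lborel)"
      by (rule LIMSEQ_unique)
    moreover have "integrable lborel (\<lambda>\<xi>. full_spectrum \<kappa> (\<lambda>j n. g j n \<omega>) \<xi> * \<phi>' \<xi>)"
      using full_spectrum_pairing(1)[OF _ _ \<kappa>b R _ P' P(1)] by simp
    ultimately show ?thesis unfolding lhs full \<phi>'_def cancel by simp
  qed
  show ?thesis
    unfolding represents_def h_def[symmetric] using h_meas main by simp
qed

end

section \<open>Lebesgue norms of the limit\<close>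

text \<open>Replaces an essential supremum by the measure of a superlevel set, which depends
  measurably on parameters.\<close>

lemma esssup_gt_iff:
  fixes f :: "'a \<Rightarrow> ennreal"
  assumes f: "f \<in> borel_measurable M"
  shows "z < esssup M f \<longleftrightarrow> emeasure M {x \<in> space M. z < f x} \<noteq> 0"
proof
  assume "z < esssup M f"
  from esssup_pos_measure[OF f this] show "emeasure M {x \<in> space M. z < f x} \<noteq> 0" by auto
next
  assume n: "emeasure M {x \<in> space M. z < f x} \<noteq> 0"
  show "z < esssup M f"
  proof (rule ccontr)
    assume "\<not> z < esssup M f"
    then have "AE x in M. f x \<le> z"
      using esssup_AE[of f M] by (auto elim!: eventually_mono intro: order_trans)
    then have "emeasure M {x \<in> space M. \<not> f x \<le> z} = 0"
      using f by (subst (asm) AE_iff_measurable[OF _ refl]) auto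
    with n show False by (simp add: not_le)
  qed
qed

lemma represents_fourier_fun:
  "represents f (fourier_distr u) \<Longrightarrow> represents (fourier_fun u) (fourier_distr u)"
  unfolding fourier_fun_def by (rule someI[where P="\<lambda>f. represents f (fourier_distr u)"])

lemma schwartz_L2:
  assumes \<phi>: "\<phi> \<in> schwartz"
  obtains P where "P \<ge> 0" "(\<integral>\<^sup>+x. ennreal ((cmod (\<phi> x))\<^sup>2) \<partial>lborel) \<le> ennreal P"
    "(\<integral>\<^sup>+x. ennreal ((cmod (inv_fourier \<phi> x))\<^sup>2) \<partial>lborel) \<le> ennreal P"
proof -
  obtain P where P: "P \<ge> 0" "(\<integral>\<^sup>+x. ennreal ((jap x * cmod (\<phi> x))\<^sup>2) \<partial>lborel) \<le> ennreal P"
    using schwartz_weighted_L2[OF \<phi>] by blast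
  have P1: "(\<integral>\<^sup>+x. ennreal ((cmod (\<phi> x))\<^sup>2) \<partial>lborel) \<le> ennreal P"
  proof (rule order_trans[OF nn_integral_mono P(2)])
    fix x
    have "1 * cmod (\<phi> x) \<le> jap x * cmod (\<phi> x)" by (intro mult_right_mono jap_ge_1) auto
    then show "ennreal ((cmod (\<phi> x))\<^sup>2) \<le> ennreal ((jap x * cmod (\<phi> x))\<^sup>2)" by (intro ennreal_leI power_mono) auto
  qed
  show thesis
    by (rule that[OF P(1) P1 order_trans[OF plancherel_le[OF schwartz_integrable[OF \<phi>]] P1]])
qed

lemma Lr_norm_AE_cong:
  assumes [measurable]: "f \<in> borel_measurable borel" "g \<in> borel_measurable borel" and eq: "AE x in lborel. f x = g x"
  shows "Lr_norm r f = Lr_norm r g"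
proof -
  have "esssup lborel (\<lambda>x. ennreal (cmod (f x))) = esssup lborel (\<lambda>x. ennreal (cmod (g x)))"
    using eq by (intro esssup_AE_cong) auto
  moreover have "(\<integral>\<^sup>+x. ennreal (cmod (f x) powr p) \<partial>lborel) = (\<integral>\<^sup>+x. ennreal (cmod (g x) powr p) \<partial>lborel)" for p
    using eq by (intro nn_integral_cong_AE) auto
  ultimately show ?thesis by (simp add: Lr_norm_def)
qed

lemma Lr_norm_distr_eq:
  assumes F: "represents F v" shows "Lr_norm_distr r v = Lr_norm r F"
proof -
  have "Lr_norm r f = Lr_norm r F" if f: "represents f v" for f
    using represents_unique[OF f F] f F by (intro Lr_norm_AE_cong) (auto simp: represents_def)
  then have "Lr_norm r ` {f. represents f v} = {Lr_norm r F}" using F by blast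
  then show ?thesis unfolding Lr_norm_distr_def by simp
qed

text \<open>Interpolation: \<open>|F|^p\<close> is at most \<open>l^(p - 2) * |F|^2\<close>. Both
  hypotheses carry the same \<open>l\<close>, hence so does the conclusion, uniformly in
  \<open>r\<close>.\<close>

lemma Lr_norm_le:
  assumes [measurable]: "F \<in> borel_measurable borel" and r: "2 \<le> r" and l: "l > 0"
    and sup: "AE x in lborel. cmod (F x) \<le> l" and L2: "(\<integral>\<^sup>+x. ennreal ((cmod (F x))\<^sup>2) \<partial>lborel) \<le> ennreal (l\<^sup>2)"
  shows "Lr_norm r F \<le> ennreal l"
proof (cases "r = \<infinity>")
  case True
  have "esssup lborel (\<lambda>x. ennreal (cmod (F x))) \<le> ennreal l"
    using sup by (intro esssup_I) (auto elim!: eventually_mono intro: ennreal_leI)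
  then show ?thesis using True by (simp add: Lr_norm_def)
next
  case False
  define p where "p = enn2real r"
  have p: "p \<ge> 2" using enn2real_mono[OF r] False by (simp add: p_def less_top)
  define I where "I = (\<integral>\<^sup>+x. ennreal (cmod (F x) powr p) \<partial>lborel)"
  have "I \<le> (\<integral>\<^sup>+x. ennreal (l powr (p - 2)) * ennreal ((cmod (F x))\<^sup>2) \<partial>lborel)"
    unfolding I_def
  proof (rule nn_integral_mono_AE)
    show "AE x in lborel. ennreal (cmod (F x) powr p) \<le> ennreal (l powr (p - 2)) * ennreal ((cmod (F x))\<^sup>2)"
      using sup
    proof eventually_elim
      case (elim x)
      have "cmod (F x) powr p = cmod (F x) powr (p - 2) * (cmod (F x))\<^sup>2"
        using powr_add[of "cmod (F x)" "p - 2" 2] by (cases "F x = 0") (auto simp: powr_numeral)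
      also have "\<dots> \<le> l powr (p - 2) * (cmod (F x))\<^sup>2"
        using elim p by (intro mult_right_mono powr_mono2) auto
      finally show ?case by (simp add: ennreal_leI flip: ennreal_mult)
    qed
  qed
  also have "\<dots> = ennreal (l powr (p - 2)) * (\<integral>\<^sup>+x. ennreal ((cmod (F x))\<^sup>2) \<partial>lborel)"
    by (rule nn_integral_cmult) measurable
  also have "\<dots> \<le> ennreal (l powr (p - 2)) * ennreal (l\<^sup>2)"
    by (intro mult_left_mono L2) simp
  also have "\<dots> = ennreal (l powr p)"
    using l powr_add[of l "p - 2" 2] by (simp add: powr_numeral flip: ennreal_mult)
  finally have I: "I \<le> ennreal (l powr p)" .
  then have fin: "I \<noteq> \<infinity>" by (auto simp: top_unique)
  have "enn2real I \<le> l powr p" using enn2real_mono[OF I] by simp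
  then have "enn2real I powr (1 / p) \<le> (l powr p) powr (1 / p)" using p by (intro powr_mono2) auto
  also have "\<dots> = l" using l p by (simp add: powr_powr)
  finally show ?thesis using False fin by (simp add: Lr_norm_def Let_def I_def[symmetric] p_def[symmetric] ennreal_leI)
qed

text \<open>For \<open>r = \<infinity>\<close> the norm exceeds \<open>z\<close> exactly if a
  superlevel set in space has positive measure, and this measure is a parameter integral.\<close>

lemma Lr_norm_measurable:
  fixes H :: "'a \<Rightarrow> real^3 \<Rightarrow> complex"
  assumes [measurable]: "(\<lambda>p. H (fst p) (snd p)) \<in> borel_measurable (M \<Otimes>\<^sub>M borel)"
  shows "(\<lambda>\<omega>. Lr_norm r (H \<omega>)) \<in> borel_measurable M"
proof (cases "r = \<infinity>")
  case True
  have [measurable]: "(\<lambda>p. H (fst p) (snd p)) \<in> borel_measurable (M \<Otimes>\<^sub>M lborel)"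
    using assms by (simp cong: measurable_cong_sets)
  have H1: "H \<omega> \<in> borel_measurable borel" if "\<omega> \<in> space M" for \<omega>
    using measurable_compose[OF measurable_Pair1'[OF that] assms] by simp
  have "{\<omega> \<in> space M. z < Lr_norm r (H \<omega>)} \<in> sets M" for z
  proof -
    have "z < Lr_norm r (H \<omega>) \<longleftrightarrow> (\<integral>\<^sup>+x. (if z < ennreal (cmod (H \<omega> x)) then 1 else 0) \<partial>lborel) \<noteq> 0"
      if \<omega>: "\<omega> \<in> space M" for \<omega>
    proof -
      note [measurable] = H1[OF \<omega>]
      have "(\<integral>\<^sup>+x. (if z < ennreal (cmod (H \<omega> x)) then 1 else 0) \<partial>lborel) =
        (\<integral>\<^sup>+x. indicator {x \<in> space lborel. z < ennreal (cmod (H \<omega> x))} x \<partial>lborel)"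
        by (intro nn_integral_cong) (auto simp: indicator_def)
      also have "\<dots> = emeasure lborel {x \<in> space lborel. z < ennreal (cmod (H \<omega> x))}"
        by (intro nn_integral_indicator) measurable
      finally show ?thesis using True by (simp add: Lr_norm_def esssup_gt_iff)
    qed
    then have "{\<omega> \<in> space M. z < Lr_norm r (H \<omega>)} =
      {\<omega> \<in> space M. (\<integral>\<^sup>+x. (if z < ennreal (cmod (H \<omega> x)) then 1 else 0) \<partial>lborel) \<noteq> 0}" by auto
    also have "\<dots> \<in> sets M"
    proof -
      have "(\<lambda>\<omega>. \<integral>\<^sup>+x. (if z < ennreal (cmod (H \<omega> x)) then 1 else 0) \<partial>lborel) \<in> borel_measurable M"
        by (rule lborel.borel_measurable_nn_integral) (simp add: case_prod_beta')
      then show ?thesis by measurable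
    qed
    finally show ?thesis .
  qed
  then show ?thesis by (intro borel_measurableI_greater) auto
next
  case False
  have [measurable]: "(\<lambda>p. H (fst p) (snd p)) \<in> borel_measurable (M \<Otimes>\<^sub>M lborel)"
    using assms by (simp cong: measurable_cong_sets)
  have [measurable]: "(\<lambda>\<omega>. \<integral>\<^sup>+x. ennreal (cmod (H \<omega> x) powr enn2real r) \<partial>lborel) \<in> borel_measurable M"
    by (rule lborel.borel_measurable_nn_integral) (simp add: case_prod_beta')
  have "(\<lambda>\<omega>. if (\<integral>\<^sup>+x. ennreal (cmod (H \<omega> x) powr enn2real r) \<partial>lborel) = \<infinity> then \<infinity>
      else ennreal (enn2real (\<integral>\<^sup>+x. ennreal (cmod (H \<omega> x) powr enn2real r) \<partial>lborel) powr (1 / enn2real r))) \<in> borel_measurable M"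
    by measurable
  then show ?thesis using False by (simp add: Lr_norm_def Let_def)
qed

section \<open>The limit field for outcomes of finite energy\<close>

context wiener_flow
begin

definition partial_energy :: "nat \<Rightarrow> 'a \<Rightarrow> real" where
  "partial_energy k \<omega> = (\<Sum>j\<in>{0, 1}. \<Sum>n\<in>lattice_box k. (cmod (g j n \<omega>))\<^sup>2 * energy j n)"

lemma partial_energy_measurable [measurable]: "partial_energy k \<in> borel_measurable M"
  unfolding partial_energy_def[abs_def]
  by (intro borel_measurable_sum borel_measurable_times borel_measurable_power measurable_compose[OF g_measurable borel_measurable_norm] borel_measurable_const)

text \<open>Its complement is the only null event to be discarded; it depends neither on the time
  nor on the test function.\<close>

definition Good :: "'a set" where
  "Good = {\<omega>\<in>space M. (SUP k. ennreal (partial_energy k \<omega>)) \<noteq> \<infinity>}"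

lemma Good_sets [measurable]: "Good \<in> sets M"
  unfolding Good_def by measurable

lemma Good_bound:
  assumes "\<omega> \<in> Good" obtains R where "\<And>k. partial_energy k \<omega> \<le> R"
proof (rule that)
  fix k
  have S: "(SUP k. ennreal (partial_energy k \<omega>)) \<noteq> \<infinity>" using assms by (simp add: Good_def)
  have "ennreal (partial_energy k \<omega>) \<le> (SUP k. ennreal (partial_energy k \<omega>))" by (rule SUP_upper) simp
  also have "\<dots> = ennreal (enn2real (SUP k. ennreal (partial_energy k \<omega>)))" by (rule ennreal_enn2real[symmetric]) (use S in \<open>simp only: less_top infinity_ennreal_def\<close>)
  finally show "partial_energy k \<omega> \<le> enn2real (SUP k. ennreal (partial_energy k \<omega>))"
    by (subst (asm) ennreal_le_iff) auto
qed

text \<open>The expected energy is bounded through \<open>g_second_moment\<close> uniformly in the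
  box, and monotone convergence carries this to the supremum.\<close>

lemma AE_Good: "AE \<omega> in M. \<omega> \<in> Good"
proof -
  have mono: "incseq (\<lambda>k \<omega>. ennreal (partial_energy k \<omega>))"
    unfolding partial_energy_def by (intro monoI le_funI ennreal_leI sum_mono sum_mono2 lattice_box_mono) auto
  have "(\<integral>\<^sup>+\<omega>. ennreal (partial_energy k \<omega>) \<partial>M) \<le> ennreal (32 * c0 * total_energy)" for k
  proof -
    have "(\<integral>\<^sup>+\<omega>. ennreal (partial_energy k \<omega>) \<partial>M) =
      (\<integral>\<^sup>+\<omega>. (\<Sum>j\<in>{0, 1}. \<Sum>n\<in>lattice_box k. ennreal ((cmod (g j n \<omega>))\<^sup>2) * ennreal (energy j n)) \<partial>M)"
      unfolding partial_energy_def by (intro nn_integral_cong) (simp add: sum_nonneg ennreal_mult flip: sum_ennreal)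
    also have "\<dots> = (\<Sum>j\<in>{0, 1}. \<integral>\<^sup>+\<omega>. (\<Sum>n\<in>lattice_box k. ennreal ((cmod (g j n \<omega>))\<^sup>2) * ennreal (energy j n)) \<partial>M)"
      by (rule nn_integral_sum) measurable
    also have "\<dots> = (\<Sum>j\<in>{0, 1}. \<Sum>n\<in>lattice_box k. \<integral>\<^sup>+\<omega>. ennreal ((cmod (g j n \<omega>))\<^sup>2) * ennreal (energy j n) \<partial>M)"
      by (intro sum.cong refl nn_integral_sum) measurable
    also have "\<dots> \<le> (\<Sum>j\<in>{0, 1}. \<Sum>n\<in>lattice_box k. ennreal (32 * c0 * energy j n))"
    proof (rule sum_mono, rule sum_mono)
      fix j :: nat and n assume j: "j \<in> {0, 1}"
      have "(\<integral>\<^sup>+\<omega>. ennreal ((cmod (g j n \<omega>))\<^sup>2) * ennreal (energy j n) \<partial>M) = (\<integral>\<^sup>+\<omega>. ennreal ((cmod (g j n \<omega>))\<^sup>2) \<partial>M) * ennreal (energy j n)"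
        using g_measurable[OF j] by (intro nn_integral_multc) auto
      also have "\<dots> \<le> ennreal (32 * c0) * ennreal (energy j n)"
        by (intro mult_right_mono g_second_moment j) auto
      finally show "(\<integral>\<^sup>+\<omega>. ennreal ((cmod (g j n \<omega>))\<^sup>2) * ennreal (energy j n) \<partial>M) \<le> ennreal (32 * c0 * energy j n)"
        using c0 by (simp add: ennreal_mult)
    qed
    also have "\<dots> = ennreal (\<Sum>j\<in>{0, 1}. \<Sum>n\<in>lattice_box k. 32 * c0 * energy j n)"
    proof -
      have "(\<Sum>n\<in>lattice_box k. ennreal (32 * c0 * energy j n)) = ennreal (\<Sum>n\<in>lattice_box k. 32 * c0 * energy j n)" for j
        using c0 by (intro sum_ennreal) auto
      then show ?thesis using c0 by (simp only:) (intro sum_ennreal sum_nonneg, auto)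
    qed
    also have "\<dots> \<le> ennreal (32 * c0 * total_energy)"
      using c0 mult_left_mono[OF energy_sum[OF finite_lattice_box[of k]], of "32 * c0"]
      by (intro ennreal_leI) (simp only: sum_distrib_left)
    finally show ?thesis .
  qed
  then have "(SUP k. \<integral>\<^sup>+\<omega>. ennreal (partial_energy k \<omega>) \<partial>M) \<le> ennreal (32 * c0 * total_energy)" by (intro SUP_least)
  then have "(\<integral>\<^sup>+\<omega>. (SUP k. ennreal (partial_energy k \<omega>)) \<partial>M) \<le> ennreal (32 * c0 * total_energy)"
    by (subst nn_integral_monotone_convergence_SUP[OF mono]) auto
  then have "(\<integral>\<^sup>+\<omega>. (SUP k. ennreal (partial_energy k \<omega>)) \<partial>M) \<noteq> \<infinity>" by (auto simp: top_unique)
  then have "AE \<omega> in M. (SUP k. ennreal (partial_energy k \<omega>)) \<noteq> \<infinity>"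
    by (intro nn_integral_noteq_infinite) measurable
  then show ?thesis
    by (rule AE_mp) (auto simp: Good_def intro!: AE_I2)
qed

definition approx :: "nat \<Rightarrow> real \<Rightarrow> 'a \<Rightarrow> real^3 \<Rightarrow> complex" where
  "approx k t \<omega> = field (symbol t) (lattice_box k) \<omega>"

text \<open>\<open>lim\<close> is total, so this is jointly measurable in outcome, time and position
  with no exceptional set. For outcomes in \<open>Good\<close> and times in \<open>{0..T}\<close>
  the limit exists at almost every position.\<close>

definition limit_field :: "real \<Rightarrow> 'a \<Rightarrow> real^3 \<Rightarrow> complex" where
  "limit_field t \<omega> x = lim (\<lambda>k. approx k t \<omega> x)"

lemma wave_joint_measurable [measurable]:
  "(\<lambda>q. wave (symbol (fst q) j) j n (snd q)) \<in> borel_measurable (borel \<Otimes>\<^sub>M borel)"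
proof -
  have [measurable]: "(\<lambda>p. m j (fst (fst p)) (snd p)) \<in> borel_measurable ((borel \<Otimes>\<^sub>M (borel :: (real^3) measure)) \<Otimes>\<^sub>M (lborel :: (real^3) measure))"
    using measurable_compose[OF _ m_measurable[of j], where f="\<lambda>p. (fst (fst p), snd p)" and
        M="(borel \<Otimes>\<^sub>M (borel :: (real^3) measure)) \<Otimes>\<^sub>M (lborel :: (real^3) measure)"] by simp
  show ?thesis
    unfolding wave_def inv_fourier_def
    by (intro borel_measurable_times borel_measurable_const lborel.borel_measurable_lebesgue_integral) (simp add: case_prod_beta')
qed

lemma approx_joint_measurable [measurable]:
  "(\<lambda>p. approx k (snd (fst p)) (fst (fst p)) (snd p)) \<in> borel_measurable ((M \<Otimes>\<^sub>M borel) \<Otimes>\<^sub>M borel)"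
proof -
  have "(\<lambda>p. g j n (fst (fst p))) \<in> borel_measurable ((M \<Otimes>\<^sub>M (borel :: real measure)) \<Otimes>\<^sub>M (borel :: (real^3) measure))"
    if "j \<in> {0, 1}" for j n
    using g_measurable[OF that] by measurable
  moreover have "(\<lambda>p. wave (symbol (snd (fst p)) j) j n (snd p)) \<in> borel_measurable ((M \<Otimes>\<^sub>M borel) \<Otimes>\<^sub>M borel)" for j n
    using measurable_compose[OF _ wave_joint_measurable[of j n], where f="\<lambda>p. (snd (fst p), snd p)" and M="(M \<Otimes>\<^sub>M borel) \<Otimes>\<^sub>M borel"]
    by simp
  ultimately show ?thesis
    unfolding approx_def field_def by (intro borel_measurable_sum borel_measurable_times)
qed

lemma limit_field_joint_measurable [measurable]:
  "(\<lambda>p. limit_field (snd (fst p)) (fst (fst p)) (snd p)) \<in> borel_measurable ((M \<Otimes>\<^sub>M borel) \<Otimes>\<^sub>M borel)"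
  unfolding limit_field_def by (rule borel_measurable_lim_metric) measurable

lemma approx_measurable [measurable]: "approx k t \<omega> \<in> borel_measurable borel"
  unfolding approx_def field_def[abs_def] by measurable

lemma limit_field_measurable [measurable]: "limit_field t \<omega> \<in> borel_measurable borel"
  unfolding limit_field_def[abs_def] by (rule borel_measurable_lim_metric) measurable

context
  fixes t :: real and \<omega> :: 'a and R :: real
  assumes t: "t \<in> {0..T}" and R: "\<And>k. partial_energy k \<omega> \<le> R"
begin

lemma symbol_jap: "j \<in> {0, 1} \<Longrightarrow> cmod (symbol t j \<xi>) \<le> A * jap \<xi> powr (- real j)"
  using m_bound t by simp

lemma R': "(\<Sum>j\<in>{0, 1}. \<Sum>n\<in>lattice_box k. (cmod (g j n \<omega>))\<^sup>2 * energy j n) \<le> R"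
  using R[of k] by (simp add: partial_energy_def)

lemma R0: "R \<ge> 0"
  by (rule R_nonneg[where \<kappa>="symbol t", OF _ _ symbol_jap R']) (use A in auto)

lemma approx_eq: "approx k t \<omega> = inv_fourier (spectrum (symbol t) (\<lambda>j n. g j n \<omega>) (lattice_box k))"
  and approx_spectrum_integrable: "integrable lborel (spectrum (symbol t) (\<lambda>j n. g j n \<omega>) (lattice_box k))"
  unfolding approx_def using A t symbol_bound by (intro field_eq_inv_fourier[where \<beta>=A]; auto)+

lemma approx_diff_L2:
  assumes kl: "k \<le> l"
  shows "(\<integral>\<^sup>+x. ennreal ((cmod (approx l t \<omega> x - approx k t \<omega> x))\<^sup>2) \<partial>lborel) \<le> ennreal (54 * A\<^sup>2 * R * (gain ^ k)\<^sup>2)"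
proof -
  define B where "B = lattice_box l - lattice_box k"
  have B: "finite B" "B \<inter> lattice_box k = {}" by (auto simp: B_def)
  have d: "approx l t \<omega> x - approx k t \<omega> x = field (symbol t) B \<omega> x" for x
    unfolding approx_def field_def sum_subtractf[symmetric] B_def
    by (intro sum.cong refl) (simp add: sum_diff lattice_box_mono kl)
  have fe: "field (symbol t) B \<omega> = inv_fourier (spectrum (symbol t) (\<lambda>j n. g j n \<omega>) B)"
    "integrable lborel (spectrum (symbol t) (\<lambda>j n. g j n \<omega>) B)"
    using A t symbol_bound B by (intro field_eq_inv_fourier[where \<beta>=A]; auto)+
  show ?thesis
    unfolding d fe(1)
    by (rule order_trans[OF plancherel_le[OF fe(2)] spectrum_far_bound[OF _ _ symbol_jap R' B]]) (use A in auto)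
qed

lemma approx_L2: "(\<integral>\<^sup>+x. ennreal ((cmod (approx k t \<omega> x))\<^sup>2) \<partial>lborel) \<le> ennreal (54 * A\<^sup>2 * R)"
  unfolding approx_eq
  by (rule order_trans[OF plancherel_le[OF approx_spectrum_integrable] spectrum_bound[OF _ _ symbol_jap R']]) (use A in auto)

lemma approx_AE_tendsto: "AE x in lborel. (\<lambda>k. approx k t \<omega> x) \<longlonglongrightarrow> limit_field t \<omega> x"
proof -
  have "AE x in lborel. convergent (\<lambda>k. approx k t \<omega> x)"
    by (rule L2_fast_Cauchy_AE_convergent[OF _ gain, where C="54 * A\<^sup>2 * R"]) (use approx_diff_L2 R0 in auto)
  then show ?thesis by (rule AE_mp) (auto simp: limit_field_def convergent_LIMSEQ_iff)
qed

lemma limit_field_approx: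
  "(\<integral>\<^sup>+x. ennreal ((cmod (limit_field t \<omega> x - approx k t \<omega> x))\<^sup>2) \<partial>lborel) \<le> ennreal (54 * A\<^sup>2 * R * (gain ^ k)\<^sup>2)"
  by (rule Fatou_L2[OF _ approx_AE_tendsto eventually_sequentiallyI[of k, OF approx_diff_L2]]) auto

lemma limit_field_L2: "(\<integral>\<^sup>+x. ennreal ((cmod (limit_field t \<omega> x))\<^sup>2) \<partial>lborel) \<le> ennreal (54 * A\<^sup>2 * R)"
proof -
  have "(\<integral>\<^sup>+x. ennreal ((cmod (limit_field t \<omega> x - 0))\<^sup>2) \<partial>lborel) \<le> ennreal (54 * A\<^sup>2 * R)"
    by (rule Fatou_L2[OF _ approx_AE_tendsto]) (use approx_L2 in auto)
  then show ?thesis by simp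
qed

lemma limit_field_pairing:
  assumes \<phi>: "\<phi> \<in> schwartz"
  shows "integrable lborel (\<lambda>x. limit_field t \<omega> x * \<phi> x)"
    and "(\<integral>x. limit_field t \<omega> x * \<phi> x \<partial>lborel) = (\<integral>\<xi>. full_spectrum (symbol t) (\<lambda>j n. g j n \<omega>) \<xi> * inv_fourier \<phi> \<xi> \<partial>lborel)"
proof -
  note [measurable] = schwartz_measurable[OF \<phi>] fourier_measurable(2)[OF schwartz_measurable[OF \<phi>]]
  obtain P where P: "P \<ge> 0" and P1: "(\<integral>\<^sup>+x. ennreal ((cmod (\<phi> x))\<^sup>2) \<partial>lborel) \<le> ennreal P"
    and P2: "(\<integral>\<^sup>+x. ennreal ((cmod (inv_fourier \<phi> x))\<^sup>2) \<partial>lborel) \<le> ennreal P"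
    by (rule schwartz_L2[OF \<phi>])
  have gt: "(\<lambda>k. 54 * A\<^sup>2 * R * (gain ^ k)\<^sup>2) \<longlonglongrightarrow> 0"
    by (rule gain_tendsto[OF _ _ symbol_jap R']) (use A in auto)
  have pt: "integrable lborel (\<lambda>x. limit_field t \<omega> x * \<phi> x)"
    "(\<lambda>k. \<integral>x. approx k t \<omega> x * \<phi> x \<partial>lborel) \<longlonglongrightarrow> (\<integral>x. limit_field t \<omega> x * \<phi> x \<partial>lborel)"
    by (rule pairing_tendsto[OF _ _ _ P1 P limit_field_L2 _ limit_field_approx _ gt]; use R0 in simp)+
  then show "integrable lborel (\<lambda>x. limit_field t \<omega> x * \<phi> x)" by simp
  have "(\<integral>x. approx k t \<omega> x * \<phi> x \<partial>lborel) =
     (\<integral>\<xi>. spectrum (symbol t) (\<lambda>j n. g j n \<omega>) (lattice_box k) \<xi> * inv_fourier \<phi> \<xi> \<partial>lborel)" for k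
    unfolding approx_eq by (rule inv_fourier_pairing[OF approx_spectrum_integrable schwartz_integrable[OF \<phi>]])
  moreover have "(\<lambda>k. \<integral>\<xi>. spectrum (symbol t) (\<lambda>j n. g j n \<omega>) (lattice_box k) \<xi> * inv_fourier \<phi> \<xi> \<partial>lborel) \<longlonglongrightarrow>
     (\<integral>\<xi>. full_spectrum (symbol t) (\<lambda>j n. g j n \<omega>) \<xi> * inv_fourier \<phi> \<xi> \<partial>lborel)"
    by (rule full_spectrum_pairing(2)[OF _ _ symbol_jap R' _ P2 P]) (use A in auto)
  ultimately show "(\<integral>x. limit_field t \<omega> x * \<phi> x \<partial>lborel) = (\<integral>\<xi>. full_spectrum (symbol t) (\<lambda>j n. g j n \<omega>) \<xi> * inv_fourier \<phi> \<xi> \<partial>lborel)"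
    using pt(2) by (intro LIMSEQ_unique) auto
qed

text \<open>Both sides pair with a test function through \<open>full_spectrum\<close>: the limit
  field by passing to the limit in the truncated pairings, the propagated distribution because the
  transform of the randomized datum \<open>j\<close> is \<open>h j\<close>.\<close>

lemma limit_field_represents:
  assumes u: "\<And>j. j \<in> {0, 1} \<Longrightarrow> fourier_fun (u j) = f j"
  shows "represents (limit_field t \<omega>) (\<lambda>\<phi>. \<Sum>j\<in>{0, 1}. multiplier (symbol t j) (randomize \<psi> (g j) (u j) \<omega>) \<phi>)"
proof -
  define h where "h j \<xi> = f j \<xi> * (\<Sum>n\<in>overlap \<xi>. g j n \<omega> * piece n \<xi>)" for j \<xi>
  have "(\<Sum>j\<in>{0, 1}. multiplier (symbol t j) (randomize \<psi> (g j) (u j) \<omega>) \<phi>) = (\<integral>x. limit_field t \<omega> x * \<phi> x \<partial>lborel)"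
    if \<phi>: "\<phi> \<in> schwartz" for \<phi>
  proof -
    note [measurable] = schwartz_measurable[OF \<phi>] fourier_measurable(2)[OF schwartz_measurable[OF \<phi>]]
    obtain P where P: "P \<ge> 0" "(\<integral>\<^sup>+x. ennreal ((cmod (inv_fourier \<phi> x))\<^sup>2) \<partial>lborel) \<le> ennreal P"
      using schwartz_L2[OF \<phi>] by blast
    have mj: "multiplier (symbol t j) (randomize \<psi> (g j) (u j) \<omega>) \<phi> = (\<integral>\<xi>. symbol t j \<xi> * h j \<xi> * inv_fourier \<phi> \<xi> \<partial>lborel) \<and>
       integrable lborel (\<lambda>\<xi>. symbol t j \<xi> * h j \<xi> * inv_fourier \<phi> \<xi>)" if j: "j \<in> {0, 1}" for j
    proof -
      \<comment> \<open>Vanishes on the other datum, so that each of the two summands is integrable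
        by itself.\<close>
      define \<kappa> where "\<kappa> i \<xi> = (if i = j then symbol t i \<xi> else 0)" for i \<xi>
      have [measurable]: "\<kappa> i \<in> borel_measurable borel" for i unfolding \<kappa>_def[abs_def] by (cases "i = j") auto
      have \<kappa>b: "cmod (\<kappa> i \<xi>) \<le> A * jap \<xi> powr (- real i)" if "i \<in> {0, 1}" for i \<xi>
        using symbol_jap[OF that, of \<xi>] A by (cases "i = j") (simp_all only: \<kappa>_def if_True if_False norm_zero, auto)
      have fs: "full_spectrum \<kappa> (\<lambda>j n. g j n \<omega>) \<xi> = symbol t j \<xi> * h j \<xi>" for \<xi>
        unfolding full_spectrum_def spectrum_eq using j by (auto simp: \<kappa>_def h_def mult.assoc)
      have int: "integrable lborel (\<lambda>\<xi>. symbol t j \<xi> * h j \<xi> * inv_fourier \<phi> \<xi>)"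
        unfolding fs[symmetric] by (rule full_spectrum_pairing(1)[OF _ _ \<kappa>b R' _ P(2) P(1)]) (use A in auto)
      have rep: "represents (h j) (fourier_distr (randomize \<psi> (g j) (u j) \<omega>))"
        unfolding h_def by (rule randomize_represents[OF j u[OF j] R'])
      have rep': "represents (fourier_fun (randomize \<psi> (g j) (u j) \<omega>)) (fourier_distr (randomize \<psi> (g j) (u j) \<omega>))"
        by (rule represents_fourier_fun[OF rep])
      have [measurable]: "fourier_fun (randomize \<psi> (g j) (u j) \<omega>) \<in> borel_measurable borel" "h j \<in> borel_measurable borel"
        using rep rep' by (auto simp: represents_def)
      have "multiplier (symbol t j) (randomize \<psi> (g j) (u j) \<omega>) \<phi> = (\<integral>\<xi>. symbol t j \<xi> * h j \<xi> * inv_fourier \<phi> \<xi> \<partial>lborel)"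
        unfolding multiplier_def using represents_unique[OF rep' rep]
        by (intro integral_cong_AE) (measurable, auto elim!: eventually_mono)
      with int show ?thesis by simp
    qed
    have "(\<Sum>j\<in>{0, 1}. multiplier (symbol t j) (randomize \<psi> (g j) (u j) \<omega>) \<phi>) =
      (\<Sum>j\<in>{0, 1}. \<integral>\<xi>. symbol t j \<xi> * h j \<xi> * inv_fourier \<phi> \<xi> \<partial>lborel)"
      using mj by (intro sum.cong refl) blast
    also have "\<dots> = (\<integral>\<xi>. (\<Sum>j\<in>{0, 1}. symbol t j \<xi> * h j \<xi> * inv_fourier \<phi> \<xi>) \<partial>lborel)"
      using mj by (intro Bochner_Integration.integral_sum[symmetric]) blast
    also have "\<dots> = (\<integral>\<xi>. full_spectrum (symbol t) (\<lambda>j n. g j n \<omega>) \<xi> * inv_fourier \<phi> \<xi> \<partial>lborel)"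
    proof (intro Bochner_Integration.integral_cong refl)
      fix \<xi>
      show "(\<Sum>j\<in>{0, 1}. symbol t j \<xi> * h j \<xi> * inv_fourier \<phi> \<xi>) = full_spectrum (symbol t) (\<lambda>j n. g j n \<omega>) \<xi> * inv_fourier \<phi> \<xi>"
        unfolding full_spectrum_def spectrum_eq sum_distrib_right h_def by (intro sum.cong refl) (simp only: mult.assoc)
    qed
    also have "\<dots> = (\<integral>x. limit_field t \<omega> x * \<phi> x \<partial>lborel)" by (rule limit_field_pairing(2)[OF \<phi>, symmetric])
    finally show ?thesis .
  qed
  then show ?thesis
    unfolding represents_def using limit_field_pairing(1) by simp
qed

end

end

section \<open>Tail bounds for the limit field\<close>

context wiener_flow
begin

text \<open>Two events are discarded, a failure of the chained sup bound and a large random energy.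
  The second has the better exponent, so both are measured by
  \<open>chain_exponent l / 2\<close>.\<close>

lemma truncated_bound:
  assumes l: "l > 0" and L: "chain_exponent l \<ge> 1"
  shows "\<exists>E\<in>sets M. emeasure M E \<le> ennreal ((16 * chain_const + 2) * (1 + T) * exp (- chain_exponent l / 2)) \<and>
    (\<forall>\<omega>\<in>space M - E. \<forall>t\<in>{0..T}. (\<forall>x. cmod (approx k t \<omega> x) \<le> l) \<and>
      (\<integral>\<^sup>+x. ennreal ((cmod (approx k t \<omega> x))\<^sup>2) \<partial>lborel) \<le> ennreal (l\<^sup>2))"
proof -
  obtain E1 where E1: "E1 \<in> sets M" "emeasure M E1 \<le> ennreal (16 * chain_const * (1 + T) * exp (- chain_exponent l / 2))"
    "\<And>\<omega> t x. \<omega> \<in> space M - E1 \<Longrightarrow> t \<in> {0..T} \<Longrightarrow> cmod (field (symbol t) (lattice_box k) \<omega> x) \<le> l"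
    by (rule truncated_sup_bound[OF finite_lattice_box[of k] uminus_lattice_box l L]) blast
  \<comment> \<open>The level of energy at which \<open>field_L2\<close> gives exactly
    \<open>l^2\<close>.\<close>
  define s where "s = l\<^sup>2 / (54 * A\<^sup>2)"
  define E2 where "E2 = {\<omega>\<in>space M. s < partial_energy k \<omega>}"
  have E2[measurable]: "E2 \<in> sets M" unfolding E2_def by measurable
  have pe: "partial_energy k \<omega> = (\<Sum>p\<in>{0, 1} \<times> lattice_box k. energy (fst p) (snd p) * (norm (g (fst p) (snd p) \<omega>))\<^sup>2)" for \<omega>
    unfolding partial_energy_def sum.cartesian_product by (intro sum.cong refl) (simp add: case_prod_beta mult.commute)
  have "emeasure M E2 \<le> ennreal (2 * exp (- s / (16 * c0 * total_energy)))"
    unfolding E2_def pe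
  proof (rule exp_square_norm_weighted_sum)
    show "(\<Sum>p\<in>{0, 1} \<times> lattice_box k. energy (fst p) (snd p)) \<le> total_energy"
      using energy_sum[OF finite_lattice_box[of k]] unfolding sum.cartesian_product by (simp only: case_prod_unfold)
  qed (use g_measurable g_exp_square total_energy_pos c0 in auto)
  also have "\<dots> \<le> ennreal (2 * (1 + T) * exp (- chain_exponent l / 2))"
  proof (rule ennreal_leI)
    have r: "(1 - ratio)\<^sup>2 \<le> 1" using ratio by (intro power_le_one) auto
    have "chain_exponent l / 2 = (l\<^sup>2 / (9216 * c0 * A\<^sup>2 * total_energy)) * (1 - ratio)\<^sup>2"
      by (simp add: chain_exponent_def)
    also have "\<dots> \<le> (l\<^sup>2 / (9216 * c0 * A\<^sup>2 * total_energy)) * 1"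
      using c0 total_energy_pos by (intro mult_left_mono r) auto
    also have "\<dots> \<le> s / (16 * c0 * total_energy)"
      using c0 A total_energy_pos by (simp add: s_def frac_le)
    finally have "exp (- s / (16 * c0 * total_energy)) \<le> exp (- chain_exponent l / 2)" by simp
    moreover have "1 * exp (- chain_exponent l / 2) \<le> (1 + T) * exp (- chain_exponent l / 2)"
      using T by (intro mult_right_mono) auto
    ultimately show "2 * exp (- s / (16 * c0 * total_energy)) \<le> 2 * (1 + T) * exp (- chain_exponent l / 2)"
      by linarith
  qed
  finally have e2: "emeasure M E2 \<le> ennreal (2 * (1 + T) * exp (- chain_exponent l / 2))" .
  show ?thesis
  proof (intro bexI[of _ "E1 \<union> E2"] conjI ballI allI)
    have "emeasure M (E1 \<union> E2) \<le> emeasure M E1 + emeasure M E2" by (intro emeasure_subadditive E1 E2)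
    also have "\<dots> \<le> ennreal (16 * chain_const * (1 + T) * exp (- chain_exponent l / 2)) + ennreal (2 * (1 + T) * exp (- chain_exponent l / 2))"
      by (intro add_mono E1 e2)
    also have "\<dots> = ennreal ((16 * chain_const + 2) * (1 + T) * exp (- chain_exponent l / 2))"
      using T chain_const_nonneg by (subst ennreal_plus[symmetric]) (auto simp: algebra_simps)
    finally show "emeasure M (E1 \<union> E2) \<le> ennreal ((16 * chain_const + 2) * (1 + T) * exp (- chain_exponent l / 2))" .
    show "E1 \<union> E2 \<in> sets M" using E1 E2 by auto
    fix \<omega> t assume w: "\<omega> \<in> space M - (E1 \<union> E2)" and t: "t \<in> {0..T}"
    show "cmod (approx k t \<omega> x) \<le> l" for x using E1(3)[of \<omega> t x] w t by (simp add: approx_def)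
    have "54 * A\<^sup>2 * partial_energy k \<omega> \<le> 54 * A\<^sup>2 * s"
      using w by (intro mult_left_mono) (auto simp: E2_def)
    also have "\<dots> = l\<^sup>2" using A by (simp add: s_def)
    finally have "54 * A\<^sup>2 * partial_energy k \<omega> \<le> l\<^sup>2" .
    then show "(\<integral>\<^sup>+x. ennreal ((cmod (approx k t \<omega> x))\<^sup>2) \<partial>lborel) \<le> ennreal (l\<^sup>2)"
      using field_L2[OF finite_lattice_box[of k] t, of \<omega>] unfolding approx_def partial_energy_def
      by (rule order_trans[rotated, OF ennreal_leI])
  qed
qed

text \<open>The bad event varies with the truncation, and the union over all truncations may be
  large. Only outcomes that are bad for all large \<open>k\<close> are discarded: they form an
  increasing union of intersections, each as small as a single bad event. Any other outcome is good
  along a subsequence, which already determines the limit.\<close>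

lemma limit_bound:
  assumes l: "l > 0" and L: "chain_exponent l \<ge> 1" and r: "2 \<le> r"
  obtains E where "E \<in> sets M"
    "emeasure M E \<le> ennreal ((16 * chain_const + 2) * (1 + T) * exp (- chain_exponent l / 2))"
    "\<And>\<omega> t. \<omega> \<in> Good - E \<Longrightarrow> t \<in> {0..T} \<Longrightarrow> Lr_norm r (limit_field t \<omega>) \<le> ennreal l"
proof -
  obtain Bad where Bad: "\<And>k. Bad k \<in> sets M"
    "\<And>k. emeasure M (Bad k) \<le> ennreal ((16 * chain_const + 2) * (1 + T) * exp (- chain_exponent l / 2))"
    "\<And>k \<omega> t x. \<omega> \<in> space M - Bad k \<Longrightarrow> t \<in> {0..T} \<Longrightarrow> cmod (approx k t \<omega> x) \<le> l"
    "\<And>k \<omega> t. \<omega> \<in> space M - Bad k \<Longrightarrow> t \<in> {0..T} \<Longrightarrow> (\<integral>\<^sup>+x. ennreal ((cmod (approx k t \<omega> x))\<^sup>2) \<partial>lborel) \<le> ennreal (l\<^sup>2)"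
    using truncated_bound[OF l L] by metis
  define D where "D n = (\<Inter>k\<in>{n..}. Bad k)" for n
  have D: "D n \<in> sets M" for n unfolding D_def using Bad(1) by (intro sets.countable_INT') auto
  show thesis
  proof (rule that[of "\<Union>n. D n"])
    show "(\<Union>n. D n) \<in> sets M" using D by auto
    have "emeasure M (\<Union>n. D n) = (SUP n. emeasure M (D n))"
      by (rule SUP_emeasure_incseq[symmetric]) (use D in \<open>auto simp: D_def incseq_def\<close>)
    also have "\<dots> \<le> ennreal ((16 * chain_const + 2) * (1 + T) * exp (- chain_exponent l / 2))"
    proof (rule SUP_least)
      fix n
      have "emeasure M (D n) \<le> emeasure M (Bad n)" by (intro emeasure_mono Bad) (auto simp: D_def)
      with Bad(2) show "emeasure M (D n) \<le> ennreal ((16 * chain_const + 2) * (1 + T) * exp (- chain_exponent l / 2))"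
        by (rule order_trans[rotated])
    qed
    finally show "emeasure M (\<Union>n. D n) \<le> ennreal ((16 * chain_const + 2) * (1 + T) * exp (- chain_exponent l / 2))" .
    fix \<omega> t assume w: "\<omega> \<in> Good - (\<Union>n. D n)" and t: "t \<in> {0..T}"
    have "\<forall>n. \<exists>k\<ge>n. \<omega> \<notin> Bad k" using w by (auto simp: D_def)
    then obtain q where q: "\<And>n. q n \<ge> n" "\<And>n. \<omega> \<notin> Bad (q n)" by metis
    have ws: "\<omega> \<in> space M - Bad (q n)" for n using w q by (auto simp: Good_def)
    have qt: "filterlim q at_top sequentially"
      by (rule filterlim_at_top_mono[OF filterlim_ident]) (simp add: q)
    obtain R where R: "\<And>k. partial_energy k \<omega> \<le> R" using Good_bound w by blast
    have lim: "AE x in lborel. (\<lambda>n. approx (q n) t \<omega> x) \<longlonglongrightarrow> limit_field t \<omega> x"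
      using approx_AE_tendsto[OF t R] by (rule AE_mp) (auto intro!: AE_I2 filterlim_compose[OF _ qt])
    show "Lr_norm r (limit_field t \<omega>) \<le> ennreal l"
    proof (rule Lr_norm_le[OF _ r l])
      show "AE x in lborel. cmod (limit_field t \<omega> x) \<le> l"
        using lim
      proof eventually_elim
        case (elim x)
        show ?case by (rule Lim_bounded[OF tendsto_norm[OF elim], of 0]) (use Bad(3)[OF ws t] in auto)
      qed
      have "(\<integral>\<^sup>+x. ennreal ((cmod (limit_field t \<omega> x - 0))\<^sup>2) \<partial>lborel) \<le> ennreal (l\<^sup>2)"
        by (rule Fatou_L2[OF _ lim]) (use Bad(4)[OF ws t] in auto)
      then show "(\<integral>\<^sup>+x. ennreal ((cmod (limit_field t \<omega> x))\<^sup>2) \<partial>lborel) \<le> ennreal (l\<^sup>2)" by simp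
    qed simp
  qed
qed

text \<open>On \<open>Good\<close> the event is the measurable set where \<open>h\<close> is
  nonzero, and the rest lies in a null set, whence the completion. When
  \<open>chain_exponent l\<close> is below 1 the right-hand side is at least 1.\<close>

lemma exceed_event_bound:
  assumes r: "2 \<le> r" and l: "l > 0"
    and rep: "\<And>\<omega> t. \<omega> \<in> Good \<Longrightarrow> t \<in> {0..T} \<Longrightarrow> represents (limit_field t \<omega>) (v \<omega> t)"
  shows "exceed_event M v T r l \<in> sets (completion M)"
    and "measure (completion M) (exceed_event M v T r l) \<le> (16 * chain_const + 2) * (1 + T) * exp (- chain_exponent l / 2)"
proof -
  define Y where "Y \<omega> t = Lr_norm r (limit_field t \<omega>)" for \<omega> t
  have Y: "(\<lambda>p. Y (fst p) (snd p)) \<in> borel_measurable (M \<Otimes>\<^sub>M borel)"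
    unfolding Y_def by (rule Lr_norm_measurable) (rule limit_field_joint_measurable)
  then have [measurable]: "(\<lambda>p. Y (fst p) (snd p)) \<in> borel_measurable (M \<Otimes>\<^sub>M lborel)"
    by (simp cong: measurable_cong_sets)
  \<comment> \<open>The Lebesgue measure of the times at which the norm exceeds
    \<open>l\<close>.\<close>
  define h where "h \<omega> = (\<integral>\<^sup>+t. (if 0 \<le> t \<and> t \<le> T \<and> ennreal l < Y \<omega> t then 1 else 0) \<partial>lborel)" for \<omega>
  have [measurable]: "h \<in> borel_measurable M"
    unfolding h_def[abs_def] by (rule lborel.borel_measurable_nn_integral) (simp add: case_prod_beta')
  have h: "ennreal l < Linf_Lr_norm T r (v \<omega>) \<longleftrightarrow> h \<omega> \<noteq> 0" if w: "\<omega> \<in> Good" for \<omega>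
  proof -
    have [measurable]: "Y \<omega> \<in> borel_measurable borel"
      using measurable_compose[OF measurable_Pair1' Y, of \<omega>] w by (simp add: Good_def)
    have Yl: "Y \<omega> \<in> borel_measurable (lebesgue_on {0..T})"
      by (intro measurable_restrict_space1 measurable_completion) simp
    have eq: "Lr_norm_distr r (v \<omega> t) = Y \<omega> t" if "t \<in> {0..T}" for t
      unfolding Y_def by (rule Lr_norm_distr_eq[OF rep[OF w that]])
    have m: "(\<lambda>t. Lr_norm_distr r (v \<omega> t)) \<in> borel_measurable (lebesgue_on {0..T})"
      using Yl by (rule measurable_cong[THEN iffD1, rotated]) (simp add: eq)
    have "ennreal l < Linf_Lr_norm T r (v \<omega>) \<longleftrightarrow>
       emeasure (lebesgue_on {0..T}) {t \<in> space (lebesgue_on {0..T}). ennreal l < Lr_norm_distr r (v \<omega> t)} \<noteq> 0"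
      unfolding Linf_Lr_norm_def by (rule esssup_gt_iff[OF m])
    also have "{t \<in> space (lebesgue_on {0..T}). ennreal l < Lr_norm_distr r (v \<omega> t)} = {t. 0 \<le> t \<and> t \<le> T \<and> ennreal l < Y \<omega> t}"
      using eq by auto
    also have "emeasure (lebesgue_on {0..T}) \<dots> = emeasure lebesgue {t. 0 \<le> t \<and> t \<le> T \<and> ennreal l < Y \<omega> t}"
      by (rule emeasure_restrict_space) auto
    also have "\<dots> = emeasure lborel {t. 0 \<le> t \<and> t \<le> T \<and> ennreal l < Y \<omega> t}"
      by (subst emeasure_completion) (auto intro!: sets_completionI_sets)
    also have "\<dots> = (\<integral>\<^sup>+t. indicator {t. 0 \<le> t \<and> t \<le> T \<and> ennreal l < Y \<omega> t} t \<partial>lborel)"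
      by (rule nn_integral_indicator[symmetric]) measurable
    also have "\<dots> = h \<omega>"
      unfolding h_def by (intro nn_integral_cong) (auto simp: indicator_def)
    finally show ?thesis .
  qed
  define X where "X = exceed_event M v T r l"
  define E' where "E' = {\<omega>\<in>Good. h \<omega> \<noteq> 0}"
  have GM: "Good \<subseteq> space M" by (auto simp: Good_def)
  have "E' = Good \<inter> {\<omega>\<in>space M. h \<omega> \<noteq> 0}" using GM by (auto simp: E'_def)
  then have E': "E' \<in> sets M" by simp
  have "space M - Good \<in> null_sets M"
    using AE_Good by (subst AE_iff_null_sets) (auto elim!: eventually_mono)
  then have N: "space M - Good \<in> null_sets (completion M)" by (rule null_sets_completionI)
  have X: "X = E' \<union> (X - Good)" "X - Good \<subseteq> space M - Good"
    using h GM by (auto simp: X_def exceed_event_def E'_def)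
  have XN: "X - Good \<in> null_sets (completion M)" by (rule null_sets_completion_subset[OF X(2) N])
  have "E' \<union> (X - Good) \<in> sets (completion M)" by (rule sets.Un[OF sets_completionI_sets[OF E'] null_setsD2[OF XN]])
  with X(1) have "X \<in> sets (completion M)" by simp
  then show "exceed_event M v T r l \<in> sets (completion M)" by (simp add: X_def)
  have "emeasure (completion M) X = emeasure (completion M) (E' \<union> (X - Good))" using X(1) by simp
  also have "\<dots> = emeasure (completion M) E'"
    by (intro emeasure_Un_null_set XN sets_completionI_sets E')
  also have "\<dots> = emeasure M E'" using E' by (simp add: sets_completionI_sets)
  finally have XE: "emeasure (completion M) X = emeasure M E'" .
  have "emeasure M E' \<le> ennreal ((16 * chain_const + 2) * (1 + T) * exp (- chain_exponent l / 2))"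
  proof (cases "chain_exponent l \<ge> 1")
    case True
    obtain E where E: "E \<in> sets M"
      "emeasure M E \<le> ennreal ((16 * chain_const + 2) * (1 + T) * exp (- chain_exponent l / 2))"
      "\<And>\<omega> t. \<omega> \<in> Good - E \<Longrightarrow> t \<in> {0..T} \<Longrightarrow> Lr_norm r (limit_field t \<omega>) \<le> ennreal l"
      by (rule limit_bound[OF l True r]) blast
    have "h \<omega> = 0" if w: "\<omega> \<in> Good - E" for \<omega>
    proof -
      have Z: "\<not> ennreal l < Y \<omega> t" if "0 \<le> t" "t \<le> T" for t
        using E(3)[OF w, of t] that by (simp add: Y_def not_less)
      have "h \<omega> = (\<integral>\<^sup>+t. 0 \<partial>(lborel :: real measure))"
        unfolding h_def by (rule nn_integral_cong) (use Z in auto)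
      then show ?thesis by simp
    qed
    then have "E' \<subseteq> E" by (auto simp: E'_def)
    then have "emeasure M E' \<le> emeasure M E" by (intro emeasure_mono E)
    with E(2) show ?thesis by (rule order_trans[rotated])
  next
    case False
    have "1 / 2 \<le> 1 - chain_exponent l / 2" using False by simp
    also have "\<dots> \<le> exp (- chain_exponent l / 2)" using exp_ge_add_one_self[of "- chain_exponent l / 2"] by simp
    finally have ex: "1 / 2 \<le> exp (- chain_exponent l / 2)" .
    have "2 * 1 \<le> (16 * chain_const + 2) * (1 + T)"
      using T chain_const_nonneg by (intro mult_mono) auto
    then have "2 * (1 / 2) \<le> (16 * chain_const + 2) * (1 + T) * exp (- chain_exponent l / 2)"
      using ex by (intro mult_mono) auto
    then have "1 \<le> (16 * chain_const + 2) * (1 + T) * exp (- chain_exponent l / 2)" by simp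
    then have "1 \<le> ennreal ((16 * chain_const + 2) * (1 + T) * exp (- chain_exponent l / 2))"
      using ennreal_leI[of 1] by simp
    with emeasure_le_1 show ?thesis by (rule order_trans)
  qed
  then have "enn2real (emeasure (completion M) X) \<le> (16 * chain_const + 2) * (1 + T) * exp (- chain_exponent l / 2)"
    unfolding XE using T chain_const_nonneg by (intro enn2real_leI) auto
  then show "measure (completion M) (exceed_event M v T r l) \<le> (16 * chain_const + 2) * (1 + T) * exp (- chain_exponent l / 2)"
    by (simp add: X_def measure_def)
qed

end

section \<open>The symbols of the propagators\<close>

lemma abs_cos_diff_le: "\<bar>cos a - cos b\<bar> \<le> \<bar>a - b\<bar>" for a b :: real
proof -
  have "\<bar>cos a - cos b\<bar> = 2 * \<bar>sin ((a + b) / 2)\<bar> * \<bar>sin ((b - a) / 2)\<bar>"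
    by (simp add: cos_diff_cos abs_mult)
  also have "\<dots> \<le> 2 * 1 * \<bar>(b - a) / 2\<bar>"
    by (intro mult_mono abs_sin_x_le_abs_x abs_sin_le_one) auto
  finally show ?thesis by simp
qed

lemma abs_sin_diff_le: "\<bar>sin a - sin b\<bar> \<le> \<bar>a - b\<bar>" for a b :: real
proof -
  have "\<bar>sin a - sin b\<bar> = 2 * \<bar>sin ((a - b) / 2)\<bar> * \<bar>cos ((a + b) / 2)\<bar>"
    by (simp add: sin_diff_sin abs_mult)
  also have "\<dots> \<le> 2 * \<bar>(a - b) / 2\<bar> * 1"
    by (intro mult_mono abs_sin_x_le_abs_x abs_cos_le_one) auto
  finally show ?thesis by simp
qed

text \<open>The origin of \<open>max 1 T\<close>: high frequencies give
  \<open>1 / norm \<xi>\<close>, but at low frequencies only \<open>|sin (t \<rho>)|\<close> at most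
  \<open>t \<rho>\<close> is available, so the symbol can be as large as \<open>T\<close>. The
  factor \<open>sqrt 2\<close> compares \<open>jap\<close> with \<open>max 1 \<rho>\<close>.\<close>

lemma jap_mult_sin_symbol_le:
  assumes "0 \<le> t" "t \<le> T"
  shows "jap \<xi> * \<bar>sin_symbol t \<xi>\<bar> \<le> sqrt 2 * max 1 T"
proof -
  define \<rho> where "\<rho> = norm \<xi>"
  have j: "jap \<xi> \<le> sqrt 2 * max 1 \<rho>"
  proof -
    have "1 + \<rho>\<^sup>2 \<le> 2 * (max 1 \<rho>)\<^sup>2"
    proof (cases "1 \<le> \<rho>")
      case True then show ?thesis using one_le_power[of \<rho> 2] by (simp add: max_absorb2)
    next
      case False then show ?thesis using power_le_one[of \<rho> 2] by (simp add: max_absorb1 \<rho>_def)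
    qed
    then have "sqrt (1 + \<rho>\<^sup>2) \<le> sqrt (2 * (max 1 \<rho>)\<^sup>2)" by simp
    then show ?thesis by (simp add: jap_def real_sqrt_mult \<rho>_def)
  qed
  have s: "max 1 \<rho> * \<bar>sin_symbol t \<xi>\<bar> \<le> max 1 T"
  proof (cases "\<xi> = 0")
    case True then show ?thesis using assms by (simp add: sin_symbol_def \<rho>_def)
  next
    case False
    then have \<rho>: "\<rho> > 0" by (simp add: \<rho>_def)
    have e: "\<bar>sin_symbol t \<xi>\<bar> = \<bar>sin (t * \<rho>)\<bar> / \<rho>" using False by (simp add: sin_symbol_def \<rho>_def)
    show ?thesis
    proof (cases "\<rho> \<ge> 1")
      case True
      have "max 1 \<rho> * \<bar>sin_symbol t \<xi>\<bar> = \<bar>sin (t * \<rho>)\<bar>" using True by (simp add: e)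
      then show ?thesis using abs_sin_le_one[of "t * \<rho>"] by linarith
    next
      case False
      have "\<bar>sin (t * \<rho>)\<bar> \<le> t * \<rho>" using abs_sin_x_le_abs_x[of "t * \<rho>"] \<rho> assms by simp
      also have "\<dots> \<le> max 1 T * \<rho>" using \<rho> assms by (intro mult_right_mono) auto
      finally show ?thesis using False \<rho> by (simp add: e divide_le_eq)
    qed
  qed
  have "jap \<xi> * \<bar>sin_symbol t \<xi>\<bar> \<le> sqrt 2 * (max 1 \<rho> * \<bar>sin_symbol t \<xi>\<bar>)"
    using mult_right_mono[OF j, of "\<bar>sin_symbol t \<xi>\<bar>"] by (simp add: mult.assoc)
  also have "\<dots> \<le> sqrt 2 * max 1 T" by (intro mult_left_mono s) simp
  finally show ?thesis .
qed

lemma abs_sin_symbol_diff_le: "\<bar>sin_symbol t \<xi> - sin_symbol t' \<xi>\<bar> \<le> \<bar>t - t'\<bar>"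
proof (cases "\<xi> = 0")
  case False
  have "\<bar>sin (t * norm \<xi>) - sin (t' * norm \<xi>)\<bar> \<le> \<bar>t - t'\<bar> * norm \<xi>"
    using abs_sin_diff_le[of "t * norm \<xi>" "t' * norm \<xi>"] by (simp add: abs_mult flip: left_diff_distrib)
  then show ?thesis using False by (simp add: sin_symbol_def divide_le_eq flip: diff_divide_distrib)
qed (simp add: sin_symbol_def)

text \<open>The constant \<open>sqrt 2 * max 1 T\<close> comes from the size of the sine symbol of
  \<open>wave_S\<close>; the other bounds hold with constant 1 and are relaxed to it.\<close>

lemma wave_symbol:
  assumes S: "S \<in> {wave_S, wave_S_tilde}" and T: "T > 0"
  obtains m :: "nat \<Rightarrow> real \<Rightarrow> real^3 \<Rightarrow> real" where
    "\<And>t u \<phi>. S t u \<phi> = (\<Sum>j\<in>{0, 1}. multiplier (\<lambda>\<xi>. of_real (m j t \<xi>)) (if j = 0 then fst u else snd u) \<phi>)"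
    "\<And>j. (\<lambda>p. m j (fst p) (snd p)) \<in> borel_measurable (borel \<Otimes>\<^sub>M borel)"
    "\<And>j t \<xi>. j \<in> {0, 1} \<Longrightarrow> t \<in> {0..T} \<Longrightarrow> \<bar>m j t \<xi>\<bar> \<le> sqrt 2 * max 1 T * jap \<xi> powr (- real j)"
    "\<And>j t t' \<xi>. j \<in> {0, 1} \<Longrightarrow> t \<in> {0..T} \<Longrightarrow> t' \<in> {0..T} \<Longrightarrow>
      \<bar>m j t \<xi> - m j t' \<xi>\<bar> \<le> sqrt 2 * max 1 T * \<bar>t - t'\<bar> * jap \<xi> powr (1 - real j)"
proof -
  have A: "1 \<le> sqrt 2 * max 1 T" using mult_mono[of 1 "sqrt 2" 1 "max 1 T"] by simp
  have pos: "jap \<xi> > 0" "jap \<xi> \<noteq> 0" "\<bar>jap \<xi>\<bar> = jap \<xi>" for \<xi> using jap_ge_1[of \<xi>] by linarith+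
  have lip: "x \<le> sqrt 2 * max 1 T * \<bar>t - t'\<bar> * y" if "x \<le> \<bar>t - t'\<bar> * y" "y \<ge> 0" for x y t t'
  proof -
    have "1 * (\<bar>t - t'\<bar> * y) \<le> sqrt 2 * max 1 T * (\<bar>t - t'\<bar> * y)" using A that by (intro mult_right_mono) auto
    then show ?thesis using that(1) by (simp add: mult.assoc)
  qed
  have c: "\<bar>cos (t * norm \<xi>) - cos (t' * norm \<xi>)\<bar> \<le> \<bar>t - t'\<bar> * norm \<xi>" for t t' :: real and \<xi> :: "real^3"
    using abs_cos_diff_le[of "t * norm \<xi>" "t' * norm \<xi>"] by (simp add: abs_mult flip: left_diff_distrib)
  have s: "\<bar>sin (t * norm \<xi>) - sin (t' * norm \<xi>)\<bar> \<le> \<bar>t - t'\<bar> * norm \<xi>" for t t' :: real and \<xi> :: "real^3"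
    using abs_sin_diff_le[of "t * norm \<xi>" "t' * norm \<xi>"] by (simp add: abs_mult flip: left_diff_distrib)
  have nj: "x * norm \<xi> \<le> x * jap \<xi>" if "x \<ge> 0" for x and \<xi> :: "real^3"
    by (intro mult_left_mono jap_ge_norm that)
  from S consider "S = wave_S" | "S = wave_S_tilde" by blast
  then show thesis
  proof cases
    case 1
    define m where "m j t \<xi> = (if j = (0::nat) then cos (t * norm \<xi>) else sin_symbol t \<xi>)" for j t \<xi>
    show thesis
    proof (rule that[of m])
      show "S t u \<phi> = (\<Sum>j\<in>{0, 1}. multiplier (\<lambda>\<xi>. of_real (m j t \<xi>)) (if j = 0 then fst u else snd u) \<phi>)" for t u \<phi>
        by (simp add: 1 wave_S_def m_def)
      show "(\<lambda>p. m j (fst p) (snd p)) \<in> borel_measurable (borel \<Otimes>\<^sub>M borel)" for j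
        unfolding m_def sin_symbol_def by (cases "j = 0") (simp_all, measurable)
      fix j :: nat and t :: real and \<xi> :: "real^3" assume j: "j \<in> {0, 1}" and t: "t \<in> {0..T}"
      have "jap \<xi> * \<bar>sin_symbol t \<xi>\<bar> \<le> sqrt 2 * max 1 T" using t by (intro jap_mult_sin_symbol_le) auto
      then have "\<bar>sin_symbol t \<xi>\<bar> \<le> sqrt 2 * max 1 T / jap \<xi>"
        using pos[of \<xi>] by (subst pos_le_divide_eq) (auto simp: mult.commute)
      then show "\<bar>m j t \<xi>\<bar> \<le> sqrt 2 * max 1 T * jap \<xi> powr (- real j)"
        using j pos[of \<xi>] order_trans[OF abs_cos_le_one[of "t * norm \<xi>"] A] by (auto simp: m_def powr_minus divide_inverse)
      fix t' assume "t' \<in> {0..T}"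
      show "\<bar>m j t \<xi> - m j t' \<xi>\<bar> \<le> sqrt 2 * max 1 T * \<bar>t - t'\<bar> * jap \<xi> powr (1 - real j)"
        using j pos[of \<xi>] order_trans[OF c[of t \<xi> t'] nj[of "\<bar>t - t'\<bar>" \<xi>]] abs_sin_symbol_diff_le[of t \<xi> t']
        by (intro lip) (auto simp: m_def)
    qed
  next
    case 2
    define m where "m j t \<xi> = (if j = (0::nat) then - (norm \<xi> / jap \<xi>) * sin (t * norm \<xi>) else cos (t * norm \<xi>) / jap \<xi>)" for j t \<xi>
    show thesis
    proof (rule that[of m])
      show "S t u \<phi> = (\<Sum>j\<in>{0, 1}. multiplier (\<lambda>\<xi>. of_real (m j t \<xi>)) (if j = 0 then fst u else snd u) \<phi>)" for t u \<phi>
        by (simp add: 2 wave_S_tilde_def m_def)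
      show "(\<lambda>p. m j (fst p) (snd p)) \<in> borel_measurable (borel \<Otimes>\<^sub>M borel)" for j
        unfolding m_def by (cases "j = 0") (simp_all, measurable)
      fix j :: nat and t :: real and \<xi> :: "real^3" assume j: "j \<in> {0, 1}" and t: "t \<in> {0..T}"
      have q: "0 \<le> norm \<xi> / jap \<xi>" "norm \<xi> / jap \<xi> \<le> 1" using pos[of \<xi>] jap_ge_norm[of \<xi>] by auto
      have "norm \<xi> / jap \<xi> * \<bar>sin (t * norm \<xi>)\<bar> \<le> 1 * 1" using q by (intro mult_mono abs_sin_le_one) auto
      then have m0: "\<bar>m 0 t \<xi>\<bar> \<le> 1" using q by (simp add: m_def abs_mult)
      have m1: "\<bar>m 1 t \<xi>\<bar> = \<bar>cos (t * norm \<xi>)\<bar> / jap \<xi>" using pos[of \<xi>] by (simp add: m_def)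
      show "\<bar>m j t \<xi>\<bar> \<le> sqrt 2 * max 1 T * jap \<xi> powr (- real j)"
      proof (cases "j = 0")
        case True then show ?thesis using order_trans[OF m0 A] pos[of \<xi>] by simp
      next
        case False
        then have "j = 1" using j by simp
        then show ?thesis using order_trans[OF abs_cos_le_one[of "t * norm \<xi>"] A] pos[of \<xi>] m1
          by (simp add: powr_minus divide_inverse)
      qed
      fix t' assume "t' \<in> {0..T}"
      have d0: "\<bar>m 0 t \<xi> - m 0 t' \<xi>\<bar> \<le> \<bar>t - t'\<bar> * jap \<xi>"
      proof -
        have "m 0 t \<xi> - m 0 t' \<xi> = - (norm \<xi> / jap \<xi>) * (sin (t * norm \<xi>) - sin (t' * norm \<xi>))"
          by (simp add: m_def algebra_simps)
        then have "\<bar>m 0 t \<xi> - m 0 t' \<xi>\<bar> = norm \<xi> / jap \<xi> * \<bar>sin (t * norm \<xi>) - sin (t' * norm \<xi>)\<bar>"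
          using q pos[of \<xi>] by (simp add: abs_mult)
        also have "\<dots> \<le> 1 * (\<bar>t - t'\<bar> * jap \<xi>)"
          using q pos[of \<xi>] by (intro mult_mono order_trans[OF s nj]) auto
        finally show ?thesis by simp
      qed
      have d1: "\<bar>m 1 t \<xi> - m 1 t' \<xi>\<bar> \<le> \<bar>t - t'\<bar>"
      proof -
        have "\<bar>m 1 t \<xi> - m 1 t' \<xi>\<bar> = \<bar>cos (t * norm \<xi>) - cos (t' * norm \<xi>)\<bar> / jap \<xi>"
          using pos[of \<xi>] by (simp add: m_def flip: diff_divide_distrib)
        then show ?thesis using order_trans[OF c[of t \<xi> t'] nj[of "\<bar>t - t'\<bar>" \<xi>]] pos[of \<xi>] by (simp add: divide_le_eq)
      qed
      show "\<bar>m j t \<xi> - m j t' \<xi>\<bar> \<le> sqrt 2 * max 1 T * \<bar>t - t'\<bar> * jap \<xi> powr (1 - real j)"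
        using j pos[of \<xi>] d0 d1 by (intro lip) auto
    qed
  qed
qed

section \<open>The constants and the final estimate\<close>

text \<open>Lowering the order brings an arbitrary \<open>\<epsilon> > 0\<close> into the range
  \<open>e <= 1\<close> of the interpolation of links.\<close>

lemma sobolev_mono:
  assumes u: "u \<in> sobolev s" and s': "s' \<le> s"
  shows "fourier_fun u \<in> borel_measurable borel"
    and "integrable lborel (\<lambda>\<xi>. (jap \<xi> powr s' * cmod (fourier_fun u \<xi>))\<^sup>2)"
    and "(\<integral>\<xi>. (jap \<xi> powr s' * cmod (fourier_fun u \<xi>))\<^sup>2 \<partial>lborel) \<le> (sobolev_norm s u)\<^sup>2"
proof -
  obtain f where "represents f (fourier_distr u)" using u by (auto simp: sobolev_def)
  then have "represents (fourier_fun u) (fourier_distr u)" by (rule represents_fourier_fun)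
  then show [measurable]: "fourier_fun u \<in> borel_measurable borel" by (simp add: represents_def)
  have i: "integrable lborel (\<lambda>\<xi>. (jap \<xi> powr s * cmod (fourier_fun u \<xi>))\<^sup>2)" using u by (simp add: sobolev_def)
  have le: "(jap \<xi> powr s' * cmod (fourier_fun u \<xi>))\<^sup>2 \<le> (jap \<xi> powr s * cmod (fourier_fun u \<xi>))\<^sup>2" for \<xi>
    by (intro power_mono mult_right_mono powr_mono s' jap_ge_1) auto
  show i': "integrable lborel (\<lambda>\<xi>. (jap \<xi> powr s' * cmod (fourier_fun u \<xi>))\<^sup>2)"
    by (rule Bochner_Integration.integrable_bound[OF i]) (use le in auto)
  have "(\<integral>\<xi>. (jap \<xi> powr s' * cmod (fourier_fun u \<xi>))\<^sup>2 \<partial>lborel) \<le> (\<integral>\<xi>. (jap \<xi> powr s * cmod (fourier_fun u \<xi>))\<^sup>2 \<partial>lborel)"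
    by (intro integral_mono i i' le)
  then show "(\<integral>\<xi>. (jap \<xi> powr s' * cmod (fourier_fun u \<xi>))\<^sup>2 \<partial>lborel) \<le> (sobolev_norm s u)\<^sup>2"
    by (simp add: sobolev_norm_def)
qed

lemma (in wiener) exceed_event_tail:
  fixes \<epsilon> :: real and r :: ennreal
  assumes \<epsilon>: "\<epsilon> > 0" and r: "2 \<le> r"
  obtains C c :: real where "C > 0" "c > 0"
    "\<And>u0 u1 N T S l. u0 \<in> sobolev \<epsilon> \<Longrightarrow> u1 \<in> sobolev (\<epsilon> - 1) \<Longrightarrow> N > 0 \<Longrightarrow> sobolev_pair_norm \<epsilon> (u0, u1) \<le> N \<Longrightarrow>
       T > 0 \<Longrightarrow> S \<in> {wave_S, wave_S_tilde} \<Longrightarrow> l > 0 \<Longrightarrow>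
       exceed_event M (\<lambda>\<omega> t. S t (wiener_randomization \<psi> g (u0, u1) \<omega>)) T r l \<in> sets (completion M) \<and>
       measure (completion M) (exceed_event M (\<lambda>\<omega> t. S t (wiener_randomization \<psi> g (u0, u1) \<omega>)) T r l)
         \<le> C * (1 + T) * exp (- c * (l\<^sup>2 / (max 1 (T\<^sup>2) * N\<^sup>2)))"
proof -
  define e where "e = min \<epsilon> 1"
  have e: "0 < e" "e \<le> 1" "e \<le> \<epsilon>" using \<epsilon> by (auto simp: e_def)
  \<comment> \<open>\<open>chain_const\<close> depends on the locale only through \<open>e\<close>,
    so it can be named before data, time and propagator are fixed. The \<open>max 1\<close> supplies
    positivity where the sign of \<open>chain_const\<close> is not yet at hand.\<close>
  define C where "C = max 1 (16 * wiener_flow.chain_const e + 2)"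
  \<comment> \<open>Half of \<open>chain_exponent l\<close> with
    \<open>A^2 = 2 * (max 1 T)^2\<close> and
    \<open>total_energy = 27 * cutoff_bound^2 * N^2\<close>, since
    \<open>497664 = 9216 * 54\<close>.\<close>
  define c where "c = (1 - 2 powr (- e / 2))\<^sup>2 / (497664 * c0 * cutoff_bound\<^sup>2)"
  have "2 powr (- e / 2) < 1" using e powr_less_mono[of "- e / 2" 0 2] by simp
  then have c: "c > 0" using c0 cutoff_bound(1) unfolding c_def by (intro divide_pos_pos zero_less_power mult_pos_pos) auto
  show thesis
  proof (rule that[of C c])
    show "C > 0" by (simp add: C_def)
    show "c > 0" by (rule c)
    fix u0 u1 and N T l :: real and S :: "real \<Rightarrow> distr3 \<times> distr3 \<Rightarrow> distr3"
    assume u0: "u0 \<in> sobolev \<epsilon>" and u1: "u1 \<in> sobolev (\<epsilon> - 1)" and N: "N > 0" "sobolev_pair_norm \<epsilon> (u0, u1) \<le> N"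
      and T: "T > 0" and S: "S \<in> {wave_S, wave_S_tilde}" and l: "l > 0"
    obtain m where m:
      "\<And>t u \<phi>. S t u \<phi> = (\<Sum>j\<in>{0, 1}. multiplier (\<lambda>\<xi>. of_real (m j t \<xi>)) (if j = 0 then fst u else snd u) \<phi>)"
      "\<And>j. (\<lambda>p. m j (fst p) (snd p)) \<in> borel_measurable (borel \<Otimes>\<^sub>M borel)"
      "\<And>j t \<xi>. j \<in> {0, 1} \<Longrightarrow> t \<in> {0..T} \<Longrightarrow> \<bar>m j t \<xi>\<bar> \<le> sqrt 2 * max 1 T * jap \<xi> powr (- real j)"
      "\<And>j t t' \<xi>. j \<in> {0, 1} \<Longrightarrow> t \<in> {0..T} \<Longrightarrow> t' \<in> {0..T} \<Longrightarrow>
        \<bar>m j t \<xi> - m j t' \<xi>\<bar> \<le> sqrt 2 * max 1 T * \<bar>t - t'\<bar> * jap \<xi> powr (1 - real j)"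
      by (rule wave_symbol[OF S T]) blast
    define u where "u j = (if j = (0::nat) then u0 else u1)" for j
    define f where "f j = fourier_fun (u j)" for j
    have u0': "fourier_fun u0 \<in> borel_measurable borel"
      "integrable lborel (\<lambda>\<xi>. (jap \<xi> powr e * cmod (fourier_fun u0 \<xi>))\<^sup>2)"
      "(\<integral>\<xi>. (jap \<xi> powr e * cmod (fourier_fun u0 \<xi>))\<^sup>2 \<partial>lborel) \<le> (sobolev_norm \<epsilon> u0)\<^sup>2"
      using sobolev_mono[OF u0 e(3)] by auto
    have u1': "fourier_fun u1 \<in> borel_measurable borel"
      "integrable lborel (\<lambda>\<xi>. (jap \<xi> powr (e - 1) * cmod (fourier_fun u1 \<xi>))\<^sup>2)"
      "(\<integral>\<xi>. (jap \<xi> powr (e - 1) * cmod (fourier_fun u1 \<xi>))\<^sup>2 \<partial>lborel) \<le> (sobolev_norm (\<epsilon> - 1) u1)\<^sup>2"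
      using sobolev_mono[OF u1, of "e - 1"] e(3) by auto
    have "(sobolev_norm \<epsilon> u0)\<^sup>2 + (sobolev_norm (\<epsilon> - 1) u1)\<^sup>2 = (sobolev_pair_norm \<epsilon> (u0, u1))\<^sup>2"
      by (simp add: sobolev_pair_norm_def)
    also have "\<dots> \<le> N\<^sup>2" using N by (intro power_mono) (auto simp: sobolev_pair_norm_def)
    finally have uN: "(sobolev_norm \<epsilon> u0)\<^sup>2 + (sobolev_norm (\<epsilon> - 1) u1)\<^sup>2 \<le> N\<^sup>2" .
    interpret wiener_flow M g \<psi> c0 f e N m T "sqrt 2 * max 1 T"
    proof
      show "f j \<in> borel_measurable borel" for j using u0'(1) u1'(1) by (simp add: f_def u_def)
      show "integrable lborel (\<lambda>\<xi>. (jap \<xi> powr (e - real j) * cmod (f j \<xi>))\<^sup>2)" if "j \<in> {0, 1}" for j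
        using u0'(2) u1'(2) that by (auto simp: f_def u_def)
      show "(\<Sum>j\<in>{0, 1}. \<integral>\<xi>. (jap \<xi> powr (e - real j) * cmod (f j \<xi>))\<^sup>2 \<partial>lborel) \<le> N\<^sup>2"
        using u0'(3) u1'(3) uN by (simp add: f_def u_def)
      show "(\<lambda>p. m j (fst p) (snd p)) \<in> borel_measurable (borel \<Otimes>\<^sub>M borel)" for j by (rule m(2))
      show "\<bar>m j t \<xi>\<bar> \<le> sqrt 2 * max 1 T * jap \<xi> powr (- real j)" if "j \<in> {0, 1}" "t \<in> {0..T}" for j t \<xi>
        by (rule m(3)[OF that])
      show "\<bar>m j t \<xi> - m j t' \<xi>\<bar> \<le> sqrt 2 * max 1 T * \<bar>t - t'\<bar> * jap \<xi> powr (1 - real j)"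
        if "j \<in> {0, 1}" "t \<in> {0..T}" "t' \<in> {0..T}" for j t t' \<xi> by (rule m(4)[OF that])
      show "0 < sqrt 2 * max 1 T" by (simp add: zero_less_mult_iff)
    qed (use e N T in auto)
    have rep: "represents (limit_field t \<omega>) (S t (wiener_randomization \<psi> g (u0, u1) \<omega>))"
      if w: "\<omega> \<in> Good" and t: "t \<in> {0..T}" for \<omega> t
    proof -
      obtain R where R: "\<And>k. partial_energy k \<omega> \<le> R" using Good_bound[OF w] by blast
      have "S t (wiener_randomization \<psi> g (u0, u1) \<omega>) = (\<lambda>\<phi>. \<Sum>j\<in>{0, 1}. multiplier (symbol t j) (randomize \<psi> (g j) (u j) \<omega>) \<phi>)"
        by (rule ext) (simp add: m(1) wiener_randomization_def u_def)
      then show ?thesis using limit_field_represents[OF t R, of u] by (simp add: f_def)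
    qed
    have mx: "(max 1 T)\<^sup>2 = max 1 (T\<^sup>2)"
      using T one_le_power[of T 2] power_le_one[of T 2] by (cases "1 \<le> T") (auto simp: max_absorb1 max_absorb2)
    have "chain_exponent l / 2 = c * (l\<^sup>2 / (max 1 (T\<^sup>2) * N\<^sup>2))"
      unfolding chain_exponent_def ratio_def total_energy_def c_def power_mult_distrib mx by (simp add: mult_ac)
    then have ex: "- chain_exponent l / 2 = - c * (l\<^sup>2 / (max 1 (T\<^sup>2) * N\<^sup>2))" by linarith
    have "(16 * chain_const + 2) * (1 + T) * exp (- chain_exponent l / 2) \<le> C * (1 + T) * exp (- chain_exponent l / 2)"
      using T by (intro mult_right_mono) (auto simp: C_def)
    with exceed_event_bound[OF r l rep]
    show "exceed_event M (\<lambda>\<omega> t. S t (wiener_randomization \<psi> g (u0, u1) \<omega>)) T r l \<in> sets (completion M) \<and>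
       measure (completion M) (exceed_event M (\<lambda>\<omega> t. S t (wiener_randomization \<psi> g (u0, u1) \<omega>)) T r l)
         \<le> C * (1 + T) * exp (- c * (l\<^sup>2 / (max 1 (T\<^sup>2) * N\<^sup>2)))"
      unfolding ex by auto
  qed
qed

theorem proposition3p3:
  fixes M :: "'a measure"
    and g :: "nat \<Rightarrow> int^3 \<Rightarrow> 'a \<Rightarrow> complex"
    and \<psi> :: "real^3 \<Rightarrow> complex"
    and c0 \<epsilon> :: real
    and r :: ennreal
  assumes "wiener_cutoff \<psi>"
    and "wiener_variables M g"
    and "c0 > 0" and "exp_moment_bound M g c0"
    and "2 \<le> r" and "\<epsilon> > 0"
  shows "\<exists>C>0. \<exists>c>0. \<forall>u0\<in>sobolev \<epsilon>. \<forall>u1\<in>sobolev (\<epsilon> - 1). real_distr u0 \<longrightarrow> real_distr u1 \<longrightarrow>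
    (\<forall>T>0. \<forall>S\<in>{wave_S, wave_S_tilde}. \<forall>l>0.
      (let E = exceed_event M (\<lambda>\<omega> t. S t (wiener_randomization \<psi> g (u0, u1) \<omega>)) T r l
       in E \<in> sets (completion M) \<and>
          measure (completion M) E \<le> tail_bound C c T (sobolev_pair_norm \<epsilon> (u0, u1)) l))"
proof -
  interpret wiener M g \<psi> c0 by standard (use assms in auto)
  obtain C c :: real where C: "C > 0" and c: "c > 0" and tail:
    "\<And>u0 u1 N T S l. u0 \<in> sobolev \<epsilon> \<Longrightarrow> u1 \<in> sobolev (\<epsilon> - 1) \<Longrightarrow> N > 0 \<Longrightarrow> sobolev_pair_norm \<epsilon> (u0, u1) \<le> N \<Longrightarrow>
       T > 0 \<Longrightarrow> S \<in> {wave_S, wave_S_tilde} \<Longrightarrow> l > 0 \<Longrightarrow>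
       exceed_event M (\<lambda>\<omega> t. S t (wiener_randomization \<psi> g (u0, u1) \<omega>)) T r l \<in> sets (completion M) \<and>
       measure (completion M) (exceed_event M (\<lambda>\<omega> t. S t (wiener_randomization \<psi> g (u0, u1) \<omega>)) T r l)
         \<le> C * (1 + T) * exp (- c * (l\<^sup>2 / (max 1 (T\<^sup>2) * N\<^sup>2)))"
    by (rule exceed_event_tail[OF \<open>\<epsilon> > 0\<close> \<open>2 \<le> r\<close>]) blast
  show ?thesis
    unfolding Let_def
  proof (rule exI[of _ C], rule conjI[OF C], rule exI[of _ c], rule conjI[OF c], intro ballI allI impI conjI)
    fix u0 u1 and T l :: real and S :: "real \<Rightarrow> distr3 \<times> distr3 \<Rightarrow> distr3"
    assume u: "u0 \<in> sobolev \<epsilon>" "u1 \<in> sobolev (\<epsilon> - 1)" and T: "T > 0" and S: "S \<in> {wave_S, wave_S_tilde}" and l: "l > 0"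
    define N where "N = sobolev_pair_norm \<epsilon> (u0, u1)"
    define E where "E = exceed_event M (\<lambda>\<omega> t. S t (wiener_randomization \<psi> g (u0, u1) \<omega>)) T r l"
    have N0: "N \<ge> 0" by (simp add: N_def sobolev_pair_norm_def)
    have tl: "E \<in> sets (completion M)" "measure (completion M) E \<le> C * (1 + T) * exp (- c * (l\<^sup>2 / (max 1 (T\<^sup>2) * N'\<^sup>2)))"
      if "N' > 0" "N \<le> N'" for N'
      using tail[OF u that(1) that(2)[unfolded N_def] T S l] by (auto simp: E_def)
    \<comment> \<open>\<open>N + 1\<close> is a positive upper bound of the norm even when
      \<open>N = 0\<close>.\<close>
    have E: "E \<in> sets (completion M)" using tl(1)[of "N + 1"] N0 by simp
    have p: "measure (completion M) E \<le> tail_bound C c T N l"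
    proof (cases "N = 0")
      case False
      then show ?thesis using tl(2)[of N] N0 by (simp add: tail_bound_def)
    next
      case True
      define p where "p = measure (completion M) E"
      define K where "K = c * (l\<^sup>2 / max 1 (T\<^sup>2))"
      have K: "K > 0" using c l by (simp add: K_def)
      have "p \<le> 0"
      proof (rule ccontr)
        assume "\<not> p \<le> 0"
        then have p: "p > 0" by simp
        \<comment> \<open>For data of norm zero the tail bound holds with every
          \<open>N' > 0\<close>. At \<open>N' = 1 / sqrt x\<close> it reads
          \<open>C * (1 + T) * exp (- K x)\<close>, which is below
          \<open>C * (1 + T) / (K x)\<close>, and \<open>x\<close> is chosen to make the latter
          equal to \<open>p\<close>.\<close>
        define x where "x = C * (1 + T) / (p * K)"
        have x: "x > 0" using C T p K by (simp add: x_def)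
        have sq: "(1 / sqrt x)\<^sup>2 = 1 / x" using x by (simp add: power_divide)
        have "p \<le> C * (1 + T) * exp (- (K * x))"
          using tl(2)[of "1 / sqrt x"] x True by (simp add: p_def sq K_def mult.assoc)
        also have "\<dots> < C * (1 + T) * (1 / (K * x))"
        proof (rule mult_strict_left_mono)
          have "K * x < exp (K * x)" using exp_ge_add_one_self[of "K * x"] by linarith
          then show "exp (- (K * x)) < 1 / (K * x)" using K x by (simp add: exp_minus field_simps)
        qed (use C T in auto)
        also have "\<dots> = p" using C T p K by (simp add: x_def)
        finally show False by simp
      qed
      then show ?thesis using True by (simp add: p_def tail_bound_def)
    qed
    show "exceed_event M (\<lambda>\<omega> t. S t (wiener_randomization \<psi> g (u0, u1) \<omega>)) T r l \<in> sets (completion M)"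
      and "measure (completion M) (exceed_event M (\<lambda>\<omega> t. S t (wiener_randomization \<psi> g (u0, u1) \<omega>)) T r l)
        \<le> tail_bound C c T (sobolev_pair_norm \<epsilon> (u0, u1)) l"
      using E p by (simp_all only: E_def N_def)
  qed
qed

end
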